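(* Let $\nu=\sum_{i=1}^n \nu_i\delta_{y_i}$ be a probability measure on $\mathbb{R}^d$ with distinct atoms $y_1,\dots,y_n$ and weights $\nu_i>0$, and let $\mu$ be an absolutely continuous Borel probability measure on $\mathbb{R}^d$ with finite second moment and density $\mu(\cdot)$. Assume that the interior of $\operatorname{supp}(\mu)$ is connected, the boundary of $\operatorname{supp}(\mu)$ has zero Lebesgue measure, and $\mu(x)>0$ for every $x$ in the interior of $\operatorname{supp}(\mu)$. Assume moreover that for all $i\ne j$ and all sufficiently small $a\ge 0$ the function $t\mapsto h_{ij}(t;a)$ on $[0,\infty)$ is continuous at $t=0$, and that for all $i\neq j$ the function $a\mapsto h_{ij}(0;a)$ on $[0,\infty)$ is continuous at $a=0$. For $\eta>0$ let $\pi_\eta$ be the minimizer of the entropic optimal transport problem with parameter $\eta$. Then, as $\eta\to\infty$, $$\mathbb{E}_{\pi_\eta}[\|x-y\|^2]=W_2^2(\mu,\nu)+\frac{\zeta(2)}{2\eta^2}\sum_{i<j}\frac{w_{ij}}{\|y_i-y_j\|}+o(\eta^{-2}),$$ where $w_{ij}:=h_{ij}(0;0)=\int_{S_i\cap S_j}\mu(x)\,d\mathcal{H}_{d-1}(x)$ and $\zeta(2)=\pi^2/6$.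
   Context: $\|\cdot\|$ is the Euclidean norm, $\Pi(\mu,\nu)$ is the set of couplings of $\mu$ and $\nu$, and $W_2^2(\mu,\nu)=\inf_{\pi\in\Pi(\mu,\nu)}\mathbb{E}_\pi[\|x-y\|^2]$. Entropic problem: $\pi_\eta$ is the unique minimizer over $\pi\in\Pi(\mu,\nu)$ of $\mathbb{E}_\pi[\|x-y\|^2]+\frac1\eta \mathrm{KL}(\pi\,\|\,\mu\otimes\nu)$, where $\mathrm{KL}(\pi\|\rho)=\int\log\frac{d\pi}{d\rho}\,d\pi$ if $\pi\ll\rho$ and $+\infty$ otherwise. Unregularized potentials: $(f^*,g^* )$ is an optimal solution of $W_2^2(\mu,\nu)=\sup\{\mathbb{E}_\mu[f]+\mathbb{E}_\nu[g]: (f,g)\in L^1(\mu)\times L^1(\nu),\ f(x)+g(y)\le\|x-y\|^2\}$ normalized by $\mathbb{E}_\nu[g^*]=0$; under the stated hypotheses on $\operatorname{supp}(\mu)$ it is unique ($\mu$-, resp. $\nu$-almost surely). Write $g^*_i=g^*(y_i)$. Power cells: $S_i=\{x\in\mathbb{R}^d:\ \|x-y_i\|^2-g^*_i\le\|x-y_j\|^2-g^*_j\ \ \forall j\}$. (The optimal map $T$ from $\mu$ to $\nu$ sends $\mu$-almost every $x\in S_i$ to $y_i$.) Slacks: for $x\in S_i$, $\Delta_{ij}(x)=\|x-y_j\|^2-f^*(x)-g^*_j$, where $f^*(x)=\|x-y_i\|^2-g^*_i$ on $S_i$. For $i\ne j$, $a\ge0$, $t\ge 0$: $S_{ij}(a)=\{x\in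 S_i:\Delta_{ik}(x)\ge a\ \ \forall k\ne i,j\}$, $H_{ij}(t;a)=\{x\in S_{ij}(a):\Delta_{ij}(x)=t\}$, and $h_{ij}(t;a)=\int_{H_{ij}(t;a)}\mu(x)\,d\mathcal{H}_{d-1}(x)$, with $\mathcal{H}_{d-1}$ the $(d-1)$-dimensional Hausdorff measure. *)

theory Defs
  imports "HOL-Probability.Probability"
begin

definition msupport :: "'a::topological_space measure \<Rightarrow> 'a set" where
  "msupport M = {x. \<forall>U. open U \<longrightarrow> x \<in> U \<longrightarrow> emeasure M U > 0}"

subsection \<open>Optimal transport with quadratic cost\<close>

definition couplings :: "'a measure \<Rightarrow> 'b measure \<Rightarrow> ('a \<times> 'b) measure set" where
  "couplings M N =
     {P. sets P = sets (M \<Otimes>\<^sub>M N) \<and> distr P M fst = M \<and> distr P N snd = N}"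

definition transport_cost :: "('a::euclidean_space \<times> 'a) measure \<Rightarrow> ennreal" where
  "transport_cost P = (\<integral>\<^sup>+z. ennreal ((norm (fst z - snd z))\<^sup>2) \<partial>P)"

definition W2_sq :: "'a::euclidean_space measure \<Rightarrow> 'a measure \<Rightarrow> ennreal" where
  "W2_sq M N = (INF P\<in>couplings M N. transport_cost P)"

text \<open>
  The relative entropy of \<open>P\<close> with respect to \<open>R\<close>. The library's \<^const>\<open>KL_divergence\<close> is
  real-valued and takes the reference measure first. For a probability measure \<open>P\<close> that is
  absolutely continuous with respect to the finite measure \<open>R\<close>, the negative part of the
  logarithm of the density is always \<open>P\<close>-integrable, so non-integrability means that the
  integral is plus infinity.
\<close>

definition rel_entropy :: "'a measure \<Rightarrow> 'a measure \<Rightarrow> ereal" where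
  "rel_entropy P R =
     (if absolutely_continuous R P \<and> integrable P (entropy_density (exp 1) R P)
      then ereal (KL_divergence (exp 1) R P) else \<infinity>)"

definition entropic_cost ::
    "'a::euclidean_space measure \<Rightarrow> 'a measure \<Rightarrow> real \<Rightarrow> ('a \<times> 'a) measure \<Rightarrow> ereal" where
  "entropic_cost M N \<eta> P =
     enn2ereal (transport_cost P) + ereal (1 / \<eta>) * rel_entropy P (M \<Otimes>\<^sub>M N)"

definition entropic_plan ::
    "'a::euclidean_space measure \<Rightarrow> 'a measure \<Rightarrow> real \<Rightarrow> ('a \<times> 'a) measure \<Rightarrow> bool" where
  "entropic_plan M N \<eta> P \<longleftrightarrow>
     P \<in> couplings M N \<and> (\<forall>Q\<in>couplings M N. entropic_cost M N \<eta> P \<le> entropic_cost M N \<eta> Q)"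

text \<open>
  Elements of \<open>L\<^sup>1\<close> are classes of functions, so the constraint is imposed off null sets of the
  two marginals. Demanding it at every pair of points would be wrong for real-valued functions:
  if \<open>M\<close> has full support and \<open>N\<close> finitely many atoms, no real-valued optimal pair would exist,
  because the second potential must be minus infinity off the convex hull of the atoms.
\<close>

definition dual_feasible ::
    "'a::euclidean_space measure \<Rightarrow> 'a measure \<Rightarrow> ('a \<Rightarrow> real) \<Rightarrow> ('a \<Rightarrow> real) \<Rightarrow> bool" where
  "dual_feasible M N f g \<longleftrightarrow>
     integrable M f \<and> integrable N g \<and>
     (\<exists>A B. (AE x in M. x \<in> A) \<and> (AE y in N. y \<in> B) \<and>
            (\<forall>x\<in>A. \<forall>y\<in>B. f x + g y \<le> (norm (x - y))\<^sup>2))"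

definition dual_optimal ::
    "'a::euclidean_space measure \<Rightarrow> 'a measure \<Rightarrow> ('a \<Rightarrow> real) \<Rightarrow> ('a \<Rightarrow> real) \<Rightarrow> bool" where
  "dual_optimal M N f g \<longleftrightarrow>
     dual_feasible M N f g \<and>
     (\<forall>f' g'. dual_feasible M N f' g' \<longrightarrow>
        (\<integral>x. f' x \<partial>M) + (\<integral>y. g' y \<partial>N) \<le> (\<integral>x. f x \<partial>M) + (\<integral>y. g y \<partial>N))"

subsection \<open>Hausdorff measure of integer dimension\<close>

text \<open>
  Normalised by the volume of the \<open>k\<close>-dimensional unit ball, so that the \<open>k\<close>-dimensional
  measure agrees with \<open>k\<close>-dimensional Lebesgue measure on \<open>k\<close>-dimensional affine subspaces.
  The empty set is treated separately because \<open>0 ^ 0 = 1\<close>; for \<open>k = 0\<close> one gets the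
  counting measure. Boundedness is required because \<^const>\<open>diameter\<close> is unspecified for
  unbounded sets.
\<close>

definition hausdorff_gauge :: "nat \<Rightarrow> 'a::metric_space set \<Rightarrow> ennreal" where
  "hausdorff_gauge k C =
     (if C = {} then 0 else ennreal (unit_ball_vol (real k) * (diameter C / 2) ^ k))"

definition hausdorff_pre :: "nat \<Rightarrow> real \<Rightarrow> 'a::metric_space set \<Rightarrow> ennreal" where
  "hausdorff_pre k \<delta> A =
     (INF C \<in> {C :: nat \<Rightarrow> 'a set. A \<subseteq> (\<Union>m. C m) \<and> (\<forall>m. bounded (C m) \<and> diameter (C m) \<le> \<delta>)}.
        \<Sum>m. hausdorff_gauge k (C m))"

definition hausdorff_outer :: "nat \<Rightarrow> 'a::metric_space set \<Rightarrow> ennreal" where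
  "hausdorff_outer k A = (SUP \<delta>\<in>{0<..}. hausdorff_pre k \<delta> A)"

definition hausdorff_measure :: "nat \<Rightarrow> 'a::metric_space measure" where
  "hausdorff_measure k = measure_of UNIV (sets borel) (hausdorff_outer k)"

subsection \<open>Power cells, slacks and slice integrals\<close>

text \<open>
  The atoms are \<open>y 1, \<dots>, y n\<close>, and \<open>\<gamma> i\<close> stands for the value of the second potential at \<open>y i\<close>.
\<close>

definition power_cell ::
    "nat \<Rightarrow> (nat \<Rightarrow> 'a::euclidean_space) \<Rightarrow> (nat \<Rightarrow> real) \<Rightarrow> nat \<Rightarrow> 'a set" where
  "power_cell n y \<gamma> i =
     {x. \<forall>j\<in>{1..n}. (norm (x - y i))\<^sup>2 - \<gamma> i \<le> (norm (x - y j))\<^sup>2 - \<gamma> j}"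

text \<open>
  The slack is only used for \<open>x\<close> in the \<open>i\<close>-th power cell; the subtracted bracket is the value
  of the first potential there.
\<close>

definition slack ::
    "(nat \<Rightarrow> 'a::euclidean_space) \<Rightarrow> (nat \<Rightarrow> real) \<Rightarrow> nat \<Rightarrow> nat \<Rightarrow> 'a \<Rightarrow> real" where
  "slack y \<gamma> i j x = (norm (x - y j))\<^sup>2 - ((norm (x - y i))\<^sup>2 - \<gamma> i) - \<gamma> j"

definition cell_part ::
    "nat \<Rightarrow> (nat \<Rightarrow> 'a::euclidean_space) \<Rightarrow> (nat \<Rightarrow> real) \<Rightarrow> nat \<Rightarrow> nat \<Rightarrow> real \<Rightarrow> 'a set" where
  "cell_part n y \<gamma> i j a =
     {x \<in> power_cell n y \<gamma> i. \<forall>k\<in>{1..n} - {i, j}. slack y \<gamma> i k x \<ge> a}"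

definition cell_slice ::
    "nat \<Rightarrow> (nat \<Rightarrow> 'a::euclidean_space) \<Rightarrow> (nat \<Rightarrow> real) \<Rightarrow> nat \<Rightarrow> nat \<Rightarrow> real \<Rightarrow> real \<Rightarrow> 'a set" where
  "cell_slice n y \<gamma> i j t a = {x \<in> cell_part n y \<gamma> i j a. slack y \<gamma> i j x = t}"

definition slice_integral ::
    "('a::euclidean_space \<Rightarrow> real) \<Rightarrow> nat \<Rightarrow> (nat \<Rightarrow> 'a) \<Rightarrow> (nat \<Rightarrow> real) \<Rightarrow>
       nat \<Rightarrow> nat \<Rightarrow> real \<Rightarrow> real \<Rightarrow> ennreal" where
  "slice_integral \<rho> n y \<gamma> i j t a =
     (\<integral>\<^sup>+x\<in>cell_slice n y \<gamma> i j t a. ennreal (\<rho> x) \<partial>hausdorff_measure (DIM('a) - 1))"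

end

theory Submission
  imports Defs
begin

text \<open>
  The minimal value of the entropic problem is a concave function of \<open>1/\<eta>\<close> whose derivative is
  the relative entropy of the minimiser, so it suffices to expand that value up to \<open>o(1/\<eta>\<^sup>2)\<close> and
  to differentiate. With excess costs \<open>\<Delta> i x = \<parallel>x - y i\<parallel>\<^sup>2 - g (y i) - f x\<close>, the Gibbs
  inequality with the unregularised potentials bounds the value from below by minus the integral of
  \<open>ln (\<Sum>i. exp (- \<eta> \<Delta> i x))\<close>. Only layers of width \<open>1/\<eta>\<close> around the facets contribute to this
  integral, and each side of a facet contributes \<open>h i j / (2 \<parallel>y i - y j\<parallel>)\<close> times
  \<open>\<integral>\<^sub>0\<^sup>\<infinity> ln (1 + e\<^sup>-\<^sup>t) dt = \<pi>\<^sup>2/12\<close>. For the matching upper bound, the Gibbs density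
  has marginal masses off by \<open>o(1/\<eta>)\<close> only, because the contributions of the two sides of a facet
  cancel; the defect is repaired at cost \<open>o(1/\<eta>\<^sup>2)\<close> by moving mass through the layers along the
  graph of facets of positive measure. This graph is connected, since a set of \<open>\<mu>\<close>-null facets
  would sweep out only a null set of segments and so cannot separate the interior of the support.

  The slab asymptotics rest on the coarea formula for affine functions. For the normalised Hausdorff
  measure it needs the isodiametric inequality, which follows from Prekopa-Leindler, and the identity
  of spherical and cube normalisations, which follows from the self-similarity of the unit cube.
\<close>

section \<open>Brunn-Minkowski and Prekopa-Leindler inequalities\<close>

text \<open>Of \<open>\<pi> \<eta>\<close> only minimality is known: no regularised potentials and
  no formula for its density enter. The cost must therefore be read off the minimal value, which
  with s = 1/\<eta> is W + H s - K s^2 + o(s^2), H being the Shannon entropy of the weights.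
  Asymptotic expansions may not be differentiated in general; comparing the minimisers at s and at
  (1 + \<tau>) s permits it here, and cost = value - s * derivative turns -K into +K. The obstacle
  is that both bounds on the value must agree to second order. They do because the Gibbs density is
  perturbed only inside layers of mass O(1/\<eta>), and only by o(1): in the relative entropy the
  linear term vanishes by normalisation, the quadratic one is o(1) times that mass, and entropy
  enters the value with a further factor 1/\<eta>. The denominator 2 \<open>norm (y i - y j)\<close>
  is the norm of the gradient of a slack. Strong duality is not an input; it drops out of the
  expansion.\<close>

lemma borel_compact_approx:
  fixes A :: "'a::euclidean_space set"
  assumes A: "A \<in> sets borel" and r: "r < emeasure lborel A"
  obtains K where "compact K" "K \<subseteq> A" "r < emeasure lborel K"
proof -
  \<comment> \<open>Cutting down to a ball first makes the measure finite; only then does a closed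
    subset that misses less than \<open>e\<close> still carry more than \<open>r\<close>.\<close>
  have "emeasure lborel A = emeasure lborel (\<Union>m::nat. A \<inter> cball 0 (real m))"
    by (rule arg_cong[where f="emeasure lborel"]) (auto simp: real_arch_simple)
  also have "\<dots> = (SUP m. emeasure lborel (A \<inter> cball 0 (real m)))"
    using A by (intro SUP_emeasure_incseq[symmetric]) (auto simp: incseq_def)
  finally obtain m :: nat where m: "r < emeasure lborel (A \<inter> cball 0 (real m))"
    using r by (auto simp: less_SUP_iff)
  define B where "B = A \<inter> cball 0 (real m)"
  have B: "B \<in> sets borel" "bounded B" using A by (auto simp: B_def intro: bounded_subset[OF bounded_cball])
  have fin: "emeasure lborel B < \<infinity>"
    using emeasure_mono[of B "cball 0 (real m)" lborel] emeasure_lborel_cball_finite[of 0 "real m"]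
    by (auto simp: B_def intro: le_less_trans)
  define e where "e = enn2real (emeasure lborel B) - enn2real r"
  have rfin: "r < \<infinity>" using m fin by (auto simp: B_def)
  have req: "r = ennreal (enn2real r)" "emeasure lborel B = ennreal (enn2real (emeasure lborel B))"
    using rfin fin by (auto simp: ennreal_enn2real_if)
  have e: "e > 0"
    using m req unfolding e_def B_def[symmetric] by (metis diff_gt_0_iff_gt enn2real_nonneg ennreal_less_iff)
  obtain T where T: "closed T" "T \<subseteq> B" "emeasure lebesgue (B - T) < ennreal e"
    using sets_lebesgue_inner_closed[of B e] e B by (metis sets_completionI_sets sets_lborel)
  have TB: "T \<in> sets borel" using T by auto
  have "emeasure lborel B = emeasure lborel T + emeasure lborel (B - T)"
    using T TB B by (subst plus_emeasure) (auto intro: arg_cong[where f="emeasure lborel"])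
  moreover have "emeasure lborel (B - T) < ennreal e"
    using T(3) TB B by simp
  ultimately have "emeasure lborel T > r"
  proof -
    obtain b where b: "emeasure lborel B = ennreal b" "0 \<le> b" using req(2) enn2real_nonneg by metis
    obtain r' where r': "r = ennreal r'" "0 \<le> r'" using req(1) enn2real_nonneg by metis
    assume s: "emeasure lborel B = emeasure lborel T + emeasure lborel (B - T)"
      and d: "emeasure lborel (B - T) < ennreal e"
    have "emeasure lborel T \<noteq> \<infinity>" "emeasure lborel (B - T) \<noteq> \<infinity>" using s b by auto
    then obtain t d' where td: "emeasure lborel T = ennreal t" "0 \<le> t"
      "emeasure lborel (B - T) = ennreal d'" "0 \<le> d'"
      by (metis ennreal_cases infinity_ennreal_def)
    have "b = t + d'" using s b td by (simp flip: ennreal_plus)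
    moreover have "d' < e" using d td by (simp add: ennreal_less_iff)
    moreover have "e = b - r'" using b r' by (simp add: e_def)
    ultimately show ?thesis using td r' by (simp add: ennreal_less_iff)
  qed
  moreover have "compact T" using T B by (meson bounded_subset compact_eq_bounded_closed)
  ultimately show ?thesis using that[of T] T by (auto simp: B_def)
qed

lemma emeasure_lborel_half_preimage:
  fixes K :: "real set"
  assumes "K \<in> sets borel"
  shows "emeasure lborel K = 2 * emeasure lborel {z. t + 2 * z \<in> K}"
proof -
  have [measurable]: "K \<in> sets borel" by fact
  have "emeasure lborel K = (\<integral>\<^sup>+x. indicator K x \<partial>lborel)" using assms by simp
  also have "\<dots> = 2 * (\<integral>\<^sup>+x. indicator K (t + 2 * x) \<partial>lborel)"
    by (subst nn_integral_real_affine[where c=2 and t=t]) auto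
  also have "(\<integral>\<^sup>+x. indicator K (t + 2 * x) \<partial>lborel) = (\<integral>\<^sup>+x. indicator {z. t + 2 * z \<in> K} x \<partial>lborel)"
    by (intro nn_integral_cong) (auto simp: indicator_def)
  also have "\<dots> = emeasure lborel {z. t + 2 * z \<in> K}"
    by (subst nn_integral_indicator) auto
  finally show ?thesis .
qed

text \<open>The midpoint set contains the half-size copies (A + min B)/2 and (max A + B)/2. The
  first lies to the left of (max A + min B)/2 and the second to the right, so they share at most
  that point and their measures add.\<close>

lemma brunn_minkowski_real_compact:
  fixes A B C :: "real set"
  assumes A: "compact A" "A \<noteq> {}" and B: "compact B" "B \<noteq> {}" and C: "C \<in> sets borel"
    and mid: "\<And>x y. x \<in> A \<Longrightarrow> y \<in> B \<Longrightarrow> (x + y) / 2 \<in> C"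
  shows "emeasure lborel A + emeasure lborel B \<le> 2 * emeasure lborel C"
proof -
  obtain a where a: "a \<in> A" "\<And>x. x \<in> A \<Longrightarrow> x \<le> a" using compact_attains_sup[OF A] by blast
  obtain b where b: "b \<in> B" "\<And>x. x \<in> B \<Longrightarrow> b \<le> x" using compact_attains_inf[OF B] by blast
  have AB[measurable]: "A \<in> sets borel" "B \<in> sets borel" using A B by (auto simp: borel_compact)
  define A' where "A' = {z. -b + 2 * z \<in> A}"
  define B' where "B' = {z. -a + 2 * z \<in> B}"
  have [measurable]: "A' \<in> sets borel" "B' \<in> sets borel" by (auto simp: A'_def B'_def)
  have sub: "A' \<union> B' \<subseteq> C"
  proof -
    have "z \<in> C" if "z \<in> A'" for z using mid[of "-b + 2*z" b] that b by (auto simp: A'_def)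
    moreover have "z \<in> C" if "z \<in> B'" for z using mid[of a "-a + 2*z"] that a by (auto simp: B'_def)
    ultimately show ?thesis by auto
  qed
  have "A' \<inter> B' \<subseteq> {(a + b) / 2}"
  proof
    fix z assume "z \<in> A' \<inter> B'"
    with a(2)[of "-b+2*z"] b(2)[of "-a+2*z"] show "z \<in> {(a + b) / 2}"
      by (auto simp: A'_def B'_def)
  qed
  then have "emeasure lborel (A' \<inter> B') = 0"
    by (metis emeasure_lborel_singleton emeasure_mono le_zero_eq sets_lborel singleton_insert_inj_eq' borel_singleton sets.empty_sets)
  then have nul: "A' \<inter> B' \<in> null_sets lborel" by (auto simp: null_sets_def)
  have "emeasure lborel A' + emeasure lborel B' = emeasure lborel (A' \<union> B')"
  proof -
    have "emeasure lborel (A' \<union> B') = emeasure lborel (A' \<union> (B' - A' \<inter> B'))"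
      by (rule arg_cong[where f="emeasure lborel"]) auto
    also have "\<dots> = emeasure lborel A' + emeasure lborel (B' - A' \<inter> B')"
      by (subst plus_emeasure) auto
    also have "emeasure lborel (B' - A' \<inter> B') = emeasure lborel B'"
      by (rule emeasure_Diff_null_set[OF nul]) auto
    finally show ?thesis ..
  qed
  also have "\<dots> \<le> emeasure lborel C" using sub C by (intro emeasure_mono) auto
  finally have "2 * (emeasure lborel A' + emeasure lborel B') \<le> 2 * emeasure lborel C"
    by (rule mult_left_mono) auto
  then show ?thesis
    using emeasure_lborel_half_preimage[of A "-b"] emeasure_lborel_half_preimage[of B "-a"]
    by (auto simp: A'_def B'_def distrib_left)
qed

lemma brunn_minkowski_real:
  fixes A B C :: "real set"
  assumes A: "A \<in> sets borel" "A \<noteq> {}" and B: "B \<in> sets borel" "B \<noteq> {}" and C: "C \<in> sets borel"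
    and mid: "\<And>x y. x \<in> A \<Longrightarrow> y \<in> B \<Longrightarrow> (x + y) / 2 \<in> C"
  shows "emeasure lborel A + emeasure lborel B \<le> 2 * emeasure lborel C"
proof -
  \<comment> \<open>The alternative \<open>r = 0\<close> covers null sets, where no \<open>r\<close>
    lies strictly below the measure; a single point then serves as the compact set, since the
    compact case needs nonempty sets.\<close>
  have cpt: "\<exists>K. compact K \<and> K \<noteq> {} \<and> K \<subseteq> A \<and> r \<le> emeasure lborel K"
    if A: "A \<in> sets borel" "A \<noteq> {}" and r: "r < emeasure lborel A \<or> r = 0" for A :: "real set" and r
  proof (cases "r < emeasure lborel A")
    case True
    with A obtain K where "compact K" "K \<subseteq> A" "r < emeasure lborel K" by (rule_tac borel_compact_approx)
    then show ?thesis by (intro exI[of _ K]) (auto simp: less_imp_le)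
  next
    case False
    with A r show ?thesis by (auto intro!: exI[of _ "{SOME x. x \<in> A}"] simp: some_in_eq)
  qed
  have key: "r + s \<le> 2 * emeasure lborel C"
    if r: "r < emeasure lborel A \<or> r = 0" and s: "s < emeasure lborel B \<or> s = 0" for r s
  proof -
    obtain K where K: "compact K" "K \<noteq> {}" "K \<subseteq> A" "r \<le> emeasure lborel K" using cpt[OF A r] by blast
    obtain L where L: "compact L" "L \<noteq> {}" "L \<subseteq> B" "s \<le> emeasure lborel L" using cpt[OF B s] by blast
    have "emeasure lborel K + emeasure lborel L \<le> 2 * emeasure lborel C"
      using K L mid by (intro brunn_minkowski_real_compact C) auto
    then show ?thesis using K(4) L(4) by (meson add_mono order_trans)
  qed
  have sup: "Sup {r. r < x \<or> r = 0} = x" for x :: ennreal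
  proof (intro antisym)
    show "Sup {r. r < x \<or> r = 0} \<le> x" by (rule Sup_least) auto
    show "x \<le> Sup {r. r < x \<or> r = 0}"
      by (rule dense_le) (auto intro: Sup_upper)
  qed
  have "(SUP r\<in>{r. r < emeasure lborel A \<or> r = 0}. r + s) \<le> 2 * emeasure lborel C"
    if "s < emeasure lborel B \<or> s = 0" for s
    using key that by (intro SUP_least) auto
  then have 1: "emeasure lborel A + s \<le> 2 * emeasure lborel C" if "s < emeasure lborel B \<or> s = 0" for s
    using that sup[of "emeasure lborel A"] by (subst (asm) ennreal_SUP_add_left) auto
  have ne: "{r. r < emeasure lborel B \<or> r = 0} \<noteq> {}" by auto
  have "(SUP s\<in>{r. r < emeasure lborel B \<or> r = 0}. emeasure lborel A + s) \<le> 2 * emeasure lborel C"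
    using 1 by (intro SUP_least) auto
  then show ?thesis
    using sup[of "emeasure lborel B"] ne ennreal_SUP_add_right[OF ne, of "emeasure lborel A" "\<lambda>r. r"]
    by simp
qed

section \<open>The Prekopa-Leindler inequality, from level sets to all dimensions\<close>

lemma (in sigma_finite_measure) nn_integral_layer_unit:
  fixes f :: "'a \<Rightarrow> real"
  assumes f[measurable]: "f \<in> borel_measurable M" and f01: "\<And>x. 0 \<le> f x" "\<And>x. f x \<le> 1"
  shows "(\<integral>\<^sup>+x. ennreal (f x) \<partial>M)
    = (\<integral>\<^sup>+t. indicator {0<..<1} t * emeasure M {x\<in>space M. t < f x} \<partial>lborel)"
proof -
  interpret L: pair_sigma_finite lborel M ..
  have "(\<integral>\<^sup>+x. ennreal (f x) \<partial>M) = (\<integral>\<^sup>+x. (\<integral>\<^sup>+t. indicator {0<..<1} t * indicator {z. z < f x} t \<partial>lborel) \<partial>M)"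
  proof (intro nn_integral_cong)
    fix x
    have "(\<integral>\<^sup>+t. indicator {0<..<1} t * indicator {z. z < f x} t \<partial>lborel)
       = (\<integral>\<^sup>+t. indicator {0<..<f x} t \<partial>lborel)"
      using f01(2)[of x] by (intro nn_integral_cong) (auto simp: indicator_def)
    then show "ennreal (f x) = (\<integral>\<^sup>+t. indicator {0<..<1} t * indicator {z. z < f x} t \<partial>lborel)"
      using f01 by simp
  qed
  also have "\<dots> = (\<integral>\<^sup>+t. (\<integral>\<^sup>+x. indicator {0<..<1} t * indicator {z. z < f x} t \<partial>M) \<partial>lborel)"
    by (rule L.Fubini') measurable
  also have "\<dots> = (\<integral>\<^sup>+t. indicator {0<..<1} t * emeasure M {x\<in>space M. t < f x} \<partial>lborel)"
  proof (intro nn_integral_cong)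
    fix t :: real
    have "(\<integral>\<^sup>+x. indicator {0<..<1} t * indicator {z. z < f x} t \<partial>M)
      = (\<integral>\<^sup>+x. indicator {0<..<1} t * indicator {x\<in>space M. t < f x} x \<partial>M)"
      by (intro nn_integral_cong) (auto simp: indicator_def)
    then show "(\<integral>\<^sup>+x. indicator {0<..<1} t * indicator {z. z < f x} t \<partial>M) =
       indicator {0<..<1} t * emeasure M {x\<in>space M. t < f x}"
      by (simp add: nn_integral_cmult)
  qed
  finally show ?thesis .
qed

text \<open>With both suprema equal to one, the superlevel sets of \<open>f\<close> and
  \<open>g\<close> are nonempty at every level t in (0,1), and the midpoint condition puts their
  midpoints into the superlevel set of \<open>h\<close> at the same level. Brunn-Minkowski level by
  level, integrated over t, gives an additive form that is stronger than the product form by the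
  inequality of arithmetic and geometric means.\<close>

lemma prekopa_leindler_unit:
  fixes f g h :: "real \<Rightarrow> real"
  assumes [measurable]: "f \<in> borel_measurable borel" "g \<in> borel_measurable borel" "h \<in> borel_measurable borel"
    and f01: "\<And>x. 0 \<le> f x" "\<And>x. f x \<le> 1" and g01: "\<And>x. 0 \<le> g x" "\<And>x. g x \<le> 1"
    and h01: "\<And>x. 0 \<le> h x" "\<And>x. h x \<le> 1"
    and supf: "\<And>t. t < 1 \<Longrightarrow> \<exists>x. t < f x" and supg: "\<And>t. t < 1 \<Longrightarrow> \<exists>x. t < g x"
    and mid: "\<And>x y. f x * g y \<le> (h ((x + y) / 2))\<^sup>2"
  shows "(\<integral>\<^sup>+x. f x \<partial>lborel) + (\<integral>\<^sup>+x. g x \<partial>lborel) \<le> 2 * (\<integral>\<^sup>+x. h x \<partial>lborel)"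
proof -
  have lev: "emeasure lborel {x\<in>space lborel. t < f x} + emeasure lborel {x\<in>space lborel. t < g x}
      \<le> 2 * emeasure lborel {x\<in>space lborel. t < h x}" if t: "0 < t" "t < 1" for t
  proof (rule brunn_minkowski_real)
    show "{x \<in> space lborel. t < f x} \<noteq> {}" "{x \<in> space lborel. t < g x} \<noteq> {}"
      using supf[OF t(2)] supg[OF t(2)] by auto
    fix x y assume "x \<in> {x \<in> space lborel. t < f x}" "y \<in> {x \<in> space lborel. t < g x}"
    then have "t * t < f x * g y" using t by (intro mult_strict_mono) auto
    also have "\<dots> \<le> (h ((x + y) / 2))\<^sup>2" by (rule mid)
    finally have "t < h ((x + y) / 2)" using t h01
      by (metis power2_eq_square power_less_imp_less_base)
    then show "(x + y) / 2 \<in> {x \<in> space lborel. t < h x}" by simp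
  qed auto
  note lay = lborel.nn_integral_layer_unit
  have [measurable]: "(\<lambda>t. emeasure lborel {x\<in>space lborel. t < u x}) \<in> borel_measurable borel"
    if [measurable]: "u \<in> borel_measurable borel" for u :: "real \<Rightarrow> real" 
    by measurable
  have "(\<integral>\<^sup>+x. f x \<partial>lborel) + (\<integral>\<^sup>+x. g x \<partial>lborel) =
     (\<integral>\<^sup>+t. indicator {0<..<1} t * emeasure lborel {x\<in>space lborel. t < f x} \<partial>lborel)
     + (\<integral>\<^sup>+t. indicator {0<..<1} t * emeasure lborel {x\<in>space lborel. t < g x} \<partial>lborel)"
    by (intro arg_cong2[where f="(+)"] lay f01 g01) auto
  also have "\<dots> = (\<integral>\<^sup>+t. indicator {0<..<1} t * emeasure lborel {x\<in>space lborel. t < f x}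
     + indicator {0<..<1} t * emeasure lborel {x\<in>space lborel. t < g x} \<partial>lborel)"
    by (subst nn_integral_add) auto
  also have "\<dots> \<le> (\<integral>\<^sup>+t. 2 * (indicator {0<..<1} t * emeasure lborel {x\<in>space lborel. t < h x}) \<partial>lborel)"
    using lev by (intro nn_integral_mono) (auto simp: indicator_def)
  also have "\<dots> = 2 * (\<integral>\<^sup>+x. h x \<partial>lborel)"
    by (subst nn_integral_cmult, measurable) (intro arg_cong2[where f="(*)"] refl lay[symmetric] h01, measurable)
  finally show ?thesis .
qed

lemma ennreal_am_gm2:
  fixes a b c :: ennreal
  assumes "a + b \<le> 2 * c"
  shows "a * b \<le> c\<^sup>2"
proof (cases "c = \<infinity>")
  case True
  then show ?thesis by (simp add: power2_eq_square ennreal_top_mult)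
next
  case False
  then obtain r where r: "c = ennreal r" "0 \<le> r" by (cases c) auto
  have "2 * c < \<infinity>" using r by (simp add: ennreal_mult_less_top)
  then have "a + b < \<infinity>" using assms by (rule le_less_trans[rotated])
  then obtain x y where xy: "a = ennreal x" "0 \<le> x" "b = ennreal y" "0 \<le> y"
    by (cases a; cases b) auto
  have "ennreal (x + y) \<le> ennreal (2 * r)"
    using assms r xy by (simp add: ennreal_mult' flip: ennreal_numeral)
  then have "x + y \<le> 2 * r" using r xy by (subst (asm) ennreal_le_iff) auto
  then have "(x + y)\<^sup>2 \<le> (2 * r)\<^sup>2" using xy by (intro power_mono) auto
  moreover have "4 * (x * y) \<le> (x + y)\<^sup>2"
    using zero_le_power2[of "x - y"] by (simp add: power2_eq_square algebra_simps)
  ultimately have "x * y \<le> r\<^sup>2" by (simp add: power2_eq_square)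
  then show ?thesis using r xy by (simp add: ennreal_mult[symmetric] ennreal_power)
qed

lemma prekopa_leindler_real_bounded:
  fixes f g h :: "real \<Rightarrow> ennreal"
  assumes [measurable]: "f \<in> borel_measurable borel" "g \<in> borel_measurable borel" "h \<in> borel_measurable borel"
    and bf: "(SUP x. f x) < \<infinity>" and bg: "(SUP x. g x) < \<infinity>"
    and mid: "\<And>x y. f x * g y \<le> (h ((x + y) / 2))\<^sup>2"
  shows "(\<integral>\<^sup>+x. f x \<partial>lborel) * (\<integral>\<^sup>+x. g x \<partial>lborel) \<le> (\<integral>\<^sup>+x. h x \<partial>lborel)\<^sup>2"
proof (cases "(SUP x. f x) = 0 \<or> (SUP x. g x) = 0")
  case True
  then have "(\<forall>x. f x = 0) \<or> (\<forall>x. g x = 0)"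
    by (metis SUP_upper UNIV_I le_zero_eq)
  then show ?thesis by auto
next
  case False
  define F where "F = enn2real (SUP x. f x)"
  define G where "G = enn2real (SUP x. g x)"
  have F: "(SUP x. f x) = ennreal F" "F > 0" using bf False
    by (simp_all add: F_def ennreal_enn2real_if enn2real_positive_iff zero_less_iff_neq_zero less_top[symmetric])
  have G: "(SUP x. g x) = ennreal G" "G > 0" using bg False
    by (simp_all add: G_def ennreal_enn2real_if enn2real_positive_iff zero_less_iff_neq_zero less_top[symmetric])
  have fF: "f x \<le> ennreal F" for x by (simp flip: F(1) add: SUP_upper)
  have gG: "g x \<le> ennreal G" for x by (simp flip: G(1) add: SUP_upper)
  define f' where "f' x = enn2real (f x) / F" for x
  define g' where "g' x = enn2real (g x) / G" for x
  \<comment> \<open>The product inequality is homogeneous, so \<open>f\<close> and \<open>g\<close>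
    are divided by their suprema and \<open>h\<close> by the geometric mean of these.\<close>
  define c where "c = sqrt (F * G)"
  have c: "c > 0" "c\<^sup>2 = F * G" using F G by (auto simp: c_def)
  \<comment> \<open>Cutting off at one keeps the midpoint condition, because
    \<open>f' x * g' y\<close> never exceeds one, and makes \<open>h'\<close> real-valued.\<close>
  define h' where "h' x = enn2real (min 1 (h x / ennreal c))" for x
  have [measurable]: "f' \<in> borel_measurable borel" "g' \<in> borel_measurable borel" "h' \<in> borel_measurable borel"
    unfolding f'_def g'_def h'_def by measurable
  have feq: "f x = ennreal (F * f' x)" for x
    using fF[of x] F by (auto simp: f'_def ennreal_enn2real_if top_unique)
  have geq: "g x = ennreal (G * g' x)" for x
    using gG[of x] G by (auto simp: g'_def ennreal_enn2real_if top_unique)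
  have f01: "0 \<le> f' x" "f' x \<le> 1" for x
    using fF[of x] F by (auto simp: f'_def enn2real_leI)
  have g01: "0 \<le> g' x" "g' x \<le> 1" for x
    using gG[of x] G by (auto simp: g'_def enn2real_leI)
  have h01: "0 \<le> h' x" "h' x \<le> 1" for x
    by (auto simp: h'_def intro!: enn2real_leI)
  have hle: "ennreal (c * h' x) \<le> h x" for x
  proof -
    have "ennreal (c * h' x) = ennreal c * min 1 (h x / ennreal c)"
      using c by (simp add: h'_def ennreal_mult' ennreal_enn2real_if min_def)
    also have "\<dots> \<le> ennreal c * (h x / ennreal c)" by (intro mult_left_mono) auto
    also have "\<dots> = h x" using c
      by (metis ennreal_eq_0_iff ennreal_mult_divide_eq ennreal_neq_top mult.commute ennreal_times_divide not_le)
    finally show ?thesis .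
  qed
  have "(\<integral>\<^sup>+x. f' x \<partial>lborel) + (\<integral>\<^sup>+x. g' x \<partial>lborel) \<le> 2 * (\<integral>\<^sup>+x. h' x \<partial>lborel)"
  proof (rule prekopa_leindler_unit)
    show "\<exists>x. t < f' x" if "t < 1" for t
    proof -
      have "ennreal (max 0 t * F) < (SUP x. f x)" using that F by (subst F(1), subst ennreal_less_iff) auto
      then obtain x where "ennreal (max 0 t * F) < ennreal (F * f' x)" by (auto simp: less_SUP_iff feq)
      then have "max 0 t < f' x" using F f01 by (subst (asm) ennreal_less_iff) (auto simp: mult.commute)
      then show ?thesis by auto
    qed
    show "\<exists>x. t < g' x" if "t < 1" for t
    proof -
      have "ennreal (max 0 t * G) < (SUP x. g x)" using that G by (subst G(1), subst ennreal_less_iff) auto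
      then obtain x where "ennreal (max 0 t * G) < ennreal (G * g' x)" by (auto simp: less_SUP_iff geq)
      then have "max 0 t < g' x" using G g01 by (subst (asm) ennreal_less_iff) (auto simp: mult.commute)
      then show ?thesis by auto
    qed
    fix x y
    define u where "u = h ((x + y) / 2) / ennreal c"
    show "f' x * g' y \<le> (h' ((x + y) / 2))\<^sup>2"
    proof (cases "1 \<le> u")
      case True
      then have "h' ((x + y) / 2) = 1" by (simp add: h'_def u_def min_def)
      then show ?thesis using f01 g01 by (simp add: mult_le_one)
    next
      case False
      then obtain r where r: "u = ennreal r" "0 \<le> r" by (cases u) (auto simp: top_unique)
      have h'r: "h' ((x + y) / 2) = r" using False r by (simp add: h'_def u_def[symmetric] min_def)
      have "h ((x + y) / 2) = ennreal (c * r)"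
        using r c unfolding u_def
        by (metis ennreal_eq_0_iff ennreal_mult' ennreal_mult_divide_eq ennreal_neq_top ennreal_times_divide less_imp_le mult.commute not_le)
      then have "ennreal (F * f' x) * ennreal (G * g' y) \<le> (ennreal (c * r))\<^sup>2"
        using mid[of x y] by (simp add: feq geq)
      then have "ennreal ((F * f' x) * (G * g' y)) \<le> ennreal ((c * r)\<^sup>2)"
        using F G f01 g01 c r by (subst ennreal_mult, simp, simp, subst ennreal_power[symmetric]) simp_all
      then have "(F * f' x) * (G * g' y) \<le> (c * r)\<^sup>2" by (subst (asm) ennreal_le_iff) auto
      then have "(F * G) * (f' x * g' y) \<le> (F * G) * r\<^sup>2"
        using c by (simp add: power_mult_distrib mult_ac)
      then show ?thesis using F G h'r by simp
    qed
  qed (use f01 g01 h01 in auto)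
  then have "(\<integral>\<^sup>+x. f' x \<partial>lborel) * (\<integral>\<^sup>+x. g' x \<partial>lborel) \<le> (\<integral>\<^sup>+x. h' x \<partial>lborel)\<^sup>2"
    by (rule ennreal_am_gm2)
  then have "ennreal (F * G) * ((\<integral>\<^sup>+x. f' x \<partial>lborel) * (\<integral>\<^sup>+x. g' x \<partial>lborel))
      \<le> ennreal (c\<^sup>2) * (\<integral>\<^sup>+x. h' x \<partial>lborel)\<^sup>2"
    unfolding c by (intro mult_left_mono) auto
  also have "\<dots> = (\<integral>\<^sup>+x. ennreal (c * h' x) \<partial>lborel)\<^sup>2"
    using c h01 by (simp add: ennreal_mult' nn_integral_cmult power_mult_distrib ennreal_power flip: c(2))
  also have "\<dots> \<le> (\<integral>\<^sup>+x. h x \<partial>lborel)\<^sup>2"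
    by (intro power_mono nn_integral_mono hle) auto
  finally show ?thesis
    using F G f01 g01 by (simp add: feq geq ennreal_mult ennreal_mult' nn_integral_cmult mult_ac)
qed

lemma nn_integral_SUP_min:
  fixes f :: "'a \<Rightarrow> ennreal"
  assumes [measurable]: "f \<in> borel_measurable M"
  shows "(\<integral>\<^sup>+x. f x \<partial>M) = (SUP m. \<integral>\<^sup>+x. min (f x) (of_nat m) \<partial>M)"
proof -
  have "(SUP m. \<integral>\<^sup>+x. min (f x) (of_nat m) \<partial>M) = (\<integral>\<^sup>+x. (SUP m. min (f x) (of_nat m)) \<partial>M)"
    by (intro nn_integral_monotone_convergence_SUP[symmetric])
       (auto simp: incseq_def le_fun_def min_le_iff_disj intro: min.mono)
  also have "(\<lambda>x. SUP m. min (f x) (of_nat m)) = f"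
  proof
    fix x
    have "(SUP m. min (f x) (of_nat m)) = min (f x) (SUP m. of_nat m)"
      by (simp add: inf_min[symmetric] inf_SUP)
    then show "(SUP m. min (f x) (of_nat m)) = f x" by (simp add: ennreal_SUP_of_nat_eq_top)
  qed
  finally show ?thesis by simp
qed

lemma prekopa_leindler_real:
  fixes f g h :: "real \<Rightarrow> ennreal"
  assumes [measurable]: "f \<in> borel_measurable borel" "g \<in> borel_measurable borel" "h \<in> borel_measurable borel"
    and mid: "\<And>x y. f x * g y \<le> (h ((x + y) / 2))\<^sup>2"
  shows "(\<integral>\<^sup>+x. f x \<partial>lborel) * (\<integral>\<^sup>+x. g x \<partial>lborel) \<le> (\<integral>\<^sup>+x. h x \<partial>lborel)\<^sup>2"
proof -
  let ?f = "\<lambda>m x. min (f x) (of_nat m)" and ?g = "\<lambda>m x. min (g x) (of_nat m)"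
  have fin: "(SUP x. min (u x) (of_nat m)) < \<infinity>" for u :: "real \<Rightarrow> ennreal" and m :: nat
    by (rule le_less_trans[OF SUP_least[where u="of_nat m"]]) (auto simp: of_nat_less_top)
  have *: "(\<integral>\<^sup>+x. ?f m x \<partial>lborel) * (\<integral>\<^sup>+x. ?g k x \<partial>lborel) \<le> (\<integral>\<^sup>+x. h x \<partial>lborel)\<^sup>2" for m k
  proof (rule prekopa_leindler_real_bounded)
    show "?f m x * ?g k y \<le> (h ((x + y) / 2))\<^sup>2" for x y
      by (rule order_trans[OF _ mid]) (auto intro!: mult_mono)
  qed (use fin in auto)
  have "(\<integral>\<^sup>+x. f x \<partial>lborel) * (\<integral>\<^sup>+x. g x \<partial>lborel)
    = (SUP m. (SUP k. (\<integral>\<^sup>+x. ?f m x \<partial>lborel) * (\<integral>\<^sup>+x. ?g k x \<partial>lborel)))"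
    by (subst nn_integral_SUP_min[of f], simp, subst nn_integral_SUP_min[of g], simp)
       (simp only: SUP_mult_left_ennreal SUP_mult_right_ennreal, rule SUP_commute)
  also have "\<dots> \<le> (\<integral>\<^sup>+x. h x \<partial>lborel)\<^sup>2" using * by (intro SUP_least) auto
  finally show ?thesis .
qed

text \<open>Tensorisation: for fixed values \<open>s\<close> and \<open>t\<close> of the new
  coordinate, the induction hypothesis applied to the slices says that the slice integrals again
  satisfy the midpoint condition, so the one-dimensional inequality applies to them.\<close>

lemma prekopa_leindler_PiM:
  fixes f g h :: "('i \<Rightarrow> real) \<Rightarrow> ennreal"
  assumes "finite I"
    and "f \<in> borel_measurable (Pi\<^sub>M I (\<lambda>_. lborel))" "g \<in> borel_measurable (Pi\<^sub>M I (\<lambda>_. lborel))"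
      "h \<in> borel_measurable (Pi\<^sub>M I (\<lambda>_. lborel))"
    and "\<And>x y. x \<in> extensional I \<Longrightarrow> y \<in> extensional I \<Longrightarrow> f x * g y \<le> (h (\<lambda>i\<in>I. (x i + y i) / 2))\<^sup>2"
  shows "(\<integral>\<^sup>+x. f x \<partial>Pi\<^sub>M I (\<lambda>_. lborel)) * (\<integral>\<^sup>+x. g x \<partial>Pi\<^sub>M I (\<lambda>_. lborel))
      \<le> (\<integral>\<^sup>+x. h x \<partial>Pi\<^sub>M I (\<lambda>_. lborel))\<^sup>2"
  using assms
proof (induction I arbitrary: f g h rule: finite_induct)
  case empty
  interpret product_sigma_finite "\<lambda>_::'i. lborel :: real measure" by standard
  show ?case using empty(4)[of "\<lambda>_. undefined" "\<lambda>_. undefined"]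
    by (simp add: PiM_empty nn_integral_count_space_finite restrict_def power2_eq_square)
next
  case (insert i I)
  interpret product_sigma_finite "\<lambda>_::'i. lborel :: real measure" by standard
  interpret I: finite_product_sigma_finite "\<lambda>_::'i. lborel :: real measure" I by standard fact
  note [measurable] = insert.prems(1-3)
  define S where "S u s = (\<integral>\<^sup>+x. u (x(i := s)) \<partial>Pi\<^sub>M I (\<lambda>_. lborel))" for u :: "('i \<Rightarrow> real) \<Rightarrow> ennreal" and s
  have eq: "(\<integral>\<^sup>+x. u x \<partial>Pi\<^sub>M (insert i I) (\<lambda>_. lborel)) = (\<integral>\<^sup>+s. S u s \<partial>lborel)"
    if "u \<in> borel_measurable (Pi\<^sub>M (insert i I) (\<lambda>_. lborel))" for u
    unfolding S_def using insert that by (subst product_nn_integral_insert_rev) auto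
  have Sm: "S u \<in> borel_measurable borel"
    if [measurable]: "u \<in> borel_measurable (Pi\<^sub>M (insert i I) (\<lambda>_. lborel))" for u
    unfolding S_def by measurable
  have "(\<integral>\<^sup>+s. S f s \<partial>lborel) * (\<integral>\<^sup>+s. S g s \<partial>lborel) \<le> (\<integral>\<^sup>+s. S h s \<partial>lborel)\<^sup>2"
  proof (rule prekopa_leindler_real)
    fix s t :: real
    show "S f s * S g t \<le> (S h ((s + t) / 2))\<^sup>2"
      unfolding S_def
    proof (rule insert.IH)
      fix x y :: "'i \<Rightarrow> real" assume xy: "x \<in> extensional I" "y \<in> extensional I"
      have "f (x(i := s)) * g (y(i := t)) \<le> (h (\<lambda>j\<in>insert i I. ((x(i := s)) j + (y(i := t)) j) / 2))\<^sup>2"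
        using xy by (intro insert.prems(4)) (auto simp: extensional_def)
      also have "(\<lambda>j\<in>insert i I. ((x(i := s)) j + (y(i := t)) j) / 2) = (\<lambda>j\<in>I. (x j + y j) / 2)(i := (s + t) / 2)"
        using insert.hyps by (auto simp: restrict_def fun_eq_iff)
      finally show "f (x(i := s)) * g (y(i := t)) \<le> (h ((\<lambda>j\<in>I. (x j + y j) / 2)(i := (s + t) / 2)))\<^sup>2" .
    qed measurable
  qed (use Sm insert.prems in auto)
  then show ?case using eq insert.prems by simp
qed

theorem prekopa_leindler:
  fixes f g h :: "'a::euclidean_space \<Rightarrow> ennreal"
  assumes [measurable]: "f \<in> borel_measurable borel" "g \<in> borel_measurable borel" "h \<in> borel_measurable borel"
    and mid: "\<And>x y. f x * g y \<le> (h ((1/2) *\<^sub>R (x + y)))\<^sup>2"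
  shows "(\<integral>\<^sup>+x. f x \<partial>lborel) * (\<integral>\<^sup>+x. g x \<partial>lborel) \<le> (\<integral>\<^sup>+x. h x \<partial>lborel)\<^sup>2"
proof -
  define T :: "('a \<Rightarrow> real) \<Rightarrow> 'a" where "T x = (\<Sum>b\<in>Basis. x b *\<^sub>R b)" for x
  have T[measurable]: "T \<in> Pi\<^sub>M Basis (\<lambda>_. lborel) \<rightarrow>\<^sub>M borel"
    unfolding T_def by measurable
  have eq: "(\<integral>\<^sup>+x. u x \<partial>lborel) = (\<integral>\<^sup>+x. u (T x) \<partial>Pi\<^sub>M Basis (\<lambda>_. lborel))"
    if "u \<in> borel_measurable borel" for u
    unfolding lborel_eq[where 'a='a] T_def[symmetric] using that by (subst nn_integral_distr) auto
  have "(\<integral>\<^sup>+x. f (T x) \<partial>Pi\<^sub>M Basis (\<lambda>_. lborel)) * (\<integral>\<^sup>+x. g (T x) \<partial>Pi\<^sub>M Basis (\<lambda>_. lborel))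
     \<le> (\<integral>\<^sup>+x. h (T x) \<partial>Pi\<^sub>M Basis (\<lambda>_. lborel))\<^sup>2"
  proof (rule prekopa_leindler_PiM)
    fix x y :: "'a \<Rightarrow> real"
    have "T (\<lambda>i\<in>Basis. (x i + y i) / 2) = (1/2) *\<^sub>R (T x + T y)"
      by (simp add: T_def scaleR_sum_right scaleR_add_left[symmetric] flip: sum.distrib)
    then show "f (T x) * g (T y) \<le> (h (T (\<lambda>i\<in>Basis. (x i + y i) / 2)))\<^sup>2" using mid by simp
  qed simp_all
  then show ?thesis by (simp add: eq)
qed

section \<open>Translation-invariant measures\<close>

lemma nn_integral_lborel_translation:
  fixes f :: "'a::euclidean_space \<Rightarrow> ennreal"
  assumes [measurable]: "f \<in> borel_measurable borel"
  shows "(\<integral>\<^sup>+x. f (z + x) \<partial>lborel) = (\<integral>\<^sup>+x. f x \<partial>lborel)"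
  by (subst (2) lborel_distr_plus[of z, symmetric], subst nn_integral_distr) auto

lemma nn_integral_lborel_reflect:
  fixes f :: "'a::euclidean_space \<Rightarrow> ennreal"
  assumes [measurable]: "f \<in> borel_measurable borel"
  shows "(\<integral>\<^sup>+x. f (z - x) \<partial>lborel) = (\<integral>\<^sup>+x. f x \<partial>lborel)"
  by (subst (2) lborel_affine[of "-1" z], simp, subst nn_integral_density, measurable,
      subst nn_integral_distr) auto

text \<open>Uniqueness of Haar measure by double counting: the product measure of the pairs (x, y)
  with x in A and x + y in B is computed in both orders, using invariance of \<open>m\<close> in one
  and of Lebesgue measure under translation and reflection in the other. The product form avoids
  dividing by measures that may be zero or infinite.\<close>

theorem translation_invariant_unique:
  fixes m :: "'a::euclidean_space measure"
  assumes sm: "sets m = sets borel" and sf: "sigma_finite_measure m"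
    and inv: "\<And>z f. f \<in> borel_measurable borel \<Longrightarrow> (\<integral>\<^sup>+x. f (z + x) \<partial>m) = (\<integral>\<^sup>+x. f x \<partial>m)"
    and A: "A \<in> sets borel" and B: "B \<in> sets borel"
  shows "emeasure m A * emeasure lborel B = emeasure m B * emeasure lborel A"
proof -
  interpret m: sigma_finite_measure m by fact
  interpret P: pair_sigma_finite m lborel ..
  note [measurable] = A B
  note [measurable_cong] = sm
  have sp: "space m = UNIV" using sets_eq_imp_space_eq[OF sm] by simp
  have "emeasure m A * emeasure lborel B = (\<integral>\<^sup>+x. indicator A x * (\<integral>\<^sup>+y. indicator B y \<partial>lborel) \<partial>m)"
    using A B by (simp add: nn_integral_multc sm)
  also have "\<dots> = (\<integral>\<^sup>+x. (\<integral>\<^sup>+y. indicator A x * indicator B (x + y) \<partial>lborel) \<partial>m)"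
    by (intro nn_integral_cong, subst nn_integral_cmult, measurable, subst nn_integral_lborel_translation) auto
  also have "\<dots> = (\<integral>\<^sup>+y. (\<integral>\<^sup>+x. indicator A x * indicator B (x + y) \<partial>m) \<partial>lborel)"
    by (rule P.Fubini'[symmetric]) measurable
  also have "\<dots> = (\<integral>\<^sup>+y. (\<integral>\<^sup>+x. indicator A (x - y) * indicator B x \<partial>m) \<partial>lborel)"
  proof (rule nn_integral_cong)
    fix y
    show "(\<integral>\<^sup>+x. indicator A x * indicator B (x + y) \<partial>m) = (\<integral>\<^sup>+x. indicator A (x - y) * indicator B x \<partial>m)"
      by (subst inv[symmetric, where z="y" and f="\<lambda>x. indicator A (x - y) * indicator B x"]) (auto simp: add.commute)
  qed
  also have "\<dots> = (\<integral>\<^sup>+x. (\<integral>\<^sup>+y. indicator A (x - y) * indicator B x \<partial>lborel) \<partial>m)"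
    by (rule P.Fubini') measurable
  also have "\<dots> = (\<integral>\<^sup>+x. emeasure lborel A * indicator B x \<partial>m)"
    using A by (intro nn_integral_cong, subst nn_integral_multc, measurable, subst nn_integral_lborel_reflect) auto
  also have "\<dots> = emeasure m B * emeasure lborel A"
    using B by (subst nn_integral_cmult_indicator) (simp_all add: sm mult.commute)
  finally show ?thesis .
qed

section \<open>Hausdorff measure\<close>

lemma hausdorff_pre_mono: "A \<subseteq> B \<Longrightarrow> hausdorff_pre k \<delta> A \<le> hausdorff_pre k \<delta> B"
  unfolding hausdorff_pre_def by (rule INF_superset_mono) auto

lemma hausdorff_pre_antimono: "\<delta> \<le> \<delta>' \<Longrightarrow> hausdorff_pre k \<delta>' A \<le> hausdorff_pre k \<delta> A"
  unfolding hausdorff_pre_def by (rule INF_superset_mono) (auto intro: order_trans)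

lemma hausdorff_outer_mono: "A \<subseteq> B \<Longrightarrow> hausdorff_outer k A \<le> hausdorff_outer k B"
  unfolding hausdorff_outer_def by (intro SUP_mono') (rule hausdorff_pre_mono)

lemma hausdorff_pre_le_outer: "0 < \<delta> \<Longrightarrow> hausdorff_pre k \<delta> A \<le> hausdorff_outer k A"
  unfolding hausdorff_outer_def by (rule SUP_upper) auto

lemma hausdorff_pre_le_gauge:
  assumes "bounded C" "diameter C \<le> \<delta>"
  shows "hausdorff_pre k \<delta> C \<le> hausdorff_gauge k C"
proof -
  have "0 \<le> \<delta>" using assms diameter_ge_0[of C] by linarith
  then have "hausdorff_pre k \<delta> C \<le> (\<Sum>m. hausdorff_gauge k ((\<lambda>m::nat. if m = 0 then C else {}) m))"
    unfolding hausdorff_pre_def using assms by (intro INF_lower) auto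
  also have "\<dots> = hausdorff_gauge k C"
    by (subst suminf_finite[of "{0}"]) (auto simp: hausdorff_gauge_def)
  finally show ?thesis .
qed

lemma hausdorff_pre_empty [simp]:
  assumes "0 \<le> \<delta>"
  shows "hausdorff_pre k \<delta> {} = 0"
  using hausdorff_pre_le_gauge[of "{}" \<delta> k] assms by (simp add: hausdorff_gauge_def)

lemma hausdorff_outer_empty [simp]: "hausdorff_outer k {} = 0"
  unfolding hausdorff_outer_def by (simp add: SUP_eq_const)

lemma hausdorff_pre_subadditive:
  fixes A :: "nat \<Rightarrow> 'a::metric_space set"
  shows "hausdorff_pre k \<delta> (\<Union>i. A i) \<le> (\<Sum>i. hausdorff_pre k \<delta> (A i))"
proof (rule ennreal_le_epsilon)
  fix e :: real assume fin: "(\<Sum>i. hausdorff_pre k \<delta> (A i)) < top" and e: "0 < e"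
  have ex: "\<exists>C. A i \<subseteq> (\<Union>m. C m) \<and> (\<forall>m. bounded (C m) \<and> diameter (C m) \<le> \<delta>)
    \<and> (\<Sum>m. hausdorff_gauge k (C m)) \<le> hausdorff_pre k \<delta> (A i) + ennreal (e * (1/2)^Suc i)" for i
  proof -
    have "hausdorff_pre k \<delta> (A i) \<noteq> \<infinity>"
      using fin ennreal_suminf_lessD[OF fin, of i] by auto
    then have "hausdorff_pre k \<delta> (A i) < hausdorff_pre k \<delta> (A i) + ennreal (e * (1/2)^Suc i)"
      using mult_pos_pos[OF e, of "(1/2)^i"]
      by (simp add: ennreal_add_left_cancel_less[of _ 0, simplified] ennreal_eq_0_iff zero_less_iff_neq_zero)
    then show ?thesis
      unfolding hausdorff_pre_def[of k \<delta> "A i"] INF_less_iff by (auto intro: less_imp_le)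
  qed
  then obtain C where C: "\<And>i. A i \<subseteq> (\<Union>m. C i m)" "\<And>i m. bounded (C i m)" "\<And>i m. diameter (C i m) \<le> \<delta>"
    "\<And>i. (\<Sum>m. hausdorff_gauge k (C i m)) \<le> hausdorff_pre k \<delta> (A i) + ennreal (e * (1/2)^Suc i)"
    by metis
  define D where "D n = (case prod_decode n of (i, m) \<Rightarrow> C i m)" for n
  have "hausdorff_pre k \<delta> (\<Union>i. A i) \<le> (\<Sum>n. hausdorff_gauge k (D n))"
    unfolding hausdorff_pre_def
  proof (rule INF_lower, safe)
    fix x i assume "x \<in> A i"
    then obtain m where "x \<in> C i m" using C(1) by blast
    then show "x \<in> (\<Union>n. D n)" by (auto simp: D_def intro!: exI[of _ "prod_encode (i, m)"])
  qed (auto simp: D_def C split: prod.split)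
  also have "\<dots> = (\<Sum>i. \<Sum>m. hausdorff_gauge k (C i m))"
    using suminf_ennreal_2dimen[of "\<lambda>i. \<Sum>m. hausdorff_gauge k (C i m)" "\<lambda>(i, m). hausdorff_gauge k (C i m)"]
    by (simp add: D_def case_prod_beta)
  also have "\<dots> \<le> (\<Sum>i. hausdorff_pre k \<delta> (A i) + ennreal (e * (1/2)^Suc i))"
    by (intro suminf_le C(4)) auto
  also have "\<dots> = (\<Sum>i. hausdorff_pre k \<delta> (A i)) + (\<Sum>i. ennreal (e * (1/2)^Suc i))"
    by (rule suminf_add[symmetric]) auto
  also have "(\<Sum>i. ennreal (e * (1/2)^Suc i)) = ennreal e"
    using e sums_mult[OF power_half_series, of e] by (intro suminf_ennreal_eq) auto
  finally show "hausdorff_pre k \<delta> (\<Union>i. A i) \<le> (\<Sum>i. hausdorff_pre k \<delta> (A i)) + ennreal e" .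
qed

lemma hausdorff_pre_Un:
  assumes "0 \<le> \<delta>"
  shows "hausdorff_pre k \<delta> (A \<union> B) \<le> hausdorff_pre k \<delta> A + hausdorff_pre k \<delta> B"
proof -
  have "hausdorff_pre k \<delta> (\<Union>i::nat. binaryset A B i) \<le> (\<Sum>i. hausdorff_pre k \<delta> (binaryset A B i))"
    by (rule hausdorff_pre_subadditive)
  then show ?thesis
    using assms by (simp add: UN_binaryset_eq suminf_binaryset_eq)
qed

lemma hausdorff_outer_subadditive:
  fixes A :: "nat \<Rightarrow> 'a::metric_space set"
  shows "hausdorff_outer k (\<Union>i. A i) \<le> (\<Sum>i. hausdorff_outer k (A i))"
  unfolding hausdorff_outer_def[of k "\<Union>i. A i"]
  by (intro SUP_least order_trans[OF hausdorff_pre_subadditive] suminf_le hausdorff_pre_le_outer) auto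

lemma hausdorff_outer_Un: "hausdorff_outer k (A \<union> B) \<le> hausdorff_outer k A + hausdorff_outer k B"
proof -
  have "hausdorff_outer k (\<Union>i::nat. binaryset A B i) \<le> (\<Sum>i. hausdorff_outer k (binaryset A B i))"
    by (rule hausdorff_outer_subadditive)
  then show ?thesis by (simp add: UN_binaryset_eq suminf_binaryset_eq)
qed

text \<open>A covering set of diameter below \<open>d\<close> cannot meet both sets, so a fine
  covering of the union splits into coverings of the two parts. This is the metric outer measure
  property, from which measurability of closed sets will follow.\<close>

lemma hausdorff_outer_separated:
  fixes A B :: "'a::metric_space set"
  assumes d: "0 < d" and sep: "\<And>x y. x \<in> A \<Longrightarrow> y \<in> B \<Longrightarrow> d \<le> dist x y"
  shows "hausdorff_outer k A + hausdorff_outer k B \<le> hausdorff_outer k (A \<union> B)"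
proof -
  have small: "hausdorff_pre k \<delta> A + hausdorff_pre k \<delta> B \<le> hausdorff_pre k \<delta> (A \<union> B)"
    if \<delta>: "0 < \<delta>" "\<delta> < d" for \<delta>
    unfolding hausdorff_pre_def[of k \<delta> "A \<union> B"]
  proof (rule INF_greatest, safe)
    fix C :: "nat \<Rightarrow> 'a set"
    assume cov: "A \<union> B \<subseteq> (\<Union>m. C m)" and C: "\<forall>m. bounded (C m) \<and> diameter (C m) \<le> \<delta>"
    define CA where "CA m = (if C m \<inter> A = {} then {} else C m)" for m
    define CB where "CB m = (if C m \<inter> A = {} then C m else {})" for m
    have dj: "C m \<inter> B = {}" if ne: "C m \<inter> A \<noteq> {}" for m
    proof (rule ccontr)
      assume "C m \<inter> B \<noteq> {}"
      then obtain x y where xy: "x \<in> C m" "x \<in> A" "y \<in> C m" "y \<in> B" using ne by auto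
      have "dist x y \<le> \<delta>" using xy C diameter_bounded_bound[of "C m" x y] by (auto intro: order_trans)
      then show False using sep[OF xy(2,4)] \<delta> by simp
    qed
    have "hausdorff_pre k \<delta> A \<le> (\<Sum>m. hausdorff_gauge k (CA m))"
      unfolding hausdorff_pre_def using cov C \<delta>
      by (intro INF_lower) (auto simp: CA_def subset_eq; metis IntI UN_iff UnI1 empty_iff)
    moreover have "hausdorff_pre k \<delta> B \<le> (\<Sum>m. hausdorff_gauge k (CB m))"
      unfolding hausdorff_pre_def
    proof (rule INF_lower, safe)
      fix x assume "x \<in> B"
      then obtain m where "x \<in> C m" using cov by auto
      then show "x \<in> (\<Union>m. CB m)" using dj[of m] \<open>x \<in> B\<close> by (auto simp: CB_def intro!: exI[of _ m])
    qed (use C \<delta> in \<open>auto simp: CB_def\<close>)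
    ultimately have "hausdorff_pre k \<delta> A + hausdorff_pre k \<delta> B
       \<le> (\<Sum>m. hausdorff_gauge k (CA m)) + (\<Sum>m. hausdorff_gauge k (CB m))" by (rule add_mono)
    also have "\<dots> = (\<Sum>m. hausdorff_gauge k (CA m) + hausdorff_gauge k (CB m))"
      by (rule suminf_add) auto
    also have "\<dots> = (\<Sum>m. hausdorff_gauge k (C m))"
      by (rule arg_cong[where f=suminf]) (auto simp: CA_def CB_def hausdorff_gauge_def)
    finally show "hausdorff_pre k \<delta> A + hausdorff_pre k \<delta> B \<le> (\<Sum>m. hausdorff_gauge k (C m))" .
  qed
  have "hausdorff_pre k \<delta> A + hausdorff_pre k \<delta>' B \<le> hausdorff_outer k (A \<union> B)"
    if "0 < \<delta>" "0 < \<delta>'" for \<delta> \<delta>'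
  proof -
    define r where "r = min (min \<delta> \<delta>') (d / 2)"
    have r: "0 < r" "r < d" "r \<le> \<delta>" "r \<le> \<delta>'" using that d by (auto simp: r_def)
    have "hausdorff_pre k \<delta> A + hausdorff_pre k \<delta>' B \<le> hausdorff_pre k r A + hausdorff_pre k r B"
      using r by (intro add_mono hausdorff_pre_antimono)
    also have "\<dots> \<le> hausdorff_pre k r (A \<union> B)" by (rule small) (use r in auto)
    also have "\<dots> \<le> hausdorff_outer k (A \<union> B)" by (rule hausdorff_pre_le_outer) fact
    finally show ?thesis .
  qed
  then have "(SUP \<delta>\<in>{0<..}. SUP \<delta>'\<in>{0<..}. hausdorff_pre k \<delta> A + hausdorff_pre k \<delta>' B) \<le> hausdorff_outer k (A \<union> B)"
    by (intro SUP_least) auto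
  then show ?thesis
    unfolding hausdorff_outer_def[of k A] hausdorff_outer_def[of k B]
    by (simp add: ennreal_SUP_add_left[symmetric] ennreal_SUP_add_right[symmetric])
qed

lemma hausdorff_outer_separated_sum:
  fixes R :: "nat \<Rightarrow> 'a::metric_space set"
  assumes sep: "\<And>i j. i < j \<Longrightarrow> \<exists>d>0. \<forall>x\<in>R i. \<forall>y\<in>R j. d \<le> dist x y"
  shows "(\<Sum>i<m. hausdorff_outer k (R i)) \<le> hausdorff_outer k (\<Union>i<m. R i)"
proof (induction m)
  case (Suc m)
  have "\<forall>i. \<exists>d>0. i < m \<longrightarrow> (\<forall>x\<in>R i. \<forall>y\<in>R m. d \<le> dist x y)" using sep zero_less_one by metis
  then obtain d where d: "\<And>i. 0 < d i" "\<And>i x y. i < m \<Longrightarrow> x \<in> R i \<Longrightarrow> y \<in> R m \<Longrightarrow> d i \<le> dist x y"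
    by metis
  define e where "e = Min (insert 1 (d ` {..<m}))"
  have "0 < e" using d(1) by (auto simp: e_def)
  have "hausdorff_outer k (\<Union>i<m. R i) + hausdorff_outer k (R m) \<le> hausdorff_outer k ((\<Union>i<m. R i) \<union> R m)"
  proof (rule hausdorff_outer_separated[OF \<open>0 < e\<close>])
    fix x y assume "x \<in> (\<Union>i<m. R i)" "y \<in> R m"
    then obtain i where i: "i < m" "x \<in> R i" by auto
    have "e \<le> d i" unfolding e_def using i by (intro Min_le) auto
    then show "e \<le> dist x y" using d(2)[OF i \<open>y \<in> R m\<close>] by linarith
  qed
  also have "(\<Union>i<m. R i) \<union> R m = (\<Union>i<Suc m. R i)" by (auto simp: less_Suc_eq)
  finally show ?case using Suc.IH by (simp add: add_mono order_trans[OF add_right_mono])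
qed simp

lemma ennreal_suminf_tail_small:
  fixes f :: "nat \<Rightarrow> ennreal"
  assumes fin: "(\<Sum>i. f i) < \<infinity>" and e: "0 < e"
  obtains m where "(\<Sum>i. f (i + m)) \<le> ennreal e"
proof -
  have fi: "f i \<noteq> \<infinity>" for i using ennreal_suminf_lessD[OF fin, of i] by auto
  define u where "u i = enn2real (f i)" for i
  have fu: "f = (\<lambda>i. ennreal (u i))" using fi by (auto simp: u_def less_top)
  have u0: "0 \<le> u i" for i by (simp add: u_def)
  have su: "summable u" using fin u0 by (intro summable_suminf_not_top) (auto simp: fu)
  obtain m where "norm (\<Sum>i. u (i + m)) < e" using suminf_exist_split[OF e su] by blast
  moreover have "(\<Sum>i. f (i + m)) = ennreal (\<Sum>i. u (i + m))"
    unfolding fu using u0 su by (intro suminf_ennreal2) (auto simp: summable_iff_shift)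
  ultimately show ?thesis using that[of m] by (auto intro: ennreal_leI)
qed

text \<open>Caratheodory's criterion. The part of E close to C but outside it is cut into rings
  \<open>R j\<close> by the distance to C. Rings with indices of the same parity are a positive
  distance apart, so their outer measures add up to at most that of E; hence the series over all
  rings converges and the rings beyond index m, those next to C, contribute arbitrarily little. What
  remains, \<open>F m\<close>, is separated from C.\<close>

lemma hausdorff_outer_caratheodory_closed:
  fixes C E :: "'a::metric_space set"
  assumes C: "closed C"
  shows "hausdorff_outer k (E \<inter> C) + hausdorff_outer k (E - C) \<le> hausdorff_outer k E"
proof (cases "hausdorff_outer k E = \<infinity> \<or> C = {}")
  case True
  then show ?thesis by auto
next
  case False
  then have ne: "C \<noteq> {}" and fin: "hausdorff_outer k E < \<infinity>" by (auto simp: less_top)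
  define \<phi> where "\<phi> x = infdist x C" for x
  have lip: "\<phi> x - \<phi> y \<le> dist x y" for x y
    using infdist_triangle[of x C y] by (simp add: \<phi>_def)
  have pos: "0 < \<phi> x" if "x \<notin> C" for x
    using that C ne in_closed_iff_infdist_zero[of C x] infdist_nonneg[of x C] by (auto simp: \<phi>_def less_le)
  have zero: "\<phi> x = 0" if "x \<in> C" for x using that by (simp add: \<phi>_def)
  define R where "R j = {x\<in>E. 1 / real (j + 2) \<le> \<phi> x \<and> \<phi> x < 1 / real (j + 1)}" for j :: nat
  define F where "F m = {x\<in>E. 1 / real (m + 1) \<le> \<phi> x}" for m :: nat
  \<comment> \<open>\<open>c\<close> selects the parity class. Consecutive members are separated by
    the ring that is skipped, which lies between the distances 1/(2 i + c + 3) and 1/(2 i + c +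
    2).\<close>
  have par: "(\<Sum>i<m. hausdorff_outer k (R (2 * i + c))) \<le> hausdorff_outer k E" for c m
  proof (rule order_trans[OF hausdorff_outer_separated_sum])
    fix i j :: nat assume ij: "i < j"
    define d where "d = 1 / real (2 * i + c + 2) - 1 / real (2 * i + c + 3)"
    have "0 < d" unfolding d_def
      using divide_strict_left_mono[of "real (2 * i + c + 2)" "real (2 * i + c + 3)" 1] by simp
    moreover have "d \<le> dist x y" if "x \<in> R (2 * i + c)" "y \<in> R (2 * j + c)" for x y
    proof -
      have "\<phi> y < 1 / real (2 * j + c + 1)" using that by (simp add: R_def)
      also have "\<dots> \<le> 1 / real (2 * i + c + 3)" using ij by (intro divide_left_mono) auto
      finally have "\<phi> y < 1 / real (2 * i + c + 3)" .
      moreover have "1 / real (2 * i + c + 2) \<le> \<phi> x" using that by (simp add: R_def)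
      ultimately show ?thesis using lip[of x y] by (simp add: d_def)
    qed
    ultimately show "\<exists>d>0. \<forall>x\<in>R (2 * i + c). \<forall>y\<in>R (2 * j + c). d \<le> dist x y" by blast
  qed (rule hausdorff_outer_mono, auto simp: R_def)
  have psum: "(\<Sum>j<2 * m. hausdorff_outer k (R j)) \<le> 2 * hausdorff_outer k E" for m
  proof -
    have "(\<Sum>j<2 * m. hausdorff_outer k (R j))
      = (\<Sum>i<m. hausdorff_outer k (R (2 * i + 0))) + (\<Sum>i<m. hausdorff_outer k (R (2 * i + 1)))"
      by (induction m) (simp_all add: algebra_simps)
    also have "\<dots> \<le> hausdorff_outer k E + hausdorff_outer k E" by (intro add_mono par)
    finally show ?thesis by (simp add: mult_2)
  qed
  have "(\<Sum>j. hausdorff_outer k (R j)) \<le> 2 * hausdorff_outer k E"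
    unfolding suminf_eq_SUP
  proof (rule SUP_least)
    fix m :: nat
    have "(\<Sum>j<m. hausdorff_outer k (R j)) \<le> (\<Sum>j<2 * m. hausdorff_outer k (R j))"
      by (rule sum_mono2) auto
    then show "(\<Sum>j<m. hausdorff_outer k (R j)) \<le> 2 * hausdorff_outer k E"
      using psum[of m] by (rule order_trans)
  qed
  then have sfin: "(\<Sum>j. hausdorff_outer k (R j)) < \<infinity>"
    using fin by (auto intro: le_less_trans simp: ennreal_mult_less_top)
  show ?thesis
  proof (rule ennreal_le_epsilon)
    fix e :: real assume "0 < e"
    then obtain m where m: "(\<Sum>j. hausdorff_outer k (R (j + m))) \<le> ennreal e"
      using ennreal_suminf_tail_small[OF sfin] by blast
    have sub: "E - C \<subseteq> F m \<union> (\<Union>j. R (j + m))"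
    proof
      fix x assume x: "x \<in> E - C"
      show "x \<in> F m \<union> (\<Union>j. R (j + m))"
      proof (cases "x \<in> F m")
        case False
        then have lt: "\<phi> x < 1 / real (m + 1)" using x by (auto simp: F_def)
        have "\<exists>l::nat. 1 / real (l + 2) \<le> \<phi> x"
        proof -
          obtain l :: nat where "1 / \<phi> x < real l" using reals_Archimedean2 by blast
          then have "1 / real (l + 2) \<le> \<phi> x" using pos[of x] x by (simp add: field_simps)
          then show ?thesis by blast
        qed
        define l where "l = (LEAST l::nat. 1 / real (l + 2) \<le> \<phi> x)"
        have l: "1 / real (l + 2) \<le> \<phi> x" unfolding l_def by (rule LeastI_ex) fact
        have lm: "m \<le> l"
        proof (rule ccontr)
          assume "\<not> m \<le> l"
          then have "1 / real (m + 1) \<le> 1 / real (l + 2)" by (intro divide_left_mono) auto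
          then show False using l lt by linarith
        qed
        have "\<phi> x < 1 / real (l + 1)"
        proof (cases l)
          case 0
          then show ?thesis using lt lm by simp
        next
          case (Suc l')
          have "l' < l" using Suc by simp
          then have "\<not> 1 / real (l' + 2) \<le> \<phi> x" unfolding l_def by (rule not_less_Least)
          then show ?thesis using Suc by (simp add: add.commute)
        qed
        then have "x \<in> R ((l - m) + m)" using l x lm by (simp add: R_def)
        then show ?thesis by blast
      qed simp
    qed
    have "hausdorff_outer k (E - C) \<le> hausdorff_outer k (F m) + hausdorff_outer k (\<Union>j. R (j + m))"
      using hausdorff_outer_mono[OF sub] hausdorff_outer_Un by (rule order_trans)
    also have "hausdorff_outer k (\<Union>j. R (j + m)) \<le> ennreal e"
      using hausdorff_outer_subadditive m by (rule order_trans)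
    finally have 1: "hausdorff_outer k (E - C) \<le> hausdorff_outer k (F m) + ennreal e"
      by (auto intro: add_left_mono)
    have "hausdorff_outer k (E \<inter> C) + hausdorff_outer k (F m) \<le> hausdorff_outer k ((E \<inter> C) \<union> F m)"
    proof (rule hausdorff_outer_separated[where d="1 / real (m + 1)"])
      fix x y assume "x \<in> E \<inter> C" "y \<in> F m"
      then show "1 / real (m + 1) \<le> dist x y"
        using lip[of y x] zero[of x] by (auto simp: F_def dist_commute)
    qed simp
    also have "\<dots> \<le> hausdorff_outer k E" by (rule hausdorff_outer_mono) (auto simp: F_def)
    finally have 2: "hausdorff_outer k (E \<inter> C) + hausdorff_outer k (F m) \<le> hausdorff_outer k E" .
    have "hausdorff_outer k (E \<inter> C) + hausdorff_outer k (E - C)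
        \<le> hausdorff_outer k (E \<inter> C) + (hausdorff_outer k (F m) + ennreal e)"
      using 1 by (rule add_left_mono)
    also have "\<dots> \<le> hausdorff_outer k E + ennreal e"
      using add_right_mono[OF 2, of "ennreal e"] by (simp only: add.assoc)
    finally show "hausdorff_outer k (E \<inter> C) + hausdorff_outer k (E - C) \<le> hausdorff_outer k E + ennreal e" .
  qed
qed

text \<open>Unless this holds, \<open>measure_of\<close> defaults to the zero measure. The sets that
  split every set additively form a sigma-algebra on which the outer measure is a measure; it
  contains the closed sets and therefore all Borel sets.\<close>

lemma measure_space_hausdorff:
  "measure_space UNIV (sets (borel :: 'a::metric_space measure)) (hausdorff_outer k :: 'a set \<Rightarrow> ennreal)"
proof -
  let ?H = "hausdorff_outer k :: 'a set \<Rightarrow> ennreal"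
  interpret P: sigma_algebra "UNIV :: 'a set" "Pow UNIV" by (rule sigma_algebra_Pow)
  have oms: "outer_measure_space (Pow UNIV) ?H"
    unfolding outer_measure_space_def positive_def increasing_def countably_subadditive_def
    by (auto intro: hausdorff_outer_mono hausdorff_outer_subadditive)
  define L where "L = lambda_system UNIV (Pow UNIV) ?H"
  have ms: "measure_space UNIV L ?H"
    unfolding L_def by (rule P.caratheodory_lemma[OF oms])
  then have saL: "sigma_algebra UNIV L" by (simp add: measure_space_def)
  have "C \<in> L" if "closed C" for C :: "'a set"
  proof -
    have "?H (E \<inter> C) + ?H (E - C) = ?H E" for E
      using hausdorff_outer_caratheodory_closed[OF that, of k E] hausdorff_outer_Un[of k "E \<inter> C" "E - C"]
      by (auto intro!: antisym simp: Int_Diff_Un)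
    then show ?thesis unfolding L_def P.lambda_system_eq by auto
  qed
  then have "sigma_sets UNIV (Collect closed) \<subseteq> L"
    by (intro sigma_algebra.sigma_sets_subset[OF saL]) auto
  then have "sets (borel :: 'a measure) \<subseteq> L"
    by (simp add: borel_eq_closed)
  moreover have "sigma_algebra UNIV (sets (borel :: 'a measure))"
    using sets.sigma_algebra_axioms[of "borel :: 'a measure"] by simp
  ultimately show ?thesis using measure_down[OF ms] by blast
qed

lemma sets_hausdorff_measure [simp, measurable_cong]: "sets (hausdorff_measure k) = sets borel"
  unfolding hausdorff_measure_def by (simp add: sigma_algebra.sets_measure_of_eq[OF sets.sigma_algebra_axioms[of borel, simplified]])

lemma space_hausdorff_measure [simp]: "space (hausdorff_measure k) = UNIV"
  unfolding hausdorff_measure_def by (simp add: space_measure_of_conv)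

lemma emeasure_hausdorff_measure:
  fixes A :: "'a::metric_space set"
  assumes "A \<in> sets borel"
  shows "emeasure (hausdorff_measure k) A = hausdorff_outer k A"
  unfolding hausdorff_measure_def using measure_space_hausdorff[of k, where 'a='a] assms
  by (intro emeasure_measure_of_sigma) (auto simp: measure_space_def)

section \<open>Scaling and translation of Hausdorff measure\<close>

lemma hausdorff_pre_similarity_le:
  fixes T :: "'a::metric_space \<Rightarrow> 'b::metric_space"
  assumes c: "0 < c" and T: "\<And>x y. dist (T x) (T y) = c * dist x y"
  shows "hausdorff_pre k (c * \<delta>) (T ` A) \<le> ennreal (c ^ k) * hausdorff_pre k \<delta> A"
proof -
  have diam: "diameter (T ` C) = c * diameter C" "bounded (T ` C)" if C: "bounded C" for C
  proof -
    obtain a e where ae: "\<And>x. x \<in> C \<Longrightarrow> dist a x \<le> e" using C by (auto simp: bounded_def)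
    show b: "bounded (T ` C)"
      unfolding bounded_def using ae c by (auto simp: T intro!: exI[of _ "T a"] exI[of _ "c * e"])
    show "diameter (T ` C) = c * diameter C"
    proof (cases "C = {}")
      case False
      show ?thesis
      proof (rule antisym)
        show "diameter (T ` C) \<le> c * diameter C"
          unfolding diameter_def[of "T ` C"] using False C c diameter_bounded_bound[OF C]
          by (auto intro!: cSUP_least simp: T)
        have "diameter C \<le> diameter (T ` C) / c"
        proof -
          have "dist x y \<le> diameter (T ` C) / c" if "x \<in> C" "y \<in> C" for x y
            using diameter_bounded_bound[OF b, of "T x" "T y"] that c by (simp add: T field_simps)
          then show ?thesis
            unfolding diameter_def[of C] using False by (auto intro!: cSUP_least)
        qed
        then show "c * diameter C \<le> diameter (T ` C)" using c by (simp add: field_simps)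
      qed
    qed simp
  qed
  have gauge: "hausdorff_gauge k (T ` C) = ennreal (c ^ k) * hausdorff_gauge k C" if "bounded C" for C
    using c diam[OF that] diameter_ge_0[OF that]
    by (auto simp: hausdorff_gauge_def ennreal_mult[symmetric] power_divide power_mult_distrib mult_ac)
  have inv: "ennreal (c ^ k) * ennreal (inverse (c ^ k)) = 1"
    using c by (simp add: ennreal_mult[symmetric])
  have "ennreal (inverse (c ^ k)) * hausdorff_pre k (c * \<delta>) (T ` A) \<le> hausdorff_pre k \<delta> A"
    unfolding hausdorff_pre_def[of k \<delta> A]
  proof (rule INF_greatest, safe)
    fix C :: "nat \<Rightarrow> 'a set"
    assume C: "A \<subseteq> (\<Union>m. C m)" "\<forall>m. bounded (C m) \<and> diameter (C m) \<le> \<delta>"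
    have "hausdorff_pre k (c * \<delta>) (T ` A) \<le> (\<Sum>m. hausdorff_gauge k (T ` C m))"
      unfolding hausdorff_pre_def
    proof (rule INF_lower, safe)
      fix x assume "x \<in> A"
      then show "T x \<in> (\<Union>m. T ` C m)" using C by blast
    qed (use C c diam in auto)
    also have "\<dots> = ennreal (c ^ k) * (\<Sum>m. hausdorff_gauge k (C m))"
      using C by (simp add: gauge)
    finally have "ennreal (inverse (c ^ k)) * hausdorff_pre k (c * \<delta>) (T ` A)
        \<le> ennreal (inverse (c ^ k)) * (ennreal (c ^ k) * (\<Sum>m. hausdorff_gauge k (C m)))"
      by (intro mult_left_mono) auto
    also have "\<dots> = (\<Sum>m. hausdorff_gauge k (C m))"
      using inv by (metis mult.assoc mult.commute mult_1)
    finally show "ennreal (inverse (c ^ k)) * hausdorff_pre k (c * \<delta>) (T ` A) \<le> (\<Sum>m. hausdorff_gauge k (C m))" .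
  qed
  then have "ennreal (c ^ k) * (ennreal (inverse (c ^ k)) * hausdorff_pre k (c * \<delta>) (T ` A))
     \<le> ennreal (c ^ k) * hausdorff_pre k \<delta> A" by (intro mult_left_mono) auto
  then show ?thesis using inv by (metis mult.assoc mult_1)
qed

text \<open>The reverse inequality is the similarity bound for the inverse map. The identity is
  recorded at a fixed scale \<delta> and not only in the limit, because the subdivision of the cube
  compares pre-measures at different scales.\<close>

lemma hausdorff_pre_affine:
  fixes A :: "'a::real_normed_vector set"
  assumes r: "0 < r"
  shows "hausdorff_pre k (r * \<delta>) ((\<lambda>x. z + r *\<^sub>R x) ` A) = ennreal (r ^ k) * hausdorff_pre k \<delta> A"
proof (rule antisym)
  have d: "dist (z + r *\<^sub>R x) (z + r *\<^sub>R y) = r * dist x y" if "0 < r" for r z and x y :: 'a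
    using that by (simp add: dist_norm flip: scaleR_diff_right)
  show "hausdorff_pre k (r * \<delta>) ((\<lambda>x. z + r *\<^sub>R x) ` A) \<le> ennreal (r ^ k) * hausdorff_pre k \<delta> A"
    by (rule hausdorff_pre_similarity_le[OF r d[OF r]])
  have r': "0 < inverse r" using r by simp
  have "hausdorff_pre k (inverse r * (r * \<delta>)) ((\<lambda>x. - (inverse r *\<^sub>R z) + inverse r *\<^sub>R x) ` (\<lambda>x. z + r *\<^sub>R x) ` A)
    \<le> ennreal (inverse r ^ k) * hausdorff_pre k (r * \<delta>) ((\<lambda>x. z + r *\<^sub>R x) ` A)"
    by (rule hausdorff_pre_similarity_le[OF r' d[OF r']])
  moreover have "(\<lambda>x. - (inverse r *\<^sub>R z) + inverse r *\<^sub>R x) ` (\<lambda>x. z + r *\<^sub>R x) ` A = A"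
    using r by (simp add: image_image scaleR_add_right)
  moreover have "inverse r * (r * \<delta>) = \<delta>" using r by simp
  ultimately have "ennreal (r ^ k) * hausdorff_pre k \<delta> A
    \<le> ennreal (r ^ k) * (ennreal (inverse r ^ k) * hausdorff_pre k (r * \<delta>) ((\<lambda>x. z + r *\<^sub>R x) ` A))"
    by (intro mult_left_mono) auto
  also have "\<dots> = hausdorff_pre k (r * \<delta>) ((\<lambda>x. z + r *\<^sub>R x) ` A)"
    using r by (simp add: mult.assoc[symmetric] ennreal_mult[symmetric] power_mult_distrib[symmetric])
  finally show "ennreal (r ^ k) * hausdorff_pre k \<delta> A \<le> hausdorff_pre k (r * \<delta>) ((\<lambda>x. z + r *\<^sub>R x) ` A)" .
qed

lemma hausdorff_outer_affine:
  fixes A :: "'a::real_normed_vector set"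
  assumes r: "0 < r"
  shows "hausdorff_outer k ((\<lambda>x. z + r *\<^sub>R x) ` A) = ennreal (r ^ k) * hausdorff_outer k A"
proof -
  have eq: "{0<..} = (*) r ` {0::real<..}"
  proof safe
    fix x :: real assume "x > 0"
    then show "x \<in> (*) r ` {0<..}" using r by (intro image_eqI[of _ _ "x / r"]) auto
  qed (use r in auto)
  have "F ` {0<..} = (\<lambda>\<delta>. F (r * \<delta>)) ` {0<..}" for F :: "real \<Rightarrow> ennreal"
    using arg_cong[OF eq, of "image F"] by (simp only: image_image)
  then have "hausdorff_outer k ((\<lambda>x. z + r *\<^sub>R x) ` A)
    = (SUP \<delta>\<in>{0<..}. hausdorff_pre k (r * \<delta>) ((\<lambda>x. z + r *\<^sub>R x) ` A))"
    unfolding hausdorff_outer_def by (rule arg_cong[where f=Sup])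
  also have "\<dots> = ennreal (r ^ k) * hausdorff_outer k A"
    unfolding hausdorff_pre_affine[OF r] hausdorff_outer_def by (rule SUP_mult_left_ennreal[symmetric])
  finally show ?thesis .
qed

lemma hausdorff_outer_translation:
  fixes A :: "'a::real_normed_vector set"
  shows "hausdorff_outer k ((+) z ` A) = hausdorff_outer k A"
  using hausdorff_outer_affine[of 1 k z A] by simp

lemma nn_integral_hausdorff_translation:
  fixes f :: "'a::real_normed_vector \<Rightarrow> ennreal"
  assumes f: "f \<in> borel_measurable borel"
  shows "(\<integral>\<^sup>+x. f (z + x) \<partial>hausdorff_measure k) = (\<integral>\<^sup>+x. f x \<partial>hausdorff_measure k)"
proof -
  have "distr (hausdorff_measure k) borel ((+) z) = hausdorff_measure k"
  proof (rule measure_eqI)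
    fix A assume "A \<in> sets (distr (hausdorff_measure k) borel ((+) z))"
    then have A[measurable]: "A \<in> sets borel" by simp
    have "(+) z ` ((+) z -` A) = A"
    proof safe
      fix x assume "x \<in> A"
      then show "x \<in> (+) z ` ((+) z -` A)" by (intro image_eqI[of _ _ "x - z"]) auto
    qed
    moreover have m: "(+) z -` A \<in> sets borel"
      using measurable_sets[of "(+) z" borel borel A] by simp
    ultimately show "emeasure (distr (hausdorff_measure k) borel ((+) z)) A = emeasure (hausdorff_measure k) A"
      using hausdorff_outer_translation[of k z "(+) z -` A"]
      by (simp add: emeasure_distr emeasure_hausdorff_measure m)
  qed simp
  then have "(\<integral>\<^sup>+x. f x \<partial>hausdorff_measure k) = (\<integral>\<^sup>+x. f x \<partial>distr (hausdorff_measure k) borel ((+) z))"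
    by simp
  also have "\<dots> = (\<integral>\<^sup>+x. f (z + x) \<partial>hausdorff_measure k)"
    using f by (subst nn_integral_distr) auto
  finally show ?thesis ..
qed

lemma nn_integral_lborel_scale:
  fixes f :: "'a::euclidean_space \<Rightarrow> ennreal"
  assumes [measurable]: "f \<in> borel_measurable borel" and s: "0 < s"
  shows "(\<integral>\<^sup>+x. f x \<partial>lborel) = ennreal (s ^ DIM('a)) * (\<integral>\<^sup>+x. f (s *\<^sub>R x) \<partial>lborel)"
  using s by (subst lborel_affine[of s 0], simp, subst nn_integral_density, measurable,
      subst nn_integral_distr) (auto simp: nn_integral_cmult)

section \<open>Lebesgue measure on hyperplanes\<close>

text \<open>Multiplying \<open>m\<close> by Lebesgue measure in the normal direction gives a measure
  invariant under all translations, hence a multiple of Lebesgue measure. Both measures on the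
  hyperplane, the projected slab and the restricted Hausdorff measure, enter through this lemma;
  afterwards only a constant has to be found for each.\<close>

lemma hyperplane_product_measure:
  fixes m :: "'a::euclidean_space measure" and v :: 'a
  assumes sm: "sets m = sets borel" and v: "norm v = 1"
    and conc: "AE x in m. v \<bullet> x = 0"
    and inv: "\<And>z f. v \<bullet> z = 0 \<Longrightarrow> f \<in> borel_measurable borel \<Longrightarrow> (\<integral>\<^sup>+x. f (z + x) \<partial>m) = (\<integral>\<^sup>+x. f x \<partial>m)"
    and fin: "\<And>r. emeasure m (ball 0 r) < \<infinity>"
  obtains c where "c < \<infinity>"
    "\<And>f. f \<in> borel_measurable borel \<Longrightarrow>
       (\<integral>\<^sup>+x. (\<integral>\<^sup>+t. f (x + t *\<^sub>R v) \<partial>lborel) \<partial>m) = c * (\<integral>\<^sup>+x. f x \<partial>lborel)"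
proof -
  have sp: "space m = UNIV" using sets_eq_imp_space_eq[OF sm] by simp
  note [measurable_cong] = sm
  have "sigma_finite_measure m"
  proof
    show "\<exists>A. countable A \<and> A \<subseteq> sets m \<and> \<Union> A = space m \<and> (\<forall>a\<in>A. emeasure m a \<noteq> \<infinity>)"
      using fin by (intro exI[of _ "range (\<lambda>n::nat. ball 0 (real n))"]) (auto simp: sm sp less_top reals_Archimedean2)
  qed
  then interpret m: sigma_finite_measure m .
  interpret P: pair_sigma_finite m lborel ..
  define T where "T = (\<lambda>(x, t). x + t *\<^sub>R v)"
  have T[measurable]: "T \<in> m \<Otimes>\<^sub>M lborel \<rightarrow>\<^sub>M borel"
    unfolding T_def by measurable
  define \<Psi> where "\<Psi> = distr (m \<Otimes>\<^sub>M lborel) borel T"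
  have int\<Psi>: "(\<integral>\<^sup>+x. f x \<partial>\<Psi>) = (\<integral>\<^sup>+x. (\<integral>\<^sup>+t. f (x + t *\<^sub>R v) \<partial>lborel) \<partial>m)"
    if [measurable]: "f \<in> borel_measurable borel" for f
    unfolding \<Psi>_def by (subst nn_integral_distr) (auto simp: T_def lborel.nn_integral_fst[symmetric])
  have s\<Psi>: "sets \<Psi> = sets borel" by (simp add: \<Psi>_def)
  have inv\<Psi>: "(\<integral>\<^sup>+x. f (z + x) \<partial>\<Psi>) = (\<integral>\<^sup>+x. f x \<partial>\<Psi>)"
    if [measurable]: "f \<in> borel_measurable borel" for f z
  proof -
    \<comment> \<open>A translation splits into a tangential part, absorbed by the invariance of
      \<open>m\<close>, and a normal part, absorbed by Lebesgue measure in \<open>t\<close>.\<close>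
    define w where "w = z - (v \<bullet> z) *\<^sub>R v"
    have w: "v \<bullet> w = 0" using v by (simp add: w_def inner_diff_right dot_square_norm)
    have zw: "z = w + (v \<bullet> z) *\<^sub>R v" by (simp add: w_def)
    have "(\<integral>\<^sup>+x. f (z + x) \<partial>\<Psi>) = (\<integral>\<^sup>+x. (\<integral>\<^sup>+t. f (w + x + ((v \<bullet> z) + t) *\<^sub>R v) \<partial>lborel) \<partial>m)"
      by (subst int\<Psi>, measurable, subst zw) (simp add: algebra_simps)
    also have "\<dots> = (\<integral>\<^sup>+x. (\<integral>\<^sup>+t. f (w + x + t *\<^sub>R v) \<partial>lborel) \<partial>m)"
      by (intro nn_integral_cong nn_integral_lborel_translation[where f="\<lambda>t. f (_ + t *\<^sub>R v)"]) measurable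
    also have "\<dots> = (\<integral>\<^sup>+x. (\<integral>\<^sup>+t. f (x + t *\<^sub>R v) \<partial>lborel) \<partial>m)"
      by (rule inv[OF w, where f="\<lambda>x. \<integral>\<^sup>+t. f (x + t *\<^sub>R v) \<partial>lborel"]) measurable
    finally show ?thesis by (simp add: int\<Psi>)
  qed
  have fin\<Psi>: "emeasure \<Psi> (ball 0 r) < \<infinity>" for r
  proof -
    have "emeasure \<Psi> (ball 0 r) = (\<integral>\<^sup>+x. indicator (ball 0 r) x \<partial>\<Psi>)" by (simp add: s\<Psi>)
    also have "\<dots> = (\<integral>\<^sup>+x. (\<integral>\<^sup>+t. indicator (ball 0 r) (x + t *\<^sub>R v) \<partial>lborel) \<partial>m)" by (rule int\<Psi>) (intro borel_measurable_indicator, simp)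
    also have "\<dots> \<le> (\<integral>\<^sup>+x. (\<integral>\<^sup>+t. indicator (ball 0 r) x * indicator {-r..r} t \<partial>lborel) \<partial>m)"
    proof (rule nn_integral_mono_AE, use conc in eventually_elim, rule nn_integral_mono)
      fix x and t :: real assume x: "v \<bullet> x = 0"
      show "indicator (ball 0 r) (x + t *\<^sub>R v) \<le> (indicator (ball 0 r) x * indicator {-r..r} t :: ennreal)"
      proof (cases "norm (x + t *\<^sub>R v) < r")
        case True
        have sq: "(norm (x + t *\<^sub>R v))\<^sup>2 = (norm x)\<^sup>2 + t\<^sup>2"
          using x v norm_add_Pythagorean[of x "t *\<^sub>R v"] by (simp add: orthogonal_def inner_commute)
        have "norm x \<le> norm (x + t *\<^sub>R v)" "\<bar>t\<bar> \<le> norm (x + t *\<^sub>R v)"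
          by (rule power2_le_imp_le, use sq in simp, simp)+
        then show ?thesis using True by (auto simp: indicator_def)
      qed (auto simp: indicator_def)
    qed
    also have "\<dots> = emeasure m (ball 0 r) * emeasure lborel {-r..r}"
    proof -
      have "(\<integral>\<^sup>+x. indicator (ball 0 r) x * emeasure lborel {-r..r} \<partial>m)
          = (\<integral>\<^sup>+x. indicator (ball 0 r) x \<partial>m) * emeasure lborel {-r..r}"
        by (intro nn_integral_multc borel_measurable_indicator) (simp add: sm)
      then show ?thesis by (simp add: nn_integral_cmult sm del: emeasure_lborel_Icc)
    qed
    also have "\<dots> < \<infinity>" using fin[of r] by (simp add: ennreal_mult_less_top emeasure_lborel_Icc_eq)
    finally show ?thesis .
  qed
  have sf: "sigma_finite_measure \<Psi>"
  proof
    show "\<exists>A. countable A \<and> A \<subseteq> sets \<Psi> \<and> \<Union> A = space \<Psi> \<and> (\<forall>a\<in>A. emeasure \<Psi> a \<noteq> \<infinity>)"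
      using fin\<Psi> by (intro exI[of _ "range (\<lambda>n::nat. ball 0 (real n))"])
        (auto simp: \<Psi>_def less_top reals_Archimedean2)
  qed
  define b where "b = enn2real (emeasure lborel (ball 0 1 :: 'a set))"
  have b: "emeasure lborel (ball 0 1 :: 'a set) = ennreal b" "0 < b"
    using emeasure_lborel_ball_finite[of "0::'a" 1]
      emeasure_ball[of 1 "0::'a"]
    by (auto simp: b_def ennreal_enn2real_if enn2real_positive_iff)
  define c where "c = emeasure \<Psi> (ball 0 1) * ennreal (1 / b)"
  have "c < \<infinity>" using fin\<Psi>[of 1] by (simp add: c_def ennreal_mult_less_top)
  have "emeasure \<Psi> A = c * emeasure lborel A" if A: "A \<in> sets borel" for A
  proof -
    have "emeasure \<Psi> A * ennreal b * ennreal (1 / b) = emeasure \<Psi> (ball 0 1) * emeasure lborel A * ennreal (1 / b)"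
      using translation_invariant_unique[OF s\<Psi> sf inv\<Psi> A, of "ball 0 1"] b by simp
    moreover have "ennreal b * ennreal (1 / b) = 1" using b by (simp add: ennreal_mult[symmetric])
    ultimately have "emeasure \<Psi> A * 1 = emeasure \<Psi> (ball 0 1) * emeasure lborel A * ennreal (1 / b)"
      by (metis mult.assoc)
    then show ?thesis by (simp add: c_def mult_ac)
  qed
  then have "\<Psi> = density lborel (\<lambda>_. c)"
    by (intro measure_eqI) (auto simp: s\<Psi> emeasure_density nn_integral_cmult)
  then have "(\<integral>\<^sup>+x. f x \<partial>\<Psi>) = c * (\<integral>\<^sup>+x. f x \<partial>lborel)" if "f \<in> borel_measurable borel" for f
    using that by (simp add: nn_integral_density nn_integral_cmult)
  then show ?thesis using that[of c] \<open>c < \<infinity>\<close> by (simp add: int\<Psi>)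
qed

text \<open>Lebesgue measure on the hyperplane orthogonal to the unit vector \<open>v\<close>, as the projection of a slab.\<close>

definition hplane_measure :: "'a::euclidean_space \<Rightarrow> 'a measure" where
  "hplane_measure v = distr (density lborel (\<lambda>x. indicator {0..1} (v \<bullet> x))) borel (\<lambda>x. x - (v \<bullet> x) *\<^sub>R v)"

lemma sets_hplane_measure [simp, measurable_cong]: "sets (hplane_measure v) = sets borel"
  by (simp add: hplane_measure_def)

lemma nn_integral_hplane_measure:
  assumes [measurable]: "f \<in> borel_measurable borel"
  shows "(\<integral>\<^sup>+x. f x \<partial>hplane_measure v)
    = (\<integral>\<^sup>+x. indicator {0..1} (v \<bullet> x) * f (x - (v \<bullet> x) *\<^sub>R v) \<partial>lborel)"
  unfolding hplane_measure_def by (subst nn_integral_distr; simp add: nn_integral_density)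

context
  fixes v :: "'a::euclidean_space"
  assumes v: "norm v = 1"
begin

lemma v_inner [simp]: "v \<bullet> v = 1"
  using v by (simp add: dot_square_norm)

lemma AE_hplane_measure: "AE x in hplane_measure v. v \<bullet> x = 0"
  unfolding hplane_measure_def by (subst AE_distr_iff) (auto simp: inner_diff_right)

lemma hplane_measure_translation:
  assumes z: "v \<bullet> z = 0" and [measurable]: "f \<in> borel_measurable borel"
  shows "(\<integral>\<^sup>+x. f (z + x) \<partial>hplane_measure v) = (\<integral>\<^sup>+x. f x \<partial>hplane_measure v)"
proof -
  have "(\<integral>\<^sup>+x. f (z + x) \<partial>hplane_measure v)
    = (\<integral>\<^sup>+x. indicator {0..1} (v \<bullet> (z + x)) * f ((z + x) - (v \<bullet> (z + x)) *\<^sub>R v) \<partial>lborel)"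
    using z by (simp add: nn_integral_hplane_measure inner_add_right algebra_simps)
  also have "\<dots> = (\<integral>\<^sup>+x. indicator {0..1} (v \<bullet> x) * f (x - (v \<bullet> x) *\<^sub>R v) \<partial>lborel)"
    by (rule nn_integral_lborel_translation[where f="\<lambda>x. indicator {0..1} (v \<bullet> x) * f (x - (v \<bullet> x) *\<^sub>R v)"]) measurable
  finally show ?thesis by (simp add: nn_integral_hplane_measure)
qed

lemma emeasure_hplane_measure:
  assumes [measurable]: "A \<in> sets borel"
  shows "emeasure (hplane_measure v) A = emeasure lborel {x. v \<bullet> x \<in> {0..1} \<and> x - (v \<bullet> x) *\<^sub>R v \<in> A}"
proof -
  define S where "S = {x. v \<bullet> x \<in> {0..1} \<and> x - (v \<bullet> x) *\<^sub>R v \<in> A}"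
  have S: "S \<in> sets borel" unfolding S_def by measurable
  have "emeasure (hplane_measure v) A = (\<integral>\<^sup>+x. indicator A x \<partial>hplane_measure v)" by simp
  also have "\<dots> = (\<integral>\<^sup>+x. indicator {0..1} (v \<bullet> x) * indicator A (x - (v \<bullet> x) *\<^sub>R v) \<partial>lborel)"
    by (rule nn_integral_hplane_measure) measurable
  also have "\<dots> = (\<integral>\<^sup>+x. indicator S x \<partial>lborel)"
    by (rule nn_integral_cong) (auto simp: indicator_def S_def)
  also have "\<dots> = emeasure lborel S" using S by simp
  finally show ?thesis unfolding S_def .
qed

lemma hplane_measure_bounded_finite:
  assumes "bounded A" "A \<in> sets borel"
  shows "emeasure (hplane_measure v) A < \<infinity>"
proof -
  obtain r where r: "\<And>x. x \<in> A \<Longrightarrow> norm x \<le> r" using assms by (auto simp: bounded_iff)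
  have "{x. v \<bullet> x \<in> {0..1} \<and> x - (v \<bullet> x) *\<^sub>R v \<in> A} \<subseteq> cball 0 (r + 1)"
  proof safe
    fix x assume x: "v \<bullet> x \<in> {0..1}" "x - (v \<bullet> x) *\<^sub>R v \<in> A"
    have "norm x \<le> norm (x - (v \<bullet> x) *\<^sub>R v) + norm ((v \<bullet> x) *\<^sub>R v)"
      using norm_triangle_ineq[of "x - (v \<bullet> x) *\<^sub>R v" "(v \<bullet> x) *\<^sub>R v"] by simp
    also have "\<dots> \<le> r + 1" using r[OF x(2)] x(1) v by auto
    finally show "x \<in> cball 0 (r + 1)" by simp
  qed
  then have "emeasure (hplane_measure v) A \<le> emeasure lborel (cball 0 (r + 1) :: 'a set)"
    using assms by (subst emeasure_hplane_measure) (auto intro: emeasure_mono)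
  also have "\<dots> < \<infinity>" by (rule emeasure_lborel_cball_finite)
  finally show ?thesis .
qed

lemma sigma_finite_hplane_measure: "sigma_finite_measure (hplane_measure v)"
proof
  show "\<exists>A. countable A \<and> A \<subseteq> sets (hplane_measure v) \<and> \<Union> A = space (hplane_measure v) \<and>
      (\<forall>a\<in>A. emeasure (hplane_measure v) a \<noteq> \<infinity>)"
    using hplane_measure_bounded_finite
    by (intro exI[of _ "range (\<lambda>n::nat. ball 0 (real n))"])
       (auto simp: less_top reals_Archimedean2 hplane_measure_def)
qed

lemma hplane_measure_ball_pos: "0 < emeasure (hplane_measure v) (ball 0 r)" if r: "0 < r"
proof -
  define e where "e = min (r / 2) (1 / 2)"
  have e: "0 < e" "e < r" "e \<le> 1 / 2" using r by (auto simp: e_def)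
  \<comment> \<open>A ball of radius at most 1/2 centred halfway up the slab stays inside the slab,
    and projection to the hyperplane does not increase norms.\<close>
  have "ball ((1/2) *\<^sub>R v) e \<subseteq> {x. v \<bullet> x \<in> {0..1} \<and> x - (v \<bullet> x) *\<^sub>R v \<in> ball 0 r}"
  proof
    fix x assume "x \<in> ball ((1/2) *\<^sub>R v) e"
    then have x: "norm (x - (1/2) *\<^sub>R v) < e" by (simp add: dist_norm norm_minus_commute)
    define y where "y = x - (1/2) *\<^sub>R v"
    have xy: "x = y + (1/2) *\<^sub>R v" by (simp add: y_def)
    have "\<bar>v \<bullet> y\<bar> \<le> norm y" using Cauchy_Schwarz_ineq2[of v y] v by simp
    then have "- (1 / 2) \<le> v \<bullet> y" "v \<bullet> y \<le> 1 / 2" using x e unfolding y_def by linarith+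
    then have 1: "v \<bullet> x \<in> {0..1}" by (simp add: xy inner_add_right)
    have 2: "x - (v \<bullet> x) *\<^sub>R v = y - (v \<bullet> y) *\<^sub>R v" by (simp add: xy inner_add_right algebra_simps)
    have "(norm (y - (v \<bullet> y) *\<^sub>R v))\<^sup>2 \<le> (norm y)\<^sup>2"
      by (simp add: power2_norm_eq_inner inner_simps inner_commute)
    then have "norm (y - (v \<bullet> y) *\<^sub>R v) \<le> norm y" by (rule power2_le_imp_le) simp
    then show "x \<in> {x. v \<bullet> x \<in> {0..1} \<and> x - (v \<bullet> x) *\<^sub>R v \<in> ball 0 r}"
    proof -
      have "norm (x - (v \<bullet> x) *\<^sub>R v) \<le> norm y" unfolding 2 by fact
      also have "\<dots> < r" using x e unfolding y_def by linarith
      finally show ?thesis using 1 by simp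
    qed
  qed
  then have "emeasure lborel (ball ((1/2) *\<^sub>R v) e) \<le> emeasure (hplane_measure v) (ball 0 r)"
    by (subst emeasure_hplane_measure) (auto intro!: emeasure_mono)
  moreover have "0 < emeasure lborel (ball ((1/2) *\<^sub>R v) e)"
    using e by (simp add: emeasure_ball)
  ultimately show ?thesis by (simp add: less_le_trans)
qed

lemma nn_integral_hplane_fubini:
  assumes [measurable]: "f \<in> borel_measurable borel"
  shows "(\<integral>\<^sup>+x. f x \<partial>lborel) = (\<integral>\<^sup>+x. (\<integral>\<^sup>+t. f (x + t *\<^sub>R v) \<partial>lborel) \<partial>hplane_measure v)"
proof -
  obtain c where c: "c < \<infinity>" and eq: "\<And>f. f \<in> borel_measurable borel \<Longrightarrow>
       (\<integral>\<^sup>+x. (\<integral>\<^sup>+t. f (x + t *\<^sub>R v) \<partial>lborel) \<partial>hplane_measure v) = c * (\<integral>\<^sup>+x. f x \<partial>lborel)"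
    by (rule hyperplane_product_measure[OF sets_hplane_measure v AE_hplane_measure hplane_measure_translation])
       (simp_all add: hplane_measure_bounded_finite[simplified])
  have [measurable]: "ball (0::'a) 1 \<in> sets borel" by simp
  \<comment> \<open>The test function that fixes the constant is the cylinder of height one over the
    unit ball: the two sides of the product identity become \<open>?b\<close> and
    \<open>c * ?b\<close>, and \<open>?b\<close> is finite and positive.\<close>
  let ?g = "\<lambda>x. indicator {0..1} (v \<bullet> x) * indicator (ball 0 1) (x - (v \<bullet> x) *\<^sub>R v) :: ennreal"
  let ?b = "emeasure (hplane_measure v) (ball 0 1)"
  have "?b = (\<integral>\<^sup>+x. (\<integral>\<^sup>+t. ?g (x + t *\<^sub>R v) \<partial>lborel) \<partial>hplane_measure v)"
  proof -
    have "?b = (\<integral>\<^sup>+x. indicator (ball 0 1) x \<partial>hplane_measure v)" by simp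
    also have "\<dots> = (\<integral>\<^sup>+x. (\<integral>\<^sup>+t. ?g (x + t *\<^sub>R v) \<partial>lborel) \<partial>hplane_measure v)"
    proof (rule nn_integral_cong_AE, use AE_hplane_measure in eventually_elim)
      fix x assume x: "v \<bullet> x = 0"
      have "(\<integral>\<^sup>+t. ?g (x + t *\<^sub>R v) \<partial>lborel) = (\<integral>\<^sup>+t. indicator {0..1::real} t * indicator (ball 0 1) x \<partial>lborel)"
        using x by (simp add: inner_add_right algebra_simps)
      then show "indicator (ball 0 1) x = (\<integral>\<^sup>+t. ?g (x + t *\<^sub>R v) \<partial>lborel)"
        by (simp add: nn_integral_multc)
    qed
    finally show ?thesis .
  qed
  also have "\<dots> = c * (\<integral>\<^sup>+x. ?g x \<partial>lborel)" by (rule eq) measurable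
  also have "(\<integral>\<^sup>+x. ?g x \<partial>lborel) = ?b"
    using nn_integral_hplane_measure[of "indicator (ball 0 1)" v] by simp
  finally have cb: "?b = c * ?b" .
  have "c = 1"
  proof -
    have "?b < \<infinity>" by (rule hplane_measure_bounded_finite) auto
    moreover have "0 < ?b" by (rule hplane_measure_ball_pos) simp
    ultimately obtain b where b: "?b = ennreal b" "0 < b" by (cases "?b") auto
    obtain r where r: "c = ennreal r" "0 \<le> r" using c by (cases c) auto
    have "b = r * b" using cb b r by (simp add: ennreal_mult[symmetric])
    then show ?thesis using b r by simp
  qed
  then show ?thesis using eq[of f] by simp
qed

end

context
  fixes v :: "'a::euclidean_space"
  assumes v: "norm v = 1"
begin

text \<open>Dilating the slab of height one over A by \<open>s\<close> multiplies its volume by the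
  full power of \<open>s\<close>, but produces a slab of height \<open>s\<close>; dividing by this
  height leaves one power less.\<close>

lemma hplane_measure_scale:
  assumes [measurable]: "A \<in> sets borel" and s: "0 < s"
  shows "emeasure (hplane_measure v) ((*\<^sub>R) s ` A) = ennreal (s ^ (DIM('a) - 1)) * emeasure (hplane_measure v) A"
proof -
  have im: "(*\<^sub>R) s ` A = {x. x /\<^sub>R s \<in> A}"
  proof safe
    fix x assume "x /\<^sub>R s \<in> A"
    then show "x \<in> (*\<^sub>R) s ` A" using s by (intro image_eqI[of _ _ "x /\<^sub>R s"]) auto
  qed (use s in auto)
  have [measurable]: "(*\<^sub>R) s ` A \<in> sets borel" unfolding im by measurable
  let ?f = "\<lambda>x. indicator {0..s} (v \<bullet> x) * indicator ((*\<^sub>R) s ` A) (x - (v \<bullet> x) *\<^sub>R v) :: ennreal"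
  have fm[measurable]: "?f \<in> borel_measurable borel" by measurable
  have "(\<integral>\<^sup>+x. ?f x \<partial>lborel) = (\<integral>\<^sup>+x. (\<integral>\<^sup>+t. ?f (x + t *\<^sub>R v) \<partial>lborel) \<partial>hplane_measure v)"
    by (rule nn_integral_hplane_fubini[OF v fm])
  also have "\<dots> = (\<integral>\<^sup>+x. indicator ((*\<^sub>R) s ` A) x * ennreal s \<partial>hplane_measure v)"
  proof (rule nn_integral_cong_AE, use AE_hplane_measure[OF v] in eventually_elim)
    fix x assume x: "v \<bullet> x = 0"
    have "(\<integral>\<^sup>+t. ?f (x + t *\<^sub>R v) \<partial>lborel) = (\<integral>\<^sup>+t. indicator ((*\<^sub>R) s ` A) x * indicator {0..s::real} t \<partial>lborel)"
      using x v_inner[OF v] by (intro nn_integral_cong) (simp add: inner_add_right algebra_simps)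
    also have "\<dots> = indicator ((*\<^sub>R) s ` A) x * ennreal s"
      using s by (simp add: nn_integral_cmult)
    finally show "(\<integral>\<^sup>+t. ?f (x + t *\<^sub>R v) \<partial>lborel) = indicator ((*\<^sub>R) s ` A) x * ennreal s" .
  qed
  also have "\<dots> = emeasure (hplane_measure v) ((*\<^sub>R) s ` A) * ennreal s"
    by (simp add: nn_integral_multc)
  finally have 1: "(\<integral>\<^sup>+x. ?f x \<partial>lborel) = emeasure (hplane_measure v) ((*\<^sub>R) s ` A) * ennreal s" .
  have "(\<integral>\<^sup>+x. ?f x \<partial>lborel) = ennreal (s ^ DIM('a)) * (\<integral>\<^sup>+x. ?f (s *\<^sub>R x) \<partial>lborel)"
    by (rule nn_integral_lborel_scale[OF fm s])
  also have "(\<integral>\<^sup>+x. ?f (s *\<^sub>R x) \<partial>lborel)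
      = (\<integral>\<^sup>+x. indicator {0..1} (v \<bullet> x) * indicator A (x - (v \<bullet> x) *\<^sub>R v) \<partial>lborel)"
  proof (rule nn_integral_cong)
    fix x
    have "(s *\<^sub>R x - (v \<bullet> s *\<^sub>R x) *\<^sub>R v) /\<^sub>R s = x - (v \<bullet> x) *\<^sub>R v"
      using s by (simp add: scaleR_diff_right)
    moreover have "v \<bullet> s *\<^sub>R x \<in> {0..s} \<longleftrightarrow> v \<bullet> x \<in> {0..1}"
      using s by (simp add: zero_le_mult_iff)
    ultimately show "?f (s *\<^sub>R x) = indicator {0..1} (v \<bullet> x) * indicator A (x - (v \<bullet> x) *\<^sub>R v)"
      unfolding im by (simp only: indicator_def mem_Collect_eq)
  qed
  also have "\<dots> = emeasure (hplane_measure v) A"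
    using nn_integral_hplane_measure[of "indicator A" v] by simp
  finally have 2: "emeasure (hplane_measure v) ((*\<^sub>R) s ` A) * ennreal s
      = ennreal (s ^ DIM('a)) * emeasure (hplane_measure v) A"
    using 1 by simp
  have "s ^ DIM('a) = s * s ^ (DIM('a) - 1)" by (simp add: power_eq_if)
  then have "emeasure (hplane_measure v) ((*\<^sub>R) s ` A) * ennreal s * ennreal (1 / s)
    = ennreal (s ^ (DIM('a) - 1)) * emeasure (hplane_measure v) A * (ennreal s * ennreal (1 / s))"
    using 2 s by (simp add: ennreal_mult mult_ac)
  moreover have "ennreal s * ennreal (1 / s) = 1" using s by (simp add: ennreal_mult[symmetric])
  ultimately show ?thesis by (simp add: mult.assoc)
qed

text \<open>Slicing the unit ball of the whole space by hyperplanes orthogonal to \<open>v\<close>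
  expresses its known volume as the unknown measure \<open>u\<close> of the unit ball in the
  hyperplane times a Beta value. The same Beta value links the ball volumes of consecutive
  dimensions, so \<open>u\<close> must be the ball volume in one dimension less.\<close>

lemma hplane_measure_cball:
  assumes r: "0 < r"
  shows "emeasure (hplane_measure v) (cball 0 r) = ennreal (unit_ball_vol (real (DIM('a) - 1)) * r ^ (DIM('a) - 1))"
proof -
  define k where "k = DIM('a) - 1"
  have dk: "DIM('a) = Suc k" using DIM_positive[where 'a='a] by (simp add: k_def)
  define u where "u = emeasure (hplane_measure v) (cball 0 1)"
  have scl: "emeasure (hplane_measure v) (cball 0 s) = ennreal (s ^ k) * u" if "0 < s" for s
  proof -
    have "(*\<^sub>R) s ` cball 0 1 = cball (0::'a) s" using that cball_scale[of s 0 1] by simp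
    then show ?thesis using hplane_measure_scale[of "cball 0 1" s] that by (simp add: u_def k_def)
  qed
  have bm: "indicator (cball (0::'a) 1) \<in> borel_measurable borel"
    by (intro borel_measurable_indicator) simp
  have "ennreal (unit_ball_vol (real (DIM('a)))) = (\<integral>\<^sup>+x. indicator (cball (0::'a) 1) x \<partial>lborel)"
    using emeasure_cball[of 1 "0::'a"] by simp
  also have "\<dots> = (\<integral>\<^sup>+x. (\<integral>\<^sup>+t. indicator (cball (0::'a) 1) (x + t *\<^sub>R v) \<partial>lborel) \<partial>hplane_measure v)"
    by (rule nn_integral_hplane_fubini[OF v bm])
  also have "\<dots> = (\<integral>\<^sup>+x. (\<integral>\<^sup>+t. indicator {-1..1} t * indicator (cball (0::'a) (sqrt (1 - t\<^sup>2))) x \<partial>lborel) \<partial>hplane_measure v)"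
  proof (rule nn_integral_cong_AE, use AE_hplane_measure[OF v] in eventually_elim, rule nn_integral_cong)
    fix x and t :: real assume x: "v \<bullet> x = 0"
    have sq: "(norm (x + t *\<^sub>R v))\<^sup>2 = (norm x)\<^sup>2 + t\<^sup>2"
      using x v norm_add_Pythagorean[of x "t *\<^sub>R v"] by (simp add: orthogonal_def inner_commute)
    have "norm (x + t *\<^sub>R v) \<le> 1 \<longleftrightarrow> (norm (x + t *\<^sub>R v))\<^sup>2 \<le> 1"
      using abs_square_le_1[of "norm (x + t *\<^sub>R v)"] by simp
    also have "\<dots> \<longleftrightarrow> t \<in> {-1..1} \<and> (norm x)\<^sup>2 \<le> 1 - t\<^sup>2"
    proof -
      have "t \<in> {-1..1} \<longleftrightarrow> t\<^sup>2 \<le> 1" using abs_square_le_1[of t] by (auto simp: abs_le_iff)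
      then show ?thesis unfolding sq using zero_le_power2[of "norm x"] by (safe; linarith)
    qed
    also have "\<dots> \<longleftrightarrow> t \<in> {-1..1} \<and> norm x \<le> sqrt (1 - t\<^sup>2)"
      by (metis norm_ge_zero real_le_rsqrt real_sqrt_le_iff real_sqrt_unique)
    finally show "indicator (cball 0 1) (x + t *\<^sub>R v) =
        (indicator {-1..1} t * indicator (cball 0 (sqrt (1 - t\<^sup>2))) x :: ennreal)"
      by (auto simp: indicator_def)
  qed
  also have "\<dots> = (\<integral>\<^sup>+t. (\<integral>\<^sup>+x. indicator {-1..1} t * indicator (cball (0::'a) (sqrt (1 - t\<^sup>2))) x \<partial>hplane_measure v) \<partial>lborel)"
  proof -
    interpret h: sigma_finite_measure "hplane_measure v" by (rule sigma_finite_hplane_measure[OF v])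
    interpret pair_sigma_finite "hplane_measure v" lborel ..
    have "(\<lambda>(x, t). indicator {-1..1} t * indicator (cball (0::'a) (sqrt (1 - t\<^sup>2))) x :: ennreal)
      = (\<lambda>(x, t). indicator {-1..1} t * indicator {y. y \<ge> 0} (sqrt (1 - t\<^sup>2) - norm x))"
      by (auto simp: indicator_def fun_eq_iff)
    also have "\<dots> \<in> borel_measurable (hplane_measure v \<Otimes>\<^sub>M lborel)" by measurable
    finally show ?thesis by (intro Fubini'[symmetric])
  qed
  also have "\<dots> = (\<integral>\<^sup>+t. indicator {-1..1} t * emeasure (hplane_measure v) (cball 0 (sqrt (1 - t\<^sup>2))) \<partial>lborel)"
    by (rule nn_integral_cong, rule nn_integral_cmult_indicator) simp
  also have "\<dots> = (\<integral>\<^sup>+t. ennreal (indicator {-1..1} t * sqrt (1 - t\<^sup>2) ^ k) * u \<partial>lborel)"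
  proof (rule nn_integral_cong_AE)
    \<comment> \<open>At the endpoints the slice has radius zero, which the scaling identity
      \<open>scl\<close> does not cover.\<close>
    have "AE t in lborel. t \<notin> {-1,1::real}"
      by (intro AE_not_in countable_imp_null_set_lborel) auto
    then show "AE t in lborel. indicator {-1..1} t * emeasure (hplane_measure v) (cball 0 (sqrt (1 - t\<^sup>2)))
        = ennreal (indicator {-1..1} t * sqrt (1 - t\<^sup>2) ^ k) * u"
    proof eventually_elim
      fix t :: real assume t: "t \<notin> {-1,1}"
      show "indicator {-1..1} t * emeasure (hplane_measure v) (cball 0 (sqrt (1 - t\<^sup>2)))
        = ennreal (indicator {-1..1} t * sqrt (1 - t\<^sup>2) ^ k) * u"
      proof (cases "t \<in> {-1..1}")
        case True
        then have "\<bar>t\<bar> < 1" using t by auto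
        then have "0 < sqrt (1 - t\<^sup>2)" by (simp add: abs_square_less_1)
        then show ?thesis using True by (simp add: scl)
      qed simp
    qed
  qed
  also have "\<dots> = ennreal (Beta (1 / 2) (real k / 2 + 1)) * u"
    by (simp add: nn_integral_multc emeasure_cball_aux_integral)
  finally have main: "ennreal (unit_ball_vol (real (Suc k))) = ennreal (Beta (1 / 2) (real k / 2 + 1)) * u"
    by (simp add: dk)
  have B: "unit_ball_vol (real k) * Beta (1 / 2) (real k / 2 + 1) = unit_ball_vol (real (Suc k))"
    by (auto simp: unit_ball_vol_def Beta_def Gamma_eq_zero_iff field_simps
          Gamma_one_half_real powr_half_sqrt [symmetric] powr_add [symmetric])
  have "0 < unit_ball_vol (real k) * Beta (1 / 2) (real k / 2 + 1)" unfolding B by simp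
  then have Bpos: "0 < Beta (1 / 2) (real k / 2 + 1)" by (rule zero_less_mult_pos) simp
  have "u < \<infinity>" unfolding u_def by (rule hplane_measure_bounded_finite[OF v]) auto
  then obtain u' where u': "u = ennreal u'" "0 \<le> u'" by (cases u) auto
  have "unit_ball_vol (real (Suc k)) = Beta (1 / 2) (real k / 2 + 1) * u'"
    using main u' Bpos by (simp add: ennreal_mult[symmetric])
  then have "u' = unit_ball_vol (real k)" using B Bpos by (simp add: mult.commute flip: B)
  then show ?thesis using scl[OF r] u' r by (simp add: k_def ennreal_mult mult.commute)
qed

text \<open>Prekopa-Leindler is applied to A and its reflection -A, which have the same measure.
  Their midpoints are halves of differences of points of A and lie in the centred ball of radius
  D/2. To use the inequality of the whole space, every set is thickened to a slab of height
  one.\<close>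

lemma hplane_measure_isodiametric:
  assumes A: "A \<in> sets borel" and D: "0 \<le> D" and diam: "\<And>x y. x \<in> A \<Longrightarrow> y \<in> A \<Longrightarrow> norm (x - y) \<le> D"
  shows "emeasure (hplane_measure v) A \<le> ennreal (unit_ball_vol (real (DIM('a) - 1)) * (D / 2) ^ (DIM('a) - 1))"
proof -
  have [measurable]: "A \<in> sets borel" by fact
  have pos: "emeasure (hplane_measure v) A \<le> emeasure (hplane_measure v) (cball 0 (D' / 2))"
    if D': "0 < D'" and dd: "\<And>x y. x \<in> A \<Longrightarrow> y \<in> A \<Longrightarrow> norm (x - y) \<le> D'" for D'
  proof -
    let ?pr = "\<lambda>x. x - (v \<bullet> x) *\<^sub>R v"
    let ?f = "\<lambda>x. indicator {0..1} (v \<bullet> x) * indicator A (?pr x) :: ennreal"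
    \<comment> \<open>The slab over -A. The map x to v - x carries it to the slab over A, because it
      sends the normal coordinate t to 1 - t and reflects the projection.\<close>
    let ?g = "\<lambda>x. indicator {0..1} (v \<bullet> x) * indicator A (- ?pr x) :: ennreal"
    let ?h = "\<lambda>x. indicator {0..1} (v \<bullet> x) * indicator {y. norm y \<le> D' / 2} (?pr x) :: ennreal"
    have fA: "(\<integral>\<^sup>+x. ?f x \<partial>lborel) = emeasure (hplane_measure v) A"
      using nn_integral_hplane_measure[of "indicator A" v] by simp
    have "(\<integral>\<^sup>+x. ?g x \<partial>lborel) = (\<integral>\<^sup>+x. ?g (v - x) \<partial>lborel)"
      by (rule nn_integral_lborel_reflect[symmetric]) measurable
    also have "\<dots> = (\<integral>\<^sup>+x. ?f x \<partial>lborel)"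
      using v_inner[OF v] by (intro nn_integral_cong) (auto simp: indicator_def inner_diff_right algebra_simps)
    finally have gA: "(\<integral>\<^sup>+x. ?g x \<partial>lborel) = emeasure (hplane_measure v) A" using fA by simp
    have cb: "cball 0 (D' / 2) = {y::'a. norm y \<le> D' / 2}" by (auto simp: dist_norm)
    have "{y::'a. norm y \<le> D' / 2} \<in> sets borel" by (simp flip: cb)
    then have hA: "(\<integral>\<^sup>+x. ?h x \<partial>lborel) = emeasure (hplane_measure v) (cball 0 (D' / 2))"
      unfolding cb using nn_integral_hplane_measure[of "indicator {y. norm y \<le> D' / 2}" v] by simp
    have "(\<integral>\<^sup>+x. ?f x \<partial>lborel) * (\<integral>\<^sup>+x. ?g x \<partial>lborel) \<le> (\<integral>\<^sup>+x. ?h x \<partial>lborel)\<^sup>2"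
    proof (rule prekopa_leindler)
      fix x y :: 'a
      show "?f x * ?g y \<le> (?h ((1 / 2) *\<^sub>R (x + y)))\<^sup>2"
      proof (cases "v \<bullet> x \<in> {0..1} \<and> ?pr x \<in> A \<and> v \<bullet> y \<in> {0..1} \<and> - ?pr y \<in> A")
        case True
        have "?pr ((1 / 2) *\<^sub>R (x + y)) = (1/2) *\<^sub>R (?pr x - (- ?pr y))"
          by (simp add: inner_add_right algebra_simps)
        then have "norm (?pr ((1 / 2) *\<^sub>R (x + y))) \<le> D' / 2"
          using dd[of "?pr x" "- ?pr y"] True by simp
        then have "?h ((1 / 2) *\<^sub>R (x + y)) = 1"
          using True by (auto simp: inner_add_right)
        then show ?thesis using True by simp
      qed auto
    qed measurable
    then have le: "emeasure (hplane_measure v) A * emeasure (hplane_measure v) A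
      \<le> (emeasure (hplane_measure v) (cball 0 (D' / 2)))\<^sup>2" unfolding fA gA hA .
    have "bounded A"
    proof (cases "A = {}")
      case False
      then obtain a where a: "a \<in> A" by auto
      have "A \<subseteq> cball a D'" using dd[OF a] by (auto simp: dist_norm)
      then show ?thesis by (rule bounded_subset[OF bounded_cball])
    qed simp
    then have "emeasure (hplane_measure v) A < \<infinity>" using A by (rule hplane_measure_bounded_finite[OF v])
    then obtain a where a: "emeasure (hplane_measure v) A = ennreal a" "0 \<le> a"
      by (cases "emeasure (hplane_measure v) A") auto
    have "emeasure (hplane_measure v) (cball 0 (D' / 2)) < \<infinity>" by (rule hplane_measure_bounded_finite[OF v]) auto
    then obtain b where b: "emeasure (hplane_measure v) (cball 0 (D' / 2)) = ennreal b" "0 \<le> b"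
      by (cases "emeasure (hplane_measure v) (cball 0 (D' / 2))") auto
    have "a\<^sup>2 \<le> b\<^sup>2" using le a b by (simp add: power2_eq_square ennreal_mult[symmetric])
    then have "a \<le> b" using b(2) by (rule power2_le_imp_le)
    then show ?thesis using a b by (simp add: ennreal_leI)
  qed
  \<comment> \<open>The diameter bound is relaxed by 1/(n + 1) and the limit taken, because the ball
    formula needs a positive radius while \<open>D\<close> may be zero.\<close>
  let ?F = "\<lambda>n. ennreal (unit_ball_vol (real (DIM('a) - 1)) * ((D + 1 / real (Suc n)) / 2) ^ (DIM('a) - 1))"
  have le: "emeasure (hplane_measure v) A \<le> ?F n" for n
  proof -
    have D': "0 < D + 1 / real (Suc n)" using D by (simp add: add_nonneg_pos)
    have "emeasure (hplane_measure v) A \<le> emeasure (hplane_measure v) (cball 0 ((D + 1 / real (Suc n)) / 2))"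
    proof (rule pos[OF D'])
      show "norm (x - y) \<le> D + 1 / real (Suc n)" if "x \<in> A" "y \<in> A" for x y
        using diam[OF that] by (rule order_trans) simp
    qed
    then show ?thesis using D' hplane_measure_cball[of "(D + 1 / real (Suc n)) / 2"] by simp
  qed
  have "?F \<longlonglongrightarrow> ennreal (unit_ball_vol (real (DIM('a) - 1)) * ((D + 0) / 2) ^ (DIM('a) - 1))"
    by (intro tendsto_ennrealI tendsto_intros LIMSEQ_inverse_real_of_nat[unfolded inverse_eq_divide]) simp
  then show ?thesis using le by (intro LIMSEQ_le_const) auto
qed

end

section \<open>Hausdorff measure on hyperplanes\<close>

lemma hausdorff_pre_finite_UN:
  assumes "finite I" "0 \<le> \<delta>"
  shows "hausdorff_pre k \<delta> (\<Union>i\<in>I. A i) \<le> (\<Sum>i\<in>I. hausdorff_pre k \<delta> (A i))"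
  using assms(1)
proof (induction I rule: finite_induct)
  case (insert i I)
  have "hausdorff_pre k \<delta> (\<Union>i\<in>insert i I. A i) \<le> hausdorff_pre k \<delta> (A i) + hausdorff_pre k \<delta> (\<Union>i\<in>I. A i)"
    using hausdorff_pre_Un[OF assms(2), of k "A i" "\<Union>i\<in>I. A i"] by simp
  also have "\<dots> \<le> hausdorff_pre k \<delta> (A i) + (\<Sum>i\<in>I. hausdorff_pre k \<delta> (A i))"
    by (intro add_left_mono insert.IH)
  finally show ?case using insert by simp
qed (use assms in simp)

text \<open>B is an orthonormal basis of the hyperplane and Q its unit cube, the test body on which
  Hausdorff and Lebesgue measure are compared: bounded, of positive measure, and divisible into
  scaled copies of itself.\<close>

locale unit_cube_in_hyperplane =
  fixes v :: "'a::euclidean_space" and B :: "'a set" and k :: nat and Q :: "'a set"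
  assumes v: "norm v = 1"
    and Bfin: "finite B" and cardB: "card B = k" and spanB: "span B = {x. v \<bullet> x = 0}"
    and orthB: "\<And>b c. b \<in> B \<Longrightarrow> c \<in> B \<Longrightarrow> b \<bullet> c = (if b = c then 1 else 0)"
    and kdef: "k = DIM('a) - 1"
    and Qdef: "Q = {x. v \<bullet> x = 0 \<and> (\<forall>b\<in>B. x \<bullet> b \<in> {0..1})}"
begin

lemma B_sub: "b \<in> B \<Longrightarrow> v \<bullet> b = 0"
  using spanB span_base[of b B] by auto

lemma norm_B: "b \<in> B \<Longrightarrow> norm b = 1"
  using orthB[of b b] by (simp add: norm_eq_1)

lemma expand: "v \<bullet> x = 0 \<Longrightarrow> (\<Sum>b\<in>B. (x \<bullet> b) *\<^sub>R b) = x"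
  using spanB orthonormal_basis_expand[of B x] Bfin orthB
  by (auto simp: pairwise_def orthogonal_def norm_eq_1)

lemma inner_sum_B: "c \<in> B \<Longrightarrow> (\<Sum>b\<in>B. a b *\<^sub>R b) \<bullet> c = a c"
  using Bfin by (simp add: inner_sum_left orthB if_distrib cong: if_cong)

lemma v_sum_B: "v \<bullet> (\<Sum>b\<in>B. a b *\<^sub>R b) = 0"
  by (simp add: inner_sum_right B_sub)

lemma Q_closed: "closed Q"
proof -
  have "Q = {x. v \<bullet> x = 0} \<inter> (\<Inter>b\<in>B. {x. 0 \<le> b \<bullet> x} \<inter> {x. b \<bullet> x \<le> 1})"
    by (auto simp: Qdef inner_commute)
  moreover have "closed \<dots>"
    by (intro closed_Int closed_hyperplane closed_INT ballI closed_halfspace_ge closed_halfspace_le)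
  ultimately show ?thesis by simp
qed

lemma Q_norm: "x \<in> Q \<Longrightarrow> norm x \<le> real k"
proof -
  assume x: "x \<in> Q"
  have "norm x = norm (\<Sum>b\<in>B. (x \<bullet> b) *\<^sub>R b)" using x expand by (simp add: Qdef)
  also have "\<dots> \<le> (\<Sum>b\<in>B. 1)"
    using x by (intro sum_norm_le) (auto simp: Qdef norm_B)
  finally show "norm x \<le> real k" using cardB by simp
qed

lemma Q_bounded: "bounded Q" "diameter Q \<le> 2 * real k"
proof -
  show b: "bounded Q" using Q_norm by (auto simp: bounded_iff)
  show "diameter Q \<le> 2 * real k"
  proof (rule diameter_le)
    show "norm (x - y) \<le> 2 * real k" if "x \<in> Q" "y \<in> Q" for x y
      using Q_norm[OF that(1)] Q_norm[OF that(2)] norm_triangle_ineq4[of x y] by simp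
  qed simp
qed

text \<open>The cube consists of \<open>m\<^sup>k\<close> copies of itself scaled by \<open>1/m\<close>, so a covering of it can be
  refined without changing its total gauge.\<close>

lemma hausdorff_pre_Q_subdivide:
  assumes m: "0 < m" and \<delta>: "0 \<le> \<delta>"
  shows "hausdorff_pre k \<delta> Q \<le> hausdorff_pre k (real m * \<delta>) Q"
proof -
  define Z where "Z = PiE B (\<lambda>_. {..<m})"
  define T where "T z x = (\<Sum>b\<in>B. (real (z b) / real m) *\<^sub>R b) + (1 / real m) *\<^sub>R x" for z :: "'a \<Rightarrow> nat" and x
  have Zf: "finite Z" "card Z = m ^ k" using Bfin cardB by (auto simp: Z_def finite_PiE card_PiE)
  have cov: "Q \<subseteq> (\<Union>z\<in>Z. T z ` Q)"
  proof
    fix x assume x: "x \<in> Q"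
    \<comment> \<open>The index is capped at m - 1 so that points on an upper face, where
      \<open>x \<bullet> b = 1\<close>, fall into the last subcube and not into one beyond the
      cube.\<close>
    define z where "z = (\<lambda>b\<in>B. min (m - 1) (nat \<lfloor>x \<bullet> b * real m\<rfloor>))"
    define q where "q = (\<Sum>b\<in>B. (x \<bullet> b * real m - real (z b)) *\<^sub>R b)"
    have zZ: "z \<in> Z" using m by (auto simp: Z_def z_def min_def)
    have rng: "0 \<le> x \<bullet> b * real m - real (z b) \<and> x \<bullet> b * real m - real (z b) \<le> 1" if b: "b \<in> B" for b
    proof -
      let ?u = "x \<bullet> b * real m"
      have xb: "0 \<le> x \<bullet> b" "x \<bullet> b \<le> 1" using x b by (auto simp: Qdef)
      have u: "0 \<le> ?u" "?u \<le> real m" using xb by (auto simp: mult_left_le_one_le)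
      have "real (nat \<lfloor>?u\<rfloor>) = of_int \<lfloor>?u\<rfloor>" using u by simp
      then obtain j where j: "nat \<lfloor>?u\<rfloor> = j" "real j \<le> ?u" "?u < real j + 1"
        using of_int_floor_le[of ?u] real_of_int_floor_add_one_gt[of ?u] by metis
      show ?thesis
      proof (cases "j \<le> m - 1")
        case True
        then have "z b = j" using b j(1) by (simp add: z_def min_def)
        then show ?thesis using j by simp
      next
        case False
        then have "z b = m - 1" using b j(1) by (simp add: z_def min_def)
        moreover have "real m \<le> real j" using False by linarith
        ultimately show ?thesis using j u m by (simp add: of_nat_diff)
      qed
    qed
    have qQ: "q \<in> Q" using rng by (auto simp: Qdef q_def v_sum_B inner_sum_B)
    have "T z q = (\<Sum>b\<in>B. (x \<bullet> b) *\<^sub>R b)"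
      unfolding T_def q_def scaleR_sum_right sum.distrib[symmetric] scaleR_scaleR scaleR_add_left[symmetric]
      using m by (intro sum.cong refl arg_cong2[where f=scaleR]) (simp add: field_simps)
    also have "\<dots> = x" using x by (intro expand) (simp add: Qdef)
    finally have "T z q = x" .
    then show "x \<in> (\<Union>z\<in>Z. T z ` Q)" using zZ qQ by blast
  qed
  have "hausdorff_pre k \<delta> Q \<le> hausdorff_pre k \<delta> (\<Union>z\<in>Z. T z ` Q)" by (rule hausdorff_pre_mono[OF cov])
  also have "\<dots> \<le> (\<Sum>z\<in>Z. hausdorff_pre k \<delta> (T z ` Q))" by (rule hausdorff_pre_finite_UN[OF Zf(1) \<delta>])
  also have "\<dots> = (\<Sum>z\<in>Z. ennreal ((1 / real m) ^ k) * hausdorff_pre k (real m * \<delta>) Q)"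
  proof (rule sum.cong)
    fix z
    show "hausdorff_pre k \<delta> (T z ` Q) = ennreal ((1 / real m) ^ k) * hausdorff_pre k (real m * \<delta>) Q"
      using hausdorff_pre_affine[of "1 / real m" k "real m * \<delta>" "\<Sum>b\<in>B. (real (z b) / real m) *\<^sub>R b" Q] m
      by (simp add: T_def[abs_def])
  qed simp
  also have "\<dots> = ennreal (real (m ^ k)) * (ennreal ((1 / real m) ^ k) * hausdorff_pre k (real m * \<delta>) Q)"
    using Zf by (simp add: ennreal_of_nat_eq_real_of_nat)
  also have "\<dots> = hausdorff_pre k (real m * \<delta>) Q"
    using m by (simp add: mult.assoc[symmetric] ennreal_mult[symmetric] power_divide)
  finally show ?thesis .
qed

text \<open>For the cube a coarse covering is as good as a fine one: shrinking it by a large integer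
  m and copying it to the subcubes gives a covering below any prescribed scale with the same total
  gauge. So the supremum over scales may be replaced by any single scale, at which large sets are
  allowed in a covering.\<close>

lemma hausdorff_outer_Q_le_pre:
  assumes \<Delta>: "0 < \<Delta>"
  shows "hausdorff_outer k Q \<le> hausdorff_pre k \<Delta> Q"
  unfolding hausdorff_outer_def
proof (rule SUP_least)
  fix \<delta> :: real assume "\<delta> \<in> {0<..}"
  then have \<delta>: "0 < \<delta>" by simp
  obtain m :: nat where m: "\<Delta> / \<delta> < real m" using reals_Archimedean2 by blast
  have "0 < real m" using m \<Delta> \<delta> by (meson divide_pos_pos less_trans)
  then have "0 < m" by simp
  have "hausdorff_pre k \<delta> Q \<le> hausdorff_pre k (real m * \<delta>) Q"
    by (rule hausdorff_pre_Q_subdivide) (use \<open>0 < m\<close> \<delta> in auto)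
  also have "\<dots> \<le> hausdorff_pre k \<Delta> Q"
    using m \<delta> by (intro hausdorff_pre_antimono) (simp add: field_simps)
  finally show "hausdorff_pre k \<delta> Q \<le> hausdorff_pre k \<Delta> Q" .
qed

definition HP :: "'a measure" where
  "HP = density (hausdorff_measure k) (indicator {x. v \<bullet> x = 0})"

lemma sets_HP [simp, measurable_cong]: "sets HP = sets borel" by (simp add: HP_def)

lemma nn_integral_HP:
  "f \<in> borel_measurable borel \<Longrightarrow> (\<integral>\<^sup>+x. f x \<partial>HP) = (\<integral>\<^sup>+x. indicator {x. v \<bullet> x = 0} x * f x \<partial>hausdorff_measure k)"
  unfolding HP_def by (rule nn_integral_density) auto

lemma emeasure_HP:
  assumes "A \<in> sets borel"
  shows "emeasure HP A = hausdorff_outer k ({x. v \<bullet> x = 0} \<inter> A)"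
proof -
  have "emeasure HP A = emeasure (hausdorff_measure k) ({x. v \<bullet> x = 0} \<inter> A)"
    unfolding HP_def using assms by (subst emeasure_density) (auto simp: indicator_inter_arith[symmetric])
  then show ?thesis using assms by (simp add: emeasure_hausdorff_measure)
qed

lemma AE_HP: "AE x in HP. v \<bullet> x = 0"
  unfolding HP_def by (subst AE_density) (auto simp: indicator_def)

lemma HP_translation:
  assumes z: "v \<bullet> z = 0" and [measurable]: "f \<in> borel_measurable borel"
  shows "(\<integral>\<^sup>+x. f (z + x) \<partial>HP) = (\<integral>\<^sup>+x. f x \<partial>HP)"
proof -
  have "(\<integral>\<^sup>+x. f (z + x) \<partial>HP) = (\<integral>\<^sup>+x. indicator {x. v \<bullet> x = 0} (z + x) * f (z + x) \<partial>hausdorff_measure k)"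
    using z by (subst nn_integral_HP) (auto simp: inner_add_right indicator_def)
  also have "\<dots> = (\<integral>\<^sup>+x. f x \<partial>HP)"
    by (subst nn_integral_HP, simp,
        rule nn_integral_hausdorff_translation[where f="\<lambda>x. indicator {x. v \<bullet> x = 0} x * f x"]) measurable
  finally show ?thesis .
qed

lemma HP_Q_finite: "hausdorff_outer k Q < \<infinity>"
proof -
  have "hausdorff_outer k Q \<le> hausdorff_pre k (2 * real k + 1) Q" by (rule hausdorff_outer_Q_le_pre) simp
  also have "\<dots> \<le> hausdorff_gauge k Q" using Q_bounded by (intro hausdorff_pre_le_gauge) auto
  also have "\<dots> < \<infinity>" by (simp add: hausdorff_gauge_def)
  finally show ?thesis .
qed

lemma HP_ball_finite: "emeasure HP (ball 0 r) < \<infinity>"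
proof (cases "0 < r")
  case True
  define T where "T x = - r *\<^sub>R (\<Sum>b\<in>B. b) + (2 * r) *\<^sub>R x" for x
  have "{x. v \<bullet> x = 0} \<inter> ball 0 r \<subseteq> T ` Q"
  proof
    fix x assume x: "x \<in> {x. v \<bullet> x = 0} \<inter> ball 0 r"
    define q where "q = (\<Sum>b\<in>B. ((x \<bullet> b + r) / (2 * r)) *\<^sub>R b)"
    have "(x \<bullet> b + r) / (2 * r) \<in> {0..1}" if "b \<in> B" for b
    proof -
      have "\<bar>x \<bullet> b\<bar> \<le> norm x * norm b" by (rule Cauchy_Schwarz_ineq2)
      also have "norm b = 1" using orthB[OF that that] by (simp add: norm_eq_1)
      finally have "\<bar>x \<bullet> b\<bar> < r" using x by simp
      then show ?thesis using True by (simp add: abs_less_iff field_simps)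
    qed
    then have q: "q \<in> Q" by (auto simp: Qdef q_def v_sum_B inner_sum_B)
    have "T q = (\<Sum>b\<in>B. (x \<bullet> b) *\<^sub>R b)"
      unfolding T_def q_def scaleR_sum_right sum.distrib[symmetric] scaleR_scaleR scaleR_add_left[symmetric]
      using True by (intro sum.cong refl arg_cong2[where f=scaleR]) (simp add: field_simps)
    also have "\<dots> = x" using x by (intro expand) simp
    finally show "x \<in> T ` Q" using q by blast
  qed
  then have "hausdorff_outer k ({x. v \<bullet> x = 0} \<inter> ball 0 r) \<le> hausdorff_outer k (T ` Q)"
    by (rule hausdorff_outer_mono)
  also have "\<dots> = ennreal ((2 * r) ^ k) * hausdorff_outer k Q"
    unfolding T_def[abs_def] using True by (intro hausdorff_outer_affine) simp
  also have "\<dots> < \<infinity>" using HP_Q_finite by (simp add: ennreal_mult_less_top)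
  finally show ?thesis by (simp add: emeasure_HP)
next
  case False
  then have eq: "ball (0::'a) r = {}" by simp
  show ?thesis unfolding eq by simp
qed

lemma Q_contains_ball:
  "{x. v \<bullet> x = 0} \<inter> cball ((1/2) *\<^sub>R (\<Sum>b\<in>B. b)) (1 / 2) \<subseteq> Q"
proof
  fix x assume x: "x \<in> {x. v \<bullet> x = 0} \<inter> cball ((1/2) *\<^sub>R (\<Sum>b\<in>B. b)) (1 / 2)"
  have "x \<bullet> c \<in> {0..1}" if c: "c \<in> B" for c
  proof -
    have "((1/2) *\<^sub>R (\<Sum>b\<in>B. b)) \<bullet> c = 1 / 2" using inner_sum_B[OF c, of "\<lambda>_. 1"] by simp
    then have "\<bar>x \<bullet> c - 1 / 2\<bar> = \<bar>(x - (1/2) *\<^sub>R (\<Sum>b\<in>B. b)) \<bullet> c\<bar>" by (simp add: inner_diff_left)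
    also have "\<dots> \<le> norm (x - (1/2) *\<^sub>R (\<Sum>b\<in>B. b)) * norm c" by (rule Cauchy_Schwarz_ineq2)
    also have "norm c = 1" using orthB[OF c c] by (simp add: norm_eq_1)
    finally have "\<bar>x \<bullet> c - 1 / 2\<bar> \<le> 1 / 2" using x by (simp add: dist_norm norm_minus_commute)
    then have "x \<bullet> c - 1 / 2 \<le> 1 / 2" "- (1 / 2) \<le> x \<bullet> c - 1 / 2" by linarith+
    then show ?thesis by simp
  qed
  then show "x \<in> Q" using x by (auto simp: Qdef)
qed

text \<open>Both measures satisfy the product identity, so they differ by a factor c. For c \<le> 1,
  cover the ball D inscribed in the cube by itself and the rest of the cube arbitrarily; the gauge
  of a ball is its Lebesgue measure, and the finite contribution of the rest cancels. For c \<ge> 1,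
  the isodiametric inequality says that each covering set has at least its Lebesgue measure as
  gauge.\<close>

lemma HP_eq_hplane_measure:
  assumes A[measurable]: "A \<in> sets borel"
  shows "emeasure HP A = emeasure (hplane_measure v) A"
proof -
  let ?L = "hplane_measure v"
  have vv: "v \<bullet> v = 1" using v by (simp add: dot_square_norm)
  obtain c where c: "c < \<infinity>" and eq: "\<And>f. f \<in> borel_measurable borel \<Longrightarrow>
       (\<integral>\<^sup>+x. (\<integral>\<^sup>+t. f (x + t *\<^sub>R v) \<partial>lborel) \<partial>HP) = c * (\<integral>\<^sup>+x. f x \<partial>lborel)"
    by (rule hyperplane_product_measure[OF sets_HP v AE_HP HP_translation HP_ball_finite]) auto
  have hp: "emeasure HP A = c * emeasure ?L A" if [measurable]: "A \<in> sets borel" for A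
  proof -
    let ?g = "\<lambda>x. indicator {0..1} (v \<bullet> x) * indicator A (x - (v \<bullet> x) *\<^sub>R v) :: ennreal"
    have "emeasure HP A = (\<integral>\<^sup>+x. indicator A x \<partial>HP)" by simp
    also have "\<dots> = (\<integral>\<^sup>+x. (\<integral>\<^sup>+t. ?g (x + t *\<^sub>R v) \<partial>lborel) \<partial>HP)"
    proof (rule nn_integral_cong_AE, use AE_HP in eventually_elim)
      fix x assume x: "v \<bullet> x = 0"
      have "(\<integral>\<^sup>+t. ?g (x + t *\<^sub>R v) \<partial>lborel) = (\<integral>\<^sup>+t. indicator {0..1::real} t * indicator A x \<partial>lborel)"
        using x vv by (simp add: inner_add_right algebra_simps)
      then show "indicator A x = (\<integral>\<^sup>+t. ?g (x + t *\<^sub>R v) \<partial>lborel)"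
        by (simp add: nn_integral_multc)
    qed
    also have "\<dots> = c * (\<integral>\<^sup>+x. ?g x \<partial>lborel)" by (rule eq) measurable
    also have "(\<integral>\<^sup>+x. ?g x \<partial>lborel) = emeasure ?L A"
      using nn_integral_hplane_measure[of "indicator A" v] by simp
    finally show ?thesis .
  qed
  have Qb[measurable]: "Q \<in> sets borel" by (intro borel_closed Q_closed)
  have QP: "{x. v \<bullet> x = 0} \<inter> Q = Q" by (auto simp: Qdef)
  define D where "D = {x. v \<bullet> x = 0} \<inter> cball ((1/2) *\<^sub>R (\<Sum>b\<in>B. b)) (1 / 2)"
  have Dm[measurable]: "D \<in> sets borel" unfolding D_def by measurable
  have DQ: "D \<subseteq> Q" unfolding D_def by (rule Q_contains_ball)
  have LD: "emeasure ?L D = ennreal (unit_ball_vol (real k) * (1 / 2) ^ k)"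
  proof -
    define p where "p = (1/2) *\<^sub>R (\<Sum>b\<in>B. b)"
    have vp: "v \<bullet> p = 0" using v_sum_B[of "\<lambda>_. 1"] by (simp add: p_def)
    have "emeasure ?L D = (\<integral>\<^sup>+x. indicator D x \<partial>?L)" by simp
    also have "\<dots> = (\<integral>\<^sup>+x. indicator D (p + x) \<partial>?L)"
      by (rule hplane_measure_translation[OF v vp, symmetric]) measurable
    also have "\<dots> = (\<integral>\<^sup>+x. indicator (cball 0 (1/2)) x \<partial>?L)"
    proof (rule nn_integral_cong_AE, use AE_hplane_measure[OF v] in eventually_elim)
      fix x assume "v \<bullet> x = 0"
      then show "indicator D (p + x) = (indicator (cball 0 (1/2)) x :: ennreal)"
        using vp by (auto simp: D_def p_def[symmetric] indicator_def inner_add_right dist_norm)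
    qed
    also have "\<dots> = emeasure ?L (cball 0 (1/2))" by simp
    finally show ?thesis using hplane_measure_cball[OF v, of "1/2"] kdef by simp
  qed
  have Lpos: "0 < emeasure ?L D" unfolding LD by simp
  have c1: "c \<le> 1"
  proof -
    have Dbd: "bounded D" "diameter D \<le> 1"
    proof -
      show "bounded D" unfolding D_def by (rule bounded_subset[OF bounded_cball]) auto
      have "diameter D \<le> diameter (cball ((1/2) *\<^sub>R (\<Sum>b\<in>B. b)) (1 / 2))"
        unfolding D_def by (rule diameter_subset) auto
      then show "diameter D \<le> 1" by simp
    qed
    \<comment> \<open>Scale one is just coarse enough for D, whose diameter is at most one, to be
      covered by itself at a cost of at most its Lebesgue measure.\<close>
    have "hausdorff_outer k Q \<le> hausdorff_pre k 1 Q" by (rule hausdorff_outer_Q_le_pre) simp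
    also have "hausdorff_pre k 1 Q = hausdorff_pre k 1 (D \<union> (Q - D))"
      using DQ by (intro arg_cong[where f="hausdorff_pre k 1"]) auto
    also have "hausdorff_pre k 1 (D \<union> (Q - D)) \<le> hausdorff_pre k 1 D + hausdorff_pre k 1 (Q - D)"
      by (rule hausdorff_pre_Un) simp
    also have "\<dots> \<le> ennreal (unit_ball_vol (real k) * (1 / 2) ^ k) + hausdorff_outer k (Q - D)"
    proof (rule add_mono)
      have "hausdorff_pre k 1 D \<le> hausdorff_gauge k D" using Dbd by (rule hausdorff_pre_le_gauge)
      also have "\<dots> \<le> ennreal (unit_ball_vol (real k) * (1 / 2) ^ k)"
        unfolding hausdorff_gauge_def using Dbd diameter_ge_0[OF Dbd(1)]
        by (auto intro!: ennreal_leI mult_left_mono power_mono)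
      finally show "hausdorff_pre k 1 D \<le> ennreal (unit_ball_vol (real k) * (1 / 2) ^ k)" .
    qed (rule hausdorff_pre_le_outer, simp)
    finally have 1: "hausdorff_outer k Q \<le> emeasure ?L D + hausdorff_outer k (Q - D)" unfolding LD .
    have "hausdorff_outer k Q = emeasure HP Q" by (simp add: emeasure_HP QP)
    also have "\<dots> = emeasure HP D + emeasure HP (Q - D)"
      using DQ by (subst plus_emeasure) (auto intro: arg_cong[where f="emeasure HP"])
    also have "emeasure HP (Q - D) = hausdorff_outer k (Q - D)"
    proof -
      have "{x. v \<bullet> x = 0} \<inter> (Q - D) = Q - D" using QP by blast
      then show ?thesis by (simp add: emeasure_HP)
    qed
    finally have 2: "hausdorff_outer k Q = emeasure HP D + hausdorff_outer k (Q - D)" .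
    have "hausdorff_outer k (Q - D) \<le> hausdorff_outer k Q" by (rule hausdorff_outer_mono) auto
    then have "hausdorff_outer k (Q - D) < \<infinity>" using HP_Q_finite by (rule le_less_trans)
    then have "hausdorff_outer k (Q - D) \<noteq> top" by simp
    then have "emeasure HP D \<le> emeasure ?L D"
      using 1 unfolding 2 by (simp add: ennreal_add_left_cancel_le add.commute[of _ "hausdorff_outer k (Q - D)"])
    then have le: "c * emeasure ?L D \<le> emeasure ?L D" by (simp add: hp)
    obtain r where r: "c = ennreal r" "0 \<le> r" using c by (cases c) auto
    define u where "u = unit_ball_vol (real k) * (1 / 2) ^ k"
    have u: "0 < u" by (simp add: u_def)
    have "r * u \<le> u" using le r u unfolding LD u_def[symmetric] by (simp add: ennreal_mult[symmetric])
    then have "r \<le> 1" using u by simp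
    then show ?thesis using r by simp
  qed
  have c2: "1 \<le> c"
  proof -
    have "emeasure ?L Q \<le> hausdorff_pre k 1 Q"
      unfolding hausdorff_pre_def
    proof (rule INF_greatest, safe)
      fix C :: "nat \<Rightarrow> 'a set" assume cov: "Q \<subseteq> (\<Union>m. C m)" and C: "\<forall>m. bounded (C m) \<and> diameter (C m) \<le> 1"
      \<comment> \<open>Closures make the covering sets Borel without changing their
        diameters.\<close>
      have "emeasure ?L Q \<le> emeasure ?L (\<Union>m. closure (C m))"
        using cov closure_subset by (intro emeasure_mono) (blast, auto)
      also have "\<dots> \<le> (\<Sum>m. emeasure ?L (closure (C m)))"
        by (rule emeasure_subadditive_countably) auto
      also have "\<dots> \<le> (\<Sum>m. hausdorff_gauge k (C m))"
      proof (rule suminf_le)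
        fix m
        have "bounded (closure (C m))" using C by (simp add: bounded_closure)
        then have "emeasure ?L (closure (C m)) \<le> ennreal (unit_ball_vol (real k) * (diameter (C m) / 2) ^ k)"
          unfolding kdef using C diameter_ge_0[of "C m"] diameter_bounded_bound[of "closure (C m)"] diameter_closure[of "C m"]
          by (intro hplane_measure_isodiametric[OF v]) (auto simp: dist_norm[symmetric])
        then show "emeasure ?L (closure (C m)) \<le> hausdorff_gauge k (C m)"
          by (auto simp: hausdorff_gauge_def)
      qed auto
      finally show "emeasure ?L Q \<le> (\<Sum>m. hausdorff_gauge k (C m))" .
    qed
    also have "\<dots> \<le> hausdorff_outer k Q" by (rule hausdorff_pre_le_outer) simp
    also have "\<dots> = c * emeasure ?L Q" using hp[of Q] by (simp add: emeasure_HP QP)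
    finally have le: "emeasure ?L Q \<le> c * emeasure ?L Q" .
    have "emeasure ?L Q < \<infinity>" by (rule hplane_measure_bounded_finite[OF v Q_bounded(1) Qb])
    then obtain q where q: "emeasure ?L Q = ennreal q" "0 \<le> q" by (cases "emeasure ?L Q") auto
    have "0 < emeasure ?L Q" using Lpos emeasure_mono[OF DQ, of ?L] by (simp add: less_le_trans)
    then have "0 < q" using q by simp
    obtain r where r: "c = ennreal r" "0 \<le> r" using c by (cases c) auto
    have "q \<le> r * q" using le q r by (simp add: ennreal_mult[symmetric])
    then show ?thesis using \<open>0 < q\<close> r by simp
  qed
  show ?thesis using hp[OF A] c1 c2 by (simp add: antisym)
qed

end

text \<open>Since Hausdorff measure on the hyperplane through zero is Lebesgue measure there, this
  is Fubini along \<open>v\<close>, each parallel hyperplane being a translate. No Jacobian appears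
  for a unit vector; it comes in later, when the level of a slack replaces the distance t.\<close>

theorem hyperplane_coarea:
  fixes f :: "'a::euclidean_space \<Rightarrow> ennreal"
  assumes v: "norm v = 1" and f[measurable]: "f \<in> borel_measurable borel"
  shows "(\<integral>\<^sup>+x. f x \<partial>lborel) = (\<integral>\<^sup>+t. (\<integral>\<^sup>+x\<in>{x. v \<bullet> x = t}. f x \<partial>hausdorff_measure (DIM('a) - 1)) \<partial>lborel)"
proof -
  have vv: "v \<bullet> v = 1" using v by (simp add: dot_square_norm)
  obtain B where B: "B \<subseteq> {x. v \<bullet> x = 0}" "pairwise orthogonal B" "\<And>x. x \<in> B \<Longrightarrow> norm x = 1"
    "independent B" "card B = dim {x. v \<bullet> x = 0}" "span B = {x. v \<bullet> x = 0}"
    using orthonormal_basis_subspace[OF subspace_hyperplane[of v]] by blast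
  have "v \<noteq> 0" using v by auto
  then have card: "card B = DIM('a) - 1" using B(5) dim_hyperplane[of v] by simp
  have orth: "b \<bullet> c = (if b = c then 1 else 0)" if "b \<in> B" "c \<in> B" for b c
    using B(2) B(3)[OF that(1)] that by (auto simp: pairwise_def orthogonal_def norm_eq_1)
  interpret unit_cube_in_hyperplane v B "DIM('a) - 1" "{x. v \<bullet> x = 0 \<and> (\<forall>b\<in>B. x \<bullet> b \<in> {0..1})}"
    by unfold_locales (fact v independent_imp_finite[OF B(4)] card B(6) orth refl)+
  have HPL: "HP = hplane_measure v"
    by (rule measure_eqI, simp only: sets_HP sets_hplane_measure)
       (rule HP_eq_hplane_measure, simp only: sets_HP)
  interpret h: sigma_finite_measure HP
    unfolding HPL by (rule sigma_finite_hplane_measure[OF v])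
  interpret pair_sigma_finite HP lborel ..
  have "(\<integral>\<^sup>+x. f x \<partial>lborel) = (\<integral>\<^sup>+x. (\<integral>\<^sup>+t. f (x + t *\<^sub>R v) \<partial>lborel) \<partial>HP)"
    unfolding HPL by (rule nn_integral_hplane_fubini[OF v f])
  also have "\<dots> = (\<integral>\<^sup>+t. (\<integral>\<^sup>+x. f (x + t *\<^sub>R v) \<partial>HP) \<partial>lborel)"
    by (rule Fubini'[symmetric]) measurable
  also have "\<dots> = (\<integral>\<^sup>+t. (\<integral>\<^sup>+x\<in>{x. v \<bullet> x = t}. f x \<partial>hausdorff_measure (DIM('a) - 1)) \<partial>lborel)"
  proof (rule nn_integral_cong)
    fix t :: real
    have [measurable]: "{x. v \<bullet> x = t} \<in> sets borel" by (intro borel_closed closed_hyperplane)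
    have "(\<integral>\<^sup>+x. f (x + t *\<^sub>R v) \<partial>HP)
       = (\<integral>\<^sup>+x. f (t *\<^sub>R v + x) * indicator {x. v \<bullet> x = t} (t *\<^sub>R v + x) \<partial>hausdorff_measure (DIM('a) - 1))"
      by (subst nn_integral_HP, simp, rule nn_integral_cong) (auto simp: indicator_def inner_add_right vv add.commute)
    also have "\<dots> = (\<integral>\<^sup>+x\<in>{x. v \<bullet> x = t}. f x \<partial>hausdorff_measure (DIM('a) - 1))"
      by (rule nn_integral_hausdorff_translation[where f="\<lambda>x. f x * indicator {x. v \<bullet> x = t} x"]) measurable
    finally show "(\<integral>\<^sup>+x. f (x + t *\<^sub>R v) \<partial>HP) = (\<integral>\<^sup>+x\<in>{x. v \<bullet> x = t}. f x \<partial>hausdorff_measure (DIM('a) - 1))" .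
  qed
  finally show ?thesis .
qed

section \<open>Boundary layer integrals\<close>

lemma nn_integral_id_times_exp:
  assumes a: "0 < (a::real)"
  shows "(\<integral>\<^sup>+r. ennreal (r * exp (- (a * r))) * indicator {0..} r \<partial>lborel) = ennreal (1 / a\<^sup>2)"
proof -
  let ?J = "\<integral>\<^sup>+r. ennreal (r * exp (- (a * r))) * indicator {0..} r \<partial>lborel"
  have "1 = (\<integral>\<^sup>+r. ennreal (r ^ 1 * exp (- r)) * indicator {0..} r \<partial>lborel)"
    by (subst nn_intergal_power_times_exp_Ici) simp
  also have "\<dots> = ennreal \<bar>a\<bar> * (\<integral>\<^sup>+r. ennreal ((0 + a * r) ^ 1 * exp (- (0 + a * r))) * indicator {0..} (0 + a * r) \<partial>lborel)"
    using a by (intro nn_integral_real_affine) auto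
  also have "(\<integral>\<^sup>+r. ennreal ((0 + a * r) ^ 1 * exp (- (0 + a * r))) * indicator {0..} (0 + a * r) \<partial>lborel)
      = (\<integral>\<^sup>+r. ennreal a * (ennreal (r * exp (- (a * r))) * indicator {0..} r) \<partial>lborel)"
    using a by (intro nn_integral_cong) (auto simp: indicator_def ennreal_mult[symmetric] mult_ac zero_le_mult_iff)
  also have "\<dots> = ennreal a * ?J" by (rule nn_integral_cmult) measurable
  finally have "1 = ennreal (a\<^sup>2) * ?J"
    using a by (simp add: mult.assoc[symmetric] ennreal_mult[symmetric] power2_eq_square)
  then have "ennreal (1 / a\<^sup>2) * 1 = (ennreal (1 / a\<^sup>2) * ennreal (a\<^sup>2)) * ?J" by (simp add: mult.assoc)
  also have "ennreal (1 / a\<^sup>2) * ennreal (a\<^sup>2) = 1" using a by (simp add: ennreal_mult[symmetric])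
  finally show ?thesis by simp
qed

text \<open>Expanding 1/(1 - q) as a geometric series turns the integral into the sum of the inverse
  squares; this is where zeta(2) enters.\<close>

lemma nn_integral_bose:
  assumes a: "0 < (a::real)"
  shows "(\<integral>\<^sup>+r. ennreal (r * exp (- (a * r)) / (1 - exp (- (a * r)))) * indicator {0<..} r \<partial>lborel)
    = ennreal (pi\<^sup>2 / (6 * a\<^sup>2))"
proof -
  have "(\<integral>\<^sup>+r. ennreal (r * exp (- (a * r)) / (1 - exp (- (a * r)))) * indicator {0<..} r \<partial>lborel)
     = (\<integral>\<^sup>+r. (\<Sum>k. ennreal (r * exp (- (a * real (Suc k) * r))) * indicator {0<..} r) \<partial>lborel)"
  proof (rule nn_integral_cong)
    fix r :: real
    show "ennreal (r * exp (- (a * r)) / (1 - exp (- (a * r)))) * indicator {0<..} r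
      = (\<Sum>k. ennreal (r * exp (- (a * real (Suc k) * r))) * indicator {0<..} r)"
    proof (cases "0 < r")
      case True
      define q where "q = exp (- (a * r))"
      have q: "0 < q" "q < 1" using True a by (auto simp: q_def)
      have qk: "exp (- (a * real (Suc k) * r)) = q * q ^ k" for k
        unfolding q_def by (simp add: exp_of_nat_mult[symmetric] exp_add[symmetric] algebra_simps)
      have "(\<lambda>k. (r * q) * q ^ k) sums ((r * q) * (1 / (1 - q)))"
        using q by (intro sums_mult geometric_sums) auto
      then have "(\<Sum>k. ennreal (r * (q * q ^ k))) = ennreal (r * q / (1 - q))"
        using True q by (intro suminf_ennreal_eq) (auto simp: mult_ac)
      then show ?thesis using True unfolding qk q_def[symmetric] by simp
    qed simp
  qed
  also have "\<dots> = (\<Sum>k. \<integral>\<^sup>+r. ennreal (r * exp (- (a * real (Suc k) * r))) * indicator {0<..} r \<partial>lborel)"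
    by (rule nn_integral_suminf) measurable
  also have "\<dots> = (\<Sum>k. ennreal (1 / a\<^sup>2 * (1 / (real k + 1)\<^sup>2)))"
  proof (rule arg_cong[where f=suminf], rule ext)
    fix k
    have "(\<integral>\<^sup>+r. ennreal (r * exp (- (a * real (Suc k) * r))) * indicator {0<..} r \<partial>lborel)
        = (\<integral>\<^sup>+r. ennreal (r * exp (- (a * real (Suc k) * r))) * indicator {0..} r \<partial>lborel)"
      by (intro nn_integral_cong) (auto simp: indicator_def)
    also have "\<dots> = ennreal (1 / (a * real (Suc k))\<^sup>2)" by (rule nn_integral_id_times_exp) (use a in simp)
    also have "1 / (a * real (Suc k))\<^sup>2 = 1 / a\<^sup>2 * (1 / (real k + 1)\<^sup>2)"
      by (simp add: power_mult_distrib add.commute)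
    finally show "(\<integral>\<^sup>+r. ennreal (r * exp (- (a * real (Suc k) * r))) * indicator {0<..} r \<partial>lborel)
        = ennreal (1 / a\<^sup>2 * (1 / (real k + 1)\<^sup>2))" .
  qed
  also have "\<dots> = ennreal (1 / a\<^sup>2 * (pi\<^sup>2 / 6))"
    using inverse_squares_sums by (intro suminf_ennreal_eq sums_mult) (auto simp: add.commute)
  finally show ?thesis by (simp add: mult.commute)
qed

text \<open>From 1/(e^r - 1) = 1/(e^r + 1) + 2/(e^(2r) - 1), the two Bose integrals pi^2/6 and 2
  pi^2/24 leave pi^2/12. The identity is used as a sum because extended nonnegative reals do not
  subtract well. Integration by parts makes this the integral of ln (1 + e^(-t)) over the
  half-line.\<close>

lemma nn_integral_fermi:
  "(\<integral>\<^sup>+r. ennreal (r / (1 + exp r)) * indicator {0..} r \<partial>lborel) = ennreal (pi\<^sup>2 / 12)"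
proof -
  let ?I = "\<integral>\<^sup>+r. ennreal (r / (1 + exp r)) * indicator {0..} r \<partial>lborel"
  let ?G = "\<lambda>a r. ennreal (r * exp (- (a * r)) / (1 - exp (- (a * r)))) * indicator {0<..} r"
  have "ennreal (pi\<^sup>2 / (6 * 1\<^sup>2)) = (\<integral>\<^sup>+r. ?G 1 r \<partial>lborel)" by (rule nn_integral_bose[symmetric]) simp
  also have "\<dots> = (\<integral>\<^sup>+r. ennreal (r / (1 + exp r)) * indicator {0..} r + 2 * ?G 2 r \<partial>lborel)"
  proof (rule nn_integral_cong)
    fix r :: real
    show "?G 1 r = ennreal (r / (1 + exp r)) * indicator {0..} r + 2 * ?G 2 r"
    proof (cases "0 < r")
      case True
      define q where "q = exp (- r)"
      have q: "0 < q" "q < 1" using True by (auto simp: q_def)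
      have q2: "exp (- (2 * r)) = q\<^sup>2" by (simp add: q_def exp_double[symmetric])
      have er: "exp r = 1 / q" by (simp add: q_def exp_minus field_simps)
      have qq: "q\<^sup>2 < 1" using q by (simp add: power_less_one_iff)
      have "r / (1 + exp r) = r * q / (1 + q)" using q by (simp add: er field_simps)
      moreover have "r * q / (1 - q) = r * q / (1 + q) + 2 * (r * q\<^sup>2 / (1 - q\<^sup>2))"
      proof -
        have "1 - q\<^sup>2 = (1 - q) * (1 + q)" by (simp add: power2_eq_square algebra_simps)
        then show ?thesis using q by (simp add: divide_simps) (simp add: power2_eq_square algebra_simps)
      qed
      moreover have "0 \<le> r * q / (1 + q)" "0 \<le> r * q\<^sup>2 / (1 - q\<^sup>2)" using True q qq by auto
      moreover have "ennreal (A + 2 * X) = ennreal A + 2 * ennreal X" if "0 \<le> A" "0 \<le> X" for A X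
        using that by (simp add: ennreal_mult')
      ultimately have "ennreal (r * q / (1 - q)) = ennreal (r / (1 + exp r)) + 2 * ennreal (r * q\<^sup>2 / (1 - q\<^sup>2))"
        by metis
      then show ?thesis using True by (simp add: q2 flip: q_def)
    qed (auto simp: indicator_def)
  qed
  also have "\<dots> = ?I + 2 * (\<integral>\<^sup>+r. ?G 2 r \<partial>lborel)"
    by (subst nn_integral_add) (auto simp: nn_integral_cmult)
  also have "(\<integral>\<^sup>+r. ?G 2 r \<partial>lborel) = ennreal (pi\<^sup>2 / (6 * 2\<^sup>2))" by (rule nn_integral_bose) simp
  finally have *: "ennreal (pi\<^sup>2 / 6) = ?I + ennreal (pi\<^sup>2 / 12)"
    by (simp add: ennreal_mult'[symmetric] flip: ennreal_numeral)
  have "?I \<noteq> \<infinity>"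
  proof
    assume "?I = \<infinity>"
    then show False using * by simp
  qed
  then obtain i where i: "?I = ennreal i" "0 \<le> i" by (cases ?I) auto
  have "pi\<^sup>2 / 6 = i + pi\<^sup>2 / 12" using * i by (simp flip: ennreal_plus)
  then have "i = pi\<^sup>2 / 12" by simp
  then show ?thesis using i by simp
qed

text \<open>Since \<phi> is the tail integral of \<psi>, exchanging integrals rewrites the left side
  as the integral of \<psi>(r) \<eta> D(r/\<eta>), where D is the distribution function of \<Delta>
  on S. The hypothesis on the ratio gives \<eta> D(r/\<eta>) \<rightarrow> \<kappa> r for each r,
  and dominated convergence finishes. Thus only the linear growth of D at zero matters, not the
  shape of the layer.\<close>

lemma (in finite_measure) layer_limit:
  fixes \<Delta> :: "'a \<Rightarrow> real" and \<phi> \<psi> :: "real \<Rightarrow> real"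
  assumes S[measurable]: "S \<in> sets M" and \<Delta>[measurable]: "\<Delta> \<in> borel_measurable M"
    and \<Delta>0: "\<And>x. x \<in> S \<Longrightarrow> 0 \<le> \<Delta> x"
    and ratio: "((\<lambda>t. measure M {x\<in>S. \<Delta> x \<le> t} / t) \<longlongrightarrow> \<kappa>) (at_right 0)"
    and \<psi>[measurable]: "\<psi> \<in> borel_measurable borel" and \<psi>0: "\<And>r. 0 \<le> r \<Longrightarrow> 0 \<le> \<psi> r"
    and \<phi>: "\<And>s. 0 \<le> s \<Longrightarrow> (\<integral>\<^sup>+r. ennreal (\<psi> r) * indicator {s..} r \<partial>lborel) = ennreal (\<phi> s)"
    and \<phi>0: "\<And>s. 0 \<le> \<phi> s" and \<phi>m[measurable]: "\<phi> \<in> borel_measurable borel"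
    and I: "(\<integral>\<^sup>+r. ennreal (r * \<psi> r) * indicator {0..} r \<partial>lborel) = ennreal I" "0 \<le> I"
  shows "((\<lambda>\<eta>. \<eta> * (\<integral>x. indicator S x * \<phi> (\<eta> * \<Delta> x) \<partial>M)) \<longlongrightarrow> \<kappa> * I) at_top"
proof -
  interpret P: pair_sigma_finite M lborel ..
  define D where "D t = measure M {x\<in>S. \<Delta> x \<le> t}" for t
  have SM: "{x\<in>S. \<Delta> x \<le> t} \<in> sets M" for t
  proof -
    have "{x\<in>S. \<Delta> x \<le> t} = S \<inter> {x\<in>space M. \<Delta> x \<le> t}" using sets.sets_into_space[OF S] by auto
    also have "\<dots> \<in> sets M" by measurable
    finally show ?thesis .
  qed
  have Dmono: "mono D" unfolding D_def mono_def by (auto intro!: finite_measure_mono SM)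
  have Dm[measurable]: "D \<in> borel_measurable borel" by (rule borel_measurable_mono[OF Dmono])
  have D0: "0 \<le> D t" for t by (simp add: D_def)
  have Dtot: "D t \<le> measure M (space M)" for t
    unfolding D_def by (rule bounded_measure)
  \<comment> \<open>A linear bound valid for every t > 0, as domination needs it: near zero from the
    limit of the ratio, away from zero from the total mass.\<close>
  obtain C where C: "\<And>t. 0 < t \<Longrightarrow> D t \<le> C * t" "0 \<le> C"
  proof -
    have "eventually (\<lambda>t. D t / t < \<kappa> + 1) (at_right 0)"
      using order_tendstoD(2)[OF ratio, of "\<kappa> + 1"] by (simp add: D_def)
    then obtain t0 where t0: "0 < t0" "\<And>t. 0 < t \<Longrightarrow> t < t0 \<Longrightarrow> D t / t < \<kappa> + 1"
      unfolding eventually_at_right_field by auto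
    define m where "m = measure M (space M)"
    have m: "0 \<le> m" by (simp add: m_def)
    have "D t \<le> (max 0 (\<kappa> + 1) + m / t0) * t" if t: "0 < t" for t
    proof (cases "t < t0")
      case True
      then have "D t \<le> (\<kappa> + 1) * t" using t0(2)[OF t] t by (simp add: field_simps)
      also have "\<dots> \<le> (max 0 (\<kappa> + 1) + m / t0) * t" using t t0 m by (intro mult_right_mono) (auto simp: add_increasing2)
      finally show ?thesis .
    next
      case False
      have "D t \<le> m" using Dtot by (simp add: m_def)
      also have "m \<le> m / t0 * t" using False t0 m by (simp add: field_simps mult_left_mono)
      also have "\<dots> \<le> (max 0 (\<kappa> + 1) + m / t0) * t" using t by (intro mult_right_mono) auto
      finally show ?thesis .
    qed
    moreover have "0 \<le> max 0 (\<kappa> + 1) + m / t0" using m t0 by simp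
    ultimately show ?thesis using that by blast
  qed
  have rint: "integrable lborel (\<lambda>r. indicator {0..} r * (r * \<psi> r))"
    and rval: "(\<integral>r. indicator {0..} r * (r * \<psi> r) \<partial>lborel) = I"
  proof -
    have eq: "(\<integral>\<^sup>+r. ennreal (indicator {0..} r * (r * \<psi> r)) \<partial>lborel) = ennreal I"
      unfolding I(1)[symmetric] by (intro nn_integral_cong) (auto simp: indicator_def)
    show "integrable lborel (\<lambda>r. indicator {0..} r * (r * \<psi> r))"
      using eq \<psi>0 by (intro integrableI_nonneg) (auto simp: indicator_def)
    show "(\<integral>r. indicator {0..} r * (r * \<psi> r) \<partial>lborel) = I"
      using eq \<psi>0 I(2) by (intro integral_eq_nn_integral[THEN trans]) (auto simp: indicator_def)
  qed
  define s where "s \<eta> r = indicator {0..} r * (\<psi> r * (\<eta> * D (r / \<eta>)))" for \<eta> r :: real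
  have sm[measurable]: "s \<eta> \<in> borel_measurable lborel" for \<eta> unfolding s_def by measurable
  have lim: "((\<lambda>\<eta>. integral\<^sup>L lborel (s \<eta>)) \<longlongrightarrow> integral\<^sup>L lborel (\<lambda>r. indicator {0..} r * (r * \<psi> r) * \<kappa>)) at_top"
  proof (rule integral_dominated_convergence_at_top[where w="\<lambda>r. C * (indicator {0..} r * (r * \<psi> r))"])
    show "AE r in lborel. ((\<lambda>\<eta>. s \<eta> r) \<longlongrightarrow> indicator {0..} r * (r * \<psi> r) * \<kappa>) at_top"
    proof (rule AE_mp[OF AE_lborel_singleton[of 0]], rule AE_I2, rule impI)
      fix r :: real assume "r \<noteq> 0"
      show "((\<lambda>\<eta>. s \<eta> r) \<longlongrightarrow> indicator {0..} r * (r * \<psi> r) * \<kappa>) at_top"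
      proof (cases "0 < r")
        case True
        have "filterlim (\<lambda>\<eta>. r / \<eta>) (at_right 0) at_top"
          unfolding filterlim_at using True
          by (auto intro!: tendsto_divide_0[OF tendsto_const] filterlim_at_top_imp_at_infinity filterlim_ident
              eventually_mono[OF eventually_gt_at_top[of 0]])
        then have "((\<lambda>\<eta>. D (r / \<eta>) / (r / \<eta>)) \<longlongrightarrow> \<kappa>) at_top"
          using ratio unfolding D_def[symmetric] by (rule filterlim_compose[rotated])
        then have "((\<lambda>\<eta>. (\<psi> r * r) * (D (r / \<eta>) / (r / \<eta>))) \<longlongrightarrow> (\<psi> r * r) * \<kappa>) at_top"
          by (intro tendsto_intros)
        moreover have "(\<psi> r * r) * (D (r / \<eta>) / (r / \<eta>)) = s \<eta> r" for \<eta>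
          using True by (simp add: s_def)
        ultimately show ?thesis using True by (simp add: mult_ac)
      next
        case False
        then show ?thesis using \<open>r \<noteq> 0\<close> by (simp add: s_def)
      qed
    qed
    show "\<forall>\<^sub>F \<eta> in at_top. AE r in lborel. norm (s \<eta> r) \<le> C * (indicator {0..} r * (r * \<psi> r))"
    proof (rule eventually_mono[OF eventually_gt_at_top[of 0]], rule AE_mp[OF AE_lborel_singleton[of 0]], rule AE_I2, rule impI)
      fix \<eta> r :: real assume \<eta>: "0 < \<eta>" and "r \<noteq> 0"
      show "norm (s \<eta> r) \<le> C * (indicator {0..} r * (r * \<psi> r))"
      proof (cases "0 < r")
        case True
        have "\<eta> * D (r / \<eta>) \<le> C * r" using C(1)[of "r / \<eta>"] \<eta> True by (simp add: field_simps)
        then have "\<psi> r * (\<eta> * D (r / \<eta>)) \<le> \<psi> r * (C * r)"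
          using \<psi>0[of r] True by (intro mult_left_mono) auto
        moreover have "0 \<le> \<psi> r * (\<eta> * D (r / \<eta>))" using \<psi>0[of r] True \<eta> D0 by simp
        ultimately show ?thesis using True by (simp add: s_def mult_ac)
      next
        case False
        then show ?thesis using \<open>r \<noteq> 0\<close> by (simp add: s_def)
      qed
    qed
    show "integrable lborel (\<lambda>r. C * (indicator {0..} r * (r * \<psi> r)))" using rint by simp
  qed simp_all
  have eq: "\<eta> * (\<integral>x. indicator S x * \<phi> (\<eta> * \<Delta> x) \<partial>M) = integral\<^sup>L lborel (s \<eta>)" if \<eta>: "0 < \<eta>" for \<eta>
  proof -
    have "(\<integral>\<^sup>+x. ennreal (indicator S x * \<phi> (\<eta> * \<Delta> x)) \<partial>M)
      = (\<integral>\<^sup>+x. (\<integral>\<^sup>+r. indicator S x * (ennreal (\<psi> r) * (indicator {0..} r * indicator {..r} (\<eta> * \<Delta> x))) \<partial>lborel) \<partial>M)"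
    proof (rule nn_integral_cong)
      fix x
      show "ennreal (indicator S x * \<phi> (\<eta> * \<Delta> x))
        = (\<integral>\<^sup>+r. indicator S x * (ennreal (\<psi> r) * (indicator {0..} r * indicator {..r} (\<eta> * \<Delta> x))) \<partial>lborel)"
      proof (cases "x \<in> S")
        case True
        then have ge: "0 \<le> \<eta> * \<Delta> x" using \<Delta>0 \<eta> by simp
        have "(\<integral>\<^sup>+r. ennreal (\<psi> r) * (indicator {0..} r * indicator {..r} (\<eta> * \<Delta> x)) \<partial>lborel)
           = (\<integral>\<^sup>+r. ennreal (\<psi> r) * indicator {\<eta> * \<Delta> x..} r \<partial>lborel)"
          using ge by (intro nn_integral_cong) (auto simp: indicator_def)
        then show ?thesis using True \<phi>[OF ge] by simp
      qed simp
    qed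
    also have "\<dots> = (\<integral>\<^sup>+r. (\<integral>\<^sup>+x. indicator S x * (ennreal (\<psi> r) * (indicator {0..} r * indicator {..r} (\<eta> * \<Delta> x))) \<partial>M) \<partial>lborel)"
    proof (rule P.Fubini'[symmetric])
      have "(\<lambda>(x, r). indicator S x * (ennreal (\<psi> r) * (indicator {0..} r * indicator {..r} (\<eta> * \<Delta> x))))
         = (\<lambda>(x, r). indicator S x * (ennreal (\<psi> r) * (indicator {0..} r * indicator {0..} (r - \<eta> * \<Delta> x))))"
        by (auto simp: indicator_def fun_eq_iff)
      also have "\<dots> \<in> borel_measurable (M \<Otimes>\<^sub>M lborel)" by measurable
      finally show "(\<lambda>(x, r). indicator S x * (ennreal (\<psi> r) * (indicator {0..} r * indicator {..r} (\<eta> * \<Delta> x))))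
        \<in> borel_measurable (M \<Otimes>\<^sub>M lborel)" .
    qed
    also have "\<dots> = (\<integral>\<^sup>+r. ennreal (indicator {0..} r * (\<psi> r * D (r / \<eta>))) \<partial>lborel)"
    proof (rule nn_integral_cong)
      fix r :: real
      have "(\<integral>\<^sup>+x. indicator S x * (ennreal (\<psi> r) * (indicator {0..} r * indicator {..r} (\<eta> * \<Delta> x))) \<partial>M)
        = (\<integral>\<^sup>+x. (ennreal (\<psi> r) * indicator {0..} r) * indicator {x\<in>S. \<Delta> x \<le> r / \<eta>} x \<partial>M)"
        using \<eta> by (intro nn_integral_cong) (auto simp: indicator_def field_simps)
      also have "\<dots> = (ennreal (\<psi> r) * indicator {0..} r) * emeasure M {x\<in>S. \<Delta> x \<le> r / \<eta>}"
        by (rule nn_integral_cmult_indicator[OF SM])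
      also have "\<dots> = ennreal (indicator {0..} r * (\<psi> r * D (r / \<eta>)))"
        using \<psi>0[of r] D0 by (auto simp: emeasure_eq_measure D_def indicator_def ennreal_mult)
      finally show "(\<integral>\<^sup>+x. indicator S x * (ennreal (\<psi> r) * (indicator {0..} r * indicator {..r} (\<eta> * \<Delta> x))) \<partial>M)
        = ennreal (indicator {0..} r * (\<psi> r * D (r / \<eta>)))" .
    qed
    finally have nn: "(\<integral>\<^sup>+x. ennreal (indicator S x * \<phi> (\<eta> * \<Delta> x)) \<partial>M)
      = (\<integral>\<^sup>+r. ennreal (indicator {0..} r * (\<psi> r * D (r / \<eta>))) \<partial>lborel)" .
    have "(\<integral>x. indicator S x * \<phi> (\<eta> * \<Delta> x) \<partial>M)
        = enn2real (\<integral>\<^sup>+x. ennreal (indicator S x * \<phi> (\<eta> * \<Delta> x)) \<partial>M)"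
      using \<phi>0 by (intro integral_eq_nn_integral) auto
    also have "\<dots> = (\<integral>r. indicator {0..} r * (\<psi> r * D (r / \<eta>)) \<partial>lborel)"
      unfolding nn using \<psi>0 D0 by (intro integral_eq_nn_integral[symmetric]) (auto simp: indicator_def)
    also have "\<eta> * \<dots> = integral\<^sup>L lborel (s \<eta>)"
      by (simp add: s_def[abs_def] mult_ac flip: integral_mult_right_zero)
    finally show ?thesis .
  qed
  have "((\<lambda>\<eta>. \<eta> * (\<integral>x. indicator S x * \<phi> (\<eta> * \<Delta> x) \<partial>M)) \<longlongrightarrow>
      integral\<^sup>L lborel (\<lambda>r. indicator {0..} r * (r * \<psi> r) * \<kappa>)) at_top"
    using lim by (rule Lim_transform_eventually) (auto intro!: eventually_mono[OF eventually_gt_at_top[of 0]] simp: eq)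
  also have "integral\<^sup>L lborel (\<lambda>r. indicator {0..} r * (r * \<psi> r) * \<kappa>) = \<kappa> * I"
    using rval by (simp add: mult.commute)
  finally show ?thesis .
qed

text \<open>Multiplying out the product of the 1 + a j gives 1 plus the sum plus terms containing at
  least two factors. On a cell this separates the logarithm of the partition function into
  contributions of single neighbours and an error from pairs of neighbours, which is noticeable only
  near triple intersections.\<close>

lemma sum_ln_one_plus_bounds:
  fixes a :: "'i \<Rightarrow> real"
  assumes "finite J" "\<And>j. j \<in> J \<Longrightarrow> 0 \<le> a j"
  shows "ln (1 + (\<Sum>j\<in>J. a j)) \<le> (\<Sum>j\<in>J. ln (1 + a j))
    \<and> (\<Sum>j\<in>J. ln (1 + a j)) - ln (1 + (\<Sum>j\<in>J. a j)) \<le> (\<Sum>j\<in>J. \<Sum>k\<in>J - {j}. a j * a k)"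
  using assms
proof (induction J rule: finite_induct)
  case (insert i J)
  define s where "s = (\<Sum>j\<in>J. a j)"
  define b where "b = a i"
  have sb: "0 \<le> s" "0 \<le> b" using insert.prems by (auto simp: s_def b_def intro: sum_nonneg)
  \<comment> \<open>One induction step changes the difference by ln ((1 + s)(1 + b)/(1 + b + s)),
    the logarithm of 1 plus s b divided by a number at least one, hence by something between 0 and s
    b.\<close>
  have eq: "ln (1 + s) + ln (1 + b) - ln (1 + (b + s)) = ln (1 + s * b / (1 + (b + s)))"
  proof -
    have "1 + s * b / (1 + (b + s)) = (1 + s) * (1 + b) / (1 + (b + s))"
      using sb by (simp add: field_simps)
    then show ?thesis using sb by (simp add: ln_mult ln_div add_pos_nonneg)
  qed
  have n0: "0 \<le> s * b / (1 + (b + s))" using sb by simp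
  have "s * b / (1 + (b + s)) \<le> s * b / 1" using sb by (intro divide_left_mono) auto
  then have up: "ln (1 + s * b / (1 + (b + s))) \<le> s * b"
    using ln_add_one_self_le_self[OF n0] by linarith
  have lo: "0 \<le> ln (1 + s * b / (1 + (b + s)))" using n0 by simp
  have dbl: "(\<Sum>j\<in>insert i J. \<Sum>k\<in>insert i J - {j}. a j * a k)
      = b * s + ((\<Sum>j\<in>J. a j * b) + (\<Sum>j\<in>J. \<Sum>k\<in>J - {j}. a j * a k))"
  proof -
    have 1: "(\<Sum>k\<in>insert i J - {i}. a i * a k) = b * s"
      using insert.hyps by (simp add: s_def b_def sum_distrib_left)
    have "(\<Sum>j\<in>J. \<Sum>k\<in>insert i J - {j}. a j * a k) = (\<Sum>j\<in>J. a j * b + (\<Sum>k\<in>J - {j}. a j * a k))"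
    proof (rule sum.cong)
      fix j assume "j \<in> J"
      then have "insert i J - {j} = insert i (J - {j})" using insert.hyps by auto
      then show "(\<Sum>k\<in>insert i J - {j}. a j * a k) = a j * b + (\<Sum>k\<in>J - {j}. a j * a k)"
        using insert.hyps by (simp add: b_def)
    qed simp
    then show ?thesis using insert.hyps 1 by (simp add: sum.distrib)
  qed
  have "(\<Sum>j\<in>J. a j * b) = s * b" by (simp add: s_def sum_distrib_right)
  moreover have "0 \<le> b * s" using sb by simp
  moreover have IH: "ln (1 + s) \<le> (\<Sum>j\<in>J. ln (1 + a j))"
    "(\<Sum>j\<in>J. ln (1 + a j)) - ln (1 + s) \<le> (\<Sum>j\<in>J. \<Sum>k\<in>J - {j}. a j * a k)"
    using insert.IH insert.prems by (auto simp: s_def)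
  moreover have e: "(\<Sum>j\<in>insert i J. a j) = b + s" "(\<Sum>j\<in>insert i J. ln (1 + a j)) = ln (1 + b) + (\<Sum>j\<in>J. ln (1 + a j))"
    using insert.hyps by (auto simp: s_def b_def)
  ultimately show ?case unfolding e dbl using eq up lo by (intro conjI; linarith)
qed simp

text \<open>This and the next two integrals supply the pairs (\<phi>, \<psi>) for
  \<open>layer_limit\<close>: ln (1 + e^(-s)) for the partition function, 1/(1 + e^s) for the mass
  that the Gibbs density gives to a neighbouring atom, and e^(-s) for the error terms.\<close>

lemma nn_integral_fermi_tail:
  "(\<integral>\<^sup>+r. ennreal (1 / (1 + exp r)) * indicator {s..} r \<partial>lborel) = ennreal (ln (1 + exp (- s)))"
proof -
  have "(\<integral>\<^sup>+r. ennreal (1 / (1 + exp r)) * indicator {s..} r \<partial>lborel) = ennreal (0 - (- ln (1 + exp (- s))))"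
  proof (rule nn_integral_FTC_atLeast)
    fix x :: real
    have p: "0 < 1 + exp (- x)" by (simp add: add_pos_pos)
    have "((\<lambda>x. - ln (1 + exp (- x))) has_real_derivative - (1 / (1 + exp (- x)) * (- exp (- x)))) (at x)"
      using p by (auto intro!: derivative_eq_intros)
    moreover have "- (1 / (1 + exp (- x)) * (- exp (- x))) = 1 / (1 + exp x)"
      by (simp add: exp_minus divide_simps add_pos_pos)
    ultimately show "((\<lambda>x. - ln (1 + exp (- x))) has_real_derivative 1 / (1 + exp x)) (at x)" by simp
  next
    have "((\<lambda>x::real. - ln (1 + exp (- x))) \<longlongrightarrow> - ln (1 + 0)) at_top"
      by (intro tendsto_intros filterlim_compose[OF exp_at_bot] filterlim_uminus_at_bot_at_top) auto
    then show "((\<lambda>x::real. - ln (1 + exp (- x))) \<longlongrightarrow> 0) at_top" by simp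
  qed (auto simp: add_pos_pos less_imp_le)
  then show ?thesis by simp
qed

lemma nn_integral_logistic_tail:
  "(\<integral>\<^sup>+r. ennreal (exp r / (1 + exp r)\<^sup>2) * indicator {s..} r \<partial>lborel) = ennreal (1 / (1 + exp s))"
proof -
  have "(\<integral>\<^sup>+r. ennreal (exp r / (1 + exp r)\<^sup>2) * indicator {s..} r \<partial>lborel) = ennreal (0 - (- (1 / (1 + exp s))))"
  proof (rule nn_integral_FTC_atLeast)
    fix x :: real
    have p: "1 + exp x \<noteq> 0" using exp_gt_zero[of x] by linarith
    show "((\<lambda>x. - (1 / (1 + exp x))) has_real_derivative exp x / (1 + exp x)\<^sup>2) (at x)"
      using p by (auto intro!: derivative_eq_intros simp: power2_eq_square)
  next
    have "((\<lambda>x::real. - (1 / (1 + exp x))) \<longlongrightarrow> - 0) at_top"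
      by (intro tendsto_minus tendsto_divide_0[OF tendsto_const] filterlim_at_top_imp_at_infinity
          filterlim_tendsto_add_at_top[OF tendsto_const] exp_at_top)
    then show "((\<lambda>x::real. - (1 / (1 + exp x))) \<longlongrightarrow> 0) at_top" by simp
  qed (auto simp: add_pos_pos)
  then show ?thesis by simp
qed

lemma nn_integral_exp_tail:
  "(\<integral>\<^sup>+r. ennreal (exp (- r)) * indicator {s..} r \<partial>lborel) = ennreal (exp (- s))"
proof -
  have "(\<integral>\<^sup>+r. ennreal (exp (- r)) * indicator {s..} r \<partial>lborel) = ennreal (0 - (- exp (- s)))"
  proof (rule nn_integral_FTC_atLeast)
    show "((\<lambda>x. - exp (- x)) has_real_derivative exp (- x)) (at x)" for x :: real
      by (auto intro!: derivative_eq_intros)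
    have "((\<lambda>x::real. - exp (- x)) \<longlongrightarrow> - 0) at_top"
      by (intro tendsto_minus filterlim_compose[OF exp_at_bot] filterlim_uminus_at_bot_at_top)
    then show "((\<lambda>x::real. - exp (- x)) \<longlongrightarrow> 0) at_top" by simp
  qed auto
  then show ?thesis by simp
qed

section \<open>Gibbs densities on layered cells\<close>

lemma abs_x_ln_x_le:
  fixes t :: real
  assumes "0 \<le> t" "t \<le> 1"
  shows "\<bar>t * ln t\<bar> \<le> 1"
proof (cases "t = 0")
  case False
  then have t: "0 < t" using assms by simp
  have "ln (1 / t) \<le> 1 / t - 1" using t by (intro ln_le_minus_one) simp
  then have "t * (- ln t) \<le> t * (1 / t)" using t by (intro mult_left_mono) (auto simp: ln_div)
  moreover have "t * ln t \<le> 0" using t assms by (simp add: mult_le_0_iff)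
  ultimately show ?thesis using t by simp
qed simp

text \<open>The geometry is reduced to what the asymptotics need. \<kappa> i j is the linear density
  of mass in cell i next to its facet with cell j. \<open>core\<close> says that almost all of this
  density is carried by points whose excess for every third atom is bounded below, so neighbourhoods
  of triple intersections are negligible. \<open>conn\<close> allows mass to be moved between any
  two atoms through facets of positive density.\<close>

locale layered_cells = prob_space M for M :: "'a measure" +
  fixes n :: nat and \<Delta> :: "nat \<Rightarrow> 'a \<Rightarrow> real" and S :: "nat \<Rightarrow> 'a set"
    and \<kappa> :: "nat \<Rightarrow> nat \<Rightarrow> real" and p :: "nat \<Rightarrow> real"
  assumes Dm[measurable]: "\<And>i. i \<in> {1..n} \<Longrightarrow> \<Delta> i \<in> borel_measurable M"
    and D0: "\<And>i x. i \<in> {1..n} \<Longrightarrow> 0 \<le> \<Delta> i x"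
    and Sdef: "\<And>i. i \<in> {1..n} \<Longrightarrow> S i = {x\<in>space M. \<Delta> i x = 0}"
    and cover: "\<And>x. x \<in> space M \<Longrightarrow> \<exists>i\<in>{1..n}. \<Delta> i x = 0"
    and disj: "\<And>i j. i \<in> {1..n} \<Longrightarrow> j \<in> {1..n} \<Longrightarrow> i \<noteq> j \<Longrightarrow> AE x in M. \<not> (x \<in> S i \<and> x \<in> S j)"
    and mass: "\<And>i. i \<in> {1..n} \<Longrightarrow> prob (S i) = p i"
    and ratio: "\<And>i j. i \<in> {1..n} \<Longrightarrow> j \<in> {1..n} \<Longrightarrow> i \<noteq> j \<Longrightarrow>
        ((\<lambda>t. prob {x\<in>S i. \<Delta> j x \<le> t} / t) \<longlongrightarrow> \<kappa> i j) (at_right 0)"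
    and core: "\<And>i j e. i \<in> {1..n} \<Longrightarrow> j \<in> {1..n} \<Longrightarrow> i \<noteq> j \<Longrightarrow> 0 < e \<Longrightarrow>
        \<exists>a>0. \<exists>\<kappa>'>\<kappa> i j - e. ((\<lambda>t. prob {x\<in>{x\<in>S i. \<forall>k\<in>{1..n} - {i, j}. a \<le> \<Delta> k x}. \<Delta> j x \<le> t} / t) \<longlongrightarrow> \<kappa>') (at_right 0)"
    and sym: "\<And>i j. i \<in> {1..n} \<Longrightarrow> j \<in> {1..n} \<Longrightarrow> \<kappa> i j = \<kappa> j i"
    and conn: "\<And>i j. i \<in> {1..n} \<Longrightarrow> j \<in> {1..n} \<Longrightarrow>
        (i, j) \<in> {(i, j). i \<in> {1..n} \<and> j \<in> {1..n} \<and> i \<noteq> j \<and> 0 < \<kappa> i j}\<^sup>*"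
begin

lemma Sm [measurable]: "i \<in> {1..n} \<Longrightarrow> S i \<in> sets M"
  using Sdef[of i] Dm[of i] by simp

lemma S_space: "i \<in> {1..n} \<Longrightarrow> x \<in> S i \<Longrightarrow> x \<in> space M \<and> \<Delta> i x = 0"
  by (simp add: Sdef)

text \<open>In the third claim the constant I stays implicit: its value ln 2 never enters, since the
  contributions from the two sides of a facet cancel. What matters is that one I serves all sets and
  all pairs, which is why the quantifiers stand inside the existential.\<close>

lemma pair_limit:
  assumes ij: "i \<in> {1..n}" "j \<in> {1..n}" and T: "T \<in> sets M" "T \<subseteq> S i"
    and rat: "((\<lambda>t. prob {x\<in>T. \<Delta> j x \<le> t} / t) \<longlongrightarrow> \<kappa>') (at_right 0)"
  shows "((\<lambda>\<eta>. \<eta> * (\<integral>x. indicator T x * ln (1 + exp (- (\<eta> * \<Delta> j x))) \<partial>M)) \<longlongrightarrow> \<kappa>' * (pi\<^sup>2 / 12)) at_top"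
    and "((\<lambda>\<eta>. \<eta> * (\<integral>x. indicator T x * exp (- (\<eta> * \<Delta> j x)) \<partial>M)) \<longlongrightarrow> \<kappa>') at_top"
    and "\<exists>I. \<forall>T \<kappa>' j. j \<in> {1..n} \<longrightarrow> T \<in> sets M \<longrightarrow> ((\<lambda>t. prob {x\<in>T. \<Delta> j x \<le> t} / t) \<longlongrightarrow> \<kappa>') (at_right 0) \<longrightarrow>
      ((\<lambda>\<eta>. \<eta> * (\<integral>x. indicator T x * (1 / (1 + exp (\<eta> * \<Delta> j x))) \<partial>M)) \<longlongrightarrow> \<kappa>' * I) at_top"
proof -
  have p1: "0 < 1 + exp x" for x :: real by (simp add: add_pos_pos)
  show "((\<lambda>\<eta>. \<eta> * (\<integral>x. indicator T x * ln (1 + exp (- (\<eta> * \<Delta> j x))) \<partial>M)) \<longlongrightarrow> \<kappa>' * (pi\<^sup>2 / 12)) at_top"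
  proof (rule layer_limit[OF T(1) Dm[OF ij(2)] _ rat, where \<psi>="\<lambda>r. 1 / (1 + exp r)"])
    show "(\<integral>\<^sup>+r. ennreal (r * (1 / (1 + exp r))) * indicator {0..} r \<partial>lborel) = ennreal (pi\<^sup>2 / 12)"
      using nn_integral_fermi by simp
  qed (use ij D0 p1 nn_integral_fermi_tail in \<open>auto simp: less_imp_le\<close>)
  have "((\<lambda>\<eta>. \<eta> * (\<integral>x. indicator T x * exp (- (\<eta> * \<Delta> j x)) \<partial>M)) \<longlongrightarrow> \<kappa>' * 1) at_top"
  proof (rule layer_limit[OF T(1) Dm[OF ij(2)] _ rat, where \<psi>="\<lambda>r. exp (- r)"])
    show "(\<integral>\<^sup>+r. ennreal (r * exp (- r)) * indicator {0..} r \<partial>lborel) = ennreal 1"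
      using nn_integral_id_times_exp[of 1] by simp
  qed (use ij D0 nn_integral_exp_tail in auto)
  then show "((\<lambda>\<eta>. \<eta> * (\<integral>x. indicator T x * exp (- (\<eta> * \<Delta> j x)) \<partial>M)) \<longlongrightarrow> \<kappa>') at_top" by simp
  define I where "I = (\<integral>\<^sup>+r. ennreal (r * (exp r / (1 + exp r)\<^sup>2)) * indicator {0..} r \<partial>lborel)"
  have "I \<le> (\<integral>\<^sup>+r. ennreal (r * exp (- (1 * r))) * indicator {0..} r \<partial>lborel)"
    unfolding I_def
  proof (intro nn_integral_mono)
    fix r :: real
    have "exp r * exp r \<le> (1 + exp r)\<^sup>2" using p1[of r] by (simp add: power2_eq_square algebra_simps add_increasing)
    then have "exp r / (1 + exp r)\<^sup>2 \<le> exp (- r)"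
      using p1[of r] by (simp add: exp_minus divide_simps)
    then have "r * (exp r / (1 + exp r)\<^sup>2) \<le> r * exp (- (1 * r))" if "0 \<le> r"
      using that by (intro mult_left_mono) auto
    then show "ennreal (r * (exp r / (1 + exp r)\<^sup>2)) * indicator {0..} r \<le> ennreal (r * exp (- (1 * r))) * indicator {0..} r"
      by (cases "0 \<le> r") (auto simp: indicator_def intro!: ennreal_leI)
  qed
  also have "\<dots> = 1" using nn_integral_id_times_exp[of 1] by simp
  finally have "I < \<infinity>" by (auto intro: le_less_trans)
  then obtain I' where I': "I = ennreal I'" "0 \<le> I'" by (cases I) auto
  show "\<exists>I. \<forall>T \<kappa>' j. j \<in> {1..n} \<longrightarrow> T \<in> sets M \<longrightarrow> ((\<lambda>t. prob {x\<in>T. \<Delta> j x \<le> t} / t) \<longlongrightarrow> \<kappa>') (at_right 0) \<longrightarrow>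
      ((\<lambda>\<eta>. \<eta> * (\<integral>x. indicator T x * (1 / (1 + exp (\<eta> * \<Delta> j x))) \<partial>M)) \<longlongrightarrow> \<kappa>' * I) at_top"
  proof (intro exI[of _ I'] allI impI)
    fix T :: "'a set" and \<kappa>' :: real and j
    assume j: "j \<in> {1..n}" and T: "T \<in> sets M" and rat: "((\<lambda>t. prob {x\<in>T. \<Delta> j x \<le> t} / t) \<longlongrightarrow> \<kappa>') (at_right 0)"
    show "((\<lambda>\<eta>. \<eta> * (\<integral>x. indicator T x * (1 / (1 + exp (\<eta> * \<Delta> j x))) \<partial>M)) \<longlongrightarrow> \<kappa>' * I') at_top"
    proof (rule layer_limit[OF T Dm[OF j] _ rat, where \<psi>="\<lambda>r. exp r / (1 + exp r)\<^sup>2"])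
      show "(\<integral>\<^sup>+r. ennreal (r * (exp r / (1 + exp r)\<^sup>2)) * indicator {0..} r \<partial>lborel) = ennreal I'"
        using I' by (simp add: I_def)
    qed (use j I' D0 p1 nn_integral_logistic_tail in \<open>auto simp: less_imp_le\<close>)
  qed
qed

lemma bounded_integrable:
  fixes f :: "'a \<Rightarrow> real"
  assumes "f \<in> borel_measurable M" "\<And>x. x \<in> space M \<Longrightarrow> \<bar>f x\<bar> \<le> C"
  shows "integrable M f"
  using assms by (intro integrable_const_bound[where B=C]) auto

lemma exp_le1: "i \<in> {1..n} \<Longrightarrow> 0 \<le> \<eta> \<Longrightarrow> exp (- (\<eta> * \<Delta> i x)) \<le> 1"
  using D0[of i x] by simp

text \<open>On the set T from \<open>core\<close> the factor belonging to k is at most exp (- \<eta>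
  a), which beats the prefactor \<eta>. Off T that factor is bounded by one, and what remains is the
  difference of two layer integrals, converging to \<kappa> i j - \<kappa>', which is below
  e/3.\<close>

lemma triple_limit:
  assumes i: "i \<in> {1..n}" and j: "j \<in> {1..n}" and k: "k \<in> {1..n}" and ne: "i \<noteq> j" "i \<noteq> k" "j \<noteq> k"
  shows "((\<lambda>\<eta>. \<eta> * (\<integral>x. indicator (S i) x * (exp (- (\<eta> * \<Delta> j x)) * exp (- (\<eta> * \<Delta> k x))) \<partial>M)) \<longlongrightarrow> 0) at_top"
proof (rule tendstoI)
  fix e :: real assume e: "0 < e"
  have e3: "0 < e / 3" using e by simp
  obtain a \<kappa>' where a: "0 < a" "\<kappa>' > \<kappa> i j - e / 3"
    and rat: "((\<lambda>t. prob {x\<in>{x\<in>S i. \<forall>k\<in>{1..n} - {i, j}. a \<le> \<Delta> k x}. \<Delta> j x \<le> t} / t) \<longlongrightarrow> \<kappa>') (at_right 0)"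
    using core[OF i j ne(1) e3] by blast
  define T where "T = {x\<in>S i. \<forall>k\<in>{1..n} - {i, j}. a \<le> \<Delta> k x}"
  have Tm[measurable]: "T \<in> sets M"
  proof -
    have "T = S i \<inter> {x\<in>space M. \<forall>k\<in>{1..n} - {i, j}. a \<le> \<Delta> k x}" using S_space[OF i] by (auto simp: T_def)
    also have "\<dots> \<in> sets M"
    proof (rule sets.Int[OF Sm[OF i]])
      show "{x\<in>space M. \<forall>k\<in>{1..n} - {i, j}. a \<le> \<Delta> k x} \<in> sets M"
        by (intro sets.sets_Collect_finite_All) auto
    qed
    finally show ?thesis .
  qed
  have TS: "T \<subseteq> S i" by (auto simp: T_def)
  note [measurable] = Sm[OF i] Dm[OF j] Dm[OF k]
  have l1: "((\<lambda>\<eta>. \<eta> * (\<integral>x. indicator (S i) x * exp (- (\<eta> * \<Delta> j x)) \<partial>M)) \<longlongrightarrow> \<kappa> i j) at_top"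
    by (rule pair_limit(2)[OF i j Sm[OF i] _ ratio[OF i j ne(1)]]) simp
  have l2: "((\<lambda>\<eta>. \<eta> * (\<integral>x. indicator T x * exp (- (\<eta> * \<Delta> j x)) \<partial>M)) \<longlongrightarrow> \<kappa>') at_top"
    by (rule pair_limit(2)[OF i j Tm TS]) (use rat in \<open>simp add: T_def\<close>)
  have "((\<lambda>\<eta>. (1 / a) * ((a * \<eta>) ^ 1 / exp (a * \<eta>))) \<longlongrightarrow> (1 / a) * 0) at_top"
    using a(1) by (intro tendsto_intros filterlim_compose[OF tendsto_power_div_exp_0]
        filterlim_tendsto_pos_mult_at_top[OF tendsto_const] filterlim_ident) auto
  then have "((\<lambda>\<eta>. \<eta> * exp (- (\<eta> * a))) \<longlongrightarrow> 0) at_top"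
    using a(1) by (simp add: exp_minus field_simps)
  then have "((\<lambda>\<eta>. \<eta> * exp (- (\<eta> * a)) + (\<eta> * (\<integral>x. indicator (S i) x * exp (- (\<eta> * \<Delta> j x)) \<partial>M)
       - \<eta> * (\<integral>x. indicator T x * exp (- (\<eta> * \<Delta> j x)) \<partial>M))) \<longlongrightarrow> 0 + (\<kappa> i j - \<kappa>')) at_top"
    by (intro tendsto_add tendsto_diff l1 l2)
  moreover have "0 + (\<kappa> i j - \<kappa>') < e" using a e by simp
  ultimately have ev: "\<forall>\<^sub>F \<eta> in at_top. \<eta> * exp (- (\<eta> * a)) + (\<eta> * (\<integral>x. indicator (S i) x * exp (- (\<eta> * \<Delta> j x)) \<partial>M)
       - \<eta> * (\<integral>x. indicator T x * exp (- (\<eta> * \<Delta> j x)) \<partial>M)) < e"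
    by (rule order_tendstoD)
  show "\<forall>\<^sub>F \<eta> in at_top. dist (\<eta> * (\<integral>x. indicator (S i) x * (exp (- (\<eta> * \<Delta> j x)) * exp (- (\<eta> * \<Delta> k x))) \<partial>M)) 0 < e"
    using ev eventually_gt_at_top[of 0]
  proof eventually_elim
    fix \<eta> :: real
    assume lt: "\<eta> * exp (- (\<eta> * a)) + (\<eta> * (\<integral>x. indicator (S i) x * exp (- (\<eta> * \<Delta> j x)) \<partial>M)
       - \<eta> * (\<integral>x. indicator T x * exp (- (\<eta> * \<Delta> j x)) \<partial>M)) < e" and \<eta>: "0 < \<eta>"
    have ej: "exp (- (\<eta> * \<Delta> j x)) \<le> 1" and ek: "exp (- (\<eta> * \<Delta> k x)) \<le> 1" for x
      using exp_le1 j k \<eta> by auto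
    have int: "integrable M (\<lambda>x. indicator U x * exp (- (\<eta> * \<Delta> j x)))" if [measurable]: "U \<in> sets M" for U
      by (rule bounded_integrable[where C=1]) (use ej in \<open>auto simp: indicator_def\<close>)
    have "(\<integral>x. indicator (S i) x * (exp (- (\<eta> * \<Delta> j x)) * exp (- (\<eta> * \<Delta> k x))) \<partial>M)
      \<le> (\<integral>x. exp (- (\<eta> * a)) + (indicator (S i) x * exp (- (\<eta> * \<Delta> j x)) - indicator T x * exp (- (\<eta> * \<Delta> j x))) \<partial>M)"
    proof (rule integral_mono)
      show "integrable M (\<lambda>x. indicator (S i) x * (exp (- (\<eta> * \<Delta> j x)) * exp (- (\<eta> * \<Delta> k x))))"
        by (rule bounded_integrable[where C=1]) (use ej ek in \<open>auto simp: indicator_def mult_le_one\<close>)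
      show "integrable M (\<lambda>x. exp (- (\<eta> * a)) + (indicator (S i) x * exp (- (\<eta> * \<Delta> j x)) - indicator T x * exp (- (\<eta> * \<Delta> j x))))"
        using int by auto
      fix x
      show "indicator (S i) x * (exp (- (\<eta> * \<Delta> j x)) * exp (- (\<eta> * \<Delta> k x)))
        \<le> exp (- (\<eta> * a)) + (indicator (S i) x * exp (- (\<eta> * \<Delta> j x)) - indicator T x * exp (- (\<eta> * \<Delta> j x)))"
      proof (cases "x \<in> T")
        case True
        then have "a \<le> \<Delta> k x" using k ne by (auto simp: T_def)
        then have "exp (- (\<eta> * \<Delta> k x)) \<le> exp (- (\<eta> * a))" using \<eta> by simp
        then have "exp (- (\<eta> * \<Delta> j x)) * exp (- (\<eta> * \<Delta> k x)) \<le> 1 * exp (- (\<eta> * a))"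
          using ej[of x] by (intro mult_mono) auto
        then show ?thesis using True TS by (auto simp: indicator_def)
      next
        case False
        have "exp (- (\<eta> * \<Delta> j x)) * exp (- (\<eta> * \<Delta> k x)) \<le> exp (- (\<eta> * \<Delta> j x)) * 1"
          using ek[of x] by (intro mult_left_mono) auto
        then show ?thesis using False by (auto simp: indicator_def intro: add_increasing)
      qed
    qed
    also have "\<dots> = exp (- (\<eta> * a)) + ((\<integral>x. indicator (S i) x * exp (- (\<eta> * \<Delta> j x)) \<partial>M)
       - (\<integral>x. indicator T x * exp (- (\<eta> * \<Delta> j x)) \<partial>M))"
      using int by (simp add: prob_space)
    finally have "\<eta> * (\<integral>x. indicator (S i) x * (exp (- (\<eta> * \<Delta> j x)) * exp (- (\<eta> * \<Delta> k x))) \<partial>M)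
      \<le> \<eta> * (exp (- (\<eta> * a)) + ((\<integral>x. indicator (S i) x * exp (- (\<eta> * \<Delta> j x)) \<partial>M)
       - (\<integral>x. indicator T x * exp (- (\<eta> * \<Delta> j x)) \<partial>M)))"
      using \<eta> by (intro mult_left_mono) auto
    also have "\<dots> < e" using lt by (simp add: algebra_simps)
    finally have "\<eta> * (\<integral>x. indicator (S i) x * (exp (- (\<eta> * \<Delta> j x)) * exp (- (\<eta> * \<Delta> k x))) \<partial>M) < e" .
    moreover have "0 \<le> \<eta> * (\<integral>x. indicator (S i) x * (exp (- (\<eta> * \<Delta> j x)) * exp (- (\<eta> * \<Delta> k x))) \<partial>M)"
      using \<eta> by (intro mult_nonneg_nonneg integral_nonneg) auto
    ultimately show "dist (\<eta> * (\<integral>x. indicator (S i) x * (exp (- (\<eta> * \<Delta> j x)) * exp (- (\<eta> * \<Delta> k x))) \<partial>M)) 0 < e"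
      by simp
  qed
qed

section \<open>Partition function and Gibbs density\<close>

definition Z :: "real \<Rightarrow> 'a \<Rightarrow> real" where
  "Z \<eta> x = (\<Sum>j\<in>{1..n}. exp (- (\<eta> * \<Delta> j x)))"

text \<open>The conditional probability of atom l given x, with the unregularised potentials in the
  exponent. It carries no weight \<open>p l\<close>: densities are taken with respect to M times
  counting measure on the atoms, and the weights return only through an additive constant in the
  entropy. Hence the two cells of a facet are treated symmetrically.\<close>

definition gibbs :: "real \<Rightarrow> nat \<Rightarrow> 'a \<Rightarrow> real" where
  "gibbs \<eta> l x = exp (- (\<eta> * \<Delta> l x)) / Z \<eta> x"

lemma Z_measurable [measurable]: "Z \<eta> \<in> borel_measurable M"
  unfolding Z_def by (intro borel_measurable_sum) simp

lemma gibbs_measurable [measurable]: "l \<in> {1..n} \<Longrightarrow> gibbs \<eta> l \<in> borel_measurable M"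
  unfolding gibbs_def by simp

lemma Z_ge1: "x \<in> space M \<Longrightarrow> 1 \<le> Z \<eta> x"
proof -
  assume "x \<in> space M"
  then obtain i where i: "i \<in> {1..n}" "\<Delta> i x = 0" using cover by blast
  have "exp (- (\<eta> * \<Delta> i x)) \<le> Z \<eta> x" unfolding Z_def by (rule member_le_sum) (use i in auto)
  then show ?thesis using i by simp
qed

lemma Z_le: "0 \<le> \<eta> \<Longrightarrow> Z \<eta> x \<le> real n"
  unfolding Z_def using sum_bounded_above[of "{1..n}" "\<lambda>j. exp (- (\<eta> * \<Delta> j x))" 1] exp_le1 by auto

lemma n_pos: "1 \<le> n"
proof -
  obtain x where "x \<in> space M" using not_empty by blast
  then show ?thesis using cover[of x] by auto
qed

lemma gibbs_pos: "x \<in> space M \<Longrightarrow> 0 < gibbs \<eta> l x"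
  using Z_ge1[of x \<eta>] by (simp add: gibbs_def)

lemma gibbs_sum: "x \<in> space M \<Longrightarrow> (\<Sum>l\<in>{1..n}. gibbs \<eta> l x) = 1"
  using Z_ge1[of x \<eta>] unfolding gibbs_def sum_divide_distrib[symmetric] Z_def[symmetric] by simp

lemma gibbs_le1: "x \<in> space M \<Longrightarrow> l \<in> {1..n} \<Longrightarrow> gibbs \<eta> l x \<le> 1"
  using member_le_sum[of l "{1..n}" "\<lambda>l. gibbs \<eta> l x"] gibbs_sum[of x \<eta>] gibbs_pos[of x \<eta>]
  by (simp add: less_imp_le)

lemma Z_cell: "i \<in> {1..n} \<Longrightarrow> x \<in> S i \<Longrightarrow> Z \<eta> x = 1 + (\<Sum>j\<in>{1..n} - {i}. exp (- (\<eta> * \<Delta> j x)))"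
  unfolding Z_def using S_space[of i x] by (subst sum.remove[of _ i]) auto

lemma integral_cells:
  fixes f :: "'a \<Rightarrow> real"
  assumes [measurable]: "f \<in> borel_measurable M" and b: "\<And>x. x \<in> space M \<Longrightarrow> \<bar>f x\<bar> \<le> C"
  shows "(\<integral>x. f x \<partial>M) = (\<Sum>i\<in>{1..n}. \<integral>x. indicator (S i) x * f x \<partial>M)"
proof -
  have "AE x in M. \<forall>i\<in>{1..n}. \<forall>j\<in>{1..n}. i \<noteq> j \<longrightarrow> \<not> (x \<in> S i \<and> x \<in> S j)"
    using disj by (auto intro!: AE_finite_allI simp del: de_Morgan_conj)
  then have "AE x in M. f x = (\<Sum>i\<in>{1..n}. indicator (S i) x * f x)"
    using AE_space
  proof eventually_elim
    fix x assume d: "\<forall>i\<in>{1..n}. \<forall>j\<in>{1..n}. i \<noteq> j \<longrightarrow> \<not> (x \<in> S i \<and> x \<in> S j)" and x: "x \<in> space M"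
    obtain i where i: "i \<in> {1..n}" "\<Delta> i x = 0" using cover[OF x] by blast
    then have xi: "x \<in> S i" using x by (simp add: Sdef)
    have "(\<Sum>j\<in>{1..n}. indicator (S j) x * f x) = indicator (S i) x * f x + (\<Sum>j\<in>{1..n} - {i}. indicator (S j) x * f x)"
      using i by (subst sum.remove[of _ i]) auto
    also have "(\<Sum>j\<in>{1..n} - {i}. indicator (S j) x * f x) = 0"
      using d xi i by (intro sum.neutral) (auto simp: indicator_def)
    finally show "f x = (\<Sum>i\<in>{1..n}. indicator (S i) x * f x)" using xi by simp
  qed
  then have "(\<integral>x. f x \<partial>M) = (\<integral>x. (\<Sum>i\<in>{1..n}. indicator (S i) x * f x) \<partial>M)"
    by (intro integral_cong_AE) auto
  also have "\<dots> = (\<Sum>i\<in>{1..n}. \<integral>x. indicator (S i) x * f x \<partial>M)"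
  proof (rule Bochner_Integration.integral_sum)
    fix i assume i: "i \<in> {1..n}"
    note [measurable] = Sm[OF i]
    show "integrable M (\<lambda>x. indicator (S i) x * f x)"
    proof (rule bounded_integrable[where C="\<bar>C\<bar>"])
      show "\<bar>indicator (S i) x * f x\<bar> \<le> \<bar>C\<bar>" if "x \<in> space M" for x
        using b[OF that] abs_ge_self[of C] by (auto simp: indicator_def)
    qed simp
  qed
  finally show ?thesis .
qed

section \<open>Asymptotics of the logarithm of the partition function\<close>

definition log_partition :: "real \<Rightarrow> real" where
  "log_partition \<eta> = (\<integral>x. ln (Z \<eta> x) \<partial>M)"

definition K :: real where
  "K = (\<Sum>i\<in>{1..n}. \<Sum>j\<in>{1..n} - {i}. \<kappa> i j * (pi\<^sup>2 / 12))"

lemma pairs_negligible: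
  assumes i: "i \<in> {1..n}" and J: "J \<subseteq> {1..n} - {i}"
  shows "((\<lambda>\<eta>. \<eta> * (\<integral>x. indicator (S i) x * (\<Sum>j\<in>J. \<Sum>k\<in>J - {j}. exp (- (\<eta> * \<Delta> j x)) * exp (- (\<eta> * \<Delta> k x))) \<partial>M)) \<longlongrightarrow> 0) at_top"
proof -
  have fJ: "finite J" using J by (rule finite_subset) simp
  note [measurable] = Sm[OF i]
  have "((\<lambda>\<eta>. \<Sum>j\<in>J. \<Sum>k\<in>J - {j}. \<eta> * (\<integral>x. indicator (S i) x * (exp (- (\<eta> * \<Delta> j x)) * exp (- (\<eta> * \<Delta> k x))) \<partial>M))
     \<longlongrightarrow> (\<Sum>j\<in>J. \<Sum>k\<in>J - {j}. 0)) at_top"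
    using J i by (intro tendsto_sum triple_limit) auto
  then have "((\<lambda>\<eta>. \<Sum>j\<in>J. \<Sum>k\<in>J - {j}. \<eta> * (\<integral>x. indicator (S i) x * (exp (- (\<eta> * \<Delta> j x)) * exp (- (\<eta> * \<Delta> k x))) \<partial>M)) \<longlongrightarrow> 0) at_top"
    by simp
  then show ?thesis
  proof (rule Lim_transform_eventually)
    show "\<forall>\<^sub>F \<eta> in at_top. (\<Sum>j\<in>J. \<Sum>k\<in>J - {j}. \<eta> * (\<integral>x. indicator (S i) x * (exp (- (\<eta> * \<Delta> j x)) * exp (- (\<eta> * \<Delta> k x))) \<partial>M))
       = \<eta> * (\<integral>x. indicator (S i) x * (\<Sum>j\<in>J. \<Sum>k\<in>J - {j}. exp (- (\<eta> * \<Delta> j x)) * exp (- (\<eta> * \<Delta> k x))) \<partial>M)"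
      using eventually_ge_at_top[of 0]
    proof eventually_elim
      fix \<eta> :: real assume \<eta>: "0 \<le> \<eta>"
      have int: "integrable M (\<lambda>x. indicator (S i) x * (exp (- (\<eta> * \<Delta> j x)) * exp (- (\<eta> * \<Delta> k x))))"
        if "j \<in> J" "k \<in> J" for j k
      proof -
        have jk: "j \<in> {1..n}" "k \<in> {1..n}" using that J by auto
        note [measurable] = Dm[OF jk(1)] Dm[OF jk(2)]
        show ?thesis
          by (rule bounded_integrable[where C=1])
             (use exp_le1[OF jk(1) \<eta>] exp_le1[OF jk(2) \<eta>] in \<open>auto simp: indicator_def mult_le_one simp del: exp_le_one_iff\<close>)
      qed
      show "(\<Sum>j\<in>J. \<Sum>k\<in>J - {j}. \<eta> * (\<integral>x. indicator (S i) x * (exp (- (\<eta> * \<Delta> j x)) * exp (- (\<eta> * \<Delta> k x))) \<partial>M))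
        = \<eta> * (\<integral>x. indicator (S i) x * (\<Sum>j\<in>J. \<Sum>k\<in>J - {j}. exp (- (\<eta> * \<Delta> j x)) * exp (- (\<eta> * \<Delta> k x))) \<partial>M)"
        unfolding sum_distrib_left
        by (subst Bochner_Integration.integral_sum, rule Bochner_Integration.integrable_sum, rule int,
            simp, simp, subst sum_distrib_left,
            rule sum.cong[OF refl], subst Bochner_Integration.integral_sum, rule int)
           (auto simp: sum_distrib_left)
    qed
  qed
qed

text \<open>A sandwich: \<open>A\<close> collects the neighbours one at a time and has the stated
  limit, \<open>E\<close> is the error from pairs of neighbours and vanishes by
  \<open>pairs_negligible\<close>.\<close>

lemma log_partition_cell_limit:
  assumes i: "i \<in> {1..n}"
  shows "((\<lambda>\<eta>. \<eta> * (\<integral>x. indicator (S i) x * ln (Z \<eta> x) \<partial>M)) \<longlongrightarrow> (\<Sum>j\<in>{1..n} - {i}. \<kappa> i j * (pi\<^sup>2 / 12))) at_top"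
proof -
  let ?J = "{1..n} - {i}"
  define A where "A \<eta> = (\<Sum>j\<in>?J. \<eta> * (\<integral>x. indicator (S i) x * ln (1 + exp (- (\<eta> * \<Delta> j x))) \<partial>M))" for \<eta>
  define E where "E \<eta> = \<eta> * (\<integral>x. indicator (S i) x * (\<Sum>j\<in>?J. \<Sum>k\<in>?J - {j}. exp (- (\<eta> * \<Delta> j x)) * exp (- (\<eta> * \<Delta> k x))) \<partial>M)" for \<eta>
  have Alim: "(A \<longlongrightarrow> (\<Sum>j\<in>?J. \<kappa> i j * (pi\<^sup>2 / 12))) at_top"
    unfolding A_def using i
    by (intro tendsto_sum pair_limit(1)[OF i _ Sm[OF i] order_refl ratio]) auto
  have Elim: "(E \<longlongrightarrow> 0) at_top" unfolding E_def by (rule pairs_negligible[OF i]) simp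
  note [measurable] = Sm[OF i]
  have bnd: "A \<eta> - E \<eta> \<le> \<eta> * (\<integral>x. indicator (S i) x * ln (Z \<eta> x) \<partial>M) \<and>
      \<eta> * (\<integral>x. indicator (S i) x * ln (Z \<eta> x) \<partial>M) \<le> A \<eta>" if \<eta>: "0 \<le> \<eta>" for \<eta>
  proof -
    define a where "a j x = exp (- (\<eta> * \<Delta> j x))" for j x
    have am[measurable]: "j \<in> {1..n} \<Longrightarrow> a j \<in> borel_measurable M" for j
      unfolding a_def[abs_def] by simp
    have a01: "0 \<le> a j x" "j \<in> {1..n} \<Longrightarrow> a j x \<le> 1" for j x
      using exp_le1[OF _ \<eta>] by (auto simp: a_def)
    have ln1: "0 \<le> ln (1 + a j x)" "j \<in> {1..n} \<Longrightarrow> ln (1 + a j x) \<le> 1" for j x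
      using a01(1)[of j x] a01(2)[of j x] ln_add_one_self_le_self[of "a j x"] by auto
    have i1: "integrable M (\<lambda>x. indicator (S i) x * ln (1 + a j x))" if "j \<in> ?J" for j
    proof (rule bounded_integrable[where C=1])
      show "(\<lambda>x. indicator (S i) x * ln (1 + a j x)) \<in> borel_measurable M" using that by simp
    qed (use ln1[of j] that in \<open>auto simp: indicator_def\<close>)
    have i2: "integrable M (\<lambda>x. indicator (S i) x * ln (Z \<eta> x))"
    proof (rule bounded_integrable[where C="ln (real n)"])
      fix x assume x: "x \<in> space M"
      show "\<bar>indicator (S i) x * ln (Z \<eta> x)\<bar> \<le> ln (real n)"
        using Z_ge1[OF x, of \<eta>] Z_le[OF \<eta>, of x] n_pos by (auto simp: indicator_def)
    qed simp
    have dm: "(\<lambda>x. \<Sum>j\<in>?J. \<Sum>k\<in>?J - {j}. a j x * a k x) \<in> borel_measurable M"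
      by (intro borel_measurable_sum) auto
    have i3: "integrable M (\<lambda>x. indicator (S i) x * (\<Sum>j\<in>?J. \<Sum>k\<in>?J - {j}. a j x * a k x))"
    proof (rule bounded_integrable[where C="\<Sum>j\<in>?J. \<Sum>k\<in>?J - {j}. 1"])
      fix x assume x: "x \<in> space M"
      have "(\<Sum>j\<in>?J. \<Sum>k\<in>?J - {j}. a j x * a k x) \<le> (\<Sum>j\<in>?J. \<Sum>k\<in>?J - {j}. 1)"
        using a01 by (intro sum_mono mult_le_one) auto
      moreover have "0 \<le> (\<Sum>j\<in>?J. \<Sum>k\<in>?J - {j}. a j x * a k x)"
        using a01 by (intro sum_nonneg) auto
      ultimately show "\<bar>indicator (S i) x * (\<Sum>j\<in>?J. \<Sum>k\<in>?J - {j}. a j x * a k x)\<bar> \<le> (\<Sum>j\<in>?J. \<Sum>k\<in>?J - {j}. 1)"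
        by (auto simp: indicator_def)
    qed (use dm in simp)
    have i4: "integrable M (\<lambda>x. \<Sum>j\<in>?J. indicator (S i) x * ln (1 + a j x))"
      using i1 by (intro Bochner_Integration.integrable_sum) auto
    have Aeq: "A \<eta> = \<eta> * (\<integral>x. (\<Sum>j\<in>?J. indicator (S i) x * ln (1 + a j x)) \<partial>M)"
      unfolding A_def a_def[symmetric] by (subst Bochner_Integration.integral_sum) (use i1 in \<open>auto simp: sum_distrib_left\<close>)
    have pt: "indicator (S i) x * ln (Z \<eta> x) \<le> (\<Sum>j\<in>?J. indicator (S i) x * ln (1 + a j x)) \<and>
      (\<Sum>j\<in>?J. indicator (S i) x * ln (1 + a j x)) - indicator (S i) x * (\<Sum>j\<in>?J. \<Sum>k\<in>?J - {j}. a j x * a k x)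
        \<le> indicator (S i) x * ln (Z \<eta> x)" for x
    proof (cases "x \<in> S i")
      case True
      then have "Z \<eta> x = 1 + (\<Sum>j\<in>?J. a j x)" using Z_cell[OF i True] by (simp add: a_def)
      then show ?thesis using True sum_ln_one_plus_bounds[of ?J "\<lambda>j. a j x"] a01 by simp
    qed simp
    have "(\<integral>x. indicator (S i) x * ln (Z \<eta> x) \<partial>M) \<le> (\<integral>x. (\<Sum>j\<in>?J. indicator (S i) x * ln (1 + a j x)) \<partial>M)"
      using pt by (intro integral_mono i2 i4) auto
    moreover have "(\<integral>x. (\<Sum>j\<in>?J. indicator (S i) x * ln (1 + a j x)) \<partial>M)
        - (\<integral>x. indicator (S i) x * (\<Sum>j\<in>?J. \<Sum>k\<in>?J - {j}. a j x * a k x) \<partial>M) \<le> (\<integral>x. indicator (S i) x * ln (Z \<eta> x) \<partial>M)"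
      unfolding Bochner_Integration.integral_diff[OF i4 i3, symmetric]
      using pt by (intro integral_mono i2 Bochner_Integration.integrable_diff i4 i3) auto
    ultimately show ?thesis
      using \<eta> unfolding Aeq E_def a_def[symmetric] right_diff_distrib[symmetric]
      by (auto intro!: mult_left_mono)
  qed
  show ?thesis
  proof (rule tendsto_sandwich[where f="\<lambda>\<eta>. A \<eta> - E \<eta>" and h=A])
    show "((\<lambda>\<eta>. A \<eta> - E \<eta>) \<longlongrightarrow> (\<Sum>j\<in>?J. \<kappa> i j * (pi\<^sup>2 / 12))) at_top"
      using tendsto_diff[OF Alim Elim] by simp
  qed (use bnd Alim in \<open>auto intro: eventually_mono[OF eventually_ge_at_top[of 0]]\<close>)
qed

lemma log_partition_limit: "((\<lambda>\<eta>. \<eta> * log_partition \<eta>) \<longlongrightarrow> K) at_top"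
proof -
  have "((\<lambda>\<eta>. \<Sum>i\<in>{1..n}. \<eta> * (\<integral>x. indicator (S i) x * ln (Z \<eta> x) \<partial>M)) \<longlongrightarrow> K) at_top"
    unfolding K_def by (intro tendsto_sum log_partition_cell_limit)
  then show ?thesis
  proof (rule Lim_transform_eventually)
    show "\<forall>\<^sub>F \<eta> in at_top. (\<Sum>i\<in>{1..n}. \<eta> * (\<integral>x. indicator (S i) x * ln (Z \<eta> x) \<partial>M)) = \<eta> * log_partition \<eta>"
      using eventually_ge_at_top[of 0]
    proof eventually_elim
      fix \<eta> :: real assume \<eta>: "0 \<le> \<eta>"
      have "log_partition \<eta> = (\<Sum>i\<in>{1..n}. \<integral>x. indicator (S i) x * ln (Z \<eta> x) \<partial>M)"
        unfolding log_partition_def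
      proof (rule integral_cells[where C="ln (real n)"])
        fix x assume x: "x \<in> space M"
        show "\<bar>ln (Z \<eta> x)\<bar> \<le> ln (real n)"
          using Z_ge1[OF x, of \<eta>] Z_le[OF \<eta>, of x] n_pos by auto
      qed simp
      then show "(\<Sum>i\<in>{1..n}. \<eta> * (\<integral>x. indicator (S i) x * ln (Z \<eta> x) \<partial>M)) = \<eta> * log_partition \<eta>"
        by (simp add: sum_distrib_left)
    qed
  qed
qed

section \<open>The mass defect of the Gibbs density\<close>

lemma gibbs_cell_integrable:
  assumes "i \<in> {1..n}" "l \<in> {1..n}"
  shows "integrable M (\<lambda>x. indicator (S i) x * gibbs \<eta> l x)"
proof (rule bounded_integrable[where C=1])
  show "(\<lambda>x. indicator (S i) x * gibbs \<eta> l x) \<in> borel_measurable M"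
    using Sm[OF assms(1)] gibbs_measurable[OF assms(2)] by simp
  show "\<bar>indicator (S i) x * gibbs \<eta> l x\<bar> \<le> 1" if "x \<in> space M" for x
    using gibbs_le1[OF that assms(2), of \<eta>] gibbs_pos[OF that, of \<eta> l] by (auto simp: indicator_def)
qed

text \<open>On cell i the Gibbs weight of j is a/(1 + a + r), with a the exponential for j and r the
  sum of those for the remaining atoms. It differs from the two-cell value a/(1 + a) by at most a r,
  again a sum over pairs of neighbours.\<close>

lemma gibbs_cell_limit:
  obtains I where "\<And>i j. i \<in> {1..n} \<Longrightarrow> j \<in> {1..n} \<Longrightarrow> i \<noteq> j \<Longrightarrow>
    ((\<lambda>\<eta>. \<eta> * (\<integral>x. indicator (S i) x * gibbs \<eta> j x \<partial>M)) \<longlongrightarrow> \<kappa> i j * I) at_top"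
proof -
  have "\<exists>I. \<forall>i\<in>{1..n}. \<forall>j\<in>{1..n}. i \<noteq> j \<longrightarrow>
    ((\<lambda>\<eta>. \<eta> * (\<integral>x. indicator (S i) x * (1 / (1 + exp (\<eta> * \<Delta> j x))) \<partial>M)) \<longlongrightarrow> \<kappa> i j * I) at_top"
  \<comment> \<open>The constant is extracted from \<open>pair_limit\<close>, which needs an actual
    pair; with a single atom the claim is vacuous.\<close>
  proof (cases "\<exists>i\<in>{1..n}. \<exists>j\<in>{1..n}. i \<noteq> j")
    case True
    then obtain i j where ij: "i \<in> {1..n}" "j \<in> {1..n}" "i \<noteq> j" by blast
    obtain I where I: "\<And>T \<kappa>' j. j \<in> {1..n} \<Longrightarrow> T \<in> sets M \<Longrightarrow> ((\<lambda>t. prob {x\<in>T. \<Delta> j x \<le> t} / t) \<longlongrightarrow> \<kappa>') (at_right 0) \<Longrightarrow>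
      ((\<lambda>\<eta>. \<eta> * (\<integral>x. indicator T x * (1 / (1 + exp (\<eta> * \<Delta> j x))) \<partial>M)) \<longlongrightarrow> \<kappa>' * I) at_top"
      using pair_limit(3)[OF ij(1,2) Sm[OF ij(1)] order_refl ratio[OF ij]] by blast
    show ?thesis
    proof (intro exI[of _ I] ballI impI)
      fix i j assume ij: "i \<in> {1..n}" "j \<in> {1..n}" "i \<noteq> j"
      show "((\<lambda>\<eta>. \<eta> * (\<integral>x. indicator (S i) x * (1 / (1 + exp (\<eta> * \<Delta> j x))) \<partial>M)) \<longlongrightarrow> \<kappa> i j * I) at_top"
        by (rule I[OF ij(2) Sm[OF ij(1)] ratio[OF ij]])
    qed
  next
    case False
    then show ?thesis by (intro exI[of _ 0]) blast
  qed
  then obtain I where I: "\<And>i j. i \<in> {1..n} \<Longrightarrow> j \<in> {1..n} \<Longrightarrow> i \<noteq> j \<Longrightarrow>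
    ((\<lambda>\<eta>. \<eta> * (\<integral>x. indicator (S i) x * (1 / (1 + exp (\<eta> * \<Delta> j x))) \<partial>M)) \<longlongrightarrow> \<kappa> i j * I) at_top" by blast
  have "((\<lambda>\<eta>. \<eta> * (\<integral>x. indicator (S i) x * gibbs \<eta> j x \<partial>M)) \<longlongrightarrow> \<kappa> i j * I) at_top"
    if i: "i \<in> {1..n}" and j: "j \<in> {1..n}" and ne: "i \<noteq> j" for i j
  proof -
    let ?J = "{1..n} - {i}"
    note [measurable] = Sm[OF i] Dm[OF j] gibbs_measurable[OF j]
    define A where "A \<eta> = \<eta> * (\<integral>x. indicator (S i) x * (1 / (1 + exp (\<eta> * \<Delta> j x))) \<partial>M)" for \<eta>
    define E where "E \<eta> = \<eta> * (\<integral>x. indicator (S i) x * (\<Sum>j\<in>?J. \<Sum>k\<in>?J - {j}. exp (- (\<eta> * \<Delta> j x)) * exp (- (\<eta> * \<Delta> k x))) \<partial>M)" for \<eta>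
    have Elim: "(E \<longlongrightarrow> 0) at_top" unfolding E_def by (rule pairs_negligible[OF i]) simp
    have bnd: "A \<eta> - E \<eta> \<le> \<eta> * (\<integral>x. indicator (S i) x * gibbs \<eta> j x \<partial>M) \<and>
      \<eta> * (\<integral>x. indicator (S i) x * gibbs \<eta> j x \<partial>M) \<le> A \<eta>" if \<eta>: "0 \<le> \<eta>" for \<eta>
    proof -
      define a where "a j x = exp (- (\<eta> * \<Delta> j x))" for j x
      have am[measurable]: "j \<in> {1..n} \<Longrightarrow> a j \<in> borel_measurable M" for j
        unfolding a_def[abs_def] by simp
      have a01: "0 \<le> a j x" "j \<in> {1..n} \<Longrightarrow> a j x \<le> 1" for j x
        using exp_le1[OF _ \<eta>] by (auto simp: a_def)
      have i1: "integrable M (\<lambda>x. indicator (S i) x * (1 / (1 + exp (\<eta> * \<Delta> j x))))"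
      proof (rule bounded_integrable[where C=1])
        fix x show "\<bar>indicator (S i) x * (1 / (1 + exp (\<eta> * \<Delta> j x)))\<bar> \<le> 1"
          using exp_gt_zero[of "\<eta> * \<Delta> j x"] by (auto simp: indicator_def add_pos_pos)
      qed simp
      have dm: "(\<lambda>x. \<Sum>j\<in>?J. \<Sum>k\<in>?J - {j}. a j x * a k x) \<in> borel_measurable M"
        by (intro borel_measurable_sum) auto
      have dn: "0 \<le> (\<Sum>j\<in>?J. \<Sum>k\<in>?J - {j}. a j x * a k x)" for x
        using a01 by (intro sum_nonneg) auto
      have i3: "integrable M (\<lambda>x. indicator (S i) x * (\<Sum>j\<in>?J. \<Sum>k\<in>?J - {j}. a j x * a k x))"
      proof (rule bounded_integrable[where C="\<Sum>j\<in>?J. \<Sum>k\<in>?J - {j}. 1"])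
        fix x assume x: "x \<in> space M"
        have "(\<Sum>j\<in>?J. \<Sum>k\<in>?J - {j}. a j x * a k x) \<le> (\<Sum>j\<in>?J. \<Sum>k\<in>?J - {j}. 1)"
          using a01 by (intro sum_mono mult_le_one) auto
        then show "\<bar>indicator (S i) x * (\<Sum>j\<in>?J. \<Sum>k\<in>?J - {j}. a j x * a k x)\<bar> \<le> (\<Sum>j\<in>?J. \<Sum>k\<in>?J - {j}. 1)"
          using dn[of x] by (auto simp: indicator_def)
      qed (use dm in simp)
      have pt: "indicator (S i) x * gibbs \<eta> j x \<le> indicator (S i) x * (1 / (1 + exp (\<eta> * \<Delta> j x))) \<and>
        indicator (S i) x * (1 / (1 + exp (\<eta> * \<Delta> j x))) - indicator (S i) x * (\<Sum>j\<in>?J. \<Sum>k\<in>?J - {j}. a j x * a k x)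
          \<le> indicator (S i) x * gibbs \<eta> j x" for x
      proof (cases "x \<in> S i")
        case True
        have jJ: "j \<in> ?J" using j ne by auto
        define r where "r = (\<Sum>k\<in>?J - {j}. a k x)"
        have r: "0 \<le> r" unfolding r_def using a01 by (intro sum_nonneg) auto
        have Zx: "Z \<eta> x = 1 + (a j x + r)"
          using Z_cell[OF i True, of \<eta>] jJ unfolding r_def a_def by (subst sum.remove[of _ j, symmetric]) auto
        have ex: "1 / (1 + exp (\<eta> * \<Delta> j x)) = a j x / (1 + a j x)"
          using exp_gt_zero[of "\<eta> * \<Delta> j x"] by (simp add: a_def exp_minus divide_simps add_pos_pos)
        have gx: "gibbs \<eta> j x = a j x / (1 + (a j x + r))" by (simp add: gibbs_def Zx a_def)
        have up: "a j x / (1 + (a j x + r)) \<le> a j x / (1 + a j x)"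
          using a01(1)[of j x] r by (intro divide_left_mono) (auto intro: mult_pos_pos add_pos_nonneg)
        have "a j x / (1 + a j x) - a j x / (1 + (a j x + r)) = a j x * r / ((1 + a j x) * (1 + (a j x + r)))"
          using a01(1)[of j x] r by (subst diff_frac_eq) (auto simp: algebra_simps add_nonneg_eq_0_iff)
        also have "\<dots> \<le> a j x * r / 1"
        proof (rule divide_left_mono)
          have "1 * 1 \<le> (1 + a j x) * (1 + (a j x + r))"
            using a01(1)[of j x] r by (intro mult_mono) auto
          then show "1 \<le> (1 + a j x) * (1 + (a j x + r))" by simp
          then show "0 < (1 + a j x) * (1 + (a j x + r)) * 1" by linarith
        qed (use a01(1)[of j x] r in simp)
        also have "a j x * r = (\<Sum>k\<in>?J - {j}. a j x * a k x)" by (simp add: r_def sum_distrib_left)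
        also have "(\<Sum>k\<in>?J - {j}. a j x * a k x) / 1 \<le> (\<Sum>j\<in>?J. \<Sum>k\<in>?J - {j}. a j x * a k x)"
          unfolding div_by_1
          by (rule member_le_sum[of j ?J "\<lambda>j. \<Sum>k\<in>?J - {j}. a j x * a k x"])
             (use jJ a01(1) in \<open>auto intro!: sum_nonneg\<close>)
        finally show ?thesis using True up by (simp add: ex gx)
      qed simp
      have "(\<integral>x. indicator (S i) x * gibbs \<eta> j x \<partial>M) \<le> (\<integral>x. indicator (S i) x * (1 / (1 + exp (\<eta> * \<Delta> j x))) \<partial>M)"
        using pt by (intro integral_mono gibbs_cell_integrable i j i1) auto
      moreover have "(\<integral>x. indicator (S i) x * (1 / (1 + exp (\<eta> * \<Delta> j x))) \<partial>M)
          - (\<integral>x. indicator (S i) x * (\<Sum>j\<in>?J. \<Sum>k\<in>?J - {j}. a j x * a k x) \<partial>M) \<le> (\<integral>x. indicator (S i) x * gibbs \<eta> j x \<partial>M)"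
        unfolding Bochner_Integration.integral_diff[OF i1 i3, symmetric]
        using pt by (intro integral_mono gibbs_cell_integrable i j Bochner_Integration.integrable_diff i1 i3) auto
      ultimately show ?thesis
        using \<eta> unfolding A_def E_def a_def[symmetric] right_diff_distrib[symmetric]
        by (auto intro!: mult_left_mono)
    qed
    have Alim: "(A \<longlongrightarrow> \<kappa> i j * I) at_top" unfolding A_def by (rule I[OF i j ne])
    show ?thesis
    proof (rule tendsto_sandwich[where f="\<lambda>\<eta>. A \<eta> - E \<eta>" and h=A])
      show "((\<lambda>\<eta>. A \<eta> - E \<eta>) \<longlongrightarrow> \<kappa> i j * I) at_top"
        using tendsto_diff[OF Alim Elim] by simp
    qed (use bnd Alim in \<open>auto intro: eventually_mono[OF eventually_ge_at_top[of 0]]\<close>)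
  qed
  then show ?thesis using that by blast
qed

definition defect :: "nat \<Rightarrow> real \<Rightarrow> real" where
  "defect i \<eta> = p i - (\<integral>x. gibbs \<eta> i x \<partial>M)"

text \<open>As the Gibbs weights sum to one, the defect at i is the mass leaking from cell i to the
  other atoms minus the mass leaking from the other cells to atom i. After multiplication by \<eta>
  the two flows through the facet with j tend to \<kappa> i j I and \<kappa> j i I, which agree by
  symmetry of \<kappa>.\<close>

lemma defect_limit:
  assumes i: "i \<in> {1..n}"
  shows "((\<lambda>\<eta>. \<eta> * defect i \<eta>) \<longlongrightarrow> 0) at_top"
proof -
  obtain I where I: "\<And>i j. i \<in> {1..n} \<Longrightarrow> j \<in> {1..n} \<Longrightarrow> i \<noteq> j \<Longrightarrow>
    ((\<lambda>\<eta>. \<eta> * (\<integral>x. indicator (S i) x * gibbs \<eta> j x \<partial>M)) \<longlongrightarrow> \<kappa> i j * I) at_top"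
    using gibbs_cell_limit by blast
  let ?J = "{1..n} - {i}"
  let ?c = "\<lambda>\<eta> i j. \<integral>x. indicator (S i) x * gibbs \<eta> j x \<partial>M"
  have eq: "\<eta> * defect i \<eta> = (\<Sum>j\<in>?J. \<eta> * ?c \<eta> i j - \<eta> * ?c \<eta> j i)" for \<eta>
  proof -
    have "(\<integral>x. gibbs \<eta> i x \<partial>M) = (\<Sum>j\<in>{1..n}. ?c \<eta> j i)"
      by (rule integral_cells[where C=1])
         (use i gibbs_le1[of _ i \<eta>] gibbs_pos[of _ \<eta> i] in \<open>auto simp: less_imp_le\<close>)
    also have "\<dots> = ?c \<eta> i i + (\<Sum>j\<in>?J. ?c \<eta> j i)" using i by (subst sum.remove[of _ i]) auto
    finally have 1: "(\<integral>x. gibbs \<eta> i x \<partial>M) = ?c \<eta> i i + (\<Sum>j\<in>?J. ?c \<eta> j i)" .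
    have "p i = (\<integral>x. indicator (S i) x \<partial>M)" using i mass[OF i] by simp
    also have "\<dots> = (\<integral>x. (\<Sum>j\<in>{1..n}. indicator (S i) x * gibbs \<eta> j x) \<partial>M)"
    proof (rule Bochner_Integration.integral_cong)
      fix x assume "x \<in> space M"
      then show "indicator (S i) x = (\<Sum>j\<in>{1..n}. indicator (S i) x * gibbs \<eta> j x)"
        by (simp only: sum_distrib_left[symmetric] gibbs_sum mult_1_right)
    qed simp
    also have "\<dots> = (\<Sum>j\<in>{1..n}. ?c \<eta> i j)"
      by (rule Bochner_Integration.integral_sum) (use i gibbs_cell_integrable in auto)
    also have "\<dots> = ?c \<eta> i i + (\<Sum>j\<in>?J. ?c \<eta> i j)" using i by (subst sum.remove[of _ i]) auto
    finally show ?thesis using 1 by (simp add: defect_def sum_subtractf sum_distrib_left[symmetric] right_diff_distrib)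
  qed
  have "((\<lambda>\<eta>. \<Sum>j\<in>?J. \<eta> * ?c \<eta> i j - \<eta> * ?c \<eta> j i) \<longlongrightarrow> (\<Sum>j\<in>?J. \<kappa> i j * I - \<kappa> j i * I)) at_top"
    using i by (intro tendsto_sum tendsto_diff I) auto
  moreover have "(\<Sum>j\<in>?J. \<kappa> i j * I - \<kappa> j i * I) = 0"
    using i sym by (intro sum.neutral) auto
  ultimately show ?thesis by (simp add: eq)
qed

section \<open>Repairing the marginals through the layers\<close>

definition active :: "real \<Rightarrow> nat \<Rightarrow> 'a set" where
  "active \<eta> l = {x\<in>space M. \<Delta> l x \<le> 1 / \<eta> \<and> (\<exists>j\<in>{1..n} - {l}. \<Delta> j x \<le> 1 / \<eta>)}"

definition layer :: "nat \<Rightarrow> nat \<Rightarrow> real \<Rightarrow> 'a set" where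
  "layer i j \<eta> = {x\<in>S i. \<Delta> j x \<le> 1 / \<eta>}"

lemma layer_measurable [measurable]:
  assumes "i \<in> {1..n}" "j \<in> {1..n}"
  shows "layer i j \<eta> \<in> sets M"
proof -
  have "layer i j \<eta> = S i \<inter> {x\<in>space M. \<Delta> j x \<le> 1 / \<eta>}"
    using S_space[OF assms(1)] by (auto simp: layer_def)
  moreover have "{x\<in>space M. \<Delta> j x \<le> 1 / \<eta>} \<in> sets M" using assms(2) by measurable
  ultimately show ?thesis using Sm[OF assms(1)] by auto
qed

lemma active_measurable [measurable]:
  assumes "l \<in> {1..n}"
  shows "active \<eta> l \<in> sets M"
proof -
  have "{x\<in>space M. \<exists>j\<in>{1..n} - {l}. \<Delta> j x \<le> 1 / \<eta>} \<in> sets M"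
    by (intro sets.sets_Collect_finite_Ex) auto
  moreover have "{x\<in>space M. \<Delta> l x \<le> 1 / \<eta>} \<in> sets M" using assms by measurable
  moreover have "active \<eta> l = {x\<in>space M. \<Delta> l x \<le> 1 / \<eta>} \<inter> {x\<in>space M. \<exists>j\<in>{1..n} - {l}. \<Delta> j x \<le> 1 / \<eta>}"
    by (auto simp: active_def)
  ultimately show ?thesis by auto
qed

lemma layer_limit_mass:
  assumes "i \<in> {1..n}" "j \<in> {1..n}" "i \<noteq> j"
  shows "((\<lambda>\<eta>. \<eta> * prob (layer i j \<eta>)) \<longlongrightarrow> \<kappa> i j) at_top"
proof -
  have "filterlim (\<lambda>\<eta>::real. 1 / \<eta>) (at_right 0) at_top"
    using filterlim_inverse_at_right_top by (simp add: inverse_eq_divide)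
  from filterlim_compose[OF ratio[OF assms] this] show ?thesis
    by (simp add: layer_def mult.commute)
qed

lemma active_prob_le:
  assumes l: "l \<in> {1..n}" and \<eta>: "0 < \<eta>"
  shows "prob (active \<eta> l) \<le> (\<Sum>i\<in>{1..n}. \<Sum>j\<in>{1..n} - {i}. prob (layer i j \<eta>))"
proof -
  have sub: "active \<eta> l \<subseteq> (\<Union>i\<in>{1..n}. \<Union>j\<in>{1..n} - {i}. layer i j \<eta>)"
  proof
    fix x assume x: "x \<in> active \<eta> l"
    then have xs: "x \<in> space M" by (simp add: active_def)
    obtain i where i: "i \<in> {1..n}" "\<Delta> i x = 0" using cover[OF xs] by blast
    then have xi: "x \<in> S i" using xs by (simp add: Sdef)
    have "\<exists>j\<in>{1..n} - {i}. \<Delta> j x \<le> 1 / \<eta>"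
    proof (cases "i = l")
      case True
      then show ?thesis using x by (auto simp: active_def)
    next
      case False
      then show ?thesis using x l by (auto simp: active_def)
    qed
    then show "x \<in> (\<Union>i\<in>{1..n}. \<Union>j\<in>{1..n} - {i}. layer i j \<eta>)" using i(1) xi by (auto simp: layer_def)
  qed
  have "prob (active \<eta> l) \<le> prob (\<Union>i\<in>{1..n}. \<Union>j\<in>{1..n} - {i}. layer i j \<eta>)"
    by (rule finite_measure_mono[OF sub]) (intro sets.finite_UN layer_measurable, auto)
  also have "\<dots> \<le> (\<Sum>i\<in>{1..n}. prob (\<Union>j\<in>{1..n} - {i}. layer i j \<eta>))"
    by (intro measure_UNION_le sets.finite_UN layer_measurable) auto
  also have "\<dots> \<le> (\<Sum>i\<in>{1..n}. \<Sum>j\<in>{1..n} - {i}. prob (layer i j \<eta>))"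
    by (intro sum_mono measure_UNION_le layer_measurable) auto
  finally show ?thesis .
qed

text \<open>A lower bound for the Gibbs density of l on \<open>active \<eta> l\<close>: there \<eta>
  \<Delta> l is at most one, and the partition function never exceeds n. The second condition in
  \<open>active\<close>, that another atom competes too, keeps the mass of the set of order
  1/\<eta>.\<close>

definition c0 :: real where "c0 = exp (- 1) / real n"

lemma c0: "0 < c0" "c0 \<le> 1"
proof -
  have "exp (- 1) / real n \<le> 1 / 1" using n_pos by (intro frac_le) auto
  then show "0 < c0" "c0 \<le> 1" using n_pos by (auto simp: c0_def)
qed

lemma gibbs_active:
  assumes "x \<in> active \<eta> l" "0 < \<eta>"
  shows "c0 \<le> gibbs \<eta> l x"
proof -
  have x: "x \<in> space M" "\<eta> * \<Delta> l x \<le> 1" using assms by (auto simp: active_def field_simps)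
  show ?thesis unfolding c0_def gibbs_def
    using x Z_ge1[OF x(1), of \<eta>] Z_le[of \<eta> x] assms(2) by (intro frac_le) auto
qed

text \<open>A perturbation \<open>r\<close> of the densities that moves unit mass from \<open>b\<close> to \<open>a\<close> and lives where
  the Gibbs density is bounded away from zero.\<close>

definition transfers :: "nat \<Rightarrow> nat \<Rightarrow> real \<Rightarrow> (real \<Rightarrow> nat \<Rightarrow> 'a \<Rightarrow> real) \<Rightarrow> bool" where
  "transfers a b C r \<longleftrightarrow> 0 \<le> C \<and> (\<forall>\<^sub>F \<eta> in at_top.
     (\<forall>l\<in>{1..n}. r \<eta> l \<in> borel_measurable M \<and> (\<integral>x. r \<eta> l x \<partial>M) = of_bool (l = a) - of_bool (l = b)
        \<and> (\<forall>x\<in>space M. \<bar>r \<eta> l x\<bar> \<le> C * \<eta> * indicator (active \<eta> l) x))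
     \<and> (\<forall>x\<in>space M. (\<Sum>l\<in>{1..n}. r \<eta> l x) = 0))"

lemma transfers_refl: "transfers a a 0 (\<lambda>_ _ _. 0)"
  by (simp add: transfers_def)

lemma transfers_trans:
  assumes "transfers a b C r" "transfers b c D s"
  shows "transfers a c (C + D) (\<lambda>\<eta> l x. r \<eta> l x + s \<eta> l x)"
proof -
  have CD: "0 \<le> C" "0 \<le> D" using assms by (auto simp: transfers_def)
  note ev = assms[unfolded transfers_def, THEN conjunct2]
  show ?thesis
    unfolding transfers_def
  proof (intro conjI)
    show "0 \<le> C + D" using CD by simp
    show "\<forall>\<^sub>F \<eta> in at_top.
     (\<forall>l\<in>{1..n}. (\<lambda>x. r \<eta> l x + s \<eta> l x) \<in> borel_measurable M \<and> (\<integral>x. r \<eta> l x + s \<eta> l x \<partial>M) = of_bool (l = a) - of_bool (l = c)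
        \<and> (\<forall>x\<in>space M. \<bar>r \<eta> l x + s \<eta> l x\<bar> \<le> (C + D) * \<eta> * indicator (active \<eta> l) x))
     \<and> (\<forall>x\<in>space M. (\<Sum>l\<in>{1..n}. r \<eta> l x + s \<eta> l x) = 0)"
      using ev(1) ev(2) eventually_ge_at_top[of 0]
    proof eventually_elim
      fix \<eta> :: real
      assume r: "(\<forall>l\<in>{1..n}. r \<eta> l \<in> borel_measurable M \<and> (\<integral>x. r \<eta> l x \<partial>M) = of_bool (l = a) - of_bool (l = b)
        \<and> (\<forall>x\<in>space M. \<bar>r \<eta> l x\<bar> \<le> C * \<eta> * indicator (active \<eta> l) x))
        \<and> (\<forall>x\<in>space M. (\<Sum>l\<in>{1..n}. r \<eta> l x) = 0)"
      assume s: "(\<forall>l\<in>{1..n}. s \<eta> l \<in> borel_measurable M \<and> (\<integral>x. s \<eta> l x \<partial>M) = of_bool (l = b) - of_bool (l = c)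
        \<and> (\<forall>x\<in>space M. \<bar>s \<eta> l x\<bar> \<le> D * \<eta> * indicator (active \<eta> l) x))
        \<and> (\<forall>x\<in>space M. (\<Sum>l\<in>{1..n}. s \<eta> l x) = 0)"
      assume \<eta>: "0 \<le> \<eta>"
      have int: "integrable M u" if "u \<in> borel_measurable M" "\<And>x. x \<in> space M \<Longrightarrow> \<bar>u x\<bar> \<le> E * \<eta> * indicator A x" "0 \<le> E"
        for u E and A :: "'a set"
      proof (rule bounded_integrable[OF that(1)])
        fix x assume "x \<in> space M"
        then show "\<bar>u x\<bar> \<le> E * \<eta>" using that(2)[of x] mult_nonneg_nonneg[OF that(3) \<eta>] by (cases "x \<in> A") auto
      qed
      show "(\<forall>l\<in>{1..n}. (\<lambda>x. r \<eta> l x + s \<eta> l x) \<in> borel_measurable M \<and> (\<integral>x. r \<eta> l x + s \<eta> l x \<partial>M) = of_bool (l = a) - of_bool (l = c)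
        \<and> (\<forall>x\<in>space M. \<bar>r \<eta> l x + s \<eta> l x\<bar> \<le> (C + D) * \<eta> * indicator (active \<eta> l) x))
        \<and> (\<forall>x\<in>space M. (\<Sum>l\<in>{1..n}. r \<eta> l x + s \<eta> l x) = 0)"
      proof (intro conjI ballI)
        fix l assume l: "l \<in> {1..n}"
        show "(\<lambda>x. r \<eta> l x + s \<eta> l x) \<in> borel_measurable M"
          using r s l by (intro borel_measurable_add) blast+
        have "integrable M (r \<eta> l)" "integrable M (s \<eta> l)"
          using r s l CD by (auto intro!: int)
        then show "(\<integral>x. r \<eta> l x + s \<eta> l x \<partial>M) = of_bool (l = a) - of_bool (l = c)"
          using r s l by simp
        fix x assume x: "x \<in> space M"
        have "\<bar>r \<eta> l x + s \<eta> l x\<bar> \<le> \<bar>r \<eta> l x\<bar> + \<bar>s \<eta> l x\<bar>" by (rule abs_triangle_ineq)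
        also have "\<dots> \<le> C * \<eta> * indicator (active \<eta> l) x + D * \<eta> * indicator (active \<eta> l) x"
          using r s l x by (intro add_mono) auto
        finally show "\<bar>r \<eta> l x + s \<eta> l x\<bar> \<le> (C + D) * \<eta> * indicator (active \<eta> l) x" by (simp add: algebra_simps)
      next
        fix x assume "x \<in> space M"
        then show "(\<Sum>l\<in>{1..n}. r \<eta> l x + s \<eta> l x) = 0" using r s by (simp add: sum.distrib)
      qed
    qed
  qed
qed

text \<open>Inside the layer of cell i along the facet with j, probability is shifted from j to i,
  uniformly in x. Moving unit mass needs a density of 1 over the mass of the layer, and positivity
  of \<kappa> i j keeps that mass above \<kappa> i j / (2 \<eta>) eventually; hence the bound linear
  in \<eta>.\<close>

lemma transfers_edge:
  assumes i: "i \<in> {1..n}" and j: "j \<in> {1..n}" and ne: "i \<noteq> j" and pos: "0 < \<kappa> i j"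
  shows "transfers i j (2 / \<kappa> i j)
    (\<lambda>\<eta> l x. (of_bool (l = i) - of_bool (l = j)) * indicator (layer i j \<eta>) x / prob (layer i j \<eta>))"
  unfolding transfers_def
proof (intro conjI)
  show "0 \<le> 2 / \<kappa> i j" using pos by simp
  have "\<forall>\<^sub>F \<eta> in at_top. \<kappa> i j / 2 < \<eta> * prob (layer i j \<eta>)"
    using pos by (intro order_tendstoD(1)[OF layer_limit_mass[OF i j ne]]) simp
  then show "\<forall>\<^sub>F \<eta> in at_top.
     (\<forall>l\<in>{1..n}. (\<lambda>x. (of_bool (l = i) - of_bool (l = j)) * indicator (layer i j \<eta>) x / prob (layer i j \<eta>)) \<in> borel_measurable M
        \<and> (\<integral>x. (of_bool (l = i) - of_bool (l = j)) * indicator (layer i j \<eta>) x / prob (layer i j \<eta>) \<partial>M) = of_bool (l = i) - of_bool (l = j)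
        \<and> (\<forall>x\<in>space M. \<bar>(of_bool (l = i) - of_bool (l = j)) * indicator (layer i j \<eta>) x / prob (layer i j \<eta>)\<bar>
             \<le> 2 / \<kappa> i j * \<eta> * indicator (active \<eta> l) x))
     \<and> (\<forall>x\<in>space M. (\<Sum>l\<in>{1..n}. (of_bool (l = i) - of_bool (l = j)) * indicator (layer i j \<eta>) x / prob (layer i j \<eta>)) = 0)"
    using eventually_gt_at_top[of 0]
  proof eventually_elim
    fix \<eta> :: real assume lt: "\<kappa> i j / 2 < \<eta> * prob (layer i j \<eta>)" and \<eta>: "0 < \<eta>"
    define b where "b = prob (layer i j \<eta>)"
    have "0 < \<eta> * b" using lt pos by (simp add: b_def)
    then have b: "0 < b" using \<eta> by (simp add: zero_less_mult_iff)
    have ib: "1 / b \<le> 2 / \<kappa> i j * \<eta>" using lt b pos by (simp add: b_def[symmetric] field_simps)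
    note [measurable] = layer_measurable[OF i j]
    show "(\<forall>l\<in>{1..n}. (\<lambda>x. (of_bool (l = i) - of_bool (l = j)) * indicator (layer i j \<eta>) x / prob (layer i j \<eta>)) \<in> borel_measurable M
        \<and> (\<integral>x. (of_bool (l = i) - of_bool (l = j)) * indicator (layer i j \<eta>) x / prob (layer i j \<eta>) \<partial>M) = of_bool (l = i) - of_bool (l = j)
        \<and> (\<forall>x\<in>space M. \<bar>(of_bool (l = i) - of_bool (l = j)) * indicator (layer i j \<eta>) x / prob (layer i j \<eta>)\<bar>
             \<le> 2 / \<kappa> i j * \<eta> * indicator (active \<eta> l) x))
     \<and> (\<forall>x\<in>space M. (\<Sum>l\<in>{1..n}. (of_bool (l = i) - of_bool (l = j)) * indicator (layer i j \<eta>) x / prob (layer i j \<eta>)) = 0)"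
      unfolding b_def[symmetric]
    proof (intro conjI ballI)
      fix l assume l: "l \<in> {1..n}"
      show "(\<lambda>x. (of_bool (l = i) - of_bool (l = j)) * indicator (layer i j \<eta>) x / b) \<in> borel_measurable M" by measurable
      show "(\<integral>x. (of_bool (l = i) - of_bool (l = j)) * indicator (layer i j \<eta>) x / b \<partial>M) = of_bool (l = i) - of_bool (l = j)"
        using b layer_measurable[OF i j, of \<eta>] sets.sets_into_space[OF layer_measurable[OF i j, of \<eta>]]
        by (simp add: b_def Int_absorb2)
      fix x assume x: "x \<in> space M"
      show "\<bar>(of_bool (l = i) - of_bool (l = j)) * indicator (layer i j \<eta>) x / b\<bar> \<le> 2 / \<kappa> i j * \<eta> * indicator (active \<eta> l) x"
      proof (cases "x \<in> layer i j \<eta> \<and> (l = i \<or> l = j)")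
        case True
        then have "\<Delta> i x = 0" "\<Delta> j x \<le> 1 / \<eta>" using S_space[OF i] by (auto simp: layer_def)
        then have d: "\<Delta> i x \<le> 1 / \<eta>" "\<Delta> j x \<le> 1 / \<eta>" using \<eta> by auto
        have "x \<in> active \<eta> l"
        proof (cases "l = i")
          case True
          then show ?thesis using d x j ne by (auto simp: active_def intro!: bexI[of _ j])
        next
          case False
          then have "l = j" using \<open>x \<in> layer i j \<eta> \<and> (l = i \<or> l = j)\<close> by simp
          then show ?thesis using d x i ne by (auto simp: active_def intro!: bexI[of _ i])
        qed
        then show ?thesis using True ib b ne by auto
      next
        case False
        then have "(of_bool (l = i) - of_bool (l = j)) * indicator (layer i j \<eta>) x / b = 0" by auto
        then show ?thesis using pos \<eta> by (simp only:) simp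
      qed
    next
      fix x assume "x \<in> space M"
      have "(\<Sum>l\<in>{1..n}. (of_bool (l = i) - of_bool (l = j)) * indicator (layer i j \<eta>) x / b)
        = ((\<Sum>l\<in>{1..n}. of_bool (l = i)) - (\<Sum>l\<in>{1..n}. of_bool (l = j))) * indicator (layer i j \<eta>) x / b"
        unfolding sum_subtractf[symmetric] sum_distrib_right sum_divide_distrib by (rule refl)
      also have "(\<Sum>l\<in>{1..n}. of_bool (l = i)) = (1::real)" using i by (simp add: of_bool_def)
      also have "(\<Sum>l\<in>{1..n}. of_bool (l = j)) = (1::real)" using j by (simp add: of_bool_def)
      finally show "(\<Sum>l\<in>{1..n}. (of_bool (l = i) - of_bool (l = j)) * indicator (layer i j \<eta>) x / b) = 0" by simp
    qed
  qed
qed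

lemma transfers_exists:
  assumes "a \<in> {1..n}" "b \<in> {1..n}"
  shows "\<exists>C r. transfers a b C r"
  using conn[OF assms]
proof (induction rule: rtrancl_induct)
  case base
  then show ?case using transfers_refl by blast
next
  case (step b c)
  then show ?case using transfers_edge[of b c] transfers_trans by blast
qed

lemma mass_sum: "(\<Sum>i\<in>{1..n}. p i) = 1"
proof -
  have "(\<integral>x. (1::real) \<partial>M) = (\<Sum>i\<in>{1..n}. \<integral>x. indicator (S i) x * 1 \<partial>M)"
    by (rule integral_cells[where C=1]) auto
  then show ?thesis using mass by (simp add: prob_space)
qed

lemma defect_sum: "(\<Sum>i\<in>{1..n}. defect i \<eta>) = 0"
proof -
  have "(\<Sum>i\<in>{1..n}. \<integral>x. gibbs \<eta> i x \<partial>M) = (\<integral>x. (\<Sum>i\<in>{1..n}. gibbs \<eta> i x) \<partial>M)"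
  proof (rule Bochner_Integration.integral_sum[symmetric])
    fix i assume i: "i \<in> {1..n}"
    show "integrable M (gibbs \<eta> i)"
      by (rule bounded_integrable[where C=1])
         (use i gibbs_le1[of _ i \<eta>] gibbs_pos[of _ \<eta> i] in \<open>auto simp: less_imp_le\<close>)
  qed
  also have "\<dots> = (\<integral>x. 1 \<partial>M)"
    by (intro Bochner_Integration.integral_cong refl gibbs_sum)
  also have "\<dots> = 1" by (simp add: prob_space)
  finally show ?thesis unfolding defect_def sum_subtractf mass_sum by simp
qed

text \<open>q is the Gibbs density plus a correction R that restores the marginals. R is a
  combination of transfers with the defects as coefficients, and since a transfer has size O(\<eta>)
  and a defect is o(1/\<eta>), R is uniformly o(1) and lives on the active sets. Relative to the
  Gibbs density its entropy is at most the integral of R + R^2/gibbs: the linear term sums to zero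
  over the atoms, and the quadratic one is bounded by \<theta>^2/c0 on sets of mass O(1/\<eta>).
  Multiplied by \<eta>, this tends to zero.\<close>

theorem trial_density:
  obtains q :: "real \<Rightarrow> nat \<Rightarrow> 'a \<Rightarrow> real" and \<epsilon> :: "real \<Rightarrow> real"
  where "(\<epsilon> \<longlongrightarrow> 0) at_top"
    and "\<forall>\<^sub>F \<eta> in at_top. (\<forall>l\<in>{1..n}. q \<eta> l \<in> borel_measurable M \<and> (\<integral>x. q \<eta> l x \<partial>M) = p l \<and>
           (\<forall>x\<in>space M. 0 \<le> q \<eta> l x \<and> q \<eta> l x * (\<eta> * \<Delta> l x) \<le> 2))
       \<and> (\<forall>x\<in>space M. (\<Sum>l\<in>{1..n}. q \<eta> l x) = 1)
       \<and> \<eta> * (\<integral>x. (\<Sum>l\<in>{1..n}. q \<eta> l x * (\<eta> * \<Delta> l x + ln (q \<eta> l x))) \<partial>M) \<le> - (\<eta> * log_partition \<eta>) + \<epsilon> \<eta>"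
proof -
  have one: "1 \<in> {1..n}" using n_pos by simp
  have "\<forall>a\<in>{1..n}. \<exists>C r. transfers a 1 C r" using transfers_exists one by blast
  then obtain C r where Cr: "\<And>a. a \<in> {1..n} \<Longrightarrow> transfers a 1 (C a) (r a)" by metis
  have C0: "0 \<le> C a" if "a \<in> {1..n}" for a using Cr[OF that] by (simp add: transfers_def)
  \<comment> \<open>\<theta> is the uniform bound for |R|: each transfer is bounded by
    \<open>C a * \<eta>\<close>, and this \<eta> is paired with the defect, whose product with it
    vanishes in the limit.\<close>
  define \<theta> where "\<theta> \<eta> = (\<Sum>a\<in>{1..n}. \<bar>\<eta> * defect a \<eta>\<bar> * C a)" for \<eta>
  have "((\<lambda>\<eta>. \<Sum>a\<in>{1..n}. \<bar>\<eta> * defect a \<eta>\<bar> * C a) \<longlongrightarrow> (\<Sum>a\<in>{1..n}. \<bar>0\<bar> * C a)) at_top"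
    by (intro tendsto_sum tendsto_mult tendsto_rabs defect_limit tendsto_const)
  then have \<theta>lim: "(\<theta> \<longlongrightarrow> 0) at_top" by (simp add: \<theta>_def[abs_def])
  define L where "L \<eta> = (\<Sum>i\<in>{1..n}. \<Sum>j\<in>{1..n} - {i}. \<eta> * prob (layer i j \<eta>))" for \<eta>
  have Llim: "(L \<longlongrightarrow> (\<Sum>i\<in>{1..n}. \<Sum>j\<in>{1..n} - {i}. \<kappa> i j)) at_top"
    unfolding L_def[abs_def] by (intro tendsto_sum layer_limit_mass) auto
  define \<epsilon> where "\<epsilon> \<eta> = (\<theta> \<eta>)\<^sup>2 / c0 * (real n * L \<eta>)" for \<eta>
  have \<epsilon>lim: "(\<epsilon> \<longlongrightarrow> 0) at_top"
  proof -
    have "((\<lambda>\<eta>. (\<theta> \<eta>)\<^sup>2 / c0 * (real n * L \<eta>)) \<longlongrightarrow> 0\<^sup>2 / c0 * (real n * (\<Sum>i\<in>{1..n}. \<Sum>j\<in>{1..n} - {i}. \<kappa> i j))) at_top"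
      using c0 by (intro tendsto_intros \<theta>lim Llim) auto
    then show ?thesis by (simp add: \<epsilon>_def[abs_def])
  qed
  define R where "R \<eta> l x = (\<Sum>a\<in>{1..n}. defect a \<eta> * r a \<eta> l x)" for \<eta> l x
  define q where "q \<eta> l x = gibbs \<eta> l x + R \<eta> l x" for \<eta> l x
  have "\<forall>\<^sub>F \<eta> in at_top. \<forall>a\<in>{1..n}. (\<forall>l\<in>{1..n}. r a \<eta> l \<in> borel_measurable M \<and> (\<integral>x. r a \<eta> l x \<partial>M) = of_bool (l = a) - of_bool (l = 1)
        \<and> (\<forall>x\<in>space M. \<bar>r a \<eta> l x\<bar> \<le> C a * \<eta> * indicator (active \<eta> l) x))
     \<and> (\<forall>x\<in>space M. (\<Sum>l\<in>{1..n}. r a \<eta> l x) = 0)"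
    using Cr by (intro eventually_ball_finite) (auto simp: transfers_def)
  moreover have "\<forall>\<^sub>F \<eta> in at_top. \<theta> \<eta> < c0" using order_tendstoD(2)[OF \<theta>lim c0(1)] .
  ultimately have "\<forall>\<^sub>F \<eta> in at_top. (\<forall>l\<in>{1..n}. q \<eta> l \<in> borel_measurable M \<and> (\<integral>x. q \<eta> l x \<partial>M) = p l \<and>
           (\<forall>x\<in>space M. 0 \<le> q \<eta> l x \<and> q \<eta> l x * (\<eta> * \<Delta> l x) \<le> 2))
       \<and> (\<forall>x\<in>space M. (\<Sum>l\<in>{1..n}. q \<eta> l x) = 1)
       \<and> \<eta> * (\<integral>x. (\<Sum>l\<in>{1..n}. q \<eta> l x * (\<eta> * \<Delta> l x + ln (q \<eta> l x))) \<partial>M) \<le> - (\<eta> * log_partition \<eta>) + \<epsilon> \<eta>"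
    using eventually_gt_at_top[of 0]
  proof eventually_elim
    fix \<eta> :: real
    assume r: "\<forall>a\<in>{1..n}. (\<forall>l\<in>{1..n}. r a \<eta> l \<in> borel_measurable M \<and> (\<integral>x. r a \<eta> l x \<partial>M) = of_bool (l = a) - of_bool (l = 1)
        \<and> (\<forall>x\<in>space M. \<bar>r a \<eta> l x\<bar> \<le> C a * \<eta> * indicator (active \<eta> l) x))
        \<and> (\<forall>x\<in>space M. (\<Sum>l\<in>{1..n}. r a \<eta> l x) = 0)"
      and \<theta>: "\<theta> \<eta> < c0" and \<eta>: "0 < \<eta>"
    have \<theta>0: "0 \<le> \<theta> \<eta>" unfolding \<theta>_def using C0 by (intro sum_nonneg mult_nonneg_nonneg) auto
    have rm: "r a \<eta> l \<in> borel_measurable M" if "a \<in> {1..n}" "l \<in> {1..n}" for a l using r that by blast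
    have rb: "\<bar>r a \<eta> l x\<bar> \<le> C a * \<eta> * indicator (active \<eta> l) x" if "a \<in> {1..n}" "l \<in> {1..n}" "x \<in> space M" for a l x
      using r that by blast
    have Rm: "R \<eta> l \<in> borel_measurable M" if "l \<in> {1..n}" for l
      unfolding R_def[abs_def] using rm that by (intro borel_measurable_sum borel_measurable_times) auto
    have Rb: "\<bar>R \<eta> l x\<bar> \<le> \<theta> \<eta> * indicator (active \<eta> l) x" if l: "l \<in> {1..n}" and x: "x \<in> space M" for l x
    proof -
      have "\<bar>R \<eta> l x\<bar> \<le> (\<Sum>a\<in>{1..n}. \<bar>defect a \<eta> * r a \<eta> l x\<bar>)" unfolding R_def by (rule sum_abs)
      also have "\<dots> \<le> (\<Sum>a\<in>{1..n}. \<bar>defect a \<eta>\<bar> * (C a * \<eta> * indicator (active \<eta> l) x))"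
        unfolding abs_mult using rb l x by (intro sum_mono mult_left_mono) auto
      also have "\<dots> = \<theta> \<eta> * indicator (active \<eta> l) x"
        unfolding \<theta>_def sum_distrib_right using \<eta> by (intro sum.cong refl) (simp add: abs_mult mult_ac)
      finally show ?thesis .
    qed
    have gint: "integrable M (gibbs \<eta> l)" if "l \<in> {1..n}" for l
      by (rule bounded_integrable[where C=1])
         (use that gibbs_le1[of _ l \<eta>] gibbs_pos[of _ \<eta> l] in \<open>auto simp: less_imp_le\<close>)
    have rint: "integrable M (r a \<eta> l)" if "a \<in> {1..n}" "l \<in> {1..n}" for a l
    proof (rule bounded_integrable[OF rm[OF that]])
      fix x assume "x \<in> space M"
      then show "\<bar>r a \<eta> l x\<bar> \<le> C a * \<eta>"
        using rb[OF that, of x] mult_nonneg_nonneg[OF C0[OF that(1)], of \<eta>] \<eta>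
        by (cases "x \<in> active \<eta> l") auto
    qed
    have Rint: "integrable M (R \<eta> l)" if "l \<in> {1..n}" for l
      unfolding R_def[abs_def] using rint that by (intro Bochner_Integration.integrable_sum integrable_mult_right) auto
    \<comment> \<open>Atom 1 is the common source of all transfers. Its own marginal comes out right
      because the defects sum to zero.\<close>
    have Rval: "(\<integral>x. R \<eta> l x \<partial>M) = defect l \<eta>" if l: "l \<in> {1..n}" for l
    proof -
      have "(\<integral>x. R \<eta> l x \<partial>M) = (\<Sum>a\<in>{1..n}. defect a \<eta> * (of_bool (l = a) - of_bool (l = 1)))"
        unfolding R_def using r rint l by (subst Bochner_Integration.integral_sum) auto
      also have "\<dots> = (\<Sum>a\<in>{1..n}. defect a \<eta> * of_bool (l = a)) - (\<Sum>a\<in>{1..n}. defect a \<eta>) * of_bool (l = 1)"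
        by (simp add: right_diff_distrib sum_subtractf sum_distrib_right)
      also have "(\<Sum>a\<in>{1..n}. defect a \<eta> * of_bool (l = a)) = defect l \<eta>"
        using l by (simp add: of_bool_def if_distrib cong: if_cong)
      finally show ?thesis unfolding defect_sum by simp
    qed
    have Rsum: "(\<Sum>l\<in>{1..n}. R \<eta> l x) = 0" if "x \<in> space M" for x
    proof -
      have "(\<Sum>l\<in>{1..n}. R \<eta> l x) = (\<Sum>a\<in>{1..n}. defect a \<eta> * (\<Sum>l\<in>{1..n}. r a \<eta> l x))"
        unfolding R_def sum_distrib_left by (rule sum.swap)
      also have "\<dots> = 0" using r that by (intro sum.neutral) auto
      finally show ?thesis .
    qed
    have qm: "q \<eta> l \<in> borel_measurable M" if "l \<in> {1..n}" for l
      unfolding q_def[abs_def] using that Rm[OF that] by simp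
    have q0: "0 \<le> q \<eta> l x" if l: "l \<in> {1..n}" and x: "x \<in> space M" for l x
    proof (cases "x \<in> active \<eta> l")
      case True
      then show ?thesis using Rb[OF l x] gibbs_active[OF True \<eta>] \<theta> by (simp add: q_def)
    next
      case False
      then show ?thesis using Rb[OF l x] gibbs_pos[OF x, of \<eta> l] by (simp add: q_def)
    qed
    have qsum: "(\<Sum>l\<in>{1..n}. q \<eta> l x) = 1" if "x \<in> space M" for x
      unfolding q_def sum.distrib gibbs_sum[OF that] Rsum[OF that] by simp
    have q1: "q \<eta> l x \<le> 1" if l: "l \<in> {1..n}" and x: "x \<in> space M" for l x
      using member_le_sum[of l "{1..n}" "\<lambda>l. q \<eta> l x"] q0 l x qsum[OF x] by auto
    \<comment> \<open>One unit comes from the Gibbs part, as u exp (- u) \<le> 1, and one from R,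
      which is supported where u \<le> 1 and is itself at most one. The bound later makes the excess
      cost of the trial plan integrable.\<close>
    have q2: "q \<eta> l x * (\<eta> * \<Delta> l x) \<le> 2" if l: "l \<in> {1..n}" and x: "x \<in> space M" for l x
    proof -
      define u where "u = \<eta> * \<Delta> l x"
      have u: "0 \<le> u" using \<eta> D0[OF l] by (simp add: u_def)
      have "gibbs \<eta> l x * u \<le> exp (- u) / 1 * u"
        unfolding gibbs_def u_def[symmetric] using Z_ge1[OF x, of \<eta>] u
        by (intro mult_right_mono divide_left_mono) auto
      also have "\<dots> \<le> 1"
      proof -
        have "u \<le> exp u" using exp_ge_add_one_self[of u] by linarith
        then show ?thesis by (simp add: exp_minus divide_simps)
      qed
      finally have 1: "gibbs \<eta> l x * u \<le> 1" .
      have 2: "R \<eta> l x * u \<le> 1"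
      proof (cases "x \<in> active \<eta> l")
        case True
        then have "u \<le> 1" using \<eta> by (simp add: u_def active_def field_simps)
        moreover have "R \<eta> l x \<le> 1" using Rb[OF l x] True \<theta> c0 by simp
        ultimately have "R \<eta> l x * u \<le> 1 * 1" using u by (intro mult_mono) auto
        then show ?thesis by simp
      next
        case False
        then have "R \<eta> l x = 0" using Rb[OF l x] by simp
        then show ?thesis by simp
      qed
      show ?thesis using 1 2 by (simp add: q_def u_def[symmetric] distrib_right)
    qed
    have pt: "(\<Sum>l\<in>{1..n}. q \<eta> l x * (\<eta> * \<Delta> l x + ln (q \<eta> l x)))
       \<le> - ln (Z \<eta> x) + (\<Sum>l\<in>{1..n}. (\<theta> \<eta>)\<^sup>2 / c0 * indicator (active \<eta> l) x)" if x: "x \<in> space M" for x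
    proof -
      have each: "q \<eta> l x * (\<eta> * \<Delta> l x + ln (q \<eta> l x))
         \<le> - (q \<eta> l x * ln (Z \<eta> x)) + R \<eta> l x + (\<theta> \<eta>)\<^sup>2 / c0 * indicator (active \<eta> l) x" if l: "l \<in> {1..n}" for l
      proof -
        have g: "0 < gibbs \<eta> l x" by (rule gibbs_pos[OF x])
        have lg: "\<eta> * \<Delta> l x = - ln (gibbs \<eta> l x) - ln (Z \<eta> x)"
          using Z_ge1[OF x, of \<eta>] by (simp add: gibbs_def ln_div)
        \<comment> \<open>ln u \<le> u - 1 with u = q/gibbs bounds the entropy by a chi-square
          expression; the case q = 0 holds with equality.\<close>
        have "q \<eta> l x * (ln (q \<eta> l x) - ln (gibbs \<eta> l x)) \<le> R \<eta> l x + (R \<eta> l x)\<^sup>2 / gibbs \<eta> l x"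
        proof (cases "q \<eta> l x = 0")
          case True
          then have "R \<eta> l x = - gibbs \<eta> l x" by (simp add: q_def)
          then show ?thesis using True g by (simp add: power2_eq_square)
        next
          case False
          then have qp: "0 < q \<eta> l x" using q0[OF l x] by simp
          have "ln (q \<eta> l x / gibbs \<eta> l x) \<le> q \<eta> l x / gibbs \<eta> l x - 1" using qp g by (intro ln_le_minus_one) simp
          then have "q \<eta> l x * (ln (q \<eta> l x) - ln (gibbs \<eta> l x)) \<le> q \<eta> l x * (q \<eta> l x / gibbs \<eta> l x - 1)"
            using qp g by (intro mult_left_mono) (auto simp: ln_div)
          also have "\<dots> = R \<eta> l x + (R \<eta> l x)\<^sup>2 / gibbs \<eta> l x"
            using g by (simp add: q_def field_simps power2_eq_square)
          finally show ?thesis .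
        qed
        moreover have "(R \<eta> l x)\<^sup>2 / gibbs \<eta> l x \<le> (\<theta> \<eta>)\<^sup>2 / c0 * indicator (active \<eta> l) x"
        proof (cases "x \<in> active \<eta> l")
          case True
          have "\<bar>R \<eta> l x\<bar> \<le> \<bar>\<theta> \<eta>\<bar>" using Rb[OF l x] True \<theta>0 by simp
          then have "(R \<eta> l x)\<^sup>2 \<le> (\<theta> \<eta>)\<^sup>2" by (simp add: abs_le_square_iff)
          then have "(R \<eta> l x)\<^sup>2 / gibbs \<eta> l x \<le> (\<theta> \<eta>)\<^sup>2 / c0"
            using gibbs_active[OF True \<eta>] c0 by (intro frac_le) auto
          then show ?thesis using True by simp
        next
          case False
          then show ?thesis using Rb[OF l x] by simp
        qed
        ultimately show ?thesis unfolding lg by (simp add: algebra_simps)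
      qed
      have "(\<Sum>l\<in>{1..n}. q \<eta> l x * (\<eta> * \<Delta> l x + ln (q \<eta> l x)))
        \<le> (\<Sum>l\<in>{1..n}. - (q \<eta> l x * ln (Z \<eta> x)) + R \<eta> l x + (\<theta> \<eta>)\<^sup>2 / c0 * indicator (active \<eta> l) x)"
        by (rule sum_mono) (rule each)
      also have "\<dots> = - ((\<Sum>l\<in>{1..n}. q \<eta> l x) * ln (Z \<eta> x)) + (\<Sum>l\<in>{1..n}. R \<eta> l x)
          + (\<Sum>l\<in>{1..n}. (\<theta> \<eta>)\<^sup>2 / c0 * indicator (active \<eta> l) x)"
        by (simp only: sum.distrib sum_negf sum_distrib_right)
      finally show ?thesis unfolding qsum[OF x] Rsum[OF x] by simp
    qed
    have Fint: "integrable M (\<lambda>x. \<Sum>l\<in>{1..n}. q \<eta> l x * (\<eta> * \<Delta> l x + ln (q \<eta> l x)))"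
    proof (intro Bochner_Integration.integrable_sum)
      fix l assume l: "l \<in> {1..n}"
      show "integrable M (\<lambda>x. q \<eta> l x * (\<eta> * \<Delta> l x + ln (q \<eta> l x)))"
      proof (rule bounded_integrable[where C=3])
        show "(\<lambda>x. q \<eta> l x * (\<eta> * \<Delta> l x + ln (q \<eta> l x))) \<in> borel_measurable M"
          using qm[OF l] Dm[OF l] by simp
        fix x assume x: "x \<in> space M"
        have "0 \<le> q \<eta> l x * (\<eta> * \<Delta> l x)" using q0[OF l x] \<eta> D0[OF l] by simp
        then show "\<bar>q \<eta> l x * (\<eta> * \<Delta> l x + ln (q \<eta> l x))\<bar> \<le> 3"
          using q2[OF l x] abs_x_ln_x_le[OF q0[OF l x] q1[OF l x]] by (simp add: distrib_left)
      qed
    qed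
    have lnZint: "integrable M (\<lambda>x. ln (Z \<eta> x))"
    proof (rule bounded_integrable[where C="ln (real n)"])
      fix x assume x: "x \<in> space M"
      show "\<bar>ln (Z \<eta> x)\<bar> \<le> ln (real n)"
        using Z_ge1[OF x, of \<eta>] Z_le[of \<eta> x] \<eta> n_pos by auto
    qed simp
    have Aint: "integrable M (\<lambda>x. \<Sum>l\<in>{1..n}. (\<theta> \<eta>)\<^sup>2 / c0 * indicator (active \<eta> l) x)"
      by (intro Bochner_Integration.integrable_sum integrable_mult_right integrable_real_indicator)
         (auto simp: active_measurable less_top[symmetric])
    have Aval: "(\<integral>x. (\<Sum>l\<in>{1..n}. (\<theta> \<eta>)\<^sup>2 / c0 * indicator (active \<eta> l) x) \<partial>M) = (\<theta> \<eta>)\<^sup>2 / c0 * (\<Sum>l\<in>{1..n}. prob (active \<eta> l))"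
    proof -
      have "(\<integral>x. (\<theta> \<eta>)\<^sup>2 / c0 * indicator (active \<eta> l) x \<partial>M) = (\<theta> \<eta>)\<^sup>2 / c0 * prob (active \<eta> l)" if "l \<in> {1..n}" for l
        using active_measurable[OF that, of \<eta>] sets.sets_into_space[OF active_measurable[OF that, of \<eta>]]
        by (simp add: Int_absorb2)
      moreover have "integrable M (\<lambda>x. (\<theta> \<eta>)\<^sup>2 / c0 * indicator (active \<eta> l) x)" if "l \<in> {1..n}" for l
        using active_measurable[OF that, of \<eta>]
        by (intro integrable_mult_right integrable_real_indicator) (auto simp: less_top[symmetric])
      ultimately show ?thesis by (subst Bochner_Integration.integral_sum) (auto simp: sum_distrib_left)
    qed
    have "(\<integral>x. (\<Sum>l\<in>{1..n}. q \<eta> l x * (\<eta> * \<Delta> l x + ln (q \<eta> l x))) \<partial>M)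
       \<le> (\<integral>x. - ln (Z \<eta> x) + (\<Sum>l\<in>{1..n}. (\<theta> \<eta>)\<^sup>2 / c0 * indicator (active \<eta> l) x) \<partial>M)"
      using pt lnZint Aint by (intro integral_mono Fint) auto
    also have "\<dots> = - log_partition \<eta> + (\<theta> \<eta>)\<^sup>2 / c0 * (\<Sum>l\<in>{1..n}. prob (active \<eta> l))"
      using lnZint Aint by (simp only: Bochner_Integration.integral_add integrable_minus integral_minus Aval log_partition_def)
    finally have "\<eta> * (\<integral>x. (\<Sum>l\<in>{1..n}. q \<eta> l x * (\<eta> * \<Delta> l x + ln (q \<eta> l x))) \<partial>M)
       \<le> \<eta> * (- log_partition \<eta> + (\<theta> \<eta>)\<^sup>2 / c0 * (\<Sum>l\<in>{1..n}. prob (active \<eta> l)))"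
      using \<eta> by (intro mult_left_mono) auto
    also have "\<dots> = - (\<eta> * log_partition \<eta>) + (\<theta> \<eta>)\<^sup>2 / c0 * (\<Sum>l\<in>{1..n}. \<eta> * prob (active \<eta> l))"
      by (simp add: algebra_simps sum_distrib_left)
    also have "(\<theta> \<eta>)\<^sup>2 / c0 * (\<Sum>l\<in>{1..n}. \<eta> * prob (active \<eta> l)) \<le> (\<theta> \<eta>)\<^sup>2 / c0 * (real n * L \<eta>)"
    proof (rule mult_left_mono)
      have "(\<Sum>l\<in>{1..n}. \<eta> * prob (active \<eta> l)) \<le> (\<Sum>l\<in>{1..n}. L \<eta>)"
      proof (rule sum_mono)
        fix l assume "l \<in> {1..n}"
        then have "\<eta> * prob (active \<eta> l) \<le> \<eta> * (\<Sum>i\<in>{1..n}. \<Sum>j\<in>{1..n} - {i}. prob (layer i j \<eta>))"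
          using active_prob_le[of l \<eta>] \<eta> by (intro mult_left_mono) auto
        then show "\<eta> * prob (active \<eta> l) \<le> L \<eta>" unfolding L_def sum_distrib_left .
      qed
      then show "(\<Sum>l\<in>{1..n}. \<eta> * prob (active \<eta> l)) \<le> real n * L \<eta>" by simp
    qed (use c0 in simp)
    finally have cost: "\<eta> * (\<integral>x. (\<Sum>l\<in>{1..n}. q \<eta> l x * (\<eta> * \<Delta> l x + ln (q \<eta> l x))) \<partial>M) \<le> - (\<eta> * log_partition \<eta>) + \<epsilon> \<eta>"
      by (simp add: \<epsilon>_def)
    have qval: "(\<integral>x. q \<eta> l x \<partial>M) = p l" if l: "l \<in> {1..n}" for l
      unfolding q_def using gint[OF l] Rint[OF l] Rval[OF l] by (simp add: defect_def)
    show "(\<forall>l\<in>{1..n}. q \<eta> l \<in> borel_measurable M \<and> (\<integral>x. q \<eta> l x \<partial>M) = p l \<and>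
           (\<forall>x\<in>space M. 0 \<le> q \<eta> l x \<and> q \<eta> l x * (\<eta> * \<Delta> l x) \<le> 2))
       \<and> (\<forall>x\<in>space M. (\<Sum>l\<in>{1..n}. q \<eta> l x) = 1)
       \<and> \<eta> * (\<integral>x. (\<Sum>l\<in>{1..n}. q \<eta> l x * (\<eta> * \<Delta> l x + ln (q \<eta> l x))) \<partial>M) \<le> - (\<eta> * log_partition \<eta>) + \<epsilon> \<eta>"
      using qm qval q0 q2 qsum cost by (intro conjI ballI)
  qed
  with \<epsilon>lim show ?thesis by (rule that)
qed

end

section \<open>Power cells\<close>

text \<open>The quadratic terms cancel, so level sets of a slack are parallel hyperplanes, and a
  slack changes at rate 2 \<open>norm (y i - y j)\<close> per unit of distance.\<close>

lemma slack_affine: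
  "slack y \<gamma> i j x = 2 * ((y i - y j) \<bullet> x) + ((norm (y j))\<^sup>2 - (norm (y i))\<^sup>2 + \<gamma> i - \<gamma> j)"
  unfolding slack_def by (simp add: power2_norm_eq_inner inner_simps inner_commute algebra_simps)

locale power_cells =
  fixes n :: nat and y :: "nat \<Rightarrow> 'a::euclidean_space" and \<gamma> :: "nat \<Rightarrow> real"
    and M :: "'a measure" and \<rho> :: "'a \<Rightarrow> real"
  assumes inj: "inj_on y {1..n}" and n1: "1 \<le> n"
    and M_prob: "prob_space M"
    and density_meas [measurable]: "\<rho> \<in> borel_measurable borel"
    and density_nonneg: "\<And>x. 0 \<le> \<rho> x"
    and M_eq: "M = density lborel (\<lambda>x. ennreal (\<rho> x))"
begin

sublocale prob_space M by (rule M_prob)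

lemma sets_M [simp, measurable_cong]: "sets M = sets borel" by (simp add: M_eq)

lemma space_M [simp]: "space M = UNIV" by (simp add: M_eq)

lemma AE_lborel_M: "AE x in lborel. P x \<Longrightarrow> AE x in M. P x"
  unfolding M_eq by (subst AE_density) auto

lemma emeasure_M: "A \<in> sets borel \<Longrightarrow> emeasure M A = (\<integral>\<^sup>+x. ennreal (\<rho> x) * indicator A x \<partial>lborel)"
  unfolding M_eq by (rule emeasure_density) auto

abbreviation cell :: "nat \<Rightarrow> 'a set" where "cell \<equiv> power_cell n y \<gamma>"

abbreviation h :: "nat \<Rightarrow> nat \<Rightarrow> real \<Rightarrow> real \<Rightarrow> ennreal" where "h \<equiv> slice_integral \<rho> n y \<gamma>"

definition potential :: "'a \<Rightarrow> real" where
  "potential x = Min ((\<lambda>j. (norm (x - y j))\<^sup>2 - \<gamma> j) ` {1..n})"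

text \<open>On cell i, \<open>excess j\<close> coincides with the slack from i to j, but it is
  defined without reference to a cell and is nonnegative everywhere. It rests on
  \<open>potential\<close>, the c-transform of \<gamma>, which takes the place of the given first
  potential.\<close>

definition excess :: "nat \<Rightarrow> 'a \<Rightarrow> real" where
  "excess i x = (norm (x - y i))\<^sup>2 - \<gamma> i - potential x"

lemma potential_measurable [measurable]: "potential \<in> borel_measurable borel"
  unfolding potential_def by (intro borel_measurable_Min) auto

lemma excess_measurable [measurable]: "excess i \<in> borel_measurable borel"
  unfolding excess_def by measurable

lemma potential_le: "i \<in> {1..n} \<Longrightarrow> potential x \<le> (norm (x - y i))\<^sup>2 - \<gamma> i"
  unfolding potential_def by (intro Min_le) auto

lemma excess_nonneg: "i \<in> {1..n} \<Longrightarrow> 0 \<le> excess i x"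
  using potential_le[of i x] by (simp add: excess_def)

lemma potential_attained: "\<exists>i\<in>{1..n}. potential x = (norm (x - y i))\<^sup>2 - \<gamma> i"
proof -
  have "potential x \<in> (\<lambda>j. (norm (x - y j))\<^sup>2 - \<gamma> j) ` {1..n}"
    unfolding potential_def using n1 by (intro Min_in) auto
  then show ?thesis by auto
qed

lemma excess_attained: "\<exists>i\<in>{1..n}. excess i x = 0"
  using potential_attained[of x] by (auto simp: excess_def)

lemma cell_eq: "i \<in> {1..n} \<Longrightarrow> cell i = {x. excess i x = 0}"
proof (rule set_eqI)
  fix x assume i: "i \<in> {1..n}"
  obtain j where j: "j \<in> {1..n}" "potential x = (norm (x - y j))\<^sup>2 - \<gamma> j" using potential_attained by blast
  show "x \<in> cell i \<longleftrightarrow> x \<in> {x. excess i x = 0}"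
  proof
    assume "x \<in> cell i"
    then have "(norm (x - y i))\<^sup>2 - \<gamma> i \<le> potential x" using j by (simp add: power_cell_def)
    then show "x \<in> {x. excess i x = 0}" using excess_nonneg[OF i, of x] by (simp add: excess_def)
  next
    assume "x \<in> {x. excess i x = 0}"
    then show "x \<in> cell i" using potential_le[of _ x] by (auto simp: power_cell_def excess_def)
  qed
qed

lemma excess_slack: "i \<in> {1..n} \<Longrightarrow> x \<in> cell i \<Longrightarrow> excess j x = slack y \<gamma> i j x"
  unfolding cell_eq by (simp add: excess_def slack_def)

lemma cell_closed: "closed (cell i)"
proof -
  have "cell i = (\<Inter>j\<in>{1..n}. {x. (norm (x - y i))\<^sup>2 - \<gamma> i \<le> (norm (x - y j))\<^sup>2 - \<gamma> j})"
    by (auto simp: power_cell_def)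
  moreover have "closed \<dots>" by (intro closed_INT ballI closed_Collect_le continuous_intros)
  ultimately show ?thesis by simp
qed

lemma cell_cover: "(\<Union>i\<in>{1..n}. cell i) = UNIV"
  using excess_attained by (auto simp: cell_eq)

lemma atoms_ne: "i \<in> {1..n} \<Longrightarrow> j \<in> {1..n} \<Longrightarrow> i \<noteq> j \<Longrightarrow> y i \<noteq> y j"
  using inj_onD[OF inj, of i j] by blast

lemma slack_zero_null:
  assumes "i \<in> {1..n}" "j \<in> {1..n}" "i \<noteq> j"
  shows "{x. slack y \<gamma> i j x = 0} \<in> null_sets lborel"
proof -
  have ne: "2 *\<^sub>R (y i - y j) \<noteq> 0" using atoms_ne[OF assms] by simp
  have "{x. slack y \<gamma> i j x = 0} = {x. (2 *\<^sub>R (y i - y j)) \<bullet> x = - ((norm (y j))\<^sup>2 - (norm (y i))\<^sup>2 + \<gamma> i - \<gamma> j)}"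
    by (auto simp: slack_affine)
  moreover have "negligible \<dots>" using ne by (intro negligible_hyperplane) auto
  moreover have "\<dots> \<in> sets borel" by (intro borel_closed closed_hyperplane)
  ultimately show ?thesis by (simp add: negligible_iff_null_sets null_sets_completion_iff)
qed

lemma cells_overlap:
  assumes "i \<in> {1..n}" "j \<in> {1..n}" "x \<in> cell i" "x \<in> cell j"
  shows "slack y \<gamma> i j x = 0"
  using assms excess_slack[OF assms(1,3), of j] by (simp add: cell_eq)

lemma cells_disjoint:
  assumes "i \<in> {1..n}" "j \<in> {1..n}" "i \<noteq> j"
  shows "AE x in M. \<not> (x \<in> cell i \<and> x \<in> cell j)"
proof (rule AE_lborel_M)
  have "AE x in lborel. x \<notin> {x. slack y \<gamma> i j x = 0}" by (rule AE_not_in[OF slack_zero_null[OF assms]])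
  then show "AE x in lborel. \<not> (x \<in> cell i \<and> x \<in> cell j)"
    by eventually_elim (use cells_overlap[OF assms(1,2)] in auto)
qed

section \<open>Mass of the slabs along a facet\<close>

lemma slack_measurable [measurable]: "slack y \<gamma> i j \<in> borel_measurable borel"
  unfolding slack_def by measurable

lemma cell_part_measurable [measurable]: "cell_part n y \<gamma> i j a \<in> sets borel"
proof -
  have "cell_part n y \<gamma> i j a = cell i \<inter> (\<Inter>k\<in>{1..n} - {i, j}. {x. a \<le> slack y \<gamma> i k x})"
    by (auto simp: cell_part_def)
  moreover have "closed \<dots>"
    unfolding slack_def by (intro closed_Int cell_closed closed_INT ballI closed_Collect_le continuous_intros)
  ultimately show ?thesis by simp
qed

lemma cell_part_slack: "j \<in> {1..n} \<Longrightarrow> x \<in> cell_part n y \<gamma> i j a \<Longrightarrow> 0 \<le> slack y \<gamma> i j x"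
  by (force simp: cell_part_def power_cell_def slack_def algebra_simps)

text \<open>The coarea formula for the unit normal, with the slack written as l t + b in terms of
  the signed distance t. The substitution is left inside the integral; its factor 1/l appears when
  the indicator is integrated in \<open>slab_ratio\<close>. The lower limit 0 is automatic, since
  slacks are nonnegative on the cell.\<close>

lemma emeasure_slab:
  assumes ij: "i \<in> {1..n}" "j \<in> {1..n}" "i \<noteq> j"
  defines "l \<equiv> 2 * norm (y i - y j)"
    and "b \<equiv> (norm (y j))\<^sup>2 - (norm (y i))\<^sup>2 + \<gamma> i - \<gamma> j"
  shows "emeasure M {x\<in>cell_part n y \<gamma> i j a. slack y \<gamma> i j x \<le> T}
    = (\<integral>\<^sup>+t. indicator {0..T} (l * t + b) * h i j (l * t + b) a \<partial>lborel)"
proof -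
  let ?E = "cell_part n y \<gamma> i j a"
  define v where "v = (1 / norm (y i - y j)) *\<^sub>R (y i - y j)"
  have ne: "norm (y i - y j) \<noteq> 0" using atoms_ne[OF ij] by simp
  have v: "norm v = 1" using ne by (simp add: v_def)
  have sl: "slack y \<gamma> i j x = l * (v \<bullet> x) + b" for x
    using ne by (simp add: slack_affine l_def b_def v_def)
  let ?f = "\<lambda>x. ennreal (\<rho> x) * indicator {x\<in>?E. slack y \<gamma> i j x \<le> T} x"
  have Em: "{x\<in>?E. slack y \<gamma> i j x \<le> T} \<in> sets borel"
  proof -
    have "{x\<in>?E. slack y \<gamma> i j x \<le> T} = ?E \<inter> {x\<in>space borel. slack y \<gamma> i j x \<le> T}" by auto
    also have "\<dots> \<in> sets borel" by measurable
    finally show ?thesis .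
  qed
  then have fm: "?f \<in> borel_measurable borel" by measurable
  have "emeasure M {x\<in>?E. slack y \<gamma> i j x \<le> T} = (\<integral>\<^sup>+x. ?f x \<partial>lborel)"
    using Em by (rule emeasure_M)
  also have "\<dots> = (\<integral>\<^sup>+t. (\<integral>\<^sup>+x\<in>{x. v \<bullet> x = t}. ?f x \<partial>hausdorff_measure (DIM('a) - 1)) \<partial>lborel)"
    by (rule hyperplane_coarea[OF v fm])
  also have "\<dots> = (\<integral>\<^sup>+t. indicator {0..T} (l * t + b) * h i j (l * t + b) a \<partial>lborel)"
  proof (rule nn_integral_cong)
    fix t :: real
    have "(\<integral>\<^sup>+x\<in>{x. v \<bullet> x = t}. ?f x \<partial>hausdorff_measure (DIM('a) - 1))
      = (\<integral>\<^sup>+x. indicator {0..T} (l * t + b) * (ennreal (\<rho> x) * indicator (cell_slice n y \<gamma> i j (l * t + b) a) x) \<partial>hausdorff_measure (DIM('a) - 1))"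
    proof (rule nn_integral_cong)
      fix x
      have "l * (v \<bullet> x) + b = l * t + b \<longleftrightarrow> v \<bullet> x = t" using ne by (auto simp: l_def)
      then show "?f x * indicator {x. v \<bullet> x = t} x
        = indicator {0..T} (l * t + b) * (ennreal (\<rho> x) * indicator (cell_slice n y \<gamma> i j (l * t + b) a) x)"
        using cell_part_slack[OF ij(2), of x i a] by (auto simp: indicator_def cell_slice_def sl)
    qed
    also have "\<dots> = indicator {0..T} (l * t + b) * h i j (l * t + b) a"
    proof -
      have "cell_slice n y \<gamma> i j (l * t + b) a = ?E \<inter> {x\<in>space borel. slack y \<gamma> i j x = l * t + b}"
        by (auto simp: cell_slice_def)
      also have "\<dots> \<in> sets borel" by measurable
      finally have [measurable]: "cell_slice n y \<gamma> i j (l * t + b) a \<in> sets borel" .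
      show ?thesis unfolding slice_integral_def by (rule nn_integral_cmult) measurable
    qed
    finally show "(\<integral>\<^sup>+x\<in>{x. v \<bullet> x = t}. ?f x \<partial>hausdorff_measure (DIM('a) - 1))
      = indicator {0..T} (l * t + b) * h i j (l * t + b) a" .
  qed
  finally show ?thesis .
qed

text \<open>Continuity at zero encloses h between h0 - d and h0 + d on thin slabs, and the slack
  values up to T occupy an interval of length T/l in the distance variable.\<close>

lemma slab_ratio:
  assumes ij: "i \<in> {1..n}" "j \<in> {1..n}" "i \<noteq> j"
    and cont: "continuous (at 0 within {0..}) (\<lambda>t. h i j t a)" and fin: "h i j 0 a < \<infinity>"
  shows "((\<lambda>t. prob {x\<in>cell_part n y \<gamma> i j a. slack y \<gamma> i j x \<le> t} / t)
     \<longlongrightarrow> enn2real (h i j 0 a) / (2 * norm (y i - y j))) (at_right 0)"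
proof -
  define l where "l = 2 * norm (y i - y j)"
  define b where "b = (norm (y j))\<^sup>2 - (norm (y i))\<^sup>2 + \<gamma> i - \<gamma> j"
  have l: "0 < l" using atoms_ne[OF ij] by (simp add: l_def)
  define h0 where "h0 = enn2real (h i j 0 a)"
  have h0: "h i j 0 a = ennreal h0" "0 \<le> h0" using fin by (auto simp: h0_def)
  have lim: "((\<lambda>t. h i j t a) \<longlongrightarrow> ennreal h0) (at 0 within {0..})"
    using cont h0 by (simp add: continuous_within)
  have slabT: "(\<integral>\<^sup>+t. indicator {0..T} (l * t + b) * ennreal c \<partial>lborel) = ennreal (c * (T / l))"
    if T: "0 \<le> T" and c: "0 \<le> c" for T c
  proof -
    have "(\<integral>\<^sup>+t. indicator {0..T} (l * t + b) * ennreal c \<partial>lborel)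
        = (\<integral>\<^sup>+t. ennreal c * indicator {- b / l..(T - b) / l} t \<partial>lborel)"
      using l by (intro nn_integral_cong) (auto simp: indicator_def field_simps)
    also have "\<dots> = ennreal c * ennreal ((T - b) / l - - b / l)"
    proof -
      have le: "- b / l \<le> (T - b) / l" using l T by (intro divide_right_mono) auto
      show ?thesis by (subst nn_integral_cmult_indicator, simp, subst emeasure_lborel_Icc[OF le], rule refl)
    qed
    also have "(T - b) / l - - b / l = T / l" by (simp add: diff_divide_distrib)
    also have "ennreal c * ennreal (T / l) = ennreal (c * (T / l))" using T c l by (intro ennreal_mult[symmetric]) auto
    finally show ?thesis .
  qed
  show ?thesis
    unfolding l_def[symmetric] h0_def[symmetric]
  proof (rule tendstoI)
    fix e :: real assume e: "0 < e"
    define d where "d = e * l / 2"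
    have d: "0 < d" using e l by (simp add: d_def)
    have "\<forall>\<^sub>F t in at 0 within {0..}. h i j t a < ennreal (h0 + d)"
      using order_tendstoD(2)[OF lim, of "ennreal (h0 + d)"] h0 d by (simp add: ennreal_less_iff)
    moreover have "\<forall>\<^sub>F t in at 0 within {0..}. ennreal (h0 - d) \<le> h i j t a"
    proof (cases "h0 - d \<le> 0")
      case True
      then show ?thesis by (simp add: ennreal_neg)
    next
      case False
      then have "ennreal (h0 - d) < ennreal h0" using d by (simp add: ennreal_less_iff)
      from order_tendstoD(1)[OF lim this] show ?thesis by eventually_elim simp
    qed
    ultimately have "\<forall>\<^sub>F t in at 0 within {0..}. ennreal (h0 - d) \<le> h i j t a \<and> h i j t a \<le> ennreal (h0 + d)"
      by eventually_elim auto
    then obtain r where r: "0 < r" "\<And>t. t \<in> {0..} \<Longrightarrow> t \<noteq> 0 \<Longrightarrow> dist t 0 < r \<Longrightarrow>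
        ennreal (h0 - d) \<le> h i j t a \<and> h i j t a \<le> ennreal (h0 + d)"
      unfolding eventually_at by blast
    \<comment> \<open>The lower bound is clipped at zero because h takes values in the extended
      nonnegative reals. The point s = 0, which the limit leaves out, is supplied by h0
      itself.\<close>
    have bd: "ennreal (max 0 (h0 - d)) \<le> h i j s a \<and> h i j s a \<le> ennreal (h0 + d)" if "0 \<le> s" "s < r" for s
    proof (cases "s = 0")
      case True
      then show ?thesis using h0 d by (auto intro!: ennreal_leI)
    next
      case False
      then show ?thesis using r(2)[of s] that by (auto simp: ennreal_max_0 max_def ennreal_neg)
    qed
    show "\<forall>\<^sub>F t in at_right 0. dist (prob {x\<in>cell_part n y \<gamma> i j a. slack y \<gamma> i j x \<le> t} / t) (h0 / l) < e"
      unfolding eventually_at_right_field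
    proof (intro exI[of _ r] conjI allI impI)
      show "0 < r" by (rule r(1))
      fix T assume T: "0 < T" "T < r"
      let ?P = "prob {x\<in>cell_part n y \<gamma> i j a. slack y \<gamma> i j x \<le> T}"
      have em: "ennreal ?P = (\<integral>\<^sup>+t. indicator {0..T} (l * t + b) * h i j (l * t + b) a \<partial>lborel)"
        using emeasure_slab[OF ij, of a T] by (simp add: emeasure_eq_measure l_def b_def)
      have "ennreal ?P \<le> (\<integral>\<^sup>+t. indicator {0..T} (l * t + b) * ennreal (h0 + d) \<partial>lborel)"
        unfolding em using bd T by (intro nn_integral_mono) (auto simp: indicator_def)
      then have up: "?P \<le> (h0 + d) * (T / l)"
        using slabT[of T "h0 + d"] T h0 d l by (simp add: ennreal_le_iff)
      have "(\<integral>\<^sup>+t. indicator {0..T} (l * t + b) * ennreal (max 0 (h0 - d)) \<partial>lborel) \<le> ennreal ?P"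
        unfolding em using bd T by (intro nn_integral_mono) (auto simp: indicator_def)
      then have "max 0 (h0 - d) * (T / l) \<le> ?P"
        using slabT[of T "max 0 (h0 - d)"] T by (simp add: ennreal_le_iff)
      moreover have "(h0 - d) * (T / l) \<le> max 0 (h0 - d) * (T / l)"
        using T l by (intro mult_right_mono) auto
      ultimately have lo: "(h0 - d) * (T / l) \<le> ?P" by linarith
      have "?P / T \<le> (h0 + d) / l" using up T l by (simp add: field_simps)
      moreover have "(h0 - d) / l \<le> ?P / T" using lo T l by (simp add: field_simps)
      moreover have "d / l = e / 2" using l by (simp add: d_def)
      ultimately have "\<bar>?P / T - h0 / l\<bar> \<le> e / 2"
        unfolding add_divide_distrib diff_divide_distrib abs_le_iff by linarith
      then show "dist (?P / T) (h0 / l) < e" using e by (simp add: dist_real_def)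
    qed
  qed
qed

end

section \<open>Connectedness of the facet graph\<close>

lemma closed_msupport: "closed (msupport (M :: 'a::topological_space measure))"
proof -
  have "- msupport M = \<Union>{U. open U \<and> emeasure M U = 0}"
    by (auto simp: msupport_def)
  then have "open (- msupport M)" by (simp only:) (rule open_Union, auto)
  then show ?thesis by (simp add: closed_def)
qed

text \<open>Second countability reduces the union to a countable one. The intersection with B lets
  the lemma serve twice: for the complement of the support, and for the largest open set in which a
  union of cells is null.\<close>

lemma null_Union_open:
  fixes M :: "'a::second_countable_topology measure"
  assumes F: "\<And>U. U \<in> F \<Longrightarrow> open U \<and> emeasure M (U \<inter> B) = 0" and sM: "sets M = sets borel" and B: "B \<in> sets borel"
  shows "emeasure M (\<Union>F \<inter> B) = 0"
proof -
  obtain F' where F': "F' \<subseteq> F" "countable F'" "\<Union>F' = \<Union>F"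
    using Lindelof[of F] F by blast
  have "(\<Union>U\<in>F'. U \<inter> B) \<in> null_sets M"
  proof (rule null_sets_UN'[OF F'(2)])
    fix U assume "U \<in> F'"
    then show "U \<inter> B \<in> null_sets M" using F[of U] F'(1) sM B by (auto simp: null_sets_def)
  qed
  moreover have "(\<Union>U\<in>F'. U \<inter> B) = \<Union>F \<inter> B" using F'(3) by auto
  ultimately show ?thesis by (simp add: null_sets_def)
qed

lemma emeasure_compl_msupport:
  fixes M :: "'a::second_countable_topology measure"
  assumes "sets M = sets borel"
  shows "emeasure M (- msupport M) = 0"
proof -
  have "- msupport M = \<Union>{U. open U \<and> emeasure M U = 0} \<inter> UNIV"
    by (auto simp: msupport_def)
  moreover have "emeasure M (\<Union>{U. open U \<and> emeasure M U = 0} \<inter> UNIV) = 0"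
    by (rule null_Union_open) (use assms in auto)
  ultimately show ?thesis by simp
qed

lemma open_positive_lborel:
  fixes U :: "'a::euclidean_space set"
  assumes "open U" "x \<in> U"
  shows "0 < emeasure lborel U"
proof -
  obtain r where r: "0 < r" "ball x r \<subseteq> U" using assms open_contains_ball by blast
  have "0 < emeasure lborel (ball x r)" using r by (simp add: emeasure_ball)
  also have "\<dots> \<le> emeasure lborel U" using r assms by (intro emeasure_mono) auto
  finally show ?thesis .
qed

text \<open>If z is parallel to the hyperplane, all points concerned lie in that null hyperplane.
  Otherwise they lie in the union E of the lines parallel to z through G, and every slice of E by a
  parallel hyperplane is contained in a translate of G, so the coarea formula makes E null.\<close>

lemma sweep_null:
  fixes G :: "'a::euclidean_space set"
  assumes a: "a \<noteq> 0" and G: "G \<in> sets borel" "\<And>x. x \<in> G \<Longrightarrow> a \<bullet> x = c"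
    and null: "emeasure (hausdorff_measure (DIM('a) - 1)) G = 0"
  shows "\<exists>E\<in>null_sets lborel. {x. \<exists>s\<in>{0..1}. x + s *\<^sub>R z \<in> G} \<subseteq> E"
proof (cases "a \<bullet> z = 0")
  case True
  have "{x. a \<bullet> x = c} \<in> null_sets lborel"
    using negligible_hyperplane[of a c] a borel_closed[OF closed_hyperplane[of a c]]
    by (simp add: negligible_iff_null_sets null_sets_completion_iff)
  moreover have "{x. \<exists>s\<in>{0..1}. x + s *\<^sub>R z \<in> G} \<subseteq> {x. a \<bullet> x = c}"
    using G(2) True by (force simp: inner_add_right)
  ultimately show ?thesis by blast
next
  case False
  define v where "v = (1 / norm a) *\<^sub>R a"
  have v: "norm v = 1" using a by (simp add: v_def)
  have na: "norm a \<noteq> 0" using a by simp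
  \<comment> \<open>The coefficient of z is the parameter at which the line through x in direction z
    meets the hyperplane.\<close>
  define E where "E = {x. x + ((c - a \<bullet> x) / (a \<bullet> z)) *\<^sub>R z \<in> G}"
  have Em: "E \<in> sets borel"
  proof -
    have "(\<lambda>x. x + ((c - a \<bullet> x) / (a \<bullet> z)) *\<^sub>R z) \<in> borel_measurable borel" by measurable
    from measurable_sets[OF this G(1)] show ?thesis by (simp add: E_def vimage_def)
  qed
  have "emeasure lborel E = (\<integral>\<^sup>+x. indicator E x \<partial>lborel)" using Em by simp
  also have "\<dots> = (\<integral>\<^sup>+t. (\<integral>\<^sup>+x\<in>{x. v \<bullet> x = t}. indicator E x \<partial>hausdorff_measure (DIM('a) - 1)) \<partial>lborel)"
    using Em by (intro hyperplane_coarea[OF v]) simp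
  also have "\<dots> = (\<integral>\<^sup>+t. 0 \<partial>(lborel :: real measure))"
  proof (rule nn_integral_cong)
    fix t :: real
    define s where "s = (c - norm a * t) / (a \<bullet> z)"
    have eqs: "indicator E x * indicator {x. v \<bullet> x = t} x \<le> (indicator G (s *\<^sub>R z + x) :: ennreal)" for x
    proof (cases "x \<in> E \<and> v \<bullet> x = t")
      case True
      then have "a \<bullet> x = norm a * t" using na by (auto simp: v_def)
      then have "x + s *\<^sub>R z \<in> G" using True by (simp add: E_def s_def)
      then show ?thesis by (simp add: add.commute indicator_def)
    qed (auto simp: indicator_def)
    have "(\<integral>\<^sup>+x\<in>{x. v \<bullet> x = t}. indicator E x \<partial>hausdorff_measure (DIM('a) - 1))
       \<le> (\<integral>\<^sup>+x. indicator G (s *\<^sub>R z + x) \<partial>hausdorff_measure (DIM('a) - 1))"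
      by (rule nn_integral_mono) (rule eqs)
    also have "\<dots> = (\<integral>\<^sup>+x. indicator G x \<partial>hausdorff_measure (DIM('a) - 1))"
      using G(1) by (intro nn_integral_hausdorff_translation) simp
    also have "\<dots> = 0" using G(1) null by simp
    finally show "(\<integral>\<^sup>+x\<in>{x. v \<bullet> x = t}. indicator E x \<partial>hausdorff_measure (DIM('a) - 1)) = 0" by simp
  qed
  finally have "E \<in> null_sets lborel" using Em by (simp add: null_sets_def)
  moreover have "{x. \<exists>s\<in>{0..1}. x + s *\<^sub>R z \<in> G} \<subseteq> E"
  proof safe
    fix x s assume xs: "x + s *\<^sub>R z \<in> G"
    have "a \<bullet> x + s * (a \<bullet> z) = c" using G(2)[OF xs] by (simp add: inner_add_right)
    then have "(c - a \<bullet> x) / (a \<bullet> z) = s" using False by (simp add: field_simps)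
    then show "x \<in> E" using xs by (simp add: E_def)
  qed
  ultimately show ?thesis by blast
qed

text \<open>Integrated over z, the measure of the points of A that z moves into B equals the product
  of the two measures, so it is positive for some z. All segments considered later share this one
  direction.\<close>

lemma translate_meets:
  fixes A B :: "'a::euclidean_space set"
  assumes [measurable]: "A \<in> sets borel" "B \<in> sets borel"
    and pos: "0 < emeasure lborel A" "0 < emeasure lborel B"
  obtains z where "0 < emeasure lborel {x\<in>A. x + z \<in> B}"
proof -
  have "emeasure lborel A * emeasure lborel B = (\<integral>\<^sup>+x. indicator A x * emeasure lborel B \<partial>lborel)"
    by (simp add: nn_integral_multc)
  also have "\<dots> = (\<integral>\<^sup>+x. (\<integral>\<^sup>+z. indicator A x * indicator B (x + z) \<partial>lborel) \<partial>lborel)"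
  proof (rule nn_integral_cong)
    fix x :: 'a
    have "(\<integral>\<^sup>+z. indicator B (x + z) \<partial>lborel) = (\<integral>\<^sup>+z. indicator B z \<partial>lborel)"
      by (rule nn_integral_lborel_translation) measurable
    then show "indicator A x * emeasure lborel B = (\<integral>\<^sup>+z. indicator A x * indicator B (x + z) \<partial>lborel)"
      by (simp add: nn_integral_cmult)
  qed
  also have "\<dots> = (\<integral>\<^sup>+z. (\<integral>\<^sup>+x. indicator A x * indicator B (x + z) \<partial>lborel) \<partial>lborel)"
    by (rule lborel_pair.Fubini') measurable
  also have "\<dots> = (\<integral>\<^sup>+z. emeasure lborel {x\<in>A. x + z \<in> B} \<partial>lborel)"
  proof (rule nn_integral_cong)
    fix z :: 'a
    have [measurable]: "{x\<in>A. x + z \<in> B} \<in> sets borel" by measurable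
    have "(\<integral>\<^sup>+x. indicator A x * indicator B (x + z) \<partial>lborel) = (\<integral>\<^sup>+x. indicator {x\<in>A. x + z \<in> B} x \<partial>lborel)"
      by (intro nn_integral_cong) (auto simp: indicator_def)
    then show "(\<integral>\<^sup>+x. indicator A x * indicator B (x + z) \<partial>lborel) = emeasure lborel {x\<in>A. x + z \<in> B}"
      by simp
  qed
  finally have eq: "emeasure lborel A * emeasure lborel B = (\<integral>\<^sup>+z. emeasure lborel {x\<in>A. x + z \<in> B} \<partial>lborel)" .
  have "\<exists>z. emeasure lborel {x\<in>A. x + z \<in> B} \<noteq> 0"
  proof (rule ccontr)
    assume "\<not> ?thesis"
    then have "emeasure lborel A * emeasure lborel B = 0" unfolding eq by simp
    then show False using pos by (auto simp: mult_eq_0_iff)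
  qed
  then show ?thesis using that by (auto simp: zero_less_iff_neq_zero)
qed

context power_cells
begin

lemma facet_eq:
  assumes "i \<in> {1..n}" "j \<in> {1..n}"
  shows "cell_slice n y \<gamma> i j 0 0 = cell i \<inter> cell j"
proof -
  have "cell_part n y \<gamma> i j 0 = cell i"
    by (force simp: cell_part_def power_cell_def slack_def algebra_simps)
  moreover have "x \<in> cell i \<Longrightarrow> slack y \<gamma> i j x = 0 \<longleftrightarrow> x \<in> cell j" for x
    using excess_slack[OF assms(1), of x j] assms by (simp add: cell_eq)
  ultimately show ?thesis by (auto simp: cell_slice_def)
qed

lemma facet_integral_sym:
  assumes "i \<in> {1..n}" "j \<in> {1..n}"
  shows "h i j 0 0 = h j i 0 0"
  unfolding slice_integral_def facet_eq[OF assms] facet_eq[OF assms(2,1)] by (simp add: Int_commute)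

text \<open>Suppose all facets between the cells of I and the others are null, and let A and B be
  the two unions of cells. Since both have mass in the interior of the support, connectedness yields
  a point there each of whose neighbourhoods meets A and B in positive Lebesgue measure. In a small
  ball around it a positive measure of parallel segments then leads from A to B. Each of them stays
  in the ball by convexity and crosses a facet; but in the interior of the support the density is
  positive, so these facets are null for Hausdorff measure and sweep out a null set.\<close>

lemma facet_exists:
  assumes conn: "connected (interior (msupport M))"
    and front: "emeasure lborel (frontier (msupport M)) = 0"
    and dpos: "\<And>x. x \<in> interior (msupport M) \<Longrightarrow> 0 < \<rho> x"
    and mass: "\<And>i. i \<in> {1..n} \<Longrightarrow> 0 < emeasure M (cell i)"
    and I: "I \<subseteq> {1..n}" "I \<noteq> {}" "{1..n} - I \<noteq> {}"
  shows "\<exists>i\<in>I. \<exists>j\<in>{1..n} - I. 0 < h i j 0 0"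
proof (rule ccontr)
  assume "\<not> ?thesis"
  then have h0: "h i j 0 0 = 0" if "i \<in> I" "j \<in> {1..n} - I" for i j
    using that by (auto simp: zero_less_iff_neq_zero)
  define \<Omega> where "\<Omega> = interior (msupport M)"
  define A where "A = (\<Union>i\<in>I. cell i)"
  define B where "B = (\<Union>i\<in>{1..n} - I. cell i)"
  have fI: "finite I" using I(1) by (rule finite_subset) simp
  have AB: "closed A" "closed B"
    unfolding A_def B_def using fI by (auto intro!: closed_UN cell_closed)
  have ABU: "A \<union> B = UNIV"
    using cell_cover unfolding A_def B_def by blast
  have ABm: "A \<in> sets borel" "B \<in> sets borel" using AB by auto
  have absc: "emeasure M X = 0" if "X \<in> sets borel" "emeasure lborel X = 0" for X
  proof -
    have "AE x in lborel. x \<notin> X" using that by (intro AE_not_in) (auto simp: null_sets_def)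
    then have "AE x in M. x \<notin> X" by (rule AE_lborel_M)
    then show ?thesis using that(1) by (subst (asm) AE_iff_measurable[OF _ refl]) auto
  qed
  have Mout: "emeasure M (- \<Omega>) = 0"
  proof -
    have "- \<Omega> \<subseteq> (- msupport M) \<union> frontier (msupport M)"
      using closure_subset[of "msupport M"] by (auto simp: \<Omega>_def frontier_def)
    then have "emeasure M (- \<Omega>) \<le> emeasure M ((- msupport M) \<union> frontier (msupport M))"
      using closed_msupport[of M] by (intro emeasure_mono) (auto intro!: borel_comp borel_closed)
    also have "\<dots> \<le> emeasure M (- msupport M) + emeasure M (frontier (msupport M))"
      using closed_msupport[of M] by (intro emeasure_subadditive) (auto intro!: borel_comp borel_closed)
    also have "\<dots> = 0" using emeasure_compl_msupport[OF sets_M] absc[OF _ front] by (simp add: borel_closed)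
    finally show ?thesis by simp
  qed
  have \<Omega>o: "open \<Omega>" by (simp add: \<Omega>_def)
  \<comment> \<open>Connectedness is tested against sets defined by measure and not by topology,
    because the point found must see both sides in positive measure; touching the closed set A would
    not suffice.\<close>
  define UA where "UA = \<Union>{U. open U \<and> emeasure lborel (U \<inter> B) = 0}"
  define UB where "UB = \<Union>{U. open U \<and> emeasure lborel (U \<inter> A) = 0}"
  have open_U: "open UA" "open UB" by (auto simp: UA_def UB_def)
  have null_U: "emeasure lborel (UA \<inter> B) = 0" "emeasure lborel (UB \<inter> A) = 0"
    unfolding UA_def UB_def using ABm by (auto intro!: null_Union_open)
  have disjU: "UA \<inter> UB = {}"
  proof (rule ccontr)
    assume "UA \<inter> UB \<noteq> {}"
    then obtain x where "x \<in> UA \<inter> UB" by blast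
    then have "0 < emeasure lborel (UA \<inter> UB)" using open_U by (intro open_positive_lborel) auto
    also have "\<dots> \<le> emeasure lborel ((UA \<inter> B) \<union> (UB \<inter> A))"
      using ABU open_U ABm by (intro emeasure_mono) auto
    also have "\<dots> \<le> emeasure lborel (UA \<inter> B) + emeasure lborel (UB \<inter> A)"
      using open_U ABm by (intro emeasure_subadditive) auto
    also have "\<dots> = 0" using null_U by simp
    finally show False by simp
  qed
  have notsub: "\<not> \<Omega> \<subseteq> U" if U: "emeasure lborel (U \<inter> C) = 0" "open U" and C: "C \<in> sets borel" "i \<in> {1..n}" "cell i \<subseteq> C" for U C i
  proof
    assume sub: "\<Omega> \<subseteq> U"
    have "emeasure M (cell i) \<le> emeasure M ((U \<inter> C) \<union> - \<Omega>)"
      using sub C \<Omega>o U(2) by (intro emeasure_mono) (auto intro!: borel_comp)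
    also have "\<dots> \<le> emeasure M (U \<inter> C) + emeasure M (- \<Omega>)"
      using C \<Omega>o U(2) by (intro emeasure_subadditive) (auto intro!: borel_comp)
    also have "\<dots> = 0" using absc[of "U \<inter> C"] U C(1) Mout by simp
    finally show False using mass[OF C(2)] by simp
  qed
  obtain i1 i2 where i12: "i1 \<in> I" "i2 \<in> {1..n} - I" using I by blast
  have "\<not> \<Omega> \<subseteq> UA" using i12 null_U open_U ABm by (intro notsub[of UA B i2]) (auto simp: B_def)
  moreover have "\<not> \<Omega> \<subseteq> UB" using i12 I(1) null_U open_U ABm by (intro notsub[of UB A i1]) (auto simp: A_def)
  ultimately have "\<not> \<Omega> \<subseteq> UA \<union> UB"
    using connectedD[OF conn[folded \<Omega>_def], of UA UB] open_U disjU by blast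
  then obtain x0 where x0: "x0 \<in> \<Omega>" "x0 \<notin> UA" "x0 \<notin> UB" by blast
  obtain r where r: "0 < r" "ball x0 r \<subseteq> \<Omega>" using \<Omega>o x0(1) open_contains_ball by blast
  define V where "V = ball x0 r"
  have V: "open V" "convex V" "x0 \<in> V" "V \<subseteq> \<Omega>" using r by (auto simp: V_def)
  have posA: "0 < emeasure lborel (A \<inter> V)"
    using x0(3) V by (auto simp: UB_def zero_less_iff_neq_zero Int_commute)
  have posB: "0 < emeasure lborel (B \<inter> V)"
    using x0(2) V by (auto simp: UA_def zero_less_iff_neq_zero Int_commute)
  obtain z where z: "0 < emeasure lborel {x\<in>A \<inter> V. x + z \<in> B \<inter> V}"
    using ABm V(1) posA posB by (rule_tac translate_meets[of "A \<inter> V" "B \<inter> V"]) auto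
  define G where "G i j = cell i \<inter> cell j \<inter> V" for i j
  have sweep: "\<exists>E\<in>null_sets lborel. {x. \<exists>s\<in>{0..1}. x + s *\<^sub>R z \<in> G i j} \<subseteq> E" if ij: "i \<in> I" "j \<in> {1..n} - I" for i j
  proof -
    have i: "i \<in> {1..n}" and j: "j \<in> {1..n}" and ne: "i \<noteq> j" using ij I(1) by auto
    have Gm: "G i j \<in> sets borel" unfolding G_def using cell_closed V(1) by (intro sets.Int) auto
    have "(\<integral>\<^sup>+x\<in>cell i \<inter> cell j. ennreal (\<rho> x) \<partial>hausdorff_measure (DIM('a) - 1)) = 0"
      using h0[OF ij] unfolding slice_integral_def facet_eq[OF i j] .
    moreover have "cell i \<inter> cell j \<in> sets borel" using cell_closed by (intro sets.Int) auto
    ultimately have "AE x in hausdorff_measure (DIM('a) - 1). ennreal (\<rho> x) * indicator (cell i \<inter> cell j) x = 0"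
      by (subst (asm) nn_integral_0_iff_AE) auto
    then have "AE x in hausdorff_measure (DIM('a) - 1). x \<notin> G i j"
    proof eventually_elim
      fix x assume "ennreal (\<rho> x) * indicator (cell i \<inter> cell j) x = 0"
      then show "x \<notin> G i j" using dpos[of x] V(4) by (auto simp: G_def \<Omega>_def indicator_def split: if_splits)
    qed
    then have Gnull: "emeasure (hausdorff_measure (DIM('a) - 1)) (G i j) = 0"
      using Gm by (subst (asm) AE_iff_measurable[OF _ refl]) auto
    have hyp: "(2 *\<^sub>R (y i - y j)) \<bullet> x = - ((norm (y j))\<^sup>2 - (norm (y i))\<^sup>2 + \<gamma> i - \<gamma> j)" if "x \<in> G i j" for x
      using cells_overlap[OF i j, of x] that by (auto simp: G_def slack_affine)
    have "2 *\<^sub>R (y i - y j) \<noteq> 0" using atoms_ne[OF i j ne] by simp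
    then show ?thesis by (rule sweep_null[OF _ Gm hyp Gnull])
  qed
  define E where "E i j = (SOME E. E \<in> null_sets lborel \<and> {x. \<exists>s\<in>{0..1}. x + s *\<^sub>R z \<in> G i j} \<subseteq> E)" for i j
  have E: "E i j \<in> null_sets lborel \<and> {x. \<exists>s\<in>{0..1}. x + s *\<^sub>R z \<in> G i j} \<subseteq> E i j"
    if "i \<in> I" "j \<in> {1..n} - I" for i j
    unfolding E_def by (rule someI_ex) (use sweep[OF that] in blast)
  have "{x\<in>A \<inter> V. x + z \<in> B \<inter> V} \<subseteq> (\<Union>i\<in>I. \<Union>j\<in>{1..n} - I. E i j)"
  proof
    fix x assume x: "x \<in> {x\<in>A \<inter> V. x + z \<in> B \<inter> V}"
    define \<phi> where "\<phi> s = x + s *\<^sub>R z" for s :: real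
    have cont: "continuous_on {0..1} \<phi>" unfolding \<phi>_def by (intro continuous_intros)
    \<comment> \<open>A and B are closed and cover the space, so the connected interval cannot be
      split into its parts in A and in B.\<close>
    have "\<exists>s\<in>{0..1}. \<phi> s \<in> A \<inter> B"
    proof (rule ccontr)
      assume no: "\<not> ?thesis"
      have cl: "closed ({0..1} \<inter> \<phi> -` A)" "closed ({0..1} \<inter> \<phi> -` B)"
        using AB cont by (auto intro!: continuous_closed_preimage)
      have disj: "({0..1} \<inter> \<phi> -` A) \<inter> ({0..1} \<inter> \<phi> -` B) \<inter> {0..1} = {}" using no by blast
      have cov: "{0..1} \<subseteq> ({0..1} \<inter> \<phi> -` A) \<union> ({0..1} \<inter> \<phi> -` B)" using ABU by blast
      have "({0..1} \<inter> \<phi> -` A) \<inter> {0..1} = {} \<or> ({0..1} \<inter> \<phi> -` B) \<inter> {0..1} = {}"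
        by (rule connected_closedD[OF connected_Icc disj cov cl])
      moreover have "0 \<in> ({0..1} \<inter> \<phi> -` A) \<inter> {0..1}" "1 \<in> ({0..1} \<inter> \<phi> -` B) \<inter> {0..1}"
        using x by (auto simp: \<phi>_def)
      ultimately show False by (metis empty_iff)
    qed
    then obtain s where s: "s \<in> {0..1}" "\<phi> s \<in> A \<inter> B" by blast
    have "\<phi> s = (1 - s) *\<^sub>R x + s *\<^sub>R (x + z)" by (simp add: \<phi>_def algebra_simps)
    then have "\<phi> s \<in> V" using s(1) x V(2) by (auto intro: convexD_alt)
    then obtain i j where ij: "i \<in> I" "j \<in> {1..n} - I" "\<phi> s \<in> G i j" using s(2) by (auto simp: A_def B_def G_def)
    have "x \<in> {x. \<exists>s\<in>{0..1}. x + s *\<^sub>R z \<in> G i j}" using ij(3) s(1) unfolding \<phi>_def by blast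
    then have "x \<in> E i j" using E[OF ij(1,2)] by blast
    then show "x \<in> (\<Union>i\<in>I. \<Union>j\<in>{1..n} - I. E i j)" using ij(1,2) by blast
  qed
  moreover have N: "(\<Union>i\<in>I. \<Union>j\<in>{1..n} - I. E i j) \<in> null_sets lborel"
    using E fI by (intro null_sets.finite_UN) auto
  ultimately have "emeasure lborel {x\<in>A \<inter> V. x + z \<in> B \<inter> V} \<le> emeasure lborel (\<Union>i\<in>I. \<Union>j\<in>{1..n} - I. E i j)"
    by (intro emeasure_mono) (auto simp: null_sets_def)
  then show False using z N by (simp add: null_sets_def)
qed

lemma facet_graph_connected:
  assumes conn: "connected (interior (msupport M))"
    and front: "emeasure lborel (frontier (msupport M)) = 0"
    and dpos: "\<And>x. x \<in> interior (msupport M) \<Longrightarrow> 0 < \<rho> x"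
    and mass: "\<And>i. i \<in> {1..n} \<Longrightarrow> 0 < emeasure M (cell i)"
    and ij: "i \<in> {1..n}" "j \<in> {1..n}"
  shows "(i, j) \<in> {(i, j). i \<in> {1..n} \<and> j \<in> {1..n} \<and> i \<noteq> j \<and> 0 < h i j 0 0}\<^sup>*"
proof (rule ccontr)
  let ?E = "{(i, j). i \<in> {1..n} \<and> j \<in> {1..n} \<and> i \<noteq> j \<and> 0 < h i j 0 0}"
  define I where "I = {k\<in>{1..n}. (i, k) \<in> ?E\<^sup>*}"
  assume "(i, j) \<notin> ?E\<^sup>*"
  then have "j \<in> {1..n} - I" "i \<in> I" using ij by (auto simp: I_def)
  then have I: "I \<subseteq> {1..n}" "I \<noteq> {}" "{1..n} - I \<noteq> {}" by (auto simp: I_def)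
  obtain k l where kl: "k \<in> I" "l \<in> {1..n} - I" "0 < h k l 0 0"
    using facet_exists[OF conn front dpos mass I] by blast
  then have "(k, l) \<in> ?E" by (auto simp: I_def)
  with kl(1) have "(i, l) \<in> ?E\<^sup>*" by (auto simp: I_def intro: rtrancl.rtrancl_into_rtrancl)
  then show False using kl(2) by (auto simp: I_def)
qed

section \<open>From power cells to layered cells\<close>

definition \<kappa> :: "nat \<Rightarrow> nat \<Rightarrow> real" where
  "\<kappa> i j = enn2real (h i j 0 0) / (2 * norm (y i - y j))"

text \<open>The masses are taken to be the actual cell masses rather than the weights: at this stage
  only the inequality between them is available, and equality will be deduced from the fact that in
  \<open>layered_cells\<close> the masses sum to one.\<close>

lemma layered_cells:
  assumes conn: "connected (interior (msupport M))"
    and front: "emeasure lborel (frontier (msupport M)) = 0"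
    and dpos: "\<And>x. x \<in> interior (msupport M) \<Longrightarrow> 0 < \<rho> x"
    and mass: "\<And>i. i \<in> {1..n} \<Longrightarrow> 0 < prob (cell i)"
    and fin: "\<And>i j. i \<in> {1..n} \<Longrightarrow> j \<in> {1..n} \<Longrightarrow> i \<noteq> j \<Longrightarrow> h i j 0 0 < \<infinity>"
    and cont_t: "\<And>i j. i \<in> {1..n} \<Longrightarrow> j \<in> {1..n} \<Longrightarrow> i \<noteq> j \<Longrightarrow>
        \<exists>e>0. \<forall>a. 0 \<le> a \<and> a < e \<longrightarrow> continuous (at 0 within {0..}) (\<lambda>t. h i j t a)"
    and cont_a: "\<And>i j. i \<in> {1..n} \<Longrightarrow> j \<in> {1..n} \<Longrightarrow> i \<noteq> j \<Longrightarrow>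
        continuous (at 0 within {0..}) (\<lambda>a. h i j 0 a)"
  shows "layered_cells M n excess cell \<kappa> (\<lambda>i. prob (cell i))"
proof (unfold_locales)
  fix i assume i: "i \<in> {1..n}"
  show "excess i \<in> borel_measurable M" by measurable
  show "0 \<le> excess i x" for x by (rule excess_nonneg[OF i])
  show "cell i = {x\<in>space M. excess i x = 0}" using cell_eq[OF i] by simp
next
  fix x show "\<exists>i\<in>{1..n}. excess i x = 0" by (rule excess_attained)
next
  fix i j assume ij: "i \<in> {1..n}" "j \<in> {1..n}" "i \<noteq> j"
  have l: "0 < 2 * norm (y i - y j)" using atoms_ne[OF ij] by simp
  show "AE x in M. \<not> (x \<in> cell i \<and> x \<in> cell j)" by (rule cells_disjoint[OF ij])
  have part: "{x\<in>{x\<in>cell i. \<forall>k\<in>{1..n} - {i, j}. a \<le> excess k x}. excess j x \<le> t}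
      = {x\<in>cell_part n y \<gamma> i j a. slack y \<gamma> i j x \<le> t}" for a t
    using excess_slack[OF ij(1)] by (auto simp: cell_part_def)
  have part0: "{x\<in>cell i. excess j x \<le> t} = {x\<in>cell_part n y \<gamma> i j 0. slack y \<gamma> i j x \<le> t}" for t
    unfolding part[symmetric] using excess_nonneg by auto
  obtain e where e: "0 < e" "\<And>a. 0 \<le> a \<Longrightarrow> a < e \<Longrightarrow> continuous (at 0 within {0..}) (\<lambda>t. h i j t a)"
    using cont_t[OF ij] by blast
  show "((\<lambda>t. prob {x\<in>cell i. excess j x \<le> t} / t) \<longlongrightarrow> \<kappa> i j) (at_right 0)"
    unfolding part0 \<kappa>_def by (rule slab_ratio[OF ij e(2) fin[OF ij]]) (use e(1) in auto)
  fix e' :: real assume e': "0 < e'"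
  \<comment> \<open>Towards \<open>core\<close>: by continuity in a the slope of the slab mass at
    small positive a stays above \<kappa> i j - e'. The a chosen must also have finite h and lie in
    the range where h is continuous in t, so that \<open>slab_ratio\<close> applies to the reduced
    cell part.\<close>
  have "((\<lambda>a. h i j 0 a) \<longlongrightarrow> h i j 0 0) (at 0 within {0..})"
    using cont_a[OF ij] by (simp add: continuous_within)
  then have lim: "((\<lambda>a. h i j 0 a) \<longlongrightarrow> h i j 0 0) (at_right 0)"
    by (rule tendsto_within_subset) auto
  have "((\<lambda>a. enn2real (h i j 0 a) / (2 * norm (y i - y j))) \<longlongrightarrow> \<kappa> i j) (at_right 0)"
    unfolding \<kappa>_def using l fin[OF ij] lim by (intro tendsto_divide tendsto_enn2real tendsto_const) auto
  from order_tendstoD(1)[OF this, of "\<kappa> i j - e'"] e'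
  have ev1: "\<forall>\<^sub>F a in at_right 0. \<kappa> i j - e' < enn2real (h i j 0 a) / (2 * norm (y i - y j))" by simp
  have ev2: "\<forall>\<^sub>F a in at_right 0. h i j 0 a < \<infinity>"
    using order_tendstoD(2)[OF lim fin[OF ij]] .
  have ev3: "\<forall>\<^sub>F a in at_right 0. 0 < a \<and> a < e"
    using e(1) unfolding eventually_at_right_field by auto
  have "\<forall>\<^sub>F a in at_right 0. \<kappa> i j - e' < enn2real (h i j 0 a) / (2 * norm (y i - y j)) \<and> h i j 0 a < \<infinity> \<and> 0 < a \<and> a < e"
    using ev1 ev2 ev3 by eventually_elim auto
  then obtain a where a: "\<kappa> i j - e' < enn2real (h i j 0 a) / (2 * norm (y i - y j))" "h i j 0 a < \<infinity>" "0 < a" "a < e"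
    using eventually_happens[of _ "at_right (0::real)"] by (auto simp: trivial_limit_at_right_real)
  show "\<exists>a>0. \<exists>\<kappa>'>\<kappa> i j - e'. ((\<lambda>t. prob {x\<in>{x\<in>cell i. \<forall>k\<in>{1..n} - {i, j}. a \<le> excess k x}. excess j x \<le> t} / t) \<longlongrightarrow> \<kappa>') (at_right 0)"
    unfolding part using a e(2)[of a] by (intro exI[of _ a] conjI exI[of _ "enn2real (h i j 0 a) / (2 * norm (y i - y j))"] slab_ratio[OF ij]) auto
next
  fix i j assume ij: "i \<in> {1..n}" "j \<in> {1..n}"
  show "\<kappa> i j = \<kappa> j i" using facet_integral_sym[OF ij] by (simp add: \<kappa>_def norm_minus_commute)
  have "{(i, j). i \<in> {1..n} \<and> j \<in> {1..n} \<and> i \<noteq> j \<and> 0 < h i j 0 0}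
    \<subseteq> {(i, j). i \<in> {1..n} \<and> j \<in> {1..n} \<and> i \<noteq> j \<and> 0 < \<kappa> i j}"
    using fin atoms_ne by (auto simp: \<kappa>_def enn2real_positive_iff)
  moreover have "(i, j) \<in> {(i, j). i \<in> {1..n} \<and> j \<in> {1..n} \<and> i \<noteq> j \<and> 0 < h i j 0 0}\<^sup>*"
    using mass by (intro facet_graph_connected[OF conn front dpos _ ij]) (auto simp: emeasure_eq_measure)
  ultimately show "(i, j) \<in> {(i, j). i \<in> {1..n} \<and> j \<in> {1..n} \<and> i \<noteq> j \<and> 0 < \<kappa> i j}\<^sup>*"
    using rtrancl_mono by blast
qed simp_all

end

text \<open>The minimal value is concave in \<open>1/\<eta>\<close>, so its second-order expansion can be differentiated.\<close>

lemma concave_expansion_derivative: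
  fixes C E :: "real \<Rightarrow> real"
  assumes min: "\<And>s t. r \<le> s \<Longrightarrow> r \<le> t \<Longrightarrow> C s + E s / s \<le> C t + E t / s"
    and lim: "((\<lambda>t. t\<^sup>2 * (C t + E t / t - W - H / t)) \<longlongrightarrow> - K) at_top"
  shows "((\<lambda>t. t\<^sup>2 * (C t - W)) \<longlongrightarrow> K) at_top"
proof -
  define u where "u t = t\<^sup>2 * (C t + E t / t - W - H / t)" for t
  have ulim: "(u \<longlongrightarrow> - K) at_top" using lim by (simp add: u_def[abs_def])
  \<comment> \<open>\<open>k\<close> is the scaled deviation of the entropy from H; the entropy
    plays the role of the derivative of the value in 1/t. The comparison below bounds
    \<open>c\<^sup>2 * u (t / c)\<close> by u t + (c - 1) k t; taking c slightly above and below one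
    encloses k near -2 K, the derivative of -K c^2 at c = 1, and then u - k tends to K.\<close>
  define k where "k t = t * (E t - H)" for t
  have rel: "t\<^sup>2 * (C t - W) = u t - k t" if "0 < t" for t
    using that by (simp add: u_def k_def power2_eq_square field_simps)
  \<comment> \<open>comparing the minimisers for \<open>t\<close> and \<open>t / c\<close>, that is, for \<open>1/t\<close> and \<open>c/t\<close>\<close>
  have cmp: "c\<^sup>2 * u (t / c) \<le> u t + (c - 1) * k t" if t: "max r 1 \<le> t" "max r 1 \<le> t / c" and c: "0 < c" for t c
  proof -
    have t0: "0 < t" "0 < t / c" using t by auto
    have "C (t / c) + E (t / c) / (t / c) \<le> C t + E t / (t / c)" using min[of "t / c" t] t by simp
    then have "t\<^sup>2 * (C (t / c) + E (t / c) / (t / c) - W - H / (t / c)) \<le> t\<^sup>2 * (C t + E t / (t / c) - W - H / (t / c))"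
      by (intro mult_left_mono) auto
    moreover have "t\<^sup>2 * (C (t / c) + E (t / c) / (t / c) - W - H / (t / c)) = c\<^sup>2 * u (t / c)"
      using c t0 by (simp add: u_def power_divide)
    moreover have "t\<^sup>2 * (C t + E t / (t / c) - W - H / (t / c)) = u t + (c - 1) * k t"
      using c t0 by (simp add: u_def k_def power2_eq_square field_simps)
    ultimately show ?thesis by simp
  qed
  have scale: "((\<lambda>t. u (t / c)) \<longlongrightarrow> - K) at_top" and big: "\<forall>\<^sub>F t in at_top. max r 1 \<le> t / c"
    if c: "0 < c" for c
  proof -
    have f: "filterlim (\<lambda>t. t / c) at_top at_top"
      using filterlim_tendsto_pos_mult_at_top[OF tendsto_const[of "inverse c"] _ filterlim_ident] c
      by (simp add: divide_inverse mult.commute)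
    show "((\<lambda>t. u (t / c)) \<longlongrightarrow> - K) at_top" by (rule filterlim_compose[OF ulim f])
    show "\<forall>\<^sub>F t in at_top. max r 1 \<le> t / c" using f unfolding filterlim_at_top by blast
  qed
  have klim: "(k \<longlongrightarrow> - (2 * K)) at_top"
  proof (rule tendstoI)
    fix e :: real assume e: "0 < e"
    \<comment> \<open>The difference quotients of -K c^2 at c = 1 miss the derivative by \<tau> |K|,
      which this choice keeps within e/2; the cap 1/2 keeps 1 - \<tau> positive.\<close>
    define \<tau> where "\<tau> = min (1 / 2) (e / (2 * (\<bar>K\<bar> + 1)))"
    have \<tau>: "0 < \<tau>" "\<tau> \<le> 1 / 2" "\<tau> * (\<bar>K\<bar> + 1) \<le> e / 2"
    proof -
      show "0 < \<tau>" using e by (simp add: \<tau>_def add_nonneg_pos)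
      show "\<tau> \<le> 1 / 2" unfolding \<tau>_def by (rule min.cobounded1)
      have "\<tau> \<le> e / (2 * (\<bar>K\<bar> + 1))" by (simp add: \<tau>_def)
      then show "\<tau> * (\<bar>K\<bar> + 1) \<le> e / 2"
        by (simp add: field_simps add_nonneg_pos pos_le_divide_eq)
    qed
    have l1: "((\<lambda>t. ((1 + \<tau>)\<^sup>2 * u (t / (1 + \<tau>)) - u t) / \<tau>) \<longlongrightarrow> ((1 + \<tau>)\<^sup>2 * (- K) - (- K)) / \<tau>) at_top"
      using \<tau> by (intro tendsto_intros scale ulim) auto
    have v1: "((1 + \<tau>)\<^sup>2 * (- K) - (- K)) / \<tau> = - (2 * K) - \<tau> * K"
      using \<tau> by (simp add: power2_eq_square field_simps)
    have l2: "((\<lambda>t. (u t - (1 - \<tau>)\<^sup>2 * u (t / (1 - \<tau>))) / \<tau>) \<longlongrightarrow> (- K - (1 - \<tau>)\<^sup>2 * (- K)) / \<tau>) at_top"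
      using \<tau> by (intro tendsto_intros scale ulim) auto
    have v2: "(- K - (1 - \<tau>)\<^sup>2 * (- K)) / \<tau> = - (2 * K) + \<tau> * K"
      using \<tau> by (simp add: power2_eq_square field_simps)
    have tK: "\<bar>\<tau> * K\<bar> \<le> e / 2"
    proof -
      have "\<bar>\<tau> * K\<bar> = \<tau> * \<bar>K\<bar>" using \<tau> by (simp add: abs_mult)
      also have "\<dots> \<le> \<tau> * (\<bar>K\<bar> + 1)" using \<tau> by (intro mult_left_mono) auto
      finally show ?thesis using \<tau>(3) by linarith
    qed
    have e1: "\<forall>\<^sub>F t in at_top. - (2 * K) - e < ((1 + \<tau>)\<^sup>2 * u (t / (1 + \<tau>)) - u t) / \<tau>"
      using tK e by (intro order_tendstoD(1)[OF l1[unfolded v1]]) (simp add: abs_le_iff)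
    have e2: "\<forall>\<^sub>F t in at_top. (u t - (1 - \<tau>)\<^sup>2 * u (t / (1 - \<tau>))) / \<tau> < - (2 * K) + e"
      using tK e by (intro order_tendstoD(2)[OF l2[unfolded v2]]) (simp add: abs_le_iff)
    have "\<forall>\<^sub>F t in at_top. max r 1 \<le> t / (1 + \<tau>)" "\<forall>\<^sub>F t in at_top. max r 1 \<le> t / (1 - \<tau>)"
      using big \<tau> by auto
    with e1 e2 show "\<forall>\<^sub>F t in at_top. dist (k t) (- (2 * K)) < e"
      using eventually_ge_at_top[of "max r 1"]
    proof eventually_elim
      fix t assume a1: "- (2 * K) - e < ((1 + \<tau>)\<^sup>2 * u (t / (1 + \<tau>)) - u t) / \<tau>"
        and a2: "(u t - (1 - \<tau>)\<^sup>2 * u (t / (1 - \<tau>))) / \<tau> < - (2 * K) + e"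
        and b: "max r 1 \<le> t / (1 + \<tau>)" "max r 1 \<le> t / (1 - \<tau>)" "max r 1 \<le> t"
      have "(1 + \<tau>)\<^sup>2 * u (t / (1 + \<tau>)) \<le> u t + \<tau> * k t" using cmp[OF b(3,1)] \<tau> by simp
      then have "((1 + \<tau>)\<^sup>2 * u (t / (1 + \<tau>)) - u t) / \<tau> \<le> k t" using \<tau> by (simp add: field_simps)
      moreover have "(1 - \<tau>)\<^sup>2 * u (t / (1 - \<tau>)) \<le> u t - \<tau> * k t" using cmp[OF b(3,2)] \<tau> by simp
      then have "k t \<le> (u t - (1 - \<tau>)\<^sup>2 * u (t / (1 - \<tau>))) / \<tau>" using \<tau> by (simp add: field_simps)
      ultimately show "dist (k t) (- (2 * K)) < e" using a1 a2 by (simp add: dist_real_def abs_less_iff)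
    qed
  qed
  have "((\<lambda>t. u t - k t) \<longlongrightarrow> - K - - (2 * K)) at_top" by (intro tendsto_diff ulim klim)
  then have "((\<lambda>t. u t - k t) \<longlongrightarrow> K) at_top" by simp
  then show ?thesis
    by (rule Lim_transform_eventually) (auto intro!: eventually_mono[OF eventually_gt_at_top[of 0]] simp: rel)
qed

text \<open>Gibbs variational inequality: the difference of the two sides is the relative entropy of
  P with respect to the probability measure with density \<psi>.\<close>

lemma (in sigma_finite_measure) KL_divergence_ge_integral_ln:
  fixes \<psi> :: "'a \<Rightarrow> real"
  assumes P: "prob_space P" "sets P = sets M" "absolutely_continuous M P"
    and int: "integrable P (entropy_density (exp 1) M P)"
    and \<psi>[measurable]: "\<psi> \<in> borel_measurable M" and \<psi>pos: "AE x in M. 0 < \<psi> x"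
    and \<psi>P: "prob_space (density M (\<lambda>x. ennreal (\<psi> x)))" and ln\<psi>: "integrable P (\<lambda>x. ln (\<psi> x))"
  shows "(\<integral>x. ln (\<psi> x) \<partial>P) \<le> KL_divergence (exp 1) M P"
proof -
  interpret P: prob_space P by fact
  define D where "D x = enn2real (RN_deriv M P x)" for x
  have Dm[measurable]: "D \<in> borel_measurable M" unfolding D_def by measurable
  have D0: "0 \<le> D x" for x by (simp add: D_def)
  have finD: "AE x in M. RN_deriv M P x \<noteq> \<infinity>"
    using P by (intro RN_deriv_finite) (auto intro: P.sigma_finite_measure_axioms)
  have PD: "P = density M (\<lambda>x. ennreal (D x))"
  proof -
    have "P = density M (RN_deriv M P)" using density_RN_deriv[OF P(3,2)] by simp
    also have "\<dots> = density M (\<lambda>x. ennreal (D x))"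
      using finD by (intro density_cong) (auto simp: D_def less_top)
    finally show ?thesis .
  qed
  have ed: "entropy_density (exp 1) M P = (\<lambda>x. ln (D x))"
    by (simp add: entropy_density_def D_def[abs_def] comp_def log_def)
  have viaD: "integrable P f \<longleftrightarrow> integrable M (\<lambda>x. D x * f x)" "(\<integral>x. f x \<partial>P) = (\<integral>x. D x * f x \<partial>M)"
    if "f \<in> borel_measurable M" for f :: "'a \<Rightarrow> real"
    using integrable_real_density[of D M f] integral_real_density[of D M f] D0 that
    unfolding PD[symmetric] by auto
  have i1: "integrable M (\<lambda>x. D x * ln (D x))" using int unfolding ed by (subst (asm) viaD) auto
  have i2: "integrable M (\<lambda>x. D x * ln (\<psi> x))" using ln\<psi> by (subst (asm) viaD) auto
  have \<psi>0: "AE x in M. 0 \<le> \<psi> x" using \<psi>pos by eventually_elim simp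
  have dec: "AE x in M. D x * log (exp 1) (D x / \<psi> x) = D x * ln (D x) - D x * ln (\<psi> x)"
    using \<psi>pos
  proof eventually_elim
    fix x assume x: "0 < \<psi> x"
    show "D x * log (exp 1) (D x / \<psi> x) = D x * ln (D x) - D x * ln (\<psi> x)"
    proof (cases "D x = 0")
      case False
      then have "0 < D x" using D0[of x] by simp
      then show ?thesis using x by (simp add: log_def ln_div right_diff_distrib)
    qed simp
  qed
  have i3: "integrable M (\<lambda>x. D x * log (exp 1) (D x / \<psi> x))"
    using Bochner_Integration.integrable_diff[OF i1 i2] by (rule integrable_cong_AE_imp) (use dec in auto)
  have ac: "AE x in M. \<psi> x = 0 \<longrightarrow> D x = 0" using \<psi>pos by eventually_elim simp
  have "0 \<le> KL_divergence (exp 1) (density M (\<lambda>x. ennreal (\<psi> x))) (density M (\<lambda>x. ennreal (D x)))"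
    using P(1) PD D0 \<psi>0 \<psi>P ac i3 by (intro KL_density_density_nonneg) auto
  also have "\<dots> = (\<integral>x. D x * log (exp 1) (D x / \<psi> x) \<partial>M)"
    using D0 \<psi>0 ac by (intro KL_density_density) auto
  also have "\<dots> = (\<integral>x. D x * ln (D x) - D x * ln (\<psi> x) \<partial>M)"
    using dec by (intro integral_cong_AE) auto
  also have "\<dots> = (\<integral>x. D x * ln (D x) \<partial>M) - (\<integral>x. D x * ln (\<psi> x) \<partial>M)" using i1 i2 by simp
  also have "(\<integral>x. D x * ln (\<psi> x) \<partial>M) = (\<integral>x. ln (\<psi> x) \<partial>P)"
    by (rule viaD(2)[symmetric]) measurable
  also have "(\<integral>x. D x * ln (D x) \<partial>M) = KL_divergence (exp 1) M P"
    unfolding KL_divergence_def ed by (rule viaD(2)[symmetric]) measurable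
  finally show ?thesis by simp
qed

section \<open>Semidiscrete couplings\<close>

lemma sum_symmetric_pairs:
  fixes a :: "nat \<Rightarrow> nat \<Rightarrow> real"
  assumes "\<And>i j. i \<in> {1..n} \<Longrightarrow> j \<in> {1..n} \<Longrightarrow> a i j = a j i"
  shows "(\<Sum>i\<in>{1..n}. \<Sum>j\<in>{1..n} - {i}. a i j) = 2 * (\<Sum>j=1..n. \<Sum>i\<in>{1..<j}. a i j)"
proof -
  have split: "sum (a i) ({1..n} - {i}) = sum (a i) {1..<i} + sum (a i) {i<..n}" if "i \<in> {1..n}" for i
  proof -
    have eq: "{1..n} - {i} = {1..<i} \<union> {i<..n}" using that by auto
    show ?thesis unfolding eq by (rule sum.union_disjoint) auto
  qed
  have "(\<Sum>i\<in>{1..n}. sum (a i) ({1..n} - {i})) = (\<Sum>i\<in>{1..n}. sum (a i) {1..<i} + sum (a i) {i<..n})"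
    by (rule sum.cong[OF refl split])
  also have "\<dots> = (\<Sum>i\<in>{1..n}. sum (a i) {1..<i}) + (\<Sum>i\<in>{1..n}. sum (a i) {i<..n})"
    by (rule sum.distrib)
  also have "(\<Sum>i\<in>{1..n}. sum (a i) {1..<i}) = (\<Sum>j\<in>{1..n}. \<Sum>i\<in>{1..<j}. a i j)"
    by (intro sum.cong refl assms) auto
  also have "(\<Sum>i\<in>{1..n}. sum (a i) {i<..n}) = (\<Sum>j\<in>{1..n}. \<Sum>i\<in>{1..<j}. a i j)"
    by (subst sum.Sigma, simp, simp, subst sum.Sigma, simp, simp,
        rule sum.reindex_bij_witness[where i="\<lambda>(j, i). (i, j)" and j="\<lambda>(i, j). (j, i)"]) auto
  finally show ?thesis by simp
qed

lemma sum_single_index: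
  fixes f :: "'i \<Rightarrow> 'b::comm_monoid_add"
  assumes "inj_on y I" "finite I" "i \<in> I"
  shows "(\<Sum>k\<in>I. if y i = y k then f k else 0) = f i"
proof -
  have "(\<Sum>k\<in>I. if y i = y k then f k else 0) = (\<Sum>k\<in>I. if k = i then f k else 0)"
    using assms by (intro sum.cong) (auto dest: inj_onD)
  then show ?thesis using assms by simp
qed

text \<open>\<gamma> is arbitrary here. Optimality of the second potential is expressed by comparing
  the interpretation at its values with interpretations at other vectors.\<close>

locale semidiscrete = power_cells n y \<gamma> M \<rho>
  for n :: nat and y :: "nat \<Rightarrow> 'a::euclidean_space" and \<gamma> :: "nat \<Rightarrow> real"
    and M :: "'a measure" and \<rho> :: "'a \<Rightarrow> real" +
  fixes p :: "nat \<Rightarrow> real" and N :: "'a measure"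
  assumes weights: "\<And>i. i \<in> {1..n} \<Longrightarrow> 0 < p i"
    and N_prob: "prob_space N" and sets_N [simp, measurable_cong]: "sets N = sets borel"
    and N_eq: "\<And>A. A \<in> sets borel \<Longrightarrow> emeasure N A = (\<Sum>i=1..n. ennreal (p i) * emeasure (return borel (y i)) A)"
    and second_moment: "integrable M (\<lambda>x. (norm x)\<^sup>2)"
begin

lemma space_N [simp]: "space N = UNIV"
  using sets_eq_imp_space_eq[OF sets_N] by simp

sublocale N: prob_space N by (rule N_prob)

sublocale MN: pair_prob_space M N ..

text \<open>Turns a family indexed by the atoms into a function of a point, extended by zero, so
  that measurability on the product space reduces to a finite sum.\<close>

definition at_atom :: "(nat \<Rightarrow> 'b::comm_monoid_add) \<Rightarrow> 'a \<Rightarrow> 'b" where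
  "at_atom F z = (\<Sum>i\<in>{1..n}. if z = y i then F i else 0)"

lemma at_atom [simp]: "i \<in> {1..n} \<Longrightarrow> at_atom F (y i) = F i"
  unfolding at_atom_def by (rule sum_single_index[OF inj]) auto

lemma at_atom_measurable:
  fixes F :: "nat \<Rightarrow> 'b \<Rightarrow> real"
  assumes "\<And>i. i \<in> {1..n} \<Longrightarrow> F i \<in> borel_measurable L" "f \<in> borel_measurable K" "g \<in> K \<rightarrow>\<^sub>M L"
  shows "(\<lambda>w. at_atom (\<lambda>i. F i (g w)) (f w)) \<in> borel_measurable K"
  unfolding at_atom_def
proof (rule borel_measurable_sum)
  fix i assume i: "i \<in> {1..n}"
  have [measurable]: "{w\<in>space K. f w = y i} \<in> sets K"
    using assms(2) by measurable
  have [measurable]: "(\<lambda>w. F i (g w)) \<in> borel_measurable K"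
    using measurable_compose[OF assms(3) assms(1)[OF i]] .
  show "(\<lambda>w. if f w = y i then F i (g w) else 0) \<in> borel_measurable K" by measurable
qed

lemma AE_N: "AE z in N. \<exists>i\<in>{1..n}. z = y i"
proof -
  have m: "- (y ` {1..n}) \<in> sets borel" by (intro borel_comp borel_closed finite_imp_closed) auto
  have "emeasure N (- (y ` {1..n})) = 0"
    unfolding N_eq[OF m] using m by (intro sum.neutral) (auto simp: indicator_def)
  then have "AE z in N. z \<notin> - (y ` {1..n})" using m by (intro AE_not_in) (auto simp: null_sets_def)
  then show ?thesis by eventually_elim auto
qed

lemma atom_mass: "i \<in> {1..n} \<Longrightarrow> emeasure N {y i} = ennreal (p i)"
proof -
  assume i: "i \<in> {1..n}"
  have "emeasure N {y i} = (\<Sum>k\<in>{1..n}. if y i = y k then ennreal (p k) else 0)"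
  proof -
    have "emeasure N {y i} = (\<Sum>k=1..n. ennreal (p k) * emeasure (return borel (y k)) {y i})"
      by (rule N_eq) simp
    also have "\<dots> = (\<Sum>k\<in>{1..n}. if y i = y k then ennreal (p k) else 0)"
      by (rule sum.cong[OF refl]) (auto simp: indicator_def)
    finally show ?thesis .
  qed
  then show ?thesis using sum_single_index[OF inj _ i, of "\<lambda>k. ennreal (p k)"] by simp
qed

lemma atom_AE:
  assumes "AE z in N. P z" and i: "i \<in> {1..n}"
  shows "P (y i)"
proof -
  obtain S where S: "{z\<in>space N. \<not> P z} \<subseteq> S" "emeasure N S = 0" "S \<in> sets N"
    using assms(1) by (rule AE_E)
  show ?thesis
  proof (rule ccontr)
    assume "\<not> P (y i)"
    then have "{y i} \<subseteq> S" using S(1) by auto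
    then have "emeasure N {y i} \<le> emeasure N S" using S(3) by (rule emeasure_mono)
    then show False using atom_mass[OF i] weights[OF i] S(2) by simp
  qed
qed

lemma nn_integral_N:
  assumes [measurable]: "F \<in> borel_measurable borel"
  shows "(\<integral>\<^sup>+z. F z \<partial>N) = (\<Sum>i\<in>{1..n}. ennreal (p i) * F (y i))"
proof -
  have "(\<integral>\<^sup>+z. F z \<partial>N) = (\<integral>\<^sup>+z. (\<Sum>i\<in>{1..n}. F (y i) * indicator {y i} z) \<partial>N)"
  proof (rule nn_integral_cong_AE, use AE_N in eventually_elim)
    fix z assume "\<exists>i\<in>{1..n}. z = y i"
    then obtain i where i: "i \<in> {1..n}" "z = y i" by blast
    have "(\<Sum>k\<in>{1..n}. F (y k) * indicator {y k} z) = (\<Sum>k\<in>{1..n}. if y i = y k then F (y k) else 0)"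
      using i by (intro sum.cong) (auto simp: indicator_def)
    also have "\<dots> = F (y i)" by (rule sum_single_index[OF inj _ i(1)]) simp
    finally show "F z = (\<Sum>k\<in>{1..n}. F (y k) * indicator {y k} z)" using i by simp
  qed
  also have "\<dots> = (\<Sum>i\<in>{1..n}. F (y i) * emeasure N {y i})"
    by (subst nn_integral_sum) (auto simp: nn_integral_cmult_indicator)
  finally show ?thesis using atom_mass by (simp add: mult.commute)
qed

lemma weights_sum: "(\<Sum>i\<in>{1..n}. p i) = 1"
proof -
  have "ennreal (\<Sum>i\<in>{1..n}. p i) = (\<Sum>i\<in>{1..n}. ennreal (p i) * 1)"
    unfolding mult_1_right by (rule sum_ennreal[symmetric]) (rule less_imp_le[OF weights])
  also have "\<dots> = (\<integral>\<^sup>+z. 1 \<partial>N)" by (rule nn_integral_N[symmetric]) simp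
  also have "\<dots> = 1" using N.emeasure_space_1 by simp
  finally show ?thesis using weights by (simp add: sum_nonneg less_imp_le ennreal_eq_1)
qed

lemma N_bounded_integrable:
  fixes F :: "'a \<Rightarrow> real"
  assumes [measurable]: "F \<in> borel_measurable borel"
  shows "integrable N F" and "(\<integral>z. F z \<partial>N) = (\<Sum>i\<in>{1..n}. p i * F (y i))"
proof -
  have fin: "(\<integral>\<^sup>+z. ennreal (G z) \<partial>N) = ennreal (\<Sum>i\<in>{1..n}. p i * G (y i))"
    if [measurable]: "G \<in> borel_measurable borel" and G: "\<And>z. 0 \<le> G z" for G
    using weights G by (subst nn_integral_N) (auto simp: ennreal_mult[symmetric] less_imp_le intro!: sum_ennreal)
  show i: "integrable N F"
    unfolding integrable_iff_bounded using fin[of "\<lambda>z. \<bar>F z\<bar>"] by simp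
  have G0: "(\<integral>z. G z \<partial>N) = (\<Sum>i\<in>{1..n}. p i * G (y i))"
    if [measurable]: "G \<in> borel_measurable borel" and G: "\<And>z. 0 \<le> G z" for G
  proof -
    have "0 \<le> (\<Sum>i\<in>{1..n}. p i * G (y i))"
      by (intro sum_nonneg mult_nonneg_nonneg less_imp_le[OF weights] G)
    then show ?thesis using fin[OF that] G by (subst integral_eq_nn_integral) auto
  qed
  have "(\<integral>z. F z \<partial>N) = (\<integral>z. max 0 (F z) - max 0 (- F z) \<partial>N)"
    by (intro Bochner_Integration.integral_cong) auto
  also have "\<dots> = (\<integral>z. max 0 (F z) \<partial>N) - (\<integral>z. max 0 (- F z) \<partial>N)"
    using i by (intro Bochner_Integration.integral_diff) auto
  also have "\<dots> = (\<Sum>i\<in>{1..n}. p i * max 0 (F (y i))) - (\<Sum>i\<in>{1..n}. p i * max 0 (- F (y i)))"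
    by (subst G0, simp, simp, subst G0) auto
  also have "\<dots> = (\<Sum>i\<in>{1..n}. p i * F (y i))"
    unfolding sum_subtractf[symmetric] by (intro sum.cong) (auto simp: max_def)
  finally show "(\<integral>z. F z \<partial>N) = (\<Sum>i\<in>{1..n}. p i * F (y i))" .
qed

lemma nn_integral_MN:
  assumes [measurable]: "F \<in> borel_measurable (M \<Otimes>\<^sub>M N)"
  shows "(\<integral>\<^sup>+w. F w \<partial>(M \<Otimes>\<^sub>M N)) = (\<Sum>i\<in>{1..n}. ennreal (p i) * (\<integral>\<^sup>+x. F (x, y i) \<partial>M))"
proof -
  have m: "(\<lambda>z. F (x, z)) \<in> borel_measurable borel" for x
    using measurable_compose[OF measurable_Pair1' assms, of x] by (simp cong: measurable_cong_sets)
  have m2: "(\<lambda>x. F (x, z)) \<in> borel_measurable M" for z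
    using measurable_compose[OF measurable_Pair2' assms, of z] by simp
  have "(\<integral>\<^sup>+w. F w \<partial>(M \<Otimes>\<^sub>M N)) = (\<integral>\<^sup>+x. (\<integral>\<^sup>+z. F (x, z) \<partial>N) \<partial>M)"
    by (rule N.nn_integral_fst[symmetric]) measurable
  also have "\<dots> = (\<integral>\<^sup>+x. (\<Sum>i\<in>{1..n}. ennreal (p i) * F (x, y i)) \<partial>M)"
    by (intro nn_integral_cong nn_integral_N m)
  also have "\<dots> = (\<Sum>i\<in>{1..n}. ennreal (p i) * (\<integral>\<^sup>+x. F (x, y i) \<partial>M))"
    using m2 by (subst nn_integral_sum) (auto simp: nn_integral_cmult)
  finally show ?thesis .
qed

lemma integral_MN:
  fixes F :: "'a \<times> 'a \<Rightarrow> real"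
  assumes F: "integrable (M \<Otimes>\<^sub>M N) F" and Fi: "\<And>i. i \<in> {1..n} \<Longrightarrow> integrable M (\<lambda>x. F (x, y i))"
  shows "(\<integral>w. F w \<partial>(M \<Otimes>\<^sub>M N)) = (\<Sum>i\<in>{1..n}. p i * (\<integral>x. F (x, y i) \<partial>M))"
proof -
  have Fm: "F \<in> borel_measurable (M \<Otimes>\<^sub>M N)" using F by (rule borel_measurable_integrable)
  have m: "(\<lambda>z. F (x, z)) \<in> borel_measurable borel" for x
    using measurable_compose[OF measurable_Pair1' Fm, of x] by (simp cong: measurable_cong_sets)
  have "(\<integral>w. F w \<partial>(M \<Otimes>\<^sub>M N)) = (\<integral>x. (\<integral>z. F (x, z) \<partial>N) \<partial>M)"
    by (rule MN.integral_fst'[symmetric]) fact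
  also have "\<dots> = (\<integral>x. (\<Sum>i\<in>{1..n}. p i * F (x, y i)) \<partial>M)"
    by (intro Bochner_Integration.integral_cong refl N_bounded_integrable m)
  also have "\<dots> = (\<Sum>i\<in>{1..n}. p i * (\<integral>x. F (x, y i) \<partial>M))"
    using Fi by (subst Bochner_Integration.integral_sum) auto
  finally show ?thesis .
qed

lemma cost_integrable: "integrable M (\<lambda>x. (norm (x - c))\<^sup>2)"
proof (rule Bochner_Integration.integrable_bound)
  show "integrable M (\<lambda>x. 2 * (norm x)\<^sup>2 + 2 * (norm c)\<^sup>2)" using second_moment by simp
  show "AE x in M. norm ((norm (x - c))\<^sup>2) \<le> norm (2 * (norm x)\<^sup>2 + 2 * (norm c)\<^sup>2)"
  proof (rule AE_I2)
    fix x :: 'a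
    have "(norm (x - c))\<^sup>2 \<le> (norm x + norm c)\<^sup>2" by (intro power_mono norm_triangle_ineq4) simp
    also have "\<dots> \<le> 2 * (norm x)\<^sup>2 + 2 * (norm c)\<^sup>2"
      using sum_squares_bound[of "norm x" "norm c"] by (simp add: power2_sum)
    finally show "norm ((norm (x - c))\<^sup>2) \<le> norm (2 * (norm x)\<^sup>2 + 2 * (norm c)\<^sup>2)" by simp
  qed
qed simp

lemma potential_ge: "- (\<Sum>i\<in>{1..n}. \<bar>\<gamma> i\<bar>) \<le> potential x"
proof -
  obtain i where i: "i \<in> {1..n}" "potential x = (norm (x - y i))\<^sup>2 - \<gamma> i" using potential_attained by blast
  have "\<bar>\<gamma> i\<bar> \<le> (\<Sum>i\<in>{1..n}. \<bar>\<gamma> i\<bar>)" by (rule member_le_sum) (use i in auto)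
  moreover have "- \<bar>\<gamma> i\<bar> \<le> (norm (x - y i))\<^sup>2 - \<gamma> i" using abs_ge_self[of "\<gamma> i"] zero_le_power2[of "norm (x - y i)"] by linarith
  ultimately show ?thesis using i by linarith
qed

lemma potential_integrable: "integrable M potential"
proof (rule Bochner_Integration.integrable_bound)
  let ?s = "\<Sum>i\<in>{1..n}. \<bar>\<gamma> i\<bar>"
  have one: "1 \<in> {1..n}" using n1 by simp
  show "integrable M (\<lambda>x. (norm (x - y 1))\<^sup>2 + ?s)" using cost_integrable by simp
  show "AE x in M. norm (potential x) \<le> norm ((norm (x - y 1))\<^sup>2 + ?s)"
  proof (rule AE_I2)
    fix x
    have "\<bar>\<gamma> 1\<bar> \<le> ?s" by (rule member_le_sum) (use one in auto)
    then have "potential x \<le> (norm (x - y 1))\<^sup>2 + ?s" using potential_le[OF one, of x] by linarith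
    moreover have "- ((norm (x - y 1))\<^sup>2 + ?s) \<le> potential x"
      using potential_ge[of x] zero_le_power2[of "norm (x - y 1)"] by linarith
    ultimately show "norm (potential x) \<le> norm ((norm (x - y 1))\<^sup>2 + ?s)" by simp
  qed
qed measurable

section \<open>Dual value, excess cost and the masses of the cells\<close>

definition W :: real where
  "W = (\<integral>x. potential x \<partial>M) + (\<Sum>i\<in>{1..n}. p i * \<gamma> i)"

lemma dual_feasible_potential:
  "dual_feasible M N potential (at_atom \<gamma>)"
proof -
  have gm: "at_atom \<gamma> \<in> borel_measurable borel"
    using at_atom_measurable[of "\<lambda>i _. \<gamma> i" borel "\<lambda>z. z" borel "\<lambda>z. z"] by simp
  have "\<exists>A B. (AE x in M. x \<in> A) \<and> (AE z in N. z \<in> B) \<and>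
            (\<forall>x\<in>A. \<forall>z\<in>B. potential x + at_atom \<gamma> z \<le> (norm (x - z))\<^sup>2)"
  proof (rule exI[of _ UNIV], rule exI[of _ "y ` {1..n}"], intro conjI ballI)
    show "AE x in M. x \<in> UNIV" by simp
    show "AE z in N. z \<in> y ` {1..n}" using AE_N by eventually_elim auto
    fix x z assume "z \<in> y ` {1..n}"
    then obtain i where i: "i \<in> {1..n}" "z = y i" by blast
    show "potential x + at_atom \<gamma> z \<le> (norm (x - z))\<^sup>2"
      using potential_le[OF i(1), of x] i by simp
  qed
  then show ?thesis
    unfolding dual_feasible_def using potential_integrable N_bounded_integrable(1)[OF gm] by blast
qed

lemma dual_value: "(\<integral>x. potential x \<partial>M) + (\<integral>z. at_atom \<gamma> z \<partial>N) = W"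
proof -
  have gm: "at_atom \<gamma> \<in> borel_measurable borel"
    using at_atom_measurable[of "\<lambda>i _. \<gamma> i" borel "\<lambda>z. z" borel "\<lambda>z. z"] by simp
  show ?thesis unfolding W_def N_bounded_integrable(2)[OF gm] by simp
qed

definition ex :: "'a \<times> 'a \<Rightarrow> real" where
  "ex w = at_atom (\<lambda>i. excess i (fst w)) (snd w)"

lemma ex_measurable [measurable]: "ex \<in> borel_measurable (borel \<Otimes>\<^sub>M borel)"
  unfolding ex_def[abs_def] by (rule at_atom_measurable) measurable

lemma ex_nonneg: "0 \<le> ex w"
  unfolding ex_def at_atom_def using excess_nonneg by (intro sum_nonneg) auto

text \<open>The potentials depend on one coordinate each, so every coupling gives them the same
  total integral W, and the cost of a coupling exceeds W exactly by the integral of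
  \<open>ex\<close>. This shifts the whole problem from costs to nonnegative excesses.\<close>

lemma coupling_facts:
  assumes P: "P \<in> couplings M N"
  shows "prob_space P" and "sets P = sets (borel \<Otimes>\<^sub>M borel)"
    and "integrable P ex" and "integrable P (\<lambda>w. (norm (fst w - snd w))\<^sup>2)"
    and "(\<integral>w. (norm (fst w - snd w))\<^sup>2 \<partial>P) = W + (\<integral>w. ex w \<partial>P)"
    and "transport_cost P = ennreal (\<integral>w. (norm (fst w - snd w))\<^sup>2 \<partial>P)"
    and "AE w in P. \<exists>i\<in>{1..n}. snd w = y i"
proof -
  have sP: "sets P = sets (M \<Otimes>\<^sub>M N)" and d1: "distr P M fst = M" and d2: "distr P N snd = N"
    using P by (auto simp: couplings_def)
  show sPb: "sets P = sets (borel \<Otimes>\<^sub>M borel)" unfolding sP by (intro sets_pair_measure_cong) simp_all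
  note [measurable_cong] = sPb
  have f1[measurable]: "fst \<in> P \<rightarrow>\<^sub>M M" and f2[measurable]: "snd \<in> P \<rightarrow>\<^sub>M N"
    using measurable_fst[of M N] measurable_snd[of M N] by (simp_all cong: measurable_cong_sets add: sP)
  show pP: "prob_space P"
  proof (rule prob_spaceI)
    have "emeasure P (space P) = emeasure (distr P M fst) (space M)"
      using measurable_space[OF f1] by (subst emeasure_distr) (auto intro: arg_cong[where f="emeasure P"])
    then show "emeasure P (space P) = 1" unfolding d1 using emeasure_space_1 by simp
  qed
  have I1: "integrable P (\<lambda>w. F (fst w))" "(\<integral>w. F (fst w) \<partial>P) = (\<integral>x. F x \<partial>M)" if "integrable M F" for F :: "'a \<Rightarrow> real"
  proof -
    have "F \<in> borel_measurable M" using that by simp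
    then show "integrable P (\<lambda>w. F (fst w))" "(\<integral>w. F (fst w) \<partial>P) = (\<integral>x. F x \<partial>M)"
      using that integrable_distr_eq[OF f1, of F] integral_distr[OF f1, of F] by (simp_all add: d1)
  qed
  have I2: "integrable P (\<lambda>w. F (snd w))" "(\<integral>w. F (snd w) \<partial>P) = (\<integral>x. F x \<partial>N)" if "F \<in> borel_measurable borel" for F :: "'a \<Rightarrow> real"
  proof -
    have "integrable N F" by (rule N_bounded_integrable(1)[OF that])
    moreover have "F \<in> borel_measurable N" using that by simp
    ultimately show "integrable P (\<lambda>w. F (snd w))" "(\<integral>w. F (snd w) \<partial>P) = (\<integral>x. F x \<partial>N)"
      using integrable_distr_eq[OF f2, of F] integral_distr[OF f2, of F] by (simp_all add: d2)
  qed
  show atoms: "AE w in P. \<exists>i\<in>{1..n}. snd w = y i"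
  proof -
    have "AE z in distr P N snd. \<exists>i\<in>{1..n}. z = y i" unfolding d2 by (rule AE_N)
    then show ?thesis by (rule AE_distrD[OF f2])
  qed
  have costm: "(\<lambda>w. (norm (fst w - snd w))\<^sup>2) \<in> borel_measurable P" by measurable
  show ci: "integrable P (\<lambda>w. (norm (fst w - snd w))\<^sup>2)"
  proof (rule Bochner_Integration.integrable_bound)
    show "integrable P (\<lambda>w. 2 * (norm (fst w))\<^sup>2 + 2 * (norm (snd w))\<^sup>2)"
      using I1(1)[OF second_moment] I2(1)[of "\<lambda>z. (norm z)\<^sup>2"] by simp
    show "AE w in P. norm ((norm (fst w - snd w))\<^sup>2) \<le> norm (2 * (norm (fst w))\<^sup>2 + 2 * (norm (snd w))\<^sup>2)"
    proof (rule AE_I2)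
      fix w :: "'a \<times> 'a"
      have "(norm (fst w - snd w))\<^sup>2 \<le> (norm (fst w) + norm (snd w))\<^sup>2" by (intro power_mono norm_triangle_ineq4) simp
      also have "\<dots> \<le> 2 * (norm (fst w))\<^sup>2 + 2 * (norm (snd w))\<^sup>2"
        using sum_squares_bound[of "norm (fst w)" "norm (snd w)"] by (simp add: power2_sum)
      finally show "norm ((norm (fst w - snd w))\<^sup>2) \<le> norm (2 * (norm (fst w))\<^sup>2 + 2 * (norm (snd w))\<^sup>2)" by simp
    qed
  qed (rule costm)
  have gm: "at_atom \<gamma> \<in> borel_measurable borel"
    using at_atom_measurable[of "\<lambda>i _. \<gamma> i" borel "\<lambda>z. z" borel "\<lambda>z. z"] by simp
  have dec: "AE w in P. ex w = (norm (fst w - snd w))\<^sup>2 - potential (fst w) - at_atom \<gamma> (snd w)"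
    using atoms by eventually_elim (auto simp: ex_def excess_def)
  have i3: "integrable P (\<lambda>w. (norm (fst w - snd w))\<^sup>2 - potential (fst w) - at_atom \<gamma> (snd w))"
    using ci I1(1)[OF potential_integrable] I2(1)[OF gm] by simp
  have exm: "ex \<in> borel_measurable P" by measurable
  show exi: "integrable P ex"
    using i3 by (rule integrable_cong_AE_imp[OF _ exm]) (use dec in \<open>eventually_elim, simp\<close>)
  have "(\<integral>w. ex w \<partial>P) = (\<integral>w. (norm (fst w - snd w))\<^sup>2 - potential (fst w) - at_atom \<gamma> (snd w) \<partial>P)"
    using dec i3 exm by (intro integral_cong_AE) auto
  also have "\<dots> = (\<integral>w. (norm (fst w - snd w))\<^sup>2 \<partial>P) - (\<integral>x. potential x \<partial>M) - (\<integral>z. at_atom \<gamma> z \<partial>N)"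
    using ci I1[OF potential_integrable] I2[OF gm] by simp
  finally show "(\<integral>w. (norm (fst w - snd w))\<^sup>2 \<partial>P) = W + (\<integral>w. ex w \<partial>P)"
    using dual_value by simp
  show "transport_cost P = ennreal (\<integral>w. (norm (fst w - snd w))\<^sup>2 \<partial>P)"
    unfolding transport_cost_def using ci by (intro nn_integral_eq_integral) auto
qed

text \<open>Every atom has positive mass, so the almost-sure constraint holds at each atom and
  forces f to lie below the c-transform of \<gamma> almost everywhere. Hence W is at least the
  optimal dual value, while the c-transform of any other \<gamma>' is a feasible competitor.\<close>

lemma W_maximal:
  assumes opt: "dual_optimal M N f g" and \<gamma>: "\<gamma> = (\<lambda>i. g (y i))"
  shows "semidiscrete.W n y \<gamma>' M p \<le> W"
proof -
  interpret B: semidiscrete n y \<gamma>' M \<rho> p N by (rule semidiscrete_axioms)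
  have feas: "dual_feasible M N f g" using opt by (simp add: dual_optimal_def)
  then obtain A B where fi: "integrable M f" and gi: "integrable N g"
    and A: "AE x in M. x \<in> A" and B: "AE z in N. z \<in> B" and le: "\<And>x z. x \<in> A \<Longrightarrow> z \<in> B \<Longrightarrow> f x + g z \<le> (norm (x - z))\<^sup>2"
    unfolding dual_feasible_def by blast
  have "B.W \<le> (\<integral>x. f x \<partial>M) + (\<integral>z. g z \<partial>N)"
    using opt B.dual_feasible_potential unfolding dual_optimal_def B.dual_value[symmetric] by blast
  also have "(\<integral>x. f x \<partial>M) \<le> (\<integral>x. potential x \<partial>M)"
  proof (rule integral_mono_AE[OF fi potential_integrable], use A in eventually_elim)
    fix x assume x: "x \<in> A"
    obtain i where i: "i \<in> {1..n}" "potential x = (norm (x - y i))\<^sup>2 - \<gamma> i" using potential_attained by blast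
    have "y i \<in> B" using B i(1) by (rule atom_AE)
    then show "f x \<le> potential x" using le[OF x, of "y i"] i by (simp add: \<gamma>)
  qed
  also have "(\<integral>z. g z \<partial>N) = (\<Sum>i\<in>{1..n}. p i * \<gamma> i)"
    unfolding \<gamma> using gi by (intro N_bounded_integrable(2)) (simp cong: measurable_cong_sets)
  finally show ?thesis by (simp add: W_def)
qed

text \<open>First variation of the dual functional: raising \<gamma> i by s gains p i s and lowers
  the c-transform by at most s, and only where the excess of i is below s. Maximality bounds p i by
  the mass of that set, which shrinks to the cell as s tends to 0. One inequality suffices, since
  both families sum to one.\<close>

lemma weight_le_cell_mass:
  assumes max: "\<And>\<gamma>'. semidiscrete.W n y \<gamma>' M p \<le> W" and i: "i \<in> {1..n}"
  shows "p i \<le> prob (cell i)"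
proof -
  have step: "p i \<le> prob {x. excess i x < s}" if s: "0 < s" for s
  proof -
    interpret B: semidiscrete n y "\<gamma>(i := \<gamma> i + s)" M \<rho> p N by (rule semidiscrete_axioms)
    have [measurable]: "{x. excess i x < s} \<in> sets borel" by measurable
    \<comment> \<open>The new minimum is attained either at i, where it is the old one plus the
      excess minus s, or at another atom, where it is not below the old one.\<close>
    have pt: "potential x - s * indicator {x. excess i x < s} x \<le> B.potential x" for x
    proof -
      obtain j where j: "j \<in> {1..n}" "B.potential x = (norm (x - y j))\<^sup>2 - (\<gamma>(i := \<gamma> i + s)) j"
        using B.potential_attained by blast
      show ?thesis
      proof (cases "j = i")
        case True
        then have "B.potential x = potential x + excess i x - s" using j by (simp add: excess_def)
        then show ?thesis using excess_nonneg[OF i, of x] by (auto simp: indicator_def)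
      next
        case False
        then have "potential x \<le> B.potential x" using j potential_le[OF j(1), of x] by simp
        then show ?thesis using s by (auto simp: indicator_def)
      qed
    qed
    have ind: "integrable M (\<lambda>x. s * indicator {x. excess i x < s} x)"
      by (intro integrable_mult_right integrable_real_indicator) (auto simp: less_top[symmetric])
    have "(\<integral>x. potential x - s * indicator {x. excess i x < s} x \<partial>M) \<le> (\<integral>x. B.potential x \<partial>M)"
      using pt by (intro integral_mono Bochner_Integration.integrable_diff potential_integrable ind B.potential_integrable)
    also have "(\<integral>x. potential x - s * indicator {x. excess i x < s} x \<partial>M) = (\<integral>x. potential x \<partial>M) - s * prob {x. excess i x < s}"
      using ind potential_integrable by simp
    finally have 1: "(\<integral>x. potential x \<partial>M) - s * prob {x. excess i x < s} \<le> (\<integral>x. B.potential x \<partial>M)" .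
    have "(\<Sum>k\<in>{1..n}. p k * (\<gamma>(i := \<gamma> i + s)) k) = (\<Sum>k\<in>{1..n}. p k * \<gamma> k + (if k = i then p i * s else 0))"
      by (intro sum.cong) (auto simp: algebra_simps)
    also have "\<dots> = (\<Sum>k\<in>{1..n}. p k * \<gamma> k) + p i * s" using i by (simp add: sum.distrib)
    finally have 2: "(\<Sum>k\<in>{1..n}. p k * (\<gamma>(i := \<gamma> i + s)) k) = (\<Sum>k\<in>{1..n}. p k * \<gamma> k) + p i * s" .
    have "B.W \<le> W" by (rule max)
    then have "p i * s \<le> s * prob {x. excess i x < s}" using 1 2 unfolding W_def B.W_def by linarith
    then show ?thesis using s by (simp add: mult.commute)
  qed
  define A where "A m = {x. excess i x < 1 / real (Suc m)}" for m
  have "(\<lambda>m. prob (A m)) \<longlonglongrightarrow> prob (\<Inter>m. A m)"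
  proof (rule finite_Lim_measure_decseq)
    show "range A \<subseteq> sets M" unfolding A_def by auto
    show "decseq A" unfolding decseq_def A_def
      by (auto elim!: less_le_trans simp: frac_le)
  qed
  moreover have "(\<Inter>m. A m) = cell i"
  proof -
    have "excess i x = 0" if "\<And>m. excess i x < 1 / real (Suc m)" for x
    proof (rule ccontr)
      assume "excess i x \<noteq> 0"
      then have "0 < excess i x" using excess_nonneg[OF i, of x] by simp
      then obtain m where "1 / real (Suc m) < excess i x" using reals_Archimedean by (auto simp: inverse_eq_divide)
      then show False using that[of m] by simp
    qed
    then show ?thesis unfolding cell_eq[OF i] A_def by auto
  qed
  moreover have "p i \<le> prob (A m)" for m unfolding A_def by (rule step) simp
  ultimately show ?thesis by (intro LIMSEQ_le_const) auto
qed

section \<open>Plans built from conditional densities\<close>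

definition neg_entropy :: real where
  "neg_entropy = (\<Sum>i\<in>{1..n}. p i * ln (p i))"

lemma MN_sets [measurable_cong]: "sets (M \<Otimes>\<^sub>M N) = sets (borel \<Otimes>\<^sub>M borel)"
  by (intro sets_pair_measure_cong) simp_all

text \<open>The plan has density q i x / p i at (x, y i) with respect to the product. Splitting the
  logarithm, and using that q i has integral p i, yields the constant - \<open>neg_entropy\<close>:
  the relative entropy of the unregularised plan, and the coefficient of 1/\<eta> in the
  value.\<close>

lemma trial_coupling:
  fixes q :: "nat \<Rightarrow> 'a \<Rightarrow> real"
  assumes qm: "\<And>l. l \<in> {1..n} \<Longrightarrow> q l \<in> borel_measurable M"
    and qint: "\<And>l. l \<in> {1..n} \<Longrightarrow> (\<integral>x. q l x \<partial>M) = p l"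
    and q0: "\<And>l x. l \<in> {1..n} \<Longrightarrow> 0 \<le> q l x"
    and qsum: "\<And>x. (\<Sum>l\<in>{1..n}. q l x) = 1"
    and qex: "\<And>l x. l \<in> {1..n} \<Longrightarrow> q l x * (\<eta> * excess l x) \<le> 2" and \<eta>: "0 < \<eta>"
  obtains P where "P \<in> couplings M N"
    "rel_entropy P (M \<Otimes>\<^sub>M N) = ereal ((\<Sum>l\<in>{1..n}. \<integral>x. q l x * ln (q l x) \<partial>M) - neg_entropy)"
    "(\<integral>w. ex w \<partial>P) = (\<Sum>l\<in>{1..n}. \<integral>x. q l x * excess l x \<partial>M)"
proof -
  let ?R = "M \<Otimes>\<^sub>M N"
  have q1: "q l x \<le> 1" if "l \<in> {1..n}" for l x
    using member_le_sum[of l "{1..n}" "\<lambda>l. q l x"] q0 that qsum[of x] by auto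
  have qi: "integrable M (q l)" if "l \<in> {1..n}" for l
    using q0[OF that] q1[OF that] qm[OF that] by (intro integrable_const_bound[where B=1]) auto
  define D where "D w = at_atom (\<lambda>i. q i (fst w) / p i) (snd w)" for w
  have Dm: "D \<in> borel_measurable ?R"
    unfolding D_def[abs_def]
  proof (rule at_atom_measurable[of "\<lambda>i x. q i x / p i" M])
    show "(\<lambda>x. q i x / p i) \<in> borel_measurable M" if "i \<in> {1..n}" for i using qm[OF that] by simp
  qed measurable
  note [measurable] = Dm
  have D0: "0 \<le> D w" for w
    unfolding D_def at_atom_def using q0 less_imp_le[OF weights] by (intro sum_nonneg) auto
  have Datom: "D (x, y i) = q i x / p i" if "i \<in> {1..n}" for x i using that by (simp add: D_def)
  define P where "P = density ?R (\<lambda>w. ennreal (D w))"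
  have nnP: "(\<integral>\<^sup>+w. F w \<partial>P) = (\<Sum>i\<in>{1..n}. \<integral>\<^sup>+x. ennreal (q i x) * F (x, y i) \<partial>M)"
    if F[measurable]: "F \<in> borel_measurable ?R" for F
  proof -
    have m2: "(\<lambda>x. F (x, z)) \<in> borel_measurable M" for z
      using measurable_compose[OF measurable_Pair2' F, of z] by simp
    have "(\<integral>\<^sup>+w. F w \<partial>P) = (\<integral>\<^sup>+w. ennreal (D w) * F w \<partial>?R)"
      unfolding P_def by (rule nn_integral_density) measurable
    also have "\<dots> = (\<Sum>i\<in>{1..n}. ennreal (p i) * (\<integral>\<^sup>+x. ennreal (D (x, y i)) * F (x, y i) \<partial>M))"
      by (rule nn_integral_MN) measurable
    also have "\<dots> = (\<Sum>i\<in>{1..n}. \<integral>\<^sup>+x. ennreal (q i x) * F (x, y i) \<partial>M)"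
    proof (rule sum.cong[OF refl])
      fix i assume i: "i \<in> {1..n}"
      note [measurable] = qm[OF i] m2[of "y i"]
      have "ennreal (p i) * (ennreal (q i x / p i) * F (x, y i)) = ennreal (q i x) * F (x, y i)" for x
        using weights[OF i] q0[OF i, of x] by (simp add: mult.assoc[symmetric] ennreal_mult[symmetric])
      then show "ennreal (p i) * (\<integral>\<^sup>+x. ennreal (D (x, y i)) * F (x, y i) \<partial>M) = (\<integral>\<^sup>+x. ennreal (q i x) * F (x, y i) \<partial>M)"
        unfolding Datom[OF i] by (subst nn_integral_cmult[symmetric]) auto
    qed
    finally show ?thesis .
  qed
  have sP: "sets P = sets ?R" by (simp add: P_def)
  note [measurable_cong] = sP
  have f1: "fst \<in> P \<rightarrow>\<^sub>M M" and f2: "snd \<in> P \<rightarrow>\<^sub>M N"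
    using measurable_fst[of M N] measurable_snd[of M N] by (simp_all cong: measurable_cong_sets add: sP)
  have d1: "distr P M fst = M"
  proof (rule measure_eqI)
    fix A assume "A \<in> sets (distr P M fst)"
    then have A[measurable]: "A \<in> sets borel" by simp
    have "emeasure (distr P M fst) A = (\<integral>\<^sup>+x. indicator A x \<partial>distr P M fst)" using A by simp
    also have "\<dots> = (\<integral>\<^sup>+w. indicator A (fst w) \<partial>P)" using A by (intro nn_integral_distr f1) simp
    also have "\<dots> = (\<Sum>i\<in>{1..n}. \<integral>\<^sup>+x. ennreal (q i x) * indicator A (fst (x, y i)) \<partial>M)"
      by (rule nnP) measurable
    also have "\<dots> = (\<integral>\<^sup>+x. (\<Sum>i\<in>{1..n}. ennreal (q i x) * indicator A x) \<partial>M)"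
      using A qm by (subst nn_integral_sum) auto
    also have "\<dots> = (\<integral>\<^sup>+x. indicator A x \<partial>M)"
    proof (rule nn_integral_cong)
      fix x
      have "(\<Sum>i\<in>{1..n}. ennreal (q i x)) = ennreal 1"
        using q0 by (subst sum_ennreal) (simp_all only: qsum)
      then show "(\<Sum>i\<in>{1..n}. ennreal (q i x) * indicator A x) = indicator A x"
        by (simp add: sum_distrib_right[symmetric])
    qed
    finally show "emeasure (distr P M fst) A = emeasure M A" using A by simp
  qed simp
  have d2: "distr P N snd = N"
  proof (rule measure_eqI)
    fix A assume "A \<in> sets (distr P N snd)"
    then have A[measurable]: "A \<in> sets borel" by simp
    have "emeasure (distr P N snd) A = (\<integral>\<^sup>+x. indicator A x \<partial>distr P N snd)" using A by simp
    also have "\<dots> = (\<integral>\<^sup>+w. indicator A (snd w) \<partial>P)" using A by (intro nn_integral_distr f2) simp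
    also have "\<dots> = (\<Sum>i\<in>{1..n}. \<integral>\<^sup>+x. ennreal (q i x) * indicator A (snd (x, y i)) \<partial>M)"
      by (rule nnP) measurable
    also have "\<dots> = (\<Sum>i\<in>{1..n}. ennreal (p i) * indicator A (y i))"
    proof (rule sum.cong[OF refl])
      fix i assume i: "i \<in> {1..n}"
      have "(\<integral>\<^sup>+x. ennreal (q i x) \<partial>M) = ennreal (p i)"
        using q0[OF i] qi[OF i] qint[OF i] by (subst nn_integral_eq_integral) auto
      then show "(\<integral>\<^sup>+x. ennreal (q i x) * indicator A (snd (x, y i)) \<partial>M) = ennreal (p i) * indicator A (y i)"
        using qm[OF i] by (simp add: nn_integral_multc)
    qed
    also have "\<dots> = (\<integral>\<^sup>+z. indicator A z \<partial>N)" using A by (intro nn_integral_N[symmetric]) simp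
    finally show "emeasure (distr P N snd) A = emeasure N A" using A by simp
  qed simp
  have coup: "P \<in> couplings M N" using sP d1 d2 by (simp add: couplings_def)
  \<comment> \<open>A uniform bound on |D ln D|, obtained from |t ln t| \<le> 1 on the unit interval
    atom by atom; it settles every integrability question about the entropy.\<close>
  define B where "B = (\<Sum>i\<in>{1..n}. (1 + \<bar>ln (p i)\<bar>) / p i)"
  have each: "\<bar>q i x / p i * ln (q i x / p i)\<bar> \<le> (1 + \<bar>ln (p i)\<bar>) / p i"
    and dec: "p i * (q i x / p i * ln (q i x / p i)) = q i x * ln (q i x) - q i x * ln (p i)" if i: "i \<in> {1..n}" for i x
  proof -
    show d: "p i * (q i x / p i * ln (q i x / p i)) = q i x * ln (q i x) - q i x * ln (p i)"
    proof (cases "q i x = 0")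
      case False
      then have "0 < q i x" using q0[OF i, of x] by simp
      then show ?thesis using weights[OF i] by (simp add: ln_div right_diff_distrib)
    qed simp
    have "\<bar>q i x * ln (q i x) - q i x * ln (p i)\<bar> \<le> \<bar>q i x * ln (q i x)\<bar> + \<bar>q i x * ln (p i)\<bar>"
      by (rule abs_triangle_ineq4)
    also have "\<dots> \<le> 1 + 1 * \<bar>ln (p i)\<bar>"
      unfolding abs_mult[of "q i x" "ln (p i)"] using q0[OF i, of x] q1[OF i, of x]
      by (intro add_mono abs_x_ln_x_le mult_right_mono) auto
    finally have "\<bar>p i * (q i x / p i * ln (q i x / p i))\<bar> \<le> 1 + \<bar>ln (p i)\<bar>" unfolding d by simp
    then have "p i * \<bar>q i x / p i * ln (q i x / p i)\<bar> \<le> 1 + \<bar>ln (p i)\<bar>"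
      using weights[OF i] by (subst (asm) abs_mult) simp
    then show "\<bar>q i x / p i * ln (q i x / p i)\<bar> \<le> (1 + \<bar>ln (p i)\<bar>) / p i"
      using weights[OF i] by (subst pos_le_divide_eq) (simp_all add: mult.commute)
  qed
  have B0: "0 \<le> B" unfolding B_def using less_imp_le[OF weights] by (intro sum_nonneg divide_nonneg_nonneg) auto
  have bnd: "\<bar>D w * ln (D w)\<bar> \<le> B" for w
  proof (cases "\<exists>i\<in>{1..n}. snd w = y i")
    case True
    then obtain i where i: "i \<in> {1..n}" "snd w = y i" by blast
    then have "w = (fst w, y i)" by (simp add: prod_eq_iff)
    then have "D w = q i (fst w) / p i" using Datom[OF i(1), of "fst w"] by simp
    then have "\<bar>D w * ln (D w)\<bar> \<le> (1 + \<bar>ln (p i)\<bar>) / p i" using each[OF i(1)] by simp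
    also have "\<dots> \<le> B" unfolding B_def
      by (rule member_le_sum) (use i(1) less_imp_le[OF weights] in \<open>auto intro!: divide_nonneg_nonneg\<close>)
    finally show ?thesis .
  next
    case False
    then have "D w = 0" by (auto simp: D_def at_atom_def intro!: sum.neutral)
    then show ?thesis using B0 by simp
  qed
  have DlnD: "integrable ?R (\<lambda>w. D w * ln (D w))"
    using bnd by (intro MN.P.integrable_const_bound[where B=B]) auto
  have KLval: "(\<integral>w. D w * ln (D w) \<partial>?R) = (\<Sum>l\<in>{1..n}. \<integral>x. q l x * ln (q l x) \<partial>M) - neg_entropy"
  proof -
    have im: "integrable M (\<lambda>x. D (x, y i) * ln (D (x, y i)))" if i: "i \<in> {1..n}" for i
      unfolding Datom[OF i] using each[OF i] qm[OF i] by (intro integrable_const_bound[where B="(1 + \<bar>ln (p i)\<bar>) / p i"]) auto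
    have "(\<integral>w. D w * ln (D w) \<partial>?R) = (\<Sum>i\<in>{1..n}. p i * (\<integral>x. D (x, y i) * ln (D (x, y i)) \<partial>M))"
      by (rule integral_MN[OF DlnD im])
    also have "\<dots> = (\<Sum>i\<in>{1..n}. (\<integral>x. q i x * ln (q i x) \<partial>M) - p i * ln (p i))"
    proof (rule sum.cong[OF refl])
      fix i assume i: "i \<in> {1..n}"
      have i1: "integrable M (\<lambda>x. q i x * ln (q i x))"
        using abs_x_ln_x_le[OF q0[OF i] q1[OF i]] qm[OF i] by (intro integrable_const_bound[where B=1]) auto
      have "p i * (\<integral>x. D (x, y i) * ln (D (x, y i)) \<partial>M) = (\<integral>x. q i x * ln (q i x) - q i x * ln (p i) \<partial>M)"
        unfolding Datom[OF i] dec[OF i, symmetric] by (rule integral_mult_right_zero[symmetric])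
      also have "\<dots> = (\<integral>x. q i x * ln (q i x) \<partial>M) - p i * ln (p i)"
        using i1 qi[OF i] qint[OF i] by simp
      finally show "p i * (\<integral>x. D (x, y i) * ln (D (x, y i)) \<partial>M) = (\<integral>x. q i x * ln (q i x) \<partial>M) - p i * ln (p i)" .
    qed
    finally show ?thesis by (simp add: sum_subtractf neg_entropy_def)
  qed
  have ac: "absolutely_continuous ?R P"
    unfolding P_def by (rule absolutely_continuousI_density) measurable
  have RN: "AE w in ?R. ennreal (D w) = RN_deriv ?R P w"
    by (rule MN.RN_deriv_unique) (auto simp: P_def)
  have eint: "integrable P (entropy_density (exp 1) ?R P)"
  proof -
    have "integrable ?R (\<lambda>w. D w * entropy_density (exp 1) ?R P w)"
    proof (rule integrable_cong_AE_imp[OF DlnD])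
      show "AE w in ?R. D w * ln (D w) = D w * entropy_density (exp 1) ?R P w"
        using RN
      proof eventually_elim
        fix w assume "ennreal (D w) = RN_deriv ?R P w"
        then have "enn2real (RN_deriv ?R P w) = D w" using D0[of w] by (metis enn2real_ennreal)
        then show "D w * ln (D w) = D w * entropy_density (exp 1) ?R P w"
          by (simp add: entropy_density_def log_def)
      qed
    qed measurable
    then show ?thesis
      unfolding P_def[symmetric] using D0 integrable_real_density[of D ?R "entropy_density (exp 1) ?R P"]
      by (simp add: P_def[symmetric])
  qed
  have "KL_divergence (exp 1) ?R P = (\<integral>w. D w * log (exp 1) (D w) \<partial>?R)"
    unfolding P_def using D0 by (intro MN.KL_density) auto
  then have KL: "KL_divergence (exp 1) ?R P = (\<Sum>l\<in>{1..n}. \<integral>x. q l x * ln (q l x) \<partial>M) - neg_entropy"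
    using KLval by (simp add: log_def)
  have rel: "rel_entropy P ?R = ereal ((\<Sum>l\<in>{1..n}. \<integral>x. q l x * ln (q l x) \<partial>M) - neg_entropy)"
    unfolding rel_entropy_def using ac eint KL by simp
  have exm: "ex \<in> borel_measurable ?R" by measurable
  have "(\<integral>w. ex w \<partial>P) = enn2real (\<integral>\<^sup>+w. ennreal (ex w) \<partial>P)"
    using ex_nonneg exm by (intro integral_eq_nn_integral) (auto simp: P_def)
  also have "(\<integral>\<^sup>+w. ennreal (ex w) \<partial>P) = (\<Sum>i\<in>{1..n}. \<integral>\<^sup>+x. ennreal (q i x) * ennreal (ex (x, y i)) \<partial>M)"
    by (rule nnP) (use exm in measurable)
  also have "\<dots> = (\<Sum>i\<in>{1..n}. ennreal (\<integral>x. q i x * excess i x \<partial>M))"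
  proof (rule sum.cong[OF refl])
    fix i assume i: "i \<in> {1..n}"
    have le: "q i x * excess i x \<le> 2 / \<eta>" for x using qex[OF i, of x] \<eta> by (simp add: field_simps)
    have nn: "0 \<le> q i x * excess i x" for x using q0[OF i] excess_nonneg[OF i] by simp
    have int: "integrable M (\<lambda>x. q i x * excess i x)"
      using le nn qm[OF i] by (intro integrable_const_bound[where B="2 / \<eta>"]) auto
    have "ennreal (q i x) * ennreal (ex (x, y i)) = ennreal (q i x * excess i x)" for x
      using q0[OF i] excess_nonneg[OF i] i by (simp add: ex_def ennreal_mult)
    then show "(\<integral>\<^sup>+x. ennreal (q i x) * ennreal (ex (x, y i)) \<partial>M) = ennreal (\<integral>x. q i x * excess i x \<partial>M)"
      using int nn by (simp add: nn_integral_eq_integral)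
  qed
  also have "\<dots> = ennreal (\<Sum>i\<in>{1..n}. \<integral>x. q i x * excess i x \<partial>M)"
    using q0 excess_nonneg by (intro sum_ennreal integral_nonneg) auto
  also have "enn2real \<dots> = (\<Sum>i\<in>{1..n}. \<integral>x. q i x * excess i x \<partial>M)"
    using q0 excess_nonneg by (intro enn2real_ennreal sum_nonneg integral_nonneg) auto
  finally have "(\<integral>w. ex w \<partial>P) = (\<Sum>i\<in>{1..n}. \<integral>x. q i x * excess i x \<partial>M)" .
  with coup rel show ?thesis by (rule that)
qed

section \<open>Lower bound on the entropy of an arbitrary plan\<close>

definition Zs :: "real \<Rightarrow> 'a \<Rightarrow> real" where
  "Zs \<eta> x = (\<Sum>j\<in>{1..n}. exp (- (\<eta> * excess j x)))"

lemma Zs_bounds: "0 \<le> \<eta> \<Longrightarrow> 1 \<le> Zs \<eta> x \<and> Zs \<eta> x \<le> real n"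
proof
  assume \<eta>: "0 \<le> \<eta>"
  obtain i where i: "i \<in> {1..n}" "excess i x = 0" using excess_attained by blast
  have "exp (- (\<eta> * excess i x)) \<le> Zs \<eta> x" unfolding Zs_def by (rule member_le_sum) (use i in auto)
  then show "1 \<le> Zs \<eta> x" using i by simp
  show "Zs \<eta> x \<le> real n"
    unfolding Zs_def using \<eta> sum_bounded_above[of "{1..n}" "\<lambda>j. exp (- (\<eta> * excess j x))" 1] excess_nonneg by auto
qed

lemma Zs_measurable [measurable]: "Zs \<eta> \<in> borel_measurable borel"
  unfolding Zs_def[abs_def] by measurable

text \<open>Gibbs inequality with \<psi> the Gibbs density relative to the product, which has total
  mass one because the weights cancel. Its second marginal may differ from N. In ln \<psi> the term
  with p depends on the atom only and the term with \<open>Zs\<close> on x only, so the marginals of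
  P fix their integrals. \<open>Zs\<close> is the function \<open>Z\<close> of
  \<open>layered_cells\<close>, restated so that the bound holds for every \<gamma>.\<close>

lemma entropy_lower_bound:
  assumes P: "P \<in> couplings M N" and ac: "absolutely_continuous (M \<Otimes>\<^sub>M N) P"
    and int: "integrable P (entropy_density (exp 1) (M \<Otimes>\<^sub>M N) P)" and \<eta>: "0 < \<eta>"
  shows "- \<eta> * (\<integral>w. ex w \<partial>P) - neg_entropy - (\<integral>x. ln (Zs \<eta> x) \<partial>M) \<le> KL_divergence (exp 1) (M \<Otimes>\<^sub>M N) P"
proof -
  let ?R = "M \<Otimes>\<^sub>M N"
  note cf = coupling_facts[OF P]
  have sP: "sets P = sets ?R" and d1: "distr P M fst = M" and d2: "distr P N snd = N"
    using P by (auto simp: couplings_def)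
  note [measurable_cong] = sP
  have f1: "fst \<in> P \<rightarrow>\<^sub>M M" and f2: "snd \<in> P \<rightarrow>\<^sub>M N"
    using measurable_fst[of M N] measurable_snd[of M N] by (simp_all cong: measurable_cong_sets add: sP)
  have Zpos: "0 < Zs \<eta> x" for x using Zs_bounds[of \<eta> x] \<eta> by simp
  define \<psi> where "\<psi> w = at_atom (\<lambda>i. exp (- (\<eta> * excess i (fst w))) / (p i * Zs \<eta> (fst w))) (snd w)" for w
  have \<psi>m[measurable]: "\<psi> \<in> borel_measurable ?R"
    unfolding \<psi>_def[abs_def] by (rule at_atom_measurable[of "\<lambda>i x. exp (- (\<eta> * excess i x)) / (p i * Zs \<eta> x)" M]) measurable
  have \<psi>atom: "\<psi> (x, y i) = exp (- (\<eta> * excess i x)) / (p i * Zs \<eta> x)" if "i \<in> {1..n}" for x i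
    using that by (simp add: \<psi>_def)
  have \<psi>0: "0 \<le> \<psi> w" for w
    unfolding \<psi>_def at_atom_def using Zpos less_imp_le[OF weights] by (intro sum_nonneg) (auto simp: less_imp_le)
  have atomsR: "AE w in ?R. \<exists>i\<in>{1..n}. snd w = y i"
  proof -
    have "AE x in M. AE z in N. \<exists>i\<in>{1..n}. snd (x, z) = y i" using AE_N by simp
    moreover have "{w \<in> space ?R. \<exists>i\<in>{1..n}. snd w = y i} \<in> sets ?R" by measurable
    ultimately show ?thesis by (intro MN.AE_pair_measure)
  qed
  have \<psi>pos: "AE w in ?R. 0 < \<psi> w"
    using atomsR
  proof eventually_elim
    fix w :: "'a \<times> 'a" assume "\<exists>i\<in>{1..n}. snd w = y i"
    then obtain i where i: "i \<in> {1..n}" "snd w = y i" by blast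
    then show "0 < \<psi> w" using \<psi>atom[OF i(1), of "fst w"] weights[OF i(1)] Zpos[of "fst w"] by (simp add: \<psi>_def)
  qed
  have \<psi>prob: "prob_space (density ?R (\<lambda>w. ennreal (\<psi> w)))"
  proof (rule prob_spaceI)
    have "emeasure (density ?R (\<lambda>w. ennreal (\<psi> w))) (space (density ?R (\<lambda>w. ennreal (\<psi> w))))
        = (\<integral>\<^sup>+w. ennreal (\<psi> w) * indicator (space ?R) w \<partial>?R)"
      unfolding space_density by (rule emeasure_density[OF _ sets.top]) measurable
    also have "\<dots> = (\<integral>\<^sup>+w. ennreal (\<psi> w) \<partial>?R)"
      by (rule nn_integral_cong) (simp only: indicator_simps mult_1_right)
    also have "\<dots> = (\<Sum>i\<in>{1..n}. ennreal (p i) * (\<integral>\<^sup>+x. ennreal (\<psi> (x, y i)) \<partial>M))"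
      by (rule nn_integral_MN) measurable
    also have "\<dots> = (\<Sum>i\<in>{1..n}. \<integral>\<^sup>+x. ennreal (exp (- (\<eta> * excess i x)) / Zs \<eta> x) \<partial>M)"
    proof (rule sum.cong[OF refl])
      fix i assume i: "i \<in> {1..n}"
      have "ennreal (p i) * ennreal (\<psi> (x, y i)) = ennreal (exp (- (\<eta> * excess i x)) / Zs \<eta> x)" for x
        using weights[OF i] Zpos[of x] by (simp add: \<psi>atom[OF i] ennreal_mult[symmetric] less_imp_le)
      then show "ennreal (p i) * (\<integral>\<^sup>+x. ennreal (\<psi> (x, y i)) \<partial>M) = (\<integral>\<^sup>+x. ennreal (exp (- (\<eta> * excess i x)) / Zs \<eta> x) \<partial>M)"
        by (subst nn_integral_cmult[symmetric]) (simp_all add: \<psi>atom[OF i])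
    qed
    also have "\<dots> = (\<integral>\<^sup>+x. (\<Sum>i\<in>{1..n}. ennreal (exp (- (\<eta> * excess i x)) / Zs \<eta> x)) \<partial>M)"
      by (rule nn_integral_sum[symmetric]) measurable
    also have "\<dots> = (\<integral>\<^sup>+x. 1 \<partial>M)"
    proof (rule nn_integral_cong)
      fix x
      have "(\<Sum>i\<in>{1..n}. ennreal (exp (- (\<eta> * excess i x)) / Zs \<eta> x)) = ennreal (\<Sum>i\<in>{1..n}. exp (- (\<eta> * excess i x)) / Zs \<eta> x)"
        using Zpos[of x] by (intro sum_ennreal) (simp add: less_imp_le)
      also have "(\<Sum>i\<in>{1..n}. exp (- (\<eta> * excess i x)) / Zs \<eta> x) = 1"
        unfolding sum_divide_distrib[symmetric] Zs_def[symmetric] using Zpos[of x] by simp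
      finally show "(\<Sum>i\<in>{1..n}. ennreal (exp (- (\<eta> * excess i x)) / Zs \<eta> x)) = 1" by simp
    qed
    also have "\<dots> = 1" using emeasure_space_1 by simp
    finally show "emeasure (density ?R (\<lambda>w. ennreal (\<psi> w))) (space (density ?R (\<lambda>w. ennreal (\<psi> w)))) = 1" .
  qed
  have lnZ: "integrable M (\<lambda>x. ln (Zs \<eta> x))"
  proof (rule integrable_const_bound[where B="ln (real n)"])
    show "AE x in M. norm (ln (Zs \<eta> x)) \<le> ln (real n)"
    proof (rule AE_I2)
      fix x show "norm (ln (Zs \<eta> x)) \<le> ln (real n)"
        using Zs_bounds[of \<eta> x] \<eta> n1 by auto
    qed
  qed measurable
  have I1: "integrable P (\<lambda>w. ln (Zs \<eta> (fst w)))" "(\<integral>w. ln (Zs \<eta> (fst w)) \<partial>P) = (\<integral>x. ln (Zs \<eta> x) \<partial>M)"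
    using lnZ integrable_distr_eq[OF f1, of "\<lambda>x. ln (Zs \<eta> x)"] integral_distr[OF f1, of "\<lambda>x. ln (Zs \<eta> x)"]
    by (simp_all add: d1)
  let ?lp = "at_atom (\<lambda>i. ln (p i))"
  have lpm: "?lp \<in> borel_measurable borel"
    using at_atom_measurable[of "\<lambda>i _. ln (p i)" borel "\<lambda>z. z" borel "\<lambda>z. z"] by simp
  have lpv: "(\<integral>z. ?lp z \<partial>N) = neg_entropy"
    unfolding N_bounded_integrable(2)[OF lpm] neg_entropy_def by simp
  have I2: "integrable P (\<lambda>w. ?lp (snd w))" "(\<integral>w. ?lp (snd w) \<partial>P) = neg_entropy"
    using N_bounded_integrable(1)[OF lpm] lpm lpv integrable_distr_eq[OF f2, of ?lp] integral_distr[OF f2, of ?lp]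
    by (simp_all add: d2)
  have dec: "AE w in P. ln (\<psi> w) = - \<eta> * ex w - ?lp (snd w) - ln (Zs \<eta> (fst w))"
    using cf(7)
  proof eventually_elim
    fix w :: "'a \<times> 'a" assume "\<exists>i\<in>{1..n}. snd w = y i"
    then obtain i where i: "i \<in> {1..n}" "snd w = y i" by blast
    then show "ln (\<psi> w) = - \<eta> * ex w - ?lp (snd w) - ln (Zs \<eta> (fst w))"
      using weights[OF i(1)] Zpos[of "fst w"] by (simp add: \<psi>_def ex_def ln_div ln_mult)
  qed
  have rhs: "integrable P (\<lambda>w. - \<eta> * ex w - ?lp (snd w) - ln (Zs \<eta> (fst w)))"
    using cf(3) I1 I2 by simp
  have lnm: "(\<lambda>w. ln (\<psi> w)) \<in> borel_measurable P" by measurable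
  have ln\<psi>: "integrable P (\<lambda>w. ln (\<psi> w))"
    using rhs by (rule integrable_cong_AE_imp[OF _ lnm]) (use dec in \<open>eventually_elim, simp\<close>)
  have "(\<integral>w. ln (\<psi> w) \<partial>P) = (\<integral>w. - \<eta> * ex w - ?lp (snd w) - ln (Zs \<eta> (fst w)) \<partial>P)"
    using dec lnm rhs by (intro integral_cong_AE) auto
  also have "\<dots> = - \<eta> * (\<integral>w. ex w \<partial>P) - neg_entropy - (\<integral>x. ln (Zs \<eta> x) \<partial>M)"
    using cf(3) I1 I2 by simp
  finally show ?thesis
    using MN.KL_divergence_ge_integral_ln[OF cf(1) sP ac int \<psi>m \<psi>pos \<psi>prob ln\<psi>] by simp
qed

section \<open>Entropic plans and the expansion of their cost\<close>

lemma finite_cost_plan: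
  assumes plan: "entropic_plan M N \<eta> P" and \<eta>: "0 < \<eta>"
    and Q: "Q \<in> couplings M N" "rel_entropy Q (M \<Otimes>\<^sub>M N) = ereal k"
  shows "rel_entropy P (M \<Otimes>\<^sub>M N) = ereal (KL_divergence (exp 1) (M \<Otimes>\<^sub>M N) P)"
    and "absolutely_continuous (M \<Otimes>\<^sub>M N) P" and "integrable P (entropy_density (exp 1) (M \<Otimes>\<^sub>M N) P)"
proof -
  have le: "entropic_cost M N \<eta> P \<le> entropic_cost M N \<eta> Q" using plan Q(1) by (simp add: entropic_plan_def)
  \<comment> \<open>A competitor of finite cost excludes the infinite branch of
    \<open>rel_entropy\<close> for the minimiser, so that its entropy is the real-valued
    divergence.\<close>
  have "entropic_cost M N \<eta> Q < \<infinity>"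
    unfolding entropic_cost_def Q(2) coupling_facts(6)[OF Q(1)] by simp
  with le have lt: "entropic_cost M N \<eta> P < \<infinity>" by (rule le_less_trans)
  have "rel_entropy P (M \<Otimes>\<^sub>M N) \<noteq> \<infinity>"
  proof
    assume "rel_entropy P (M \<Otimes>\<^sub>M N) = \<infinity>"
    then have "entropic_cost M N \<eta> P = \<infinity>" using \<eta> by (simp add: entropic_cost_def)
    then show False using lt by simp
  qed
  then show "rel_entropy P (M \<Otimes>\<^sub>M N) = ereal (KL_divergence (exp 1) (M \<Otimes>\<^sub>M N) P)"
    "absolutely_continuous (M \<Otimes>\<^sub>M N) P" "integrable P (entropy_density (exp 1) (M \<Otimes>\<^sub>M N) P)"
    by (auto simp: rel_entropy_def split: if_splits)
qed

lemma entropic_cost_real: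
  assumes "P \<in> couplings M N" "rel_entropy P (M \<Otimes>\<^sub>M N) = ereal k"
  shows "entropic_cost M N \<eta> P = ereal ((\<integral>w. (norm (fst w - snd w))\<^sup>2 \<partial>P) + k / \<eta>)"
  unfolding entropic_cost_def assms(2) coupling_facts(6)[OF assms(1)] by (simp add: enn2ereal_ennreal)

text \<open>The scaled second-order remainder of the minimal value, with slope -
  \<open>neg_entropy\<close> in 1/\<eta>, lies between - \<eta> \<open>log_partition\<close> \<eta>,
  by the entropy bound, and the same quantity plus \<epsilon> \<eta>, by the trial plan. Minimality
  is then used once more, now between plans of different parameters, to pass from the value to the
  cost.\<close>

lemma transport_cost_expansion:
  assumes L: "layered_cells M n excess cell \<kappa> p"
    and plans: "\<And>\<eta>. 0 < \<eta> \<Longrightarrow> entropic_plan M N \<eta> (\<pi> \<eta>)"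
  shows "((\<lambda>\<eta>. \<eta>\<^sup>2 * ((\<integral>w. (norm (fst w - snd w))\<^sup>2 \<partial>\<pi> \<eta>) - W)) \<longlongrightarrow> layered_cells.K n \<kappa>) at_top"
proof -
  interpret L: layered_cells M n excess cell \<kappa> p by (rule L)
  let ?R = "M \<Otimes>\<^sub>M N"
  obtain q \<epsilon> where \<epsilon>: "(\<epsilon> \<longlongrightarrow> 0) at_top"
    and q: "\<forall>\<^sub>F \<eta> in at_top. (\<forall>l\<in>{1..n}. q \<eta> l \<in> borel_measurable M \<and> (\<integral>x. q \<eta> l x \<partial>M) = p l \<and>
           (\<forall>x\<in>space M. 0 \<le> q \<eta> l x \<and> q \<eta> l x * (\<eta> * excess l x) \<le> 2))
       \<and> (\<forall>x\<in>space M. (\<Sum>l\<in>{1..n}. q \<eta> l x) = 1)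
       \<and> \<eta> * (\<integral>x. (\<Sum>l\<in>{1..n}. q \<eta> l x * (\<eta> * excess l x + ln (q \<eta> l x))) \<partial>M) \<le> - (\<eta> * L.log_partition \<eta>) + \<epsilon> \<eta>"
    by (rule L.trial_density)
  have lp: "L.log_partition \<eta> = (\<integral>x. ln (Zs \<eta> x) \<partial>M)" for \<eta>
    by (simp add: L.log_partition_def L.Z_def[abs_def] Zs_def[abs_def])
  obtain r0 where r0: "\<And>\<eta>. r0 \<le> \<eta> \<Longrightarrow> (\<forall>l\<in>{1..n}. q \<eta> l \<in> borel_measurable M \<and> (\<integral>x. q \<eta> l x \<partial>M) = p l \<and>
           (\<forall>x\<in>space M. 0 \<le> q \<eta> l x \<and> q \<eta> l x * (\<eta> * excess l x) \<le> 2))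
       \<and> (\<forall>x\<in>space M. (\<Sum>l\<in>{1..n}. q \<eta> l x) = 1)
       \<and> \<eta> * (\<integral>x. (\<Sum>l\<in>{1..n}. q \<eta> l x * (\<eta> * excess l x + ln (q \<eta> l x))) \<partial>M) \<le> - (\<eta> * L.log_partition \<eta>) + \<epsilon> \<eta>"
    using q unfolding eventually_at_top_linorder by blast
  \<comment> \<open>Beyond \<open>r\<close> trial plans exist, so the entropies are finite and all
    comparisons between two plans are inequalities of real numbers.\<close>
  define r where "r = max r0 1"
  define C where "C \<eta> = (\<integral>w. (norm (fst w - snd w))\<^sup>2 \<partial>\<pi> \<eta>)" for \<eta>
  define E where "E \<eta> = KL_divergence (exp 1) ?R (\<pi> \<eta>)" for \<eta>
  have main: "rel_entropy (\<pi> \<eta>) ?R = ereal (E \<eta>) \<and> \<pi> \<eta> \<in> couplings M N \<and>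
      - (\<eta> * L.log_partition \<eta>) \<le> \<eta>\<^sup>2 * (C \<eta> + E \<eta> / \<eta> - W - (- neg_entropy) / \<eta>) \<and>
      \<eta>\<^sup>2 * (C \<eta> + E \<eta> / \<eta> - W - (- neg_entropy) / \<eta>) \<le> - (\<eta> * L.log_partition \<eta>) + \<epsilon> \<eta>" if \<eta>r: "r \<le> \<eta>" for \<eta>
  proof -
    have \<eta>: "0 < \<eta>" "r0 \<le> \<eta>" using \<eta>r by (auto simp: r_def)
    note r0' = r0[OF \<eta>(2)]
    have qm: "q \<eta> l \<in> borel_measurable M" and qi: "(\<integral>x. q \<eta> l x \<partial>M) = p l" if "l \<in> {1..n}" for l
      using r0' that by blast+
    have q0: "0 \<le> q \<eta> l x" and qe: "q \<eta> l x * (\<eta> * excess l x) \<le> 2" if "l \<in> {1..n}" for l x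
      using r0' that by (simp_all only: space_M UNIV_I)
    have qs: "(\<Sum>l\<in>{1..n}. q \<eta> l x) = 1" for x using r0' by (simp only: space_M UNIV_I)
    have qc: "\<eta> * (\<integral>x. (\<Sum>l\<in>{1..n}. q \<eta> l x * (\<eta> * excess l x + ln (q \<eta> l x))) \<partial>M) \<le> - (\<eta> * L.log_partition \<eta>) + \<epsilon> \<eta>"
      using r0' by blast
    have q1: "q \<eta> l x \<le> 1" if "l \<in> {1..n}" for l x
      using member_le_sum[of l "{1..n}" "\<lambda>l. q \<eta> l x"] q0 that qs[of x] by auto
    obtain Q where Q: "Q \<in> couplings M N"
      "rel_entropy Q ?R = ereal ((\<Sum>l\<in>{1..n}. \<integral>x. q \<eta> l x * ln (q \<eta> l x) \<partial>M) - neg_entropy)"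
      "(\<integral>w. ex w \<partial>Q) = (\<Sum>l\<in>{1..n}. \<integral>x. q \<eta> l x * excess l x \<partial>M)"
      by (rule trial_coupling[OF qm qi q0 qs qe \<eta>(1)])
    note plan = plans[OF \<eta>(1)]
    have Pc: "\<pi> \<eta> \<in> couplings M N" using plan by (simp add: entropic_plan_def)
    note fin = finite_cost_plan[OF plan \<eta>(1) Q(1,2)]
    have rel: "rel_entropy (\<pi> \<eta>) ?R = ereal (E \<eta>)" using fin(1) by (simp add: E_def)
    have Ceq: "C \<eta> = W + (\<integral>w. ex w \<partial>\<pi> \<eta>)" unfolding C_def by (rule coupling_facts(5)[OF Pc])
    have "- \<eta> * (\<integral>w. ex w \<partial>\<pi> \<eta>) - neg_entropy - L.log_partition \<eta> \<le> E \<eta>"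
      unfolding E_def lp by (rule entropy_lower_bound[OF Pc fin(2,3) \<eta>(1)])
    then have "- L.log_partition \<eta> \<le> \<eta> * (C \<eta> - W) + E \<eta> + neg_entropy" using Ceq by simp
    then have "\<eta> * (- L.log_partition \<eta>) \<le> \<eta> * (\<eta> * (C \<eta> - W) + E \<eta> + neg_entropy)"
      using \<eta> by (intro mult_left_mono) auto
    also have eq: "\<eta> * (\<eta> * (C \<eta> - W) + E \<eta> + neg_entropy) = \<eta>\<^sup>2 * (C \<eta> + E \<eta> / \<eta> - W - (- neg_entropy) / \<eta>)"
      using \<eta> by (simp add: power2_eq_square field_simps)
    finally have lower: "- (\<eta> * L.log_partition \<eta>) \<le> \<eta>\<^sup>2 * (C \<eta> + E \<eta> / \<eta> - W - (- neg_entropy) / \<eta>)" by simp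
    have "entropic_cost M N \<eta> (\<pi> \<eta>) \<le> entropic_cost M N \<eta> Q" using plan Q(1) by (simp add: entropic_plan_def)
    then have "C \<eta> + E \<eta> / \<eta> \<le> (\<integral>w. (norm (fst w - snd w))\<^sup>2 \<partial>Q) + ((\<Sum>l\<in>{1..n}. \<integral>x. q \<eta> l x * ln (q \<eta> l x) \<partial>M) - neg_entropy) / \<eta>"
      unfolding entropic_cost_real[OF Pc rel] entropic_cost_real[OF Q(1,2)] by (simp add: C_def)
    then have "C \<eta> + E \<eta> / \<eta> \<le> W + (\<Sum>l\<in>{1..n}. \<integral>x. q \<eta> l x * excess l x \<partial>M)
        + ((\<Sum>l\<in>{1..n}. \<integral>x. q \<eta> l x * ln (q \<eta> l x) \<partial>M) - neg_entropy) / \<eta>"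
      unfolding coupling_facts(5)[OF Q(1)] Q(3) .
    then have "C \<eta> + E \<eta> / \<eta> - W - (- neg_entropy) / \<eta>
        \<le> (\<Sum>l\<in>{1..n}. \<integral>x. q \<eta> l x * excess l x \<partial>M) + (\<Sum>l\<in>{1..n}. \<integral>x. q \<eta> l x * ln (q \<eta> l x) \<partial>M) / \<eta>"
      by (simp add: diff_divide_distrib)
    then have "\<eta>\<^sup>2 * (C \<eta> + E \<eta> / \<eta> - W - (- neg_entropy) / \<eta>)
        \<le> \<eta>\<^sup>2 * ((\<Sum>l\<in>{1..n}. \<integral>x. q \<eta> l x * excess l x \<partial>M) + (\<Sum>l\<in>{1..n}. \<integral>x. q \<eta> l x * ln (q \<eta> l x) \<partial>M) / \<eta>)"
      by (intro mult_left_mono) auto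
    also have "\<dots> = \<eta> * (\<eta> * (\<Sum>l\<in>{1..n}. \<integral>x. q \<eta> l x * excess l x \<partial>M) + (\<Sum>l\<in>{1..n}. \<integral>x. q \<eta> l x * ln (q \<eta> l x) \<partial>M))"
      using \<eta> by (simp add: power2_eq_square field_simps)
    also have "\<eta> * (\<Sum>l\<in>{1..n}. \<integral>x. q \<eta> l x * excess l x \<partial>M) + (\<Sum>l\<in>{1..n}. \<integral>x. q \<eta> l x * ln (q \<eta> l x) \<partial>M)
        = (\<integral>x. (\<Sum>l\<in>{1..n}. q \<eta> l x * (\<eta> * excess l x + ln (q \<eta> l x))) \<partial>M)"
    proof -
      have i1: "integrable M (\<lambda>x. q \<eta> l x * excess l x)" if l: "l \<in> {1..n}" for l
      proof (rule integrable_const_bound[where B="2 / \<eta>"])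
        show "AE x in M. norm (q \<eta> l x * excess l x) \<le> 2 / \<eta>"
          using qe[OF l] q0[OF l] excess_nonneg[OF l] \<eta> by (auto simp: field_simps)
      qed (use qm[OF l] in simp)
      have i2: "integrable M (\<lambda>x. q \<eta> l x * ln (q \<eta> l x))" if l: "l \<in> {1..n}" for l
        using abs_x_ln_x_le[OF q0[OF l] q1[OF l]] qm[OF l] by (intro integrable_const_bound[where B=1]) auto
      have i3: "integrable M (\<lambda>x. q \<eta> l x * (\<eta> * excess l x + ln (q \<eta> l x)))"
        and v3: "(\<integral>x. q \<eta> l x * (\<eta> * excess l x + ln (q \<eta> l x)) \<partial>M) = \<eta> * (\<integral>x. q \<eta> l x * excess l x \<partial>M) + (\<integral>x. q \<eta> l x * ln (q \<eta> l x) \<partial>M)"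
        if l: "l \<in> {1..n}" for l
      proof -
        have e: "(\<lambda>x. q \<eta> l x * (\<eta> * excess l x + ln (q \<eta> l x))) = (\<lambda>x. \<eta> * (q \<eta> l x * excess l x) + q \<eta> l x * ln (q \<eta> l x))"
          by (simp add: fun_eq_iff algebra_simps)
        show "integrable M (\<lambda>x. q \<eta> l x * (\<eta> * excess l x + ln (q \<eta> l x)))"
          unfolding e using i1[OF l] i2[OF l] by simp
        show "(\<integral>x. q \<eta> l x * (\<eta> * excess l x + ln (q \<eta> l x)) \<partial>M) = \<eta> * (\<integral>x. q \<eta> l x * excess l x \<partial>M) + (\<integral>x. q \<eta> l x * ln (q \<eta> l x) \<partial>M)"
          unfolding e using i1[OF l] i2[OF l] by simp
      qed
      have "(\<integral>x. (\<Sum>l\<in>{1..n}. q \<eta> l x * (\<eta> * excess l x + ln (q \<eta> l x))) \<partial>M)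
         = (\<Sum>l\<in>{1..n}. \<integral>x. q \<eta> l x * (\<eta> * excess l x + ln (q \<eta> l x)) \<partial>M)"
        by (rule Bochner_Integration.integral_sum) (rule i3)
      also have "\<dots> = (\<Sum>l\<in>{1..n}. \<eta> * (\<integral>x. q \<eta> l x * excess l x \<partial>M) + (\<integral>x. q \<eta> l x * ln (q \<eta> l x) \<partial>M))"
        by (rule sum.cong[OF refl]) (rule v3)
      finally show ?thesis by (simp only: sum.distrib sum_distrib_left)
    qed
    also have "\<eta> * \<dots> \<le> - (\<eta> * L.log_partition \<eta>) + \<epsilon> \<eta>" by (rule qc)
    finally show ?thesis using rel Pc lower by blast
  qed
  have V: "((\<lambda>\<eta>. \<eta>\<^sup>2 * (C \<eta> + E \<eta> / \<eta> - W - (- neg_entropy) / \<eta>)) \<longlongrightarrow> - L.K) at_top"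
  proof (rule tendsto_sandwich[where f="\<lambda>\<eta>. - (\<eta> * L.log_partition \<eta>)" and h="\<lambda>\<eta>. - (\<eta> * L.log_partition \<eta>) + \<epsilon> \<eta>"])
    show "((\<lambda>\<eta>. - (\<eta> * L.log_partition \<eta>)) \<longlongrightarrow> - L.K) at_top" by (intro tendsto_minus L.log_partition_limit)
    have "((\<lambda>\<eta>. - (\<eta> * L.log_partition \<eta>) + \<epsilon> \<eta>) \<longlongrightarrow> - L.K + 0) at_top"
      by (intro tendsto_add tendsto_minus L.log_partition_limit \<epsilon>)
    then show "((\<lambda>\<eta>. - (\<eta> * L.log_partition \<eta>) + \<epsilon> \<eta>) \<longlongrightarrow> - L.K) at_top" by simp
  qed (use main in \<open>auto intro!: eventually_mono[OF eventually_ge_at_top[of r]]\<close>)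
  have "((\<lambda>\<eta>. \<eta>\<^sup>2 * (C \<eta> - W)) \<longlongrightarrow> L.K) at_top"
  proof (rule concave_expansion_derivative[OF _ V])
    fix s t assume st: "r \<le> s" "r \<le> t"
    have s: "0 < s" using st by (simp add: r_def)
    have "entropic_cost M N s (\<pi> s) \<le> entropic_cost M N s (\<pi> t)"
      using plans[OF s] main[OF st(2)] by (simp add: entropic_plan_def)
    then show "C s + E s / s \<le> C t + E t / s"
      using main[OF st(1)] main[OF st(2)] by (simp add: entropic_cost_real C_def)
  qed
  then show ?thesis by (simp add: C_def)
qed

text \<open>Strong duality as a by-product: W is a lower bound for the cost of every coupling, and
  the entropic plans are couplings whose costs converge to W. No optimal map has to be
  constructed.\<close>

lemma W2_sq_eq:
  assumes "\<And>\<eta>. 0 < \<eta> \<Longrightarrow> \<pi> \<eta> \<in> couplings M N"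
    and "((\<lambda>\<eta>. \<eta>\<^sup>2 * ((\<integral>w. (norm (fst w - snd w))\<^sup>2 \<partial>\<pi> \<eta>) - W)) \<longlongrightarrow> k) at_top"
  shows "enn2real (W2_sq M N) = W"
proof -
  define C where "C P = (\<integral>w. (norm (fst w - snd w))\<^sup>2 \<partial>P)" for P :: "('a \<times> 'a) measure"
  have tc: "transport_cost P = ennreal (C P)" and Wle: "W \<le> C P" and C0: "0 \<le> C P" if "P \<in> couplings M N" for P
  proof -
    show "transport_cost P = ennreal (C P)" unfolding C_def by (rule coupling_facts(6)[OF that])
    have "0 \<le> (\<integral>w. ex w \<partial>P)" by (intro Bochner_Integration.integral_nonneg) (simp add: ex_nonneg)
    then show "W \<le> C P" using coupling_facts(5)[OF that] by (simp add: C_def)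
    show "0 \<le> C P" unfolding C_def by simp
  qed
  have "((\<lambda>\<eta>. (1 / \<eta>)\<^sup>2 * (\<eta>\<^sup>2 * (C (\<pi> \<eta>) - W))) \<longlongrightarrow> 0\<^sup>2 * k) at_top"
    using assms(2) unfolding C_def
    by (intro tendsto_mult tendsto_power tendsto_divide_0[OF tendsto_const] filterlim_at_top_imp_at_infinity filterlim_ident)
  then have "((\<lambda>\<eta>. (1 / \<eta>)\<^sup>2 * (\<eta>\<^sup>2 * (C (\<pi> \<eta>) - W)) + W) \<longlongrightarrow> 0\<^sup>2 * k + W) at_top"
    by (intro tendsto_add tendsto_const)
  then have lim': "((\<lambda>\<eta>. (1 / \<eta>)\<^sup>2 * (\<eta>\<^sup>2 * (C (\<pi> \<eta>) - W)) + W) \<longlongrightarrow> W) at_top"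
    by (simp only: zero_power2 mult_zero_left add_0)
  have lim: "((\<lambda>\<eta>. C (\<pi> \<eta>)) \<longlongrightarrow> W) at_top"
  proof (rule Lim_transform_eventually[OF lim'])
    show "\<forall>\<^sub>F \<eta> in at_top. (1 / \<eta>)\<^sup>2 * (\<eta>\<^sup>2 * (C (\<pi> \<eta>) - W)) + W = C (\<pi> \<eta>)"
      using eventually_gt_at_top[of 0] by eventually_elim (simp add: power_divide)
  qed
  have W0: "0 \<le> W"
    by (rule tendsto_lowerbound[OF lim]) (auto intro!: eventually_mono[OF eventually_gt_at_top[of 0]] C0 assms(1))
  have "W2_sq M N \<le> ennreal W"
  proof (rule tendsto_lowerbound[OF tendsto_ennrealI[OF lim]])
    show "\<forall>\<^sub>F \<eta> in at_top. W2_sq M N \<le> ennreal (C (\<pi> \<eta>))"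
      using eventually_gt_at_top[of 0]
    proof eventually_elim
      fix \<eta> :: real assume "0 < \<eta>"
      then have c: "\<pi> \<eta> \<in> couplings M N" by (rule assms(1))
      show "W2_sq M N \<le> ennreal (C (\<pi> \<eta>))"
        unfolding W2_sq_def tc[OF c, symmetric] using c by (rule INF_lower)
    qed
  qed simp
  moreover have "ennreal W \<le> W2_sq M N"
    unfolding W2_sq_def using tc Wle by (intro INF_greatest) (simp add: ennreal_leI)
  ultimately show ?thesis using W0 by (simp add: antisym enn2real_ennreal)
qed

end

theorem theorem1p1:
  fixes n :: nat
    and y :: "nat \<Rightarrow> 'a::euclidean_space"
    and p :: "nat \<Rightarrow> real"
    and M N :: "'a measure"
    and \<rho> :: "'a \<Rightarrow> real"
    and f g :: "'a \<Rightarrow> real"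
    and \<pi> :: "real \<Rightarrow> ('a \<times> 'a) measure"
    and h :: "nat \<Rightarrow> nat \<Rightarrow> real \<Rightarrow> real \<Rightarrow> ennreal"
    and w :: "nat \<Rightarrow> nat \<Rightarrow> real"
  assumes atoms: "inj_on y {1..n}"
    and weights: "\<forall>i\<in>{1..n}. p i > 0"
    and N_prob: "prob_space N"
    and N_sets: "sets N = sets borel"
    and N_eq: "\<forall>A\<in>sets borel. emeasure N A = (\<Sum>i=1..n. ennreal (p i) * emeasure (return borel (y i)) A)"
    and M_prob: "prob_space M"
    and density_meas: "\<rho> \<in> borel_measurable borel"
    and density_nonneg: "\<forall>x. \<rho> x \<ge> 0"
    and M_eq: "M = density lborel (\<lambda>x. ennreal (\<rho> x))"
    and second_moment: "integrable M (\<lambda>x. (norm x)\<^sup>2)"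
    and supp_connected: "connected (interior (msupport M))"
    and supp_frontier: "emeasure lborel (frontier (msupport M)) = 0"
    and density_pos: "\<forall>x\<in>interior (msupport M). \<rho> x > 0"
    and potentials: "dual_optimal M N f g" "(\<integral>z. g z \<partial>N) = 0"
    and h_def: "h = slice_integral \<rho> n y (\<lambda>i. g (y i))"
    and h_finite: "\<forall>i\<in>{1..n}. \<forall>j\<in>{1..n}. i \<noteq> j \<longrightarrow> h i j 0 0 < \<infinity>"
    and h_cont_t: "\<forall>i\<in>{1..n}. \<forall>j\<in>{1..n}. i \<noteq> j \<longrightarrow>
        (\<exists>\<epsilon>>0. \<forall>a. 0 \<le> a \<and> a < \<epsilon> \<longrightarrow> continuous (at 0 within {0..}) (\<lambda>t. h i j t a))"
    and h_cont_a: "\<forall>i\<in>{1..n}. \<forall>j\<in>{1..n}. i \<noteq> j \<longrightarrow>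
        continuous (at 0 within {0..}) (\<lambda>a. h i j 0 a)"
    and w_def: "w = (\<lambda>i j. enn2real (h i j 0 0))"
    and plans: "\<forall>\<eta>>0. entropic_plan M N \<eta> (\<pi> \<eta>)"
  shows "(\<lambda>\<eta>. (\<integral>z. (norm (fst z - snd z))\<^sup>2 \<partial>\<pi> \<eta>)
             - (enn2real (W2_sq M N)
                + (pi\<^sup>2 / 6) / (2 * \<eta>\<^sup>2) * (\<Sum>j=1..n. \<Sum>i\<in>{1..<j}. w i j / norm (y i - y j))))
           \<in> o[at_top](\<lambda>\<eta>. 1 / \<eta>\<^sup>2)
         \<and> (\<forall>i\<in>{1..n}. \<forall>j\<in>{1..n}. i \<noteq> j \<longrightarrow>
              ennreal (w i j) =
                (\<integral>\<^sup>+x\<in>power_cell n y (\<lambda>i. g (y i)) i \<inter> power_cell n y (\<lambda>i. g (y i)) j.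
                    ennreal (\<rho> x) \<partial>hausdorff_measure (DIM('a) - 1)))"
proof -
  let ?\<gamma> = "\<lambda>i. g (y i)"
  have n1: "1 \<le> n"
  proof (rule ccontr)
    assume "\<not> 1 \<le> n"
    then have "emeasure N UNIV = 0" using N_eq by simp
    then show False using prob_space.emeasure_space_1[OF N_prob] sets_eq_imp_space_eq[OF N_sets] by simp
  qed
  interpret semidiscrete n y ?\<gamma> M \<rho> p N
    using density_nonneg weights N_eq
    by (intro semidiscrete.intro power_cells.intro semidiscrete_axioms.intro n1 atoms M_prob density_meas
        M_eq N_prob N_sets second_moment) blast+
  have hh: "h = slice_integral \<rho> n y ?\<gamma>" by (rule h_def)
  have le: "p i \<le> prob (cell i)" if "i \<in> {1..n}" for i
    by (rule weight_le_cell_mass[OF W_maximal[OF potentials(1) refl] that])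
  have pos: "0 < prob (cell i)" if "i \<in> {1..n}" for i using le[OF that] weights that by force
  have L0: "layered_cells M n excess cell \<kappa> (\<lambda>i. prob (cell i))"
    using density_pos pos h_finite h_cont_t h_cont_a unfolding hh
    by (intro layered_cells supp_connected supp_frontier) blast+
  interpret L0: layered_cells M n excess cell \<kappa> "\<lambda>i. prob (cell i)" by (rule L0)
  \<comment> \<open>The cells cover the space with null overlaps, so their masses sum to one, as do
    the weights; an inequality between all terms with equal sums is an equality. This allows
    \<open>layered_cells\<close> to be re-established with the weights as masses.\<close>
  have mass: "p i = prob (cell i)" if "i \<in> {1..n}" for i
    using sum_mono_inv[of p "{1..n}" "\<lambda>i. prob (cell i)"] le that weights_sum L0.mass_sum by simp
  have L: "layered_cells M n excess cell \<kappa> p"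
    by (intro layered_cells.intro layered_cells_axioms.intro M_prob L0.Dm L0.D0 L0.Sdef L0.cover L0.disj
        L0.ratio L0.core L0.sym L0.conn mass[symmetric])
  have exp: "((\<lambda>\<eta>. \<eta>\<^sup>2 * ((\<integral>w. (norm (fst w - snd w))\<^sup>2 \<partial>\<pi> \<eta>) - W)) \<longlongrightarrow> L0.K) at_top"
    by (rule transport_cost_expansion[OF L]) (use plans in blast)
  have W2: "enn2real (W2_sq M N) = W"
    by (rule W2_sq_eq[OF _ exp]) (use plans in \<open>simp add: entropic_plan_def\<close>)
  have facet: "ennreal (w i j) = (\<integral>\<^sup>+x\<in>cell i \<inter> cell j. ennreal (\<rho> x) \<partial>hausdorff_measure (DIM('a) - 1))"
    if ij: "i \<in> {1..n}" "j \<in> {1..n}" "i \<noteq> j" for i j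
  proof -
    have "h i j 0 0 < \<infinity>" using h_finite ij by blast
    then have "ennreal (w i j) = h i j 0 0" unfolding w_def by simp
    then show ?thesis unfolding hh slice_integral_def facet_eq[OF ij(1,2)] .
  qed
  define K where "K = (pi\<^sup>2 / 6) / 2 * (\<Sum>j=1..n. \<Sum>i\<in>{1..<j}. w i j / norm (y i - y j))"
  have KK: "L0.K = K"
  proof -
    \<comment> \<open>K runs over ordered pairs. The factor 2 for unordered pairs cancels the 2 in
      the denominator of \<kappa>, which leaves pi^2/12 = (pi^2/6)/2.\<close>
    have "L0.K = 2 * (\<Sum>j=1..n. \<Sum>i\<in>{1..<j}. \<kappa> i j * (pi\<^sup>2 / 12))"
      unfolding L0.K_def by (rule sum_symmetric_pairs) (simp only: L0.sym)
    also have "\<dots> = K"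
      unfolding K_def sum_distrib_left
      by (intro sum.cong refl) (simp add: \<kappa>_def w_def hh)
    finally show ?thesis .
  qed
  have asym: "(\<lambda>\<eta>. (\<integral>z. (norm (fst z - snd z))\<^sup>2 \<partial>\<pi> \<eta>) - (W + K / \<eta>\<^sup>2)) \<in> o[at_top](\<lambda>\<eta>. 1 / \<eta>\<^sup>2)"
  proof (rule smalloI_tendsto)
    have "((\<lambda>\<eta>. \<eta>\<^sup>2 * ((\<integral>w. (norm (fst w - snd w))\<^sup>2 \<partial>\<pi> \<eta>) - W) - K) \<longlongrightarrow> K - K) at_top"
      using exp unfolding KK by (intro tendsto_intros)
    then have lim0: "((\<lambda>\<eta>. \<eta>\<^sup>2 * ((\<integral>w. (norm (fst w - snd w))\<^sup>2 \<partial>\<pi> \<eta>) - W) - K) \<longlongrightarrow> 0) at_top" by simp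
    show "((\<lambda>\<eta>. ((\<integral>z. (norm (fst z - snd z))\<^sup>2 \<partial>\<pi> \<eta>) - (W + K / \<eta>\<^sup>2)) / (1 / \<eta>\<^sup>2)) \<longlongrightarrow> 0) at_top"
    proof (rule Lim_transform_eventually[OF lim0])
      show "\<forall>\<^sub>F \<eta> in at_top. \<eta>\<^sup>2 * ((\<integral>w. (norm (fst w - snd w))\<^sup>2 \<partial>\<pi> \<eta>) - W) - K
          = ((\<integral>z. (norm (fst z - snd z))\<^sup>2 \<partial>\<pi> \<eta>) - (W + K / \<eta>\<^sup>2)) / (1 / \<eta>\<^sup>2)"
        using eventually_gt_at_top[of 0] by eventually_elim (simp add: field_simps)
    qed
    show "\<forall>\<^sub>F \<eta> in at_top. 1 / \<eta>\<^sup>2 \<noteq> (0::real)"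
      using eventually_gt_at_top[of 0] by eventually_elim simp
  qed
  have "K / \<eta>\<^sup>2 = (pi\<^sup>2 / 6) / (2 * \<eta>\<^sup>2) * (\<Sum>j=1..n. \<Sum>i\<in>{1..<j}. w i j / norm (y i - y j))" for \<eta> :: real
    by (simp add: K_def)
  then show ?thesis using asym facet unfolding W2 by simp
qed

end
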